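(* Suppose there exists a key-testable private-key unclonable bit encryption scheme $\mathsf{UE}=(\mathsf{Enc},\mathsf{Dec},\mathsf{Test})$ (whose keys are sampled uniformly at random from the key space). Then any quantum state indistinguishability obfuscation scheme $(\mathsf{Obf},\mathsf{Eval})$ is also an unclonable puncturable obfuscation scheme satisfying generalized UPO security with respect to $\mathsf{Id}_{\mathcal U}$, for any generalized puncturable keyed circuit class $\mathcal{W}=\{\{W_s\}_{s\in\mathcal{K}_\lambda}\}_\lambda$ in $\mathsf{P/poly}$.
   Context: QPT means quantum polynomial time. **Quantum state indistinguishability obfuscation (qsiO).** A pair $(C,\rho)$ of a quantum circuit and a quantum state is a $(1-\varepsilon)$-implementation of a classical function $f$ if for every input $x$, running $C$ on $(\rho,x)$ outputs $f(x)$ with probability at least $1-\varepsilon$. A qsiO scheme consists of QPT $\mathsf{Obf}(1^\lambda,(C,\rho))$, outputting a quantum state $\tilde\rho$, and $\mathsf{Eval}(\tilde\rho,x)$, such that: (correctness) if $(C,\rho)$ is a $(1-\mathsf{negl}(\lambda))$-implementation of $f$, then $\mathsf{Eval}(\tilde\rho,x)$ outputs $f(x)$ except with negligible probability for every $x$; (security) for any two same-size $(1-\mathsf{negl}(\lambda))$-implementations $(C_0,\rho_0)$, $(C_1,\rho_1)$ of the same function, $\mathsf{Obf}(1^\lambda,(C_0,\rho_0))$ and $\mathsf{Obf}(1^\lambda,(C_1,\rho_1))$ are indistinguishable to QPT adversaries. A classical circuit is obfuscated by taking $\rho$ trivial. **Unclonable encryption.** QPT algorithms: key generation (here: uniform in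 $\{0,1\}^\lambda$), $\mathsf{Enc}(sk,m)\to\rho$ (quantum ciphertext), $\mathsf{Dec}(sk,\rho)\to m'$; correctness: $m'=m$ except with negligible probability. Security (unclonable indistinguishability): for every QPT $(\mathcal{A},\mathcal{B},\mathcal{C})$ the following outputs 1 with probability at most $\frac12+\mathsf{negl}(\lambda)$: sample $sk$; $\mathcal{A}$ sends $(m_0,m_1)$; the challenger picks uniform $b$ and sends $\mathsf{Enc}(sk,m_b)$ to $\mathcal{A}$; $\mathcal{A}$ outputs a bipartite state $\sigma$; $(\mathcal{B}(sk,\cdot)\otimes\mathcal{C}(sk,\cdot))(\sigma)$ gives $(b^{\mathcal B},b^{\mathcal C})$; output 1 iff $b^{\mathcal B}=b^{\mathcal C}=b$. "Bit encryption" means one-bit messages. **Key-testable.** There is an additional QPT algorithm $\mathsf{Test}(sk',\rho)$ outputting a bit such that for all keys $sk,sk'$ (equal or not) and every message $m$, on $\rho\leftarrow\mathsf{Enc}(sk,m)$, $\mathsf{Test}(sk',\rho)$ outputs 1 if $sk'=sk$ and 0 otherwise, with probability 1. **Keyed circuit class.** $\mathcal{W}=\{\mathcal{W}_\lambda\}$, $\mathcal{W}_\lambda=\{W_s:s\in\mathcal{K}_\lambda\}$, polynomial-size classical circuits of the same size, input length $n(\lambda)$, output length $m(\lambda)$. It is *generalized puncturable* if equipped with an efficient $\mathsf{GenPuncture}$ which on $s$, points $x^{\mathcal B},x^{\mathcal C}$ and poly-size circuits $\mu_{\mathcal B},\mu_{\mathcal C}:\{0,1\}^n\to\{0,1\}^m$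 outputs a circuit $G$ (of the same size as $W_s$) with $G(x)=W_s(x)$ for $x\notin\{x^{\mathcal B},x^{\mathcal C}\}$, $G(x^{\mathcal B})=\mu_{\mathcal B}(x^{\mathcal B})$ and, if $x^{\mathcal C}\neq x^{\mathcal B}$, $G(x^{\mathcal C})=\mu_{\mathcal C}(x^{\mathcal C})$. **UPO and generalized UPO security.** QPT algorithms $\mathsf{Obf}(1^\lambda,W)\to\rho_W$ and $\mathsf{Eval}(\rho_W,x)$ returning $W(x)$ except with negligible probability. Generalized security with respect to $\mathcal{D}_{\mathcal X}$: for every QPT $(\mathcal{A},\mathcal{B},\mathcal{C})$ the following with uniform $b\in\{0,1\}$ outputs 1 with probability at most $\frac12+\mathsf{negl}(\lambda)$: $\mathcal{A}$ sends $(s,\mu_{\mathcal B},\mu_{\mathcal C})$; $(x^{\mathcal B},x^{\mathcal C})\leftarrow\mathcal{D}_{\mathcal X}(1^\lambda)$, $G\leftarrow\mathsf{GenPuncture}(s,x^{\mathcal B},x^{\mathcal C},\mu_{\mathcal B},\mu_{\mathcal C})$; $\mathcal{A}$ receives $\mathsf{Obf}(1^\lambda,W_s)$ if $b=0$, $\mathsf{Obf}(1^\lambda,G)$ if $b=1$, and outputs a bipartite state $\sigma$; $(\mathcal{B}(x^{\mathcal B},\cdot)\otimes\mathcal{C}(x^{\mathcal C},\cdot))(\sigma)$ gives $(b_{\mathcal B},b_{\mathcal C})$; output 1 iff $b_{\mathcal B}=b_{\mathcal C}=b$. $\mathsf{Id}_{\mathcal U}$ samples $x$ uniformly in $\{0,1\}^n$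 and outputs $(x,x)$. (As usual, circuits are assumed padded to the size required.)
   Formalization: The input length n(λ) is assumed polynomially related to λ (for constant n the claim fails: evaluate on all inputs), and circuits are padded to a size chosen after a polynomial bound on the sizes of μ_B and μ_C. *)

theory Defs
  imports
    "HOL-Probability.Probability_Mass_Function"
    "Jordan_Normal_Form.Schur_Decomposition"
begin

section \<open>Asymptotics\<close>

definition negligible :: "(nat \<Rightarrow> real) \<Rightarrow> bool" where
  "negligible \<epsilon> \<longleftrightarrow> (\<forall>c::nat. \<forall>\<^sub>F l in sequentially. \<bar>\<epsilon> l\<bar> \<le> 1 / real l ^ c)"

definition poly_bounded :: "(nat \<Rightarrow> nat) \<Rightarrow> bool" where
  "poly_bounded p \<longleftrightarrow> (\<exists>c. \<forall>l. p l \<le> l ^ c + c)"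


section \<open>Quantum states\<close>

definition bitstrings :: "nat \<Rightarrow> bool list set" where
  "bitstrings n = {xs. length xs = n}"

text \<open>
  The space of \<open>n\<close> qubits is indexed by \<open>{..<2 ^ n}\<close>; the value of wire \<open>w\<close> in the basis state
  \<open>i\<close> is \<open>bit i w\<close>, so wire 0 is the least significant bit.
\<close>

definition idx :: "bool list \<Rightarrow> nat" where
  "idx xs = horner_sum of_bool 2 xs"

definition matrix_unit :: "nat \<Rightarrow> nat \<Rightarrow> nat \<Rightarrow> complex mat" where
  "matrix_unit n i j = mat (2 ^ n) (2 ^ n) (\<lambda>(r, c). if r = i \<and> c = j then 1 else 0)"

definition basis_state :: "bool list \<Rightarrow> complex mat" where
  "basis_state xs = matrix_unit (length xs) (idx xs) (idx xs)"

definition density :: "nat \<Rightarrow> complex mat \<Rightarrow> bool" where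
  "density n \<rho> \<longleftrightarrow> \<rho> \<in> carrier_mat (2 ^ n) (2 ^ n)
     \<and> (\<forall>v \<in> carrier_vec (2 ^ n). (\<rho> *\<^sub>v v) \<bullet>c v \<ge> 0)
     \<and> (\<Sum>i<2 ^ n. \<rho> $$ (i, i)) = 1"

text \<open>In a tensor product the wires of the left factor come first (low-order bits).\<close>

definition tensor :: "complex mat \<Rightarrow> complex mat \<Rightarrow> complex mat" (infixl \<open>\<otimes>\<^sub>q\<close> 70) where
  "A \<otimes>\<^sub>q B = mat (dim_row A * dim_row B) (dim_col A * dim_col B)
     (\<lambda>(r, c). A $$ (r mod dim_row A, c mod dim_col A) * B $$ (r div dim_row A, c div dim_col A))"


section \<open>Generalized quantum circuits\<close>

datatype gate = Hadamard nat | TGate nat | NOT nat | CNOT nat nat | Toffoli nat nat nat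

fun gate_wires :: "gate \<Rightarrow> nat list" where
  "gate_wires (Hadamard i) = [i]"
| "gate_wires (TGate i) = [i]"
| "gate_wires (NOT i) = [i]"
| "gate_wires (CNOT i j) = [i, j]"
| "gate_wires (Toffoli i j k) = [i, j, k]"

fun gate_entry :: "gate \<Rightarrow> nat \<Rightarrow> nat \<Rightarrow> complex" where
  "gate_entry (Hadamard i) r c =
     (if unset_bit i r = unset_bit i c
      then (if bit r i \<and> bit c i then - 1 else 1) / complex_of_real (sqrt 2) else 0)"
| "gate_entry (TGate i) r c = (if r = c then (if bit c i then cis (pi / 4) else 1) else 0)"
| "gate_entry (NOT i) r c = of_bool (r = flip_bit i c)"
| "gate_entry (CNOT i j) r c = of_bool (r = (if bit c i then flip_bit j c else c))"
| "gate_entry (Toffoli i j k) r c = of_bool (r = (if bit c i \<and> bit c j then flip_bit k c else c))"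

definition gate_mat :: "nat \<Rightarrow> gate \<Rightarrow> complex mat" where
  "gate_mat N g = mat (2 ^ N) (2 ^ N) (\<lambda>(r, c). gate_entry g r c)"

definition gates_mat :: "nat \<Rightarrow> gate list \<Rightarrow> complex mat" where
  "gates_mat N gs = foldl (\<lambda>U g. gate_mat N g * U) (1\<^sub>m (2 ^ N)) gs"

text \<open>
  \<open>QCircuit a b gs os\<close> acts on \<open>a\<close> input wires followed by \<open>b\<close> ancilla wires initialized to zero,
  applies \<open>gs\<close> from left to right, outputs the wires \<open>os\<close> in this order and traces out the others.
\<close>

datatype qcircuit =
  QCircuit (q_in: nat) (q_anc: nat) (q_gates: "gate list") (q_outs: "nat list")

abbreviation q_out :: "qcircuit \<Rightarrow> nat" where
  "q_out Q \<equiv> length (q_outs Q)"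

definition q_wires :: "qcircuit \<Rightarrow> nat" where
  "q_wires Q = q_in Q + q_anc Q"

definition q_wf :: "qcircuit \<Rightarrow> bool" where
  "q_wf Q \<longleftrightarrow> (\<forall>g \<in> set (q_gates Q). distinct (gate_wires g) \<and> (\<forall>w \<in> set (gate_wires g). w < q_wires Q))
     \<and> distinct (q_outs Q) \<and> (\<forall>w \<in> set (q_outs Q). w < q_wires Q)"

definition q_size :: "qcircuit \<Rightarrow> nat" where
  "q_size Q = q_wires Q + length (q_gates Q) + q_out Q"

definition reduced :: "nat \<Rightarrow> nat list \<Rightarrow> complex mat \<Rightarrow> complex mat" where
  "reduced N os M = mat (2 ^ length os) (2 ^ length os) (\<lambda>(r, c).
     \<Sum>R<2 ^ N. \<Sum>C<2 ^ N.
       if (\<forall>t<length os. bit R (os ! t) = bit r t \<and> bit C (os ! t) = bit c t)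
          \<and> (\<forall>w<N. w \<notin> set os \<longrightarrow> bit R w = bit C w)
       then M $$ (R, C) else 0)"

definition run :: "qcircuit \<Rightarrow> complex mat \<Rightarrow> complex mat" where
  "run Q \<rho> =
     (let U = gates_mat (q_wires Q) (q_gates Q)
      in reduced (q_wires Q) (q_outs Q)
           (U * (\<rho> \<otimes>\<^sub>q basis_state (replicate (q_anc Q) False)) * mat_adjoint U))"

definition outcome_prob :: "qcircuit \<Rightarrow> complex mat \<Rightarrow> bool list \<Rightarrow> real" where
  "outcome_prob Q \<rho> y = Re (run Q \<rho> $$ (idx y, idx y))"


section \<open>Boolean circuits\<close>

text \<open>
  Straight-line NAND programs: every gate \<open>(i, j)\<close> appends a new wire carrying the NAND of the
  earlier wires \<open>i\<close> and \<open>j\<close>.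
\<close>

datatype bcircuit = BCircuit (b_in: nat) (b_gates: "(nat \<times> nat) list") (b_outs: "nat list")

definition b_size :: "bcircuit \<Rightarrow> nat" where
  "b_size B = length (b_gates B)"

definition b_wf :: "nat \<Rightarrow> nat \<Rightarrow> bcircuit \<Rightarrow> bool" where
  "b_wf n m B \<longleftrightarrow> b_in B = n \<and> length (b_outs B) = m
     \<and> (\<forall>t<b_size B. fst (b_gates B ! t) < n + t \<and> snd (b_gates B ! t) < n + t)
     \<and> (\<forall>w \<in> set (b_outs B). w < n + b_size B)"

definition b_eval :: "bcircuit \<Rightarrow> bool list \<Rightarrow> bool list" where
  "b_eval B x =
     (let ws = foldl (\<lambda>ws (i, j). ws @ [\<not> (ws ! i \<and> ws ! j)]) x (b_gates B)
      in map ((!) ws) (b_outs B))"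

text \<open>
  A Boolean circuit as a quantum circuit taking (and ignoring) a \<open>k\<close>-qubit state in front of its
  input. Each NAND gate and each output bit gets its own ancilla.
\<close>

definition b_to_q :: "nat \<Rightarrow> bcircuit \<Rightarrow> qcircuit" where
  "b_to_q k B =
     (let a = k + b_in B; g = b_size B; m = length (b_outs B)
      in QCircuit a (g + m)
           (concat (map (\<lambda>t. let (i, j) = b_gates B ! t
                             in [if i = j then CNOT (k + i) (a + t) else Toffoli (k + i) (k + j) (a + t),
                                 NOT (a + t)]) [0..<g])
            @ map (\<lambda>u. CNOT (k + b_outs B ! u) (a + g + u)) [0..<m])
           [a + g..<a + g + m])"


section \<open>Descriptions of circuits\<close>

definition enc_nat :: "nat \<Rightarrow> bool list" where
  "enc_nat n = replicate n True @ [False]"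

definition enc_list :: "('a \<Rightarrow> bool list) \<Rightarrow> 'a list \<Rightarrow> bool list" where
  "enc_list e xs = enc_nat (length xs) @ concat (map e xs)"

fun enc_gate :: "gate \<Rightarrow> bool list" where
  "enc_gate (Hadamard i) = enc_nat 0 @ enc_nat i"
| "enc_gate (TGate i) = enc_nat 1 @ enc_nat i"
| "enc_gate (NOT i) = enc_nat 2 @ enc_nat i"
| "enc_gate (CNOT i j) = enc_nat 3 @ enc_nat i @ enc_nat j"
| "enc_gate (Toffoli i j k) = enc_nat 4 @ enc_nat i @ enc_nat j @ enc_nat k"

fun enc_qcircuit :: "qcircuit \<Rightarrow> bool list" where
  "enc_qcircuit (QCircuit a b gs os) =
     enc_nat a @ enc_nat b @ enc_list enc_gate gs @ enc_list enc_nat os"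

fun enc_bcircuit :: "bcircuit \<Rightarrow> bool list" where
  "enc_bcircuit (BCircuit n gs os) =
     enc_nat n @ enc_list (\<lambda>(i, j). enc_nat i @ enc_nat j) gs @ enc_list enc_nat os"

text \<open>
  The description of \<open>C\<close> padded to size \<open>L\<close>. The encodings are prefix-free (shown below), so the
  padding can be stripped again; it is only used with \<open>length (enc_qcircuit C) \<le> L\<close>.
\<close>

definition padded_desc :: "nat \<Rightarrow> qcircuit \<Rightarrow> bool list" where
  "padded_desc L C = enc_qcircuit C @ replicate (L - length (enc_qcircuit C)) False"

lemma enc_nat_prefix_free: "enc_nat a @ u = enc_nat b @ v \<longleftrightarrow> a = b \<and> u = v"
proof (induction a arbitrary: b)
  case 0
  then show ?case by (cases b) (auto simp: enc_nat_def)
next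
  case (Suc a)
  then show ?case by (cases b) (auto simp: enc_nat_def)
qed

lemma enc_list_prefix_free:
  assumes e: "\<And>x y u v. e x @ u = e y @ v \<longleftrightarrow> x = y \<and> u = v"
  shows "enc_list e xs @ u = enc_list e ys @ v \<longleftrightarrow> xs = ys \<and> u = v"
proof -
  have "concat (map e xs) @ u = concat (map e ys) @ v \<longleftrightarrow> xs = ys \<and> u = v"
    if "length xs = length ys"
    using that by (induction xs ys rule: list_induct2) (auto simp: e)
  then show ?thesis
    by (auto simp: enc_list_def enc_nat_prefix_free)
qed

lemma enc_gate_prefix_free: "enc_gate g @ u = enc_gate h @ v \<longleftrightarrow> g = h \<and> u = v"
  by (cases g; cases h) (auto simp: enc_nat_prefix_free)

lemma enc_qcircuit_prefix_free: "enc_qcircuit C @ u = enc_qcircuit D @ v \<longleftrightarrow> C = D \<and> u = v"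
  by (cases C; cases D)
     (auto simp: enc_nat_prefix_free enc_list_prefix_free[of enc_gate, OF enc_gate_prefix_free]
        enc_list_prefix_free[of enc_nat, OF enc_nat_prefix_free])

lemma enc_bcircuit_prefix_free: "enc_bcircuit C @ u = enc_bcircuit D @ v \<longleftrightarrow> C = D \<and> u = v"
proof -
  have e: "(case x of (i, j) \<Rightarrow> enc_nat i @ enc_nat j) @ u = (case y of (i, j) \<Rightarrow> enc_nat i @ enc_nat j) @ v
      \<longleftrightarrow> x = y \<and> u = v" for x y u v
    by (cases x; cases y) (auto simp: enc_nat_prefix_free)
  show ?thesis
    by (cases C; cases D)
       (auto simp: enc_nat_prefix_free enc_list_prefix_free[OF e]
          enc_list_prefix_free[of enc_nat, OF enc_nat_prefix_free])
qed


section \<open>Efficient algorithms\<close>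

text \<open>
  Deterministic single-tape Turing machines. States are \<open>0\<close> (halting), \<open>1\<close> (initial), and so on;
  symbol \<open>0\<close> is the blank, and \<open>1\<close>, \<open>2\<close> represent the bits.
\<close>

record tm =
  tm_states :: nat
  tm_symbols :: nat
  tm_delta :: "nat \<Rightarrow> nat \<Rightarrow> nat \<times> nat \<times> int"

definition tm_wf :: "tm \<Rightarrow> bool" where
  "tm_wf M \<longleftrightarrow> tm_states M \<ge> 2 \<and> tm_symbols M \<ge> 3
     \<and> (\<forall>q<tm_states M. \<forall>a<tm_symbols M. case tm_delta M q a of (q', a', d) \<Rightarrow>
          q' < tm_states M \<and> a' < tm_symbols M \<and> d \<in> {-1, 0, 1})"

definition tm_step :: "tm \<Rightarrow> nat \<times> int \<times> (int \<Rightarrow> nat) \<Rightarrow> nat \<times> int \<times> (int \<Rightarrow> nat)" where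
  "tm_step M = (\<lambda>(q, h, tape).
     if q = 0 then (q, h, tape)
     else case tm_delta M q (tape h) of (q', a', d) \<Rightarrow> (q', h + d, tape(h := a')))"

definition tm_tape :: "bool list \<Rightarrow> int \<Rightarrow> nat" where
  "tm_tape xs i = (if 0 \<le> i \<and> i < int (length xs) then (if xs ! nat i then 2 else 1) else 0)"

definition tm_computes :: "tm \<Rightarrow> bool list \<Rightarrow> bool list \<Rightarrow> nat \<Rightarrow> bool" where
  "tm_computes M xs ys t \<longleftrightarrow> (\<exists>h. (tm_step M ^^ t) (1, 0, tm_tape xs) = (0, h, tm_tape ys))"

text \<open>
  The circuits of a quantum polynomial-time algorithm are indexed by \<open>r\<close> size parameters (security
  parameter, lengths of the inputs), given in unary, and printed by a polynomial-time Turing machine.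
\<close>

definition qpt :: "nat \<Rightarrow> (nat list \<Rightarrow> qcircuit) \<Rightarrow> bool" where
  "qpt r F \<longleftrightarrow>
     (\<forall>ns. length ns = r \<longrightarrow> q_wf (F ns))
   \<and> (\<exists>c. \<forall>ns. length ns = r \<longrightarrow> q_size (F ns) \<le> sum_list ns ^ c + c)
   \<and> (\<exists>M c. tm_wf M \<and> (\<forall>ns. length ns = r \<longrightarrow>
        tm_computes M (concat (map enc_nat ns)) (enc_qcircuit (F ns)) (sum_list ns ^ c + c)))"

text \<open>
  Adversaries are non-uniform: polynomial-size circuit families, together with an arbitrary
  quantum advice state that is one of the inputs (see \<open>distinguisher\<close> and \<open>cloner_wf\<close>).
\<close>

definition poly_size :: "(nat \<Rightarrow> qcircuit) \<Rightarrow> bool" where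
  "poly_size F \<longleftrightarrow> (\<forall>l. q_wf (F l)) \<and> poly_bounded (\<lambda>l. q_size (F l))"


section \<open>Quantum state indistinguishability obfuscation\<close>

text \<open>\<open>(C, \<rho>)\<close> is a \<open>p\<close>-implementation of \<open>f : {0,1}\<^sup>n \<rightarrow> {0,1}\<^sup>m\<close>, with \<open>\<rho>\<close> on \<open>k\<close> qubits.\<close>

definition implementation ::
  "nat \<Rightarrow> nat \<Rightarrow> nat \<Rightarrow> real \<Rightarrow> qcircuit \<Rightarrow> complex mat \<Rightarrow> (bool list \<Rightarrow> bool list) \<Rightarrow> bool" where
  "implementation n m k p C \<rho> f \<longleftrightarrow>
     q_wf C \<and> q_in C = k + n \<and> q_out C = m \<and> density k \<rho>
   \<and> (\<forall>x \<in> bitstrings n. f x \<in> bitstrings m \<and> outcome_prob C (\<rho> \<otimes>\<^sub>q basis_state x) (f x) \<ge> p)"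

text \<open>
  Polynomial-size families of \<open>(1 - negl)\<close>-implementations. The size of \<open>(C, \<rho>)\<close> is given by the
  length \<open>L\<close> of the (padded) description of \<open>C\<close> and the number \<open>k\<close> of qubits of \<open>\<rho>\<close>.
\<close>

definition negl_implementation ::
  "(nat \<Rightarrow> nat) \<Rightarrow> (nat \<Rightarrow> nat) \<Rightarrow> (nat \<Rightarrow> nat) \<Rightarrow> (nat \<Rightarrow> nat) \<Rightarrow>
   (nat \<Rightarrow> qcircuit) \<Rightarrow> (nat \<Rightarrow> complex mat) \<Rightarrow> (nat \<Rightarrow> bool list \<Rightarrow> bool list) \<Rightarrow> bool" where
  "negl_implementation n m L k C \<rho> f \<longleftrightarrow>
     poly_bounded n \<and> poly_bounded m \<and> poly_bounded L \<and> poly_bounded k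
   \<and> (\<forall>l. length (enc_qcircuit (C l)) \<le> L l)
   \<and> (\<exists>\<epsilon>. negligible \<epsilon> \<and> (\<forall>l. implementation (n l) (m l) (k l) (1 - \<epsilon> l) (C l) (\<rho> l) (f l)))"

text \<open>
  \<open>Obf l L k\<close> is the circuit run on descriptions of length \<open>L\<close> and states of \<open>k\<close> qubits;
  \<open>Eval l N n m\<close> is run on obfuscations of \<open>N\<close> qubits and inputs of \<open>n\<close> bits, with \<open>m\<close> output bits.
\<close>

type_synonym obfuscator = "nat \<Rightarrow> nat \<Rightarrow> nat \<Rightarrow> qcircuit"
type_synonym evaluator = "nat \<Rightarrow> nat \<Rightarrow> nat \<Rightarrow> nat \<Rightarrow> qcircuit"

definition obfuscate :: "obfuscator \<Rightarrow> nat \<Rightarrow> nat \<Rightarrow> nat \<Rightarrow> qcircuit \<Rightarrow> complex mat \<Rightarrow> complex mat" where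
  "obfuscate Obf l L k C \<rho> = run (Obf l L k) (basis_state (padded_desc L C) \<otimes>\<^sub>q \<rho>)"

definition obf_eval_prob ::
  "obfuscator \<Rightarrow> evaluator \<Rightarrow> nat \<Rightarrow> nat \<Rightarrow> nat \<Rightarrow> nat \<Rightarrow> nat \<Rightarrow> qcircuit \<Rightarrow> complex mat \<Rightarrow>
   bool list \<Rightarrow> bool list \<Rightarrow> real" where
  "obf_eval_prob Obf Eval l n m L k C \<rho> x y =
     outcome_prob (Eval l (q_out (Obf l L k)) n m) (obfuscate Obf l L k C \<rho> \<otimes>\<^sub>q basis_state x) y"

definition qpt_obfuscator :: "obfuscator \<Rightarrow> evaluator \<Rightarrow> bool" where
  "qpt_obfuscator Obf Eval \<longleftrightarrow>
     qpt 3 (\<lambda>ns. Obf (ns ! 0) (ns ! 1) (ns ! 2))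
   \<and> qpt 4 (\<lambda>ns. Eval (ns ! 0) (ns ! 1) (ns ! 2) (ns ! 3))
   \<and> (\<forall>l L k. q_in (Obf l L k) = L + k)
   \<and> (\<forall>l N n m. q_in (Eval l N n m) = N + n \<and> q_out (Eval l N n m) = m)"

definition distinguisher ::
  "(nat \<Rightarrow> nat) \<Rightarrow> (nat \<Rightarrow> nat) \<Rightarrow> (nat \<Rightarrow> complex mat) \<Rightarrow> (nat \<Rightarrow> qcircuit) \<Rightarrow> bool" where
  "distinguisher N a \<alpha> D \<longleftrightarrow> poly_size D
     \<and> (\<forall>l. q_in (D l) = a l + N l \<and> q_out (D l) = 1 \<and> density (a l) (\<alpha> l))"

definition qsio_correct :: "obfuscator \<Rightarrow> evaluator \<Rightarrow> bool" where
  "qsio_correct Obf Eval \<longleftrightarrow> (\<forall>n m L k C \<rho> f. negl_implementation n m L k C \<rho> f \<longrightarrow>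
     (\<exists>\<epsilon>. negligible \<epsilon> \<and> (\<forall>l. \<forall>x \<in> bitstrings (n l).
        obf_eval_prob Obf Eval l (n l) (m l) (L l) (k l) (C l) (\<rho> l) x (f l x) \<ge> 1 - \<epsilon> l)))"

definition qsio_secure :: "obfuscator \<Rightarrow> bool" where
  "qsio_secure Obf \<longleftrightarrow> (\<forall>n m L k C\<^sub>0 \<rho>\<^sub>0 C\<^sub>1 \<rho>\<^sub>1 f a \<alpha> D.
     negl_implementation n m L k C\<^sub>0 \<rho>\<^sub>0 f \<longrightarrow> negl_implementation n m L k C\<^sub>1 \<rho>\<^sub>1 f \<longrightarrow>
     distinguisher (\<lambda>l. q_out (Obf l (L l) (k l))) a \<alpha> D \<longrightarrow>
     negligible (\<lambda>l.
       outcome_prob (D l) (\<alpha> l \<otimes>\<^sub>q obfuscate Obf l (L l) (k l) (C\<^sub>0 l) (\<rho>\<^sub>0 l)) [True]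
     - outcome_prob (D l) (\<alpha> l \<otimes>\<^sub>q obfuscate Obf l (L l) (k l) (C\<^sub>1 l) (\<rho>\<^sub>1 l)) [True]))"

definition qsio :: "obfuscator \<Rightarrow> evaluator \<Rightarrow> bool" where
  "qsio Obf Eval \<longleftrightarrow> qpt_obfuscator Obf Eval \<and> qsio_correct Obf Eval \<and> qsio_secure Obf"


section \<open>Cloning adversaries\<close>

text \<open>
  An adversary \<open>(A, B, C)\<close>: the first stage of \<open>A\<close> maps the advice to a classical message and a
  memory, the second stage maps the memory and the challenge state to a state for \<open>B\<close> and \<open>C\<close>.
\<close>

record cloner =
  advice_len :: "nat \<Rightarrow> nat"
  advice :: "nat \<Rightarrow> complex mat"
  msg_len :: "nat \<Rightarrow> nat"
  stage1 :: "nat \<Rightarrow> qcircuit"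
  stage2 :: "nat \<Rightarrow> qcircuit"
  bob_len :: "nat \<Rightarrow> nat"
  bob :: "nat \<Rightarrow> qcircuit"
  charlie :: "nat \<Rightarrow> qcircuit"

definition mem_len :: "cloner \<Rightarrow> nat \<Rightarrow> nat" where
  "mem_len A l = q_out (stage1 A l) - msg_len A l"

definition charlie_len :: "cloner \<Rightarrow> nat \<Rightarrow> nat" where
  "charlie_len A l = q_out (stage2 A l) - bob_len A l"

text \<open>Challenge states have \<open>c l\<close> qubits; \<open>B\<close> and \<open>C\<close> each receive \<open>n l\<close> classical bits.\<close>

definition cloner_wf :: "(nat \<Rightarrow> nat) \<Rightarrow> (nat \<Rightarrow> nat) \<Rightarrow> cloner \<Rightarrow> bool" where
  "cloner_wf c n A \<longleftrightarrow>
     poly_size (stage1 A) \<and> poly_size (stage2 A) \<and> poly_size (bob A) \<and> poly_size (charlie A)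
   \<and> (\<forall>l. density (advice_len A l) (advice A l)
        \<and> q_in (stage1 A l) = advice_len A l \<and> msg_len A l \<le> q_out (stage1 A l)
        \<and> q_in (stage2 A l) = mem_len A l + c l \<and> bob_len A l \<le> q_out (stage2 A l)
        \<and> q_in (bob A l) = n l + bob_len A l \<and> q_out (bob A l) = 1
        \<and> q_in (charlie A l) = n l + charlie_len A l \<and> q_out (charlie A l) = 1)"

text \<open>
  The memory of \<open>A\<close> after sending \<open>z\<close>; it is not normalized, its trace is the probability of \<open>z\<close>.
\<close>

definition memory_after :: "cloner \<Rightarrow> nat \<Rightarrow> bool list \<Rightarrow> complex mat" where
  "memory_after A l z =
     (let \<tau> = run (stage1 A l) (advice A l); d = 2 ^ msg_len A l
      in mat (2 ^ mem_len A l) (2 ^ mem_len A l) (\<lambda>(r, c). \<tau> $$ (idx z + d * r, idx z + d * c)))"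

text \<open>
  The probability that \<open>(B(x\<^sub>B, \<cdot>) \<otimes> C(x\<^sub>C, \<cdot>))(\<sigma>)\<close> gives \<open>(b, b)\<close>, by expanding \<open>\<sigma>\<close> into tensor
  products of matrix units, on which the product of the two (linear) channels is determined.
\<close>

definition both_output_prob ::
  "qcircuit \<Rightarrow> qcircuit \<Rightarrow> nat \<Rightarrow> nat \<Rightarrow> bool list \<Rightarrow> bool list \<Rightarrow> complex mat \<Rightarrow> bool \<Rightarrow> real" where
  "both_output_prob B C kB kC x\<^sub>B x\<^sub>C \<sigma> b = Re (\<Sum>i<2 ^ kB. \<Sum>i'<2 ^ kB. \<Sum>j<2 ^ kC. \<Sum>j'<2 ^ kC.
     \<sigma> $$ (i + 2 ^ kB * j, i' + 2 ^ kB * j')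
     * run B (basis_state x\<^sub>B \<otimes>\<^sub>q matrix_unit kB i i') $$ (idx [b], idx [b])
     * run C (basis_state x\<^sub>C \<otimes>\<^sub>q matrix_unit kC j j') $$ (idx [b], idx [b]))"

text \<open>
  The probability that \<open>A\<close> sends \<open>z\<close> and, given the challenge state \<open>\<omega>\<close>, both \<open>B\<close> and \<open>C\<close> output \<open>b\<close>.
\<close>

definition clone_prob ::
  "cloner \<Rightarrow> nat \<Rightarrow> bool list \<Rightarrow> complex mat \<Rightarrow> bool list \<Rightarrow> bool list \<Rightarrow> bool \<Rightarrow> real" where
  "clone_prob A l z \<omega> x\<^sub>B x\<^sub>C b =
     both_output_prob (bob A l) (charlie A l) (bob_len A l) (charlie_len A l) x\<^sub>B x\<^sub>C
       (run (stage2 A l) (memory_after A l z \<otimes>\<^sub>q \<omega>)) b"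


section \<open>Key-testable unclonable bit encryption\<close>

definition ciphertext :: "(nat \<Rightarrow> qcircuit) \<Rightarrow> nat \<Rightarrow> bool list \<Rightarrow> bool \<Rightarrow> complex mat" where
  "ciphertext Enc l sk b = run (Enc l) (basis_state (sk @ [b]))"

definition ue_syntax :: "(nat \<Rightarrow> qcircuit) \<Rightarrow> (nat \<Rightarrow> qcircuit) \<Rightarrow> (nat \<Rightarrow> qcircuit) \<Rightarrow> bool" where
  "ue_syntax Enc Dec Test \<longleftrightarrow>
     qpt 1 (\<lambda>ns. Enc (ns ! 0)) \<and> qpt 1 (\<lambda>ns. Dec (ns ! 0)) \<and> qpt 1 (\<lambda>ns. Test (ns ! 0))
   \<and> (\<forall>l. q_in (Enc l) = l + 1
        \<and> q_in (Dec l) = l + q_out (Enc l) \<and> q_out (Dec l) = 1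
        \<and> q_in (Test l) = l + q_out (Enc l) \<and> q_out (Test l) = 1)"

definition ue_correct :: "(nat \<Rightarrow> qcircuit) \<Rightarrow> (nat \<Rightarrow> qcircuit) \<Rightarrow> bool" where
  "ue_correct Enc Dec \<longleftrightarrow> (\<exists>\<epsilon>. negligible \<epsilon> \<and> (\<forall>l b.
     measure_pmf.expectation (pmf_of_set (bitstrings l))
       (\<lambda>sk. outcome_prob (Dec l) (basis_state sk \<otimes>\<^sub>q ciphertext Enc l sk b) [b]) \<ge> 1 - \<epsilon> l))"

definition key_testable :: "(nat \<Rightarrow> qcircuit) \<Rightarrow> (nat \<Rightarrow> qcircuit) \<Rightarrow> bool" where
  "key_testable Enc Test \<longleftrightarrow> (\<forall>l b. \<forall>sk \<in> bitstrings l. \<forall>sk' \<in> bitstrings l.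
     outcome_prob (Test l) (basis_state sk' \<otimes>\<^sub>q ciphertext Enc l sk b) [sk' = sk] = 1)"

definition ue_win_prob :: "(nat \<Rightarrow> qcircuit) \<Rightarrow> cloner \<Rightarrow> nat \<Rightarrow> real" where
  "ue_win_prob Enc A l =
     measure_pmf.expectation (pmf_of_set (bitstrings l)) (\<lambda>sk.
       \<Sum>z \<in> bitstrings 2. (\<Sum>b \<in> UNIV. clone_prob A l z (ciphertext Enc l sk (z ! of_bool b)) sk sk b) / 2)"

definition unclonable_indistinguishable :: "(nat \<Rightarrow> qcircuit) \<Rightarrow> bool" where
  "unclonable_indistinguishable Enc \<longleftrightarrow>
     (\<forall>A. cloner_wf (\<lambda>l. q_out (Enc l)) (\<lambda>l. l) A \<and> (\<forall>l. msg_len A l = 2) \<longrightarrow>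
        (\<exists>\<epsilon>. negligible \<epsilon> \<and> (\<forall>l. ue_win_prob Enc A l \<le> 1 / 2 + \<epsilon> l)))"

definition key_testable_ue ::
  "(nat \<Rightarrow> qcircuit) \<Rightarrow> (nat \<Rightarrow> qcircuit) \<Rightarrow> (nat \<Rightarrow> qcircuit) \<Rightarrow> bool" where
  "key_testable_ue Enc Dec Test \<longleftrightarrow> ue_syntax Enc Dec Test \<and> ue_correct Enc Dec
     \<and> unclonable_indistinguishable Enc \<and> key_testable Enc Test"


section \<open>Generalized puncturable keyed circuit classes\<close>

record circuit_class =
  key_len :: "nat \<Rightarrow> nat"
  keys :: "nat \<Rightarrow> bool list set"
  in_len :: "nat \<Rightarrow> nat"
  out_len :: "nat \<Rightarrow> nat"
  circ :: "nat \<Rightarrow> bool list \<Rightarrow> bcircuit"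

definition keyed_circuit_class :: "circuit_class \<Rightarrow> bool" where
  "keyed_circuit_class W \<longleftrightarrow>
     poly_bounded (key_len W) \<and> poly_bounded (in_len W) \<and> poly_bounded (out_len W)
   \<and> (\<forall>l. keys W l \<subseteq> bitstrings (key_len W l))
   \<and> (\<exists>S. poly_bounded S \<and> (\<forall>l. \<forall>s \<in> keys W l.
        b_wf (in_len W l) (out_len W l) (circ W l s) \<and> b_size (circ W l s) = S l))"

type_synonym gen_puncture =
  "nat \<Rightarrow> bool list \<Rightarrow> bool list \<Rightarrow> bool list \<Rightarrow> bcircuit \<Rightarrow> bcircuit \<Rightarrow> bcircuit"

definition gen_puncture_correct :: "circuit_class \<Rightarrow> gen_puncture \<Rightarrow> bool" where
  "gen_puncture_correct W GP \<longleftrightarrow>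
     (\<forall>l. \<forall>s \<in> keys W l. \<forall>x\<^sub>B \<in> bitstrings (in_len W l). \<forall>x\<^sub>C \<in> bitstrings (in_len W l). \<forall>\<mu>\<^sub>B \<mu>\<^sub>C.
        b_wf (in_len W l) (out_len W l) \<mu>\<^sub>B \<and> b_wf (in_len W l) (out_len W l) \<mu>\<^sub>C \<longrightarrow>
        b_wf (in_len W l) (out_len W l) (GP l s x\<^sub>B x\<^sub>C \<mu>\<^sub>B \<mu>\<^sub>C)
      \<and> b_size (GP l s x\<^sub>B x\<^sub>C \<mu>\<^sub>B \<mu>\<^sub>C) = b_size (circ W l s)
      \<and> (\<forall>x \<in> bitstrings (in_len W l). b_eval (GP l s x\<^sub>B x\<^sub>C \<mu>\<^sub>B \<mu>\<^sub>C) x =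
           (if x = x\<^sub>B then b_eval \<mu>\<^sub>B x\<^sub>B else if x = x\<^sub>C then b_eval \<mu>\<^sub>C x\<^sub>C else b_eval (circ W l s) x)))"

text \<open>
  As the class is in P/poly, so is \<open>GenPuncture\<close>: it is computed by Boolean circuits of size
  polynomial in the security parameter and the lengths of the descriptions of the two given circuits.
\<close>

definition gen_puncture_efficient :: "circuit_class \<Rightarrow> gen_puncture \<Rightarrow> bool" where
  "gen_puncture_efficient W GP \<longleftrightarrow> (\<exists>P c. \<forall>l. \<forall>s \<in> keys W l.
     \<forall>x\<^sub>B \<in> bitstrings (in_len W l). \<forall>x\<^sub>C \<in> bitstrings (in_len W l). \<forall>\<mu>\<^sub>B \<mu>\<^sub>C.
       b_wf (in_len W l) (out_len W l) \<mu>\<^sub>B \<and> b_wf (in_len W l) (out_len W l) \<mu>\<^sub>C \<longrightarrow>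
       (let l\<^sub>B = length (enc_bcircuit \<mu>\<^sub>B); l\<^sub>C = length (enc_bcircuit \<mu>\<^sub>C);
            inp = s @ x\<^sub>B @ x\<^sub>C @ enc_bcircuit \<mu>\<^sub>B @ enc_bcircuit \<mu>\<^sub>C;
            Q = P l l\<^sub>B l\<^sub>C
        in b_wf (length inp) (length (b_outs Q)) Q
         \<and> b_size Q + length (b_outs Q) \<le> (l + l\<^sub>B + l\<^sub>C) ^ c + c
         \<and> (\<exists>j. b_eval Q inp = enc_bcircuit (GP l s x\<^sub>B x\<^sub>C \<mu>\<^sub>B \<mu>\<^sub>C) @ replicate j False)))"

definition generalized_puncturable :: "circuit_class \<Rightarrow> gen_puncture \<Rightarrow> bool" where
  "generalized_puncturable W GP \<longleftrightarrow>
     keyed_circuit_class W \<and> gen_puncture_correct W GP \<and> gen_puncture_efficient W GP"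


section \<open>Unclonable puncturable obfuscation\<close>

text \<open>
  Classical circuits are obfuscated with the trivial state, padded to \<open>k\<close> zero qubits and to
  description length \<open>L\<close>.
\<close>

definition obfuscate_classical :: "obfuscator \<Rightarrow> nat \<Rightarrow> nat \<Rightarrow> nat \<Rightarrow> bcircuit \<Rightarrow> complex mat" where
  "obfuscate_classical Obf l L k B =
     obfuscate Obf l L k (b_to_q k B) (basis_state (replicate k False))"

definition upo_correct ::
  "circuit_class \<Rightarrow> (nat \<Rightarrow> nat) \<Rightarrow> (nat \<Rightarrow> nat) \<Rightarrow> obfuscator \<Rightarrow> evaluator \<Rightarrow> bool" where
  "upo_correct W L k Obf Eval \<longleftrightarrow> (\<exists>\<epsilon>. negligible \<epsilon> \<and>
     (\<forall>l. \<forall>s \<in> keys W l. \<forall>x \<in> bitstrings (in_len W l).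
        outcome_prob (Eval l (q_out (Obf l (L l) (k l))) (in_len W l) (out_len W l))
          (obfuscate_classical Obf l (L l) (k l) (circ W l s) \<otimes>\<^sub>q basis_state x)
          (b_eval (circ W l s) x) \<ge> 1 - \<epsilon> l))"

text \<open>
  The bit string \<open>z\<close> is the message \<open>(s, \<mu>\<^sub>B, \<mu>\<^sub>C)\<close>. The polynomial size bound \<open>q\<close> on \<open>\<mu>\<^sub>B\<close> and \<open>\<mu>\<^sub>C\<close>
  is explicit because the padding of the obfuscated circuits has to be chosen after it.
\<close>

definition upo_msg ::
  "circuit_class \<Rightarrow> (nat \<Rightarrow> nat) \<Rightarrow> nat \<Rightarrow> bool list \<Rightarrow> bool list \<times> bcircuit \<times> bcircuit \<Rightarrow> bool" where
  "upo_msg W q l z = (\<lambda>(s, \<mu>\<^sub>B, \<mu>\<^sub>C). s \<in> keys W l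
     \<and> b_wf (in_len W l) (out_len W l) \<mu>\<^sub>B \<and> b_size \<mu>\<^sub>B \<le> q l
     \<and> b_wf (in_len W l) (out_len W l) \<mu>\<^sub>C \<and> b_size \<mu>\<^sub>C \<le> q l
     \<and> (\<exists>j. z = s @ enc_bcircuit \<mu>\<^sub>B @ enc_bcircuit \<mu>\<^sub>C @ replicate j False))"

lemma upo_msg_unique:
  assumes "keyed_circuit_class W" "upo_msg W q l z t" "upo_msg W q l z t'"
  shows "t = t'"
proof -
  obtain s B C s' B' C' where t: "t = (s, B, C)" "t' = (s', B', C')" by (metis prod.exhaust)
  have "length s = key_len W l" "length s' = key_len W l"
    using assms unfolding t upo_msg_def keyed_circuit_class_def bitstrings_def by blast+
  then show ?thesis
    using assms(2,3) unfolding t upo_msg_def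
    by (auto simp: enc_bcircuit_prefix_free)
qed

definition upo_win_prob ::
  "circuit_class \<Rightarrow> gen_puncture \<Rightarrow> (nat \<Rightarrow> nat) \<Rightarrow> (nat \<Rightarrow> nat) \<Rightarrow> obfuscator \<Rightarrow>
   (nat \<Rightarrow> (bool list \<times> bool list) pmf) \<Rightarrow> (nat \<Rightarrow> nat) \<Rightarrow> cloner \<Rightarrow> nat \<Rightarrow> real" where
  "upo_win_prob W GP L k Obf \<D> q A l =
     (\<Sum>z \<in> bitstrings (msg_len A l).
        if \<exists>t. upo_msg W q l z t
        then case THE t. upo_msg W q l z t of (s, \<mu>\<^sub>B, \<mu>\<^sub>C) \<Rightarrow>
          measure_pmf.expectation (\<D> l) (\<lambda>(x\<^sub>B, x\<^sub>C).
            (\<Sum>b \<in> UNIV. clone_prob A l z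
               (obfuscate_classical Obf l (L l) (k l)
                  (if b then GP l s x\<^sub>B x\<^sub>C \<mu>\<^sub>B \<mu>\<^sub>C else circ W l s))
               x\<^sub>B x\<^sub>C b) / 2)
        else 0)"

definition generalized_upo_secure ::
  "circuit_class \<Rightarrow> gen_puncture \<Rightarrow> (nat \<Rightarrow> nat) \<Rightarrow> (nat \<Rightarrow> nat) \<Rightarrow> obfuscator \<Rightarrow>
   (nat \<Rightarrow> (bool list \<times> bool list) pmf) \<Rightarrow> (nat \<Rightarrow> nat) \<Rightarrow> bool" where
  "generalized_upo_secure W GP L k Obf \<D> q \<longleftrightarrow>
     (\<forall>A. cloner_wf (\<lambda>l. q_out (Obf l (L l) (k l))) (in_len W) A \<longrightarrow>
        (\<exists>\<epsilon>. negligible \<epsilon> \<and> (\<forall>l. upo_win_prob W GP L k Obf \<D> q A l \<le> 1 / 2 + \<epsilon> l)))"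

definition generalized_upo ::
  "circuit_class \<Rightarrow> gen_puncture \<Rightarrow> (nat \<Rightarrow> nat) \<Rightarrow> (nat \<Rightarrow> nat) \<Rightarrow> obfuscator \<Rightarrow> evaluator \<Rightarrow>
   (nat \<Rightarrow> (bool list \<times> bool list) pmf) \<Rightarrow> (nat \<Rightarrow> nat) \<Rightarrow> bool" where
  "generalized_upo W GP L k Obf Eval \<D> q \<longleftrightarrow>
     qpt_obfuscator Obf Eval \<and> upo_correct W L k Obf Eval \<and> generalized_upo_secure W GP L k Obf \<D> q"

text \<open>
  The description length \<open>L\<close> needed depends on the number \<open>k\<close> of padding qubits, because the padded
  circuits have these qubits among their inputs.
\<close>

definition sufficiently_padded :: "((nat \<Rightarrow> nat) \<Rightarrow> (nat \<Rightarrow> nat) \<Rightarrow> bool) \<Rightarrow> bool" where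
  "sufficiently_padded P \<longleftrightarrow>
     (\<exists>k\<^sub>0. poly_bounded k\<^sub>0 \<and> (\<forall>k. poly_bounded k \<and> k\<^sub>0 \<le> k \<longrightarrow>
     (\<exists>L\<^sub>0. poly_bounded L\<^sub>0 \<and> (\<forall>L. poly_bounded L \<and> L\<^sub>0 \<le> L \<longrightarrow> P L k))))"

definition Id_U :: "(nat \<Rightarrow> nat) \<Rightarrow> nat \<Rightarrow> (bool list \<times> bool list) pmf" where
  "Id_U n l = map_pmf (\<lambda>x. (x, x)) (pmf_of_set (bitstrings (n l)))"

end

theory Submission
  imports Defs "HOL-Library.Nat_Bijection"
begin

text \<open>
  For a point \<open>x\<close> and a bit \<open>b\<close> let \<open>\<rho>\<close> be an encryption of \<open>b\<close> under the key \<open>x\<close>, and let \<open>C\<close> be the circuit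
  that on \<open>\<rho>\<close> and \<open>x'\<close> tests whether \<open>x'\<close> is the key of \<open>\<rho>\<close>; if it is, and \<open>\<rho>\<close> decrypts to 1, it outputs
  \<open>\<mu>\<^sub>B x'\<close>, otherwise \<open>W\<^sub>s x'\<close>. As the test is never wrong, copying its outcome and uncomputing it leaves \<open>\<rho>\<close>
  intact, so \<open>(C, \<rho>)\<close> implements \<open>W\<^sub>s\<close> if \<open>b = 0\<close> and the circuit punctured at \<open>x\<close> if \<open>b = 1\<close>. Hence the
  obfuscation received by the adversary may be replaced by that of \<open>(C, \<rho>)\<close>, which can be computed from
  the ciphertext alone: the adversary breaks unclonable encryption with \<open>x\<close> as the key. Decryption is
  correct only for an average key, so by Markov's inequality the replacement is made for all but a
  negligible fraction of the points.

  The key length, and hence the security parameter of the encryption scheme, is the input length of the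
  class. Since this grows polynomially, a successful attack at infinitely many security parameters of the
  obfuscation game gives one at infinitely many security parameters of the encryption scheme.
\<close>

section \<open>Gates acting on vectors and kernels\<close>

text \<open>The replacement is made for one point and one bit at a time. These, and the memory that
  the cloner keeps after its message, go into the advice of a distinguisher that plays the rest of
  the game and accepts iff both guesses equal the bit. Indistinguishability speaks of one family of
  instances, whereas averaging over points needs a common bound for all of them; taking a worst
  instance at every security parameter supplies it, and this is where non-uniformity enters.

  The circuit \<open>switch\<close> depends on \<open>s\<close> and \<open>\<mu>\<^sub>B\<close> but
  neither on the point nor on the bit, which are carried by the ciphertext. So the adversary against
  encryption can hold its description as advice. As the two sampled points coincide, the punctured
  circuit differs from the original only in returning \<open>\<mu>\<^sub>B x\<close> at
  \<open>x\<close>.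

  Circuits are explicit gate lists, so composing them, copying a bit and undoing a test have to be
  derived from the action of single gates. The joint winning probability is defined through matrix
  units; it has to be recognized as the acceptance probability of a circuit before a distinguisher
  can use it.\<close>

text \<open>
  A basis state is represented by the set of wires that carry a 1, a vector by a function on such sets,
  and an operator by a kernel on pairs of them. No number of wires is fixed, so ancillas initialized to
  zero need not be mentioned. The parameter \<open>\<omega>\<close> is the phase of the T gate, the only complex gate; the
  conjugated action on the second argument of a kernel is obtained by conjugating it.
\<close>

definition flip :: "nat \<Rightarrow> nat set \<Rightarrow> nat set" where
  "flip i \<beta> = (if i \<in> \<beta> then \<beta> - {i} else insert i \<beta>)"

fun act :: "complex \<Rightarrow> gate \<Rightarrow> (nat set \<Rightarrow> complex) \<Rightarrow> nat set \<Rightarrow> complex" where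
  "act \<omega> (Hadamard i) \<psi> \<beta> =
     (\<psi> (\<beta> - {i}) + (if i \<in> \<beta> then - 1 else 1) * \<psi> (insert i \<beta>)) / complex_of_real (sqrt 2)"
| "act \<omega> (TGate i) \<psi> \<beta> = (if i \<in> \<beta> then \<omega> else 1) * \<psi> \<beta>"
| "act \<omega> (NOT i) \<psi> \<beta> = \<psi> (flip i \<beta>)"
| "act \<omega> (CNOT i j) \<psi> \<beta> = \<psi> (if i \<in> \<beta> then flip j \<beta> else \<beta>)"
| "act \<omega> (Toffoli i j k) \<psi> \<beta> = \<psi> (if i \<in> \<beta> \<and> j \<in> \<beta> then flip k \<beta> else \<beta>)"

type_synonym kernel = "nat set \<Rightarrow> nat set \<Rightarrow> complex"

definition phase :: complex where "phase = cis (pi / 4)"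

definition act2 :: "gate \<Rightarrow> kernel \<Rightarrow> kernel" where
  "act2 g K \<beta> \<gamma> = act phase g (\<lambda>x. act (cnj phase) g (K x) \<gamma>) \<beta>"

definition evo2 :: "gate list \<Rightarrow> kernel \<Rightarrow> kernel" where
  "evo2 gs K = fold act2 gs K"

lemma evo2_Nil [simp]: "evo2 [] K = K"
  and evo2_Cons: "evo2 (g # gs) K = evo2 gs (act2 g K)"
  and evo2_append: "evo2 (gs @ hs) K = evo2 hs (evo2 gs K)"
  by (simp_all add: evo2_def)

definition gate_ok :: "nat set \<Rightarrow> gate \<Rightarrow> bool" where
  "gate_ok X g \<longleftrightarrow> distinct (gate_wires g) \<and> set (gate_wires g) \<subseteq> X"

lemma gate_ok_mono: "gate_ok X g \<Longrightarrow> X \<subseteq> Y \<Longrightarrow> gate_ok Y g"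
  by (auto simp: gate_ok_def)

fun map_wires :: "(nat \<Rightarrow> nat) \<Rightarrow> gate \<Rightarrow> gate" where
  "map_wires f (Hadamard i) = Hadamard (f i)"
| "map_wires f (TGate i) = TGate (f i)"
| "map_wires f (NOT i) = NOT (f i)"
| "map_wires f (CNOT i j) = CNOT (f i) (f j)"
| "map_wires f (Toffoli i j k) = Toffoli (f i) (f j) (f k)"

lemma gate_wires_map: "gate_wires (map_wires f g) = map f (gate_wires g)"
  by (cases g) auto

lemma gate_ok_map: "gate_ok X g \<Longrightarrow> inj_on f X \<Longrightarrow> gate_ok (f ` X) (map_wires f g)"
  by (auto simp: gate_ok_def gate_wires_map distinct_map inj_on_def subset_iff)

lemma phase_cnj [simp]: "phase * cnj phase = 1" "cnj phase * phase = 1"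
  by (simp_all add: phase_def cis_cnj cis_mult)

lemma flip_subset: "i \<in> X \<Longrightarrow> \<beta> \<subseteq> X \<Longrightarrow> flip i \<beta> \<subseteq> X"
  by (auto simp: flip_def)

lemma flip_subset_iff: "i \<in> X \<Longrightarrow> flip i \<beta> \<subseteq> X \<longleftrightarrow> \<beta> \<subseteq> X"
  by (auto simp: flip_def)

lemma flip_flip [simp]: "flip i (flip i \<beta>) = \<beta>"
  by (auto simp: flip_def)

lemma mem_flip: "j \<in> flip i \<beta> \<longleftrightarrow> (if i = j then j \<notin> \<beta> else j \<in> \<beta>)"
  by (auto simp: flip_def)

section \<open>Locality of gates and relabelling of wires\<close>

lemma act_cong:
  assumes "gate_ok X g" "\<beta> \<subseteq> X" "\<And>x. x \<subseteq> X \<Longrightarrow> \<phi> x = \<psi> x"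
  shows "act \<omega> g \<phi> \<beta> = act \<omega> g \<psi> \<beta>"
proof -
  have *: "\<beta> - {i} \<subseteq> X" for i using assms(2) by auto
  show ?thesis
    using assms * by (cases g) (auto simp: gate_ok_def flip_subset)
qed

text \<open>A gate sees only its own wires, so the part \<open>\<rho>\<close> of the basis state
  outside the image is carried along unchanged. Composition of circuits rests on this: a subcircuit
  acts on its relabelled wires while the rest is frozen.\<close>

lemma act_map_wires:
  assumes "inj_on f X" "gate_ok X g" "s \<subseteq> X" "\<rho> \<inter> f ` X = {}"
  shows "act \<omega> (map_wires f g) \<psi> (f ` s \<union> \<rho>) = act \<omega> g (\<lambda>s. \<psi> (f ` s \<union> \<rho>)) s"
proof -
  have mem: "f i \<in> f ` s \<union> \<rho> \<longleftrightarrow> i \<in> s" if "i \<in> X" for i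
    using assms that by (auto simp: inj_on_def)
  have rem: "f ` s \<union> \<rho> - {f i} = f ` (s - {i}) \<union> \<rho>" if "i \<in> X" for i
    using assms that by (auto simp: inj_on_def)
  have ins: "insert (f i) (f ` s \<union> \<rho>) = f ` (insert i s) \<union> \<rho>" for i by auto
  have fl: "flip (f i) (f ` s \<union> \<rho>) = f ` (flip i s) \<union> \<rho>" if "i \<in> X" for i
    using that by (simp only: flip_def mem rem ins) auto
  show ?thesis
    using assms(2) by (cases g) (auto simp: gate_ok_def mem rem ins fl simp del: Un_iff Un_insert_left)
qed

lemma act_sum: "act \<omega> g (\<lambda>x. \<Sum>a\<in>A. \<psi> a x) \<beta> = (\<Sum>a\<in>A. act \<omega> g (\<psi> a) \<beta>)"
  by (cases g) (auto simp: sum_distrib_left sum.distrib sum_negf simp flip: sum_divide_distrib)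

lemma act_scale: "act \<omega> g (\<lambda>x. c * \<psi> x) \<beta> = c * act \<omega> g \<psi> \<beta>"
  by (cases g) (auto simp: algebra_simps add_divide_distrib diff_divide_distrib)

text \<open>The gate changes only wires in \<open>X\<close>, so wires outside \<open>X\<close> that
  start at zero stay at zero.\<close>

lemma act_support:
  assumes "gate_ok X g" "\<And>x. \<not> x \<subseteq> X \<Longrightarrow> \<psi> x = 0" "\<not> \<beta> \<subseteq> X"
  shows "act \<omega> g \<psi> \<beta> = 0"
proof -
  have "\<not> \<beta> - {i} \<subseteq> X" "\<not> insert i \<beta> \<subseteq> X" if "i \<in> X" for i using assms(3) that by auto
  then show ?thesis
    using assms by (cases g) (auto simp: gate_ok_def flip_subset_iff)
qed

lemma act_cnj: "cnj (act \<omega> g \<psi> \<beta>) = act (cnj \<omega>) g (\<lambda>x. cnj (\<psi> x)) \<beta>"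
  by (cases g) auto

text \<open>Rows and columns are transformed independently and linearly. With this the two row
  actions, and the two column actions, of a gate and its inverse can be brought together.\<close>

lemma act_commute:
  "act \<omega> g (\<lambda>x. act \<omega>' h (K x) \<gamma>) \<beta> = act \<omega>' h (\<lambda>y. act \<omega> g (\<lambda>x. K x y) \<beta>) \<gamma>"
  by (cases g; cases h)
     (auto simp: field_simps)

section \<open>Unitarity of the gates\<close>

lemma sum_Pow_split:
  fixes F :: "nat set \<Rightarrow> 'a :: comm_monoid_add"
  assumes "finite X" "i \<in> X"
  shows "(\<Sum>\<beta>\<in>Pow X. F \<beta>) = (\<Sum>\<beta>\<in>Pow (X - {i}). F \<beta> + F (insert i \<beta>))"
proof -
  have "Pow X = Pow (X - {i}) \<union> insert i ` Pow (X - {i})"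
    using assms Pow_insert[of i "X - {i}"] by (simp add: insert_absorb)
  then have "(\<Sum>\<beta>\<in>Pow X. F \<beta>) = (\<Sum>\<beta>\<in>Pow (X - {i}). F \<beta>) + (\<Sum>\<beta>\<in>insert i ` Pow (X - {i}). F \<beta>)"
    using assms by (simp only:) (rule sum.union_disjoint, auto)
  also have "(\<Sum>\<beta>\<in>insert i ` Pow (X - {i}). F \<beta>) = (\<Sum>\<beta>\<in>Pow (X - {i}). F (insert i \<beta>))"
    by (subst sum.reindex) (auto simp: inj_on_def)
  finally show ?thesis by (simp add: sum.distrib)
qed

lemma sum_Pow_involution:
  assumes "\<And>x. x \<subseteq> X \<Longrightarrow> p x \<subseteq> X" "\<And>x. x \<subseteq> X \<Longrightarrow> p (p x) = x"
  shows "(\<Sum>x\<in>Pow X. F (p x)) = (\<Sum>x\<in>Pow X. F x)"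
  by (rule sum.reindex_bij_witness[of _ p p]) (use assms in auto)

fun perm :: "gate \<Rightarrow> nat set \<Rightarrow> nat set" where
  "perm (NOT i) \<beta> = flip i \<beta>"
| "perm (CNOT i j) \<beta> = (if i \<in> \<beta> then flip j \<beta> else \<beta>)"
| "perm (Toffoli i j k) \<beta> = (if i \<in> \<beta> \<and> j \<in> \<beta> then flip k \<beta> else \<beta>)"
| "perm _ \<beta> = \<beta>"

fun classical :: "gate \<Rightarrow> bool" where
  "classical (Hadamard i) = False"
| "classical (TGate i) = False"
| "classical _ = True"

lemma perm_perm: "distinct (gate_wires g) \<Longrightarrow> perm g (perm g \<beta>) = \<beta>"
  by (cases g) (auto simp: mem_flip)

lemma perm_subset: "gate_ok X g \<Longrightarrow> \<beta> \<subseteq> X \<Longrightarrow> perm g \<beta> \<subseteq> X"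
  by (cases g) (auto simp: gate_ok_def flip_subset)

lemma act_classical: "classical g \<Longrightarrow> act \<omega> g \<psi> \<beta> = \<psi> (perm g \<beta>)"
  by (cases g) auto

lemma sqrt2_sq: "complex_of_real (sqrt 2) * complex_of_real (sqrt 2) = 2"
  by (simp flip: of_real_mult)

text \<open>Unitarity: permutation gates reorder the diagonal, T multiplies its entries by a phase
  times the conjugate phase, and Hadamard preserves the sum over each pair of sets that differ in
  wire \<open>i\<close>.\<close>

lemma act2_trace:
  assumes "finite X" "gate_ok X g"
  shows "(\<Sum>\<beta>\<in>Pow X. act2 g K \<beta> \<beta>) = (\<Sum>\<beta>\<in>Pow X. K \<beta> \<beta>)"
proof (cases "classical g")
  case True
  then show ?thesis
    using sum_Pow_involution[of X "perm g" "\<lambda>x. K x x"] assms perm_subset perm_perm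
    by (simp add: act2_def act_classical gate_ok_def)
next
  case False
  then consider i where "g = Hadamard i" | i where "g = TGate i" by (cases g) auto
  then show ?thesis
  proof cases
    case 1
    then have i: "i \<in> X" using assms by (auto simp: gate_ok_def)
    have "act2 g K \<beta> \<beta> + act2 g K (insert i \<beta>) (insert i \<beta>) = K \<beta> \<beta> + K (insert i \<beta>) (insert i \<beta>)"
      if "\<beta> \<in> Pow (X - {i})" for \<beta>
    proof -
      have "\<beta> - {i} = \<beta>" "i \<notin> \<beta>" using that by auto
      then show ?thesis using sqrt2_sq by (simp add: act2_def 1 field_simps)
    qed
    then show ?thesis
      unfolding sum_Pow_split[OF assms(1) i] by (intro sum.cong refl)
  next
    case 2
    then show ?thesis by (auto simp: act2_def intro!: sum.cong simp flip: mult.assoc)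
  qed
qed

text \<open>Every gate matrix equals its transpose, so its adjoint is the entrywise conjugate. This
  is what lets \<open>form_act2\<close> move a gate from the kernel to the test vector.\<close>

lemma act_symmetric:
  assumes "finite X" "gate_ok X g"
  shows "(\<Sum>\<beta>\<in>Pow X. act \<omega> g \<phi> \<beta> * u \<beta>) = (\<Sum>\<beta>\<in>Pow X. \<phi> \<beta> * act \<omega> g u \<beta>)"
proof (cases "classical g")
  case True
  have "(\<Sum>\<beta>\<in>Pow X. \<phi> (perm g \<beta>) * u (perm g (perm g \<beta>))) = (\<Sum>\<beta>\<in>Pow X. \<phi> \<beta> * u (perm g \<beta>))"
    by (rule sum_Pow_involution) (use assms perm_subset perm_perm in \<open>auto simp: gate_ok_def\<close>)
  then show ?thesis
    using True assms by (simp add: act_classical perm_perm gate_ok_def)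
next
  case False
  then consider i where "g = Hadamard i" | i where "g = TGate i" by (cases g) auto
  then show ?thesis
  proof cases
    case 1
    then have i: "i \<in> X" using assms by (auto simp: gate_ok_def)
    have "act \<omega> g \<phi> \<beta> * u \<beta> + act \<omega> g \<phi> (insert i \<beta>) * u (insert i \<beta>)
        = \<phi> \<beta> * act \<omega> g u \<beta> + \<phi> (insert i \<beta>) * act \<omega> g u (insert i \<beta>)"
      if "\<beta> \<in> Pow (X - {i})" for \<beta>
    proof -
      have "\<beta> - {i} = \<beta>" "i \<notin> \<beta>" using that by auto
      then show ?thesis by (simp add: 1 field_simps)
    qed
    then show ?thesis
      unfolding sum_Pow_split[OF assms(1) i] by (intro sum.cong refl)
  next
    case 2
    then show ?thesis by (auto intro!: sum.cong)
  qed
qed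

lemma act2_map_wires:
  assumes "inj_on f X" "gate_ok X g" "s \<subseteq> X" "t \<subseteq> X" "\<rho> \<inter> f ` X = {}" "\<tau> \<inter> f ` X = {}"
  shows "act2 (map_wires f g) K (f ` s \<union> \<rho>) (f ` t \<union> \<tau>)
       = act2 g (\<lambda>x y. K (f ` x \<union> \<rho>) (f ` y \<union> \<tau>)) s t"
  using assms by (simp add: act2_def act_map_wires)

lemma act2_cong:
  assumes "gate_ok X g" "\<beta> \<subseteq> X" "\<gamma> \<subseteq> X" "\<And>x y. x \<subseteq> X \<Longrightarrow> y \<subseteq> X \<Longrightarrow> K x y = L x y"
  shows "act2 g K \<beta> \<gamma> = act2 g L \<beta> \<gamma>"
  unfolding act2_def using assms by (intro act_cong[of X]) auto

lemma evo2_cong: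
  assumes "\<forall>g\<in>set gs. gate_ok X g" "\<beta> \<subseteq> X" "\<gamma> \<subseteq> X" "\<And>x y. x \<subseteq> X \<Longrightarrow> y \<subseteq> X \<Longrightarrow> K x y = L x y"
  shows "evo2 gs K \<beta> \<gamma> = evo2 gs L \<beta> \<gamma>"
  using assms
proof (induction gs arbitrary: K L)
  case (Cons g gs)
  show ?case unfolding evo2_Cons
    by (rule Cons.IH) (use Cons.prems act2_cong[of X g _ _ K L] in auto)
qed auto

lemma evo2_map_wires:
  assumes "inj_on f X" "\<forall>g\<in>set gs. gate_ok X g" "s \<subseteq> X" "t \<subseteq> X" "\<rho> \<inter> f ` X = {}" "\<tau> \<inter> f ` X = {}"
  shows "evo2 (map (map_wires f) gs) K (f ` s \<union> \<rho>) (f ` t \<union> \<tau>)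
       = evo2 gs (\<lambda>x y. K (f ` x \<union> \<rho>) (f ` y \<union> \<tau>)) s t"
  using assms
proof (induction gs arbitrary: K)
  case (Cons g gs)
  have "evo2 (map (map_wires f) (g # gs)) K (f ` s \<union> \<rho>) (f ` t \<union> \<tau>)
     = evo2 gs (\<lambda>x y. act2 (map_wires f g) K (f ` x \<union> \<rho>) (f ` y \<union> \<tau>)) s t"
    using Cons by (simp add: evo2_Cons)
  also have "\<dots> = evo2 gs (act2 g (\<lambda>x y. K (f ` x \<union> \<rho>) (f ` y \<union> \<tau>))) s t"
    by (rule evo2_cong[of _ X]) (use Cons.prems act2_map_wires in auto)
  finally show ?case by (simp add: evo2_Cons)
qed auto

lemma act2_sum: "act2 g (\<lambda>x y. \<Sum>a\<in>A. K a x y) \<beta> \<gamma> = (\<Sum>a\<in>A. act2 g (K a) \<beta> \<gamma>)"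
  by (simp add: act2_def act_sum)

lemma evo2_sum: "evo2 gs (\<lambda>x y. \<Sum>a\<in>A. K a x y) \<beta> \<gamma> = (\<Sum>a\<in>A. evo2 gs (K a) \<beta> \<gamma>)"
  by (induction gs arbitrary: K) (simp_all add: evo2_Cons act2_sum[abs_def])

lemma act2_scale: "act2 g (\<lambda>x y. c * K x y) \<beta> \<gamma> = c * act2 g K \<beta> \<gamma>"
  by (simp add: act2_def act_scale)

lemma evo2_scale: "evo2 gs (\<lambda>x y. c * K x y) \<beta> \<gamma> = c * evo2 gs K \<beta> \<gamma>"
  by (induction gs arbitrary: K) (simp_all add: evo2_Cons act2_scale[abs_def])

text \<open>All wires outside \<open>X\<close> are in the zero state.\<close>

definition supported :: "nat set \<Rightarrow> kernel \<Rightarrow> bool" where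
  "supported X K \<longleftrightarrow> (\<forall>x y. K x y \<noteq> 0 \<longrightarrow> x \<subseteq> X \<and> y \<subseteq> X)"

lemma supportedD: "supported X K \<Longrightarrow> \<not> x \<subseteq> X \<or> \<not> y \<subseteq> X \<Longrightarrow> K x y = 0"
  by (auto simp: supported_def)

lemma supported_mono: "supported X K \<Longrightarrow> X \<subseteq> Y \<Longrightarrow> supported Y K"
  unfolding supported_def by (meson subset_trans)

lemma act_0: "act \<omega> g (\<lambda>x. 0) \<beta> = 0"
  using act_scale[of \<omega> g 0 "\<lambda>x. 0" \<beta>] by simp

lemma act2_supported: "gate_ok X g \<Longrightarrow> supported X K \<Longrightarrow> supported X (act2 g K)"
proof -
  assume *: "gate_ok X g" "supported X K"
  have "act2 g K \<beta> \<gamma> = 0" if "\<not> \<beta> \<subseteq> X \<or> \<not> \<gamma> \<subseteq> X" for \<beta> \<gamma>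
  proof (cases "\<gamma> \<subseteq> X")
    case True
    then have "\<not> \<beta> \<subseteq> X" using that by blast
    then show ?thesis unfolding act2_def
    proof (rule act_support[OF *(1), rotated])
      fix x assume "\<not> x \<subseteq> X"
      then have "K x = (\<lambda>_. 0)" using *(2) supportedD by blast
      then show "act (cnj phase) g (K x) \<gamma> = 0" by (simp add: act_0)
    qed
  next
    case False
    then have "act (cnj phase) g (K x) \<gamma> = 0" for x
      by (rule act_support[OF *(1), rotated]) (use *(2) supportedD in auto)
    then show ?thesis unfolding act2_def by (simp add: act_0)
  qed
  then show ?thesis by (auto simp: supported_def)
qed

lemma evo2_supported: "\<forall>g\<in>set gs. gate_ok X g \<Longrightarrow> supported X K \<Longrightarrow> supported X (evo2 gs K)"
  by (induction gs arbitrary: K) (simp_all add: evo2_Cons act2_supported)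

lemma evo2_trace:
  assumes "finite X" "\<forall>g\<in>set gs. gate_ok X g"
  shows "(\<Sum>\<beta>\<in>Pow X. evo2 gs K \<beta> \<beta>) = (\<Sum>\<beta>\<in>Pow X. K \<beta> \<beta>)"
  using assms by (induction gs arbitrary: K) (simp_all add: evo2_Cons act2_trace)

section \<open>Positive semidefinite kernels\<close>

definition form :: "nat set \<Rightarrow> kernel \<Rightarrow> (nat set \<Rightarrow> complex) \<Rightarrow> complex" where
  "form X K v = (\<Sum>\<beta>\<in>Pow X. \<Sum>\<gamma>\<in>Pow X. K \<beta> \<gamma> * cnj (v \<beta>) * v \<gamma>)"

text \<open>In the order on complex numbers \<open>\<ge> 0\<close> includes being real, so the
  condition contains Hermitian symmetry on \<open>X\<close>.\<close>

definition psd :: "nat set \<Rightarrow> kernel \<Rightarrow> bool" where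
  "psd X K \<longleftrightarrow> (\<forall>v. form X K v \<ge> 0)"

text \<open>Conjugating the kernel by a unitary amounts to applying its adjoint to the test vector;
  as gates are symmetric, the adjoint is the action with the conjugate phase.\<close>

lemma form_act2:
  assumes "finite X" "gate_ok X g"
  shows "form X (act2 g K) v = form X K (act (cnj phase) g v)"
proof -
  have "form X (act2 g K) v
      = (\<Sum>\<gamma>\<in>Pow X. \<Sum>\<beta>\<in>Pow X. act phase g (\<lambda>x. act (cnj phase) g (K x) \<gamma>) \<beta> * (cnj (v \<beta>) * v \<gamma>))"
    unfolding form_def act2_def by (subst sum.swap) (simp add: mult.assoc)
  also have "\<dots> = (\<Sum>\<gamma>\<in>Pow X. \<Sum>\<beta>\<in>Pow X. act phase g (\<lambda>x. act (cnj phase) g (K x) \<gamma>) \<beta> * cnj (v \<beta>) * v \<gamma>)"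
    by (simp add: mult.assoc)
  also have "\<dots> = (\<Sum>\<gamma>\<in>Pow X. \<Sum>\<beta>\<in>Pow X. act (cnj phase) g (K \<beta>) \<gamma> * act phase g (\<lambda>x. cnj (v x)) \<beta> * v \<gamma>)"
    by (simp add: act_symmetric[OF assms] flip: sum_distrib_right)
  also have "\<dots> = (\<Sum>\<beta>\<in>Pow X. act phase g (\<lambda>x. cnj (v x)) \<beta> * (\<Sum>\<gamma>\<in>Pow X. act (cnj phase) g (K \<beta>) \<gamma> * v \<gamma>))"
    by (subst sum.swap) (simp add: sum_distrib_left algebra_simps)
  also have "\<dots> = (\<Sum>\<beta>\<in>Pow X. act phase g (\<lambda>x. cnj (v x)) \<beta> * (\<Sum>\<gamma>\<in>Pow X. K \<beta> \<gamma> * act (cnj phase) g v \<gamma>))"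
    by (simp add: act_symmetric[OF assms])
  also have "\<dots> = form X K (act (cnj phase) g v)"
    by (simp add: form_def act_cnj sum_distrib_left algebra_simps)
  finally show ?thesis .
qed

lemma evo2_psd: "finite X \<Longrightarrow> \<forall>g\<in>set gs. gate_ok X g \<Longrightarrow> psd X K \<Longrightarrow> psd X (evo2 gs K)"
  by (induction gs arbitrary: K) (simp_all add: evo2_Cons psd_def form_act2)

lemma psd_diag:
  assumes "finite X" "psd X K" "\<beta> \<subseteq> X"
  shows "K \<beta> \<beta> \<ge> 0"
proof -
  have "form X K (\<lambda>x. of_bool (x = \<beta>)) = (\<Sum>\<gamma>\<in>Pow X. if \<gamma> = \<beta> then K \<beta> \<beta> else 0)"
    unfolding form_def
    by (intro sum.cong refl) (use assms in \<open>auto simp: sum.delta' if_distrib cong: if_cong intro: sum.neutral\<close>)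
  also have "\<dots> = K \<beta> \<beta>" using assms by (simp add: sum.delta)
  finally show ?thesis using assms by (metis psd_def)
qed

lemma form_two:
  assumes "finite X" "\<beta> \<subseteq> X" "\<gamma> \<subseteq> X" "\<beta> \<noteq> \<gamma>"
  shows "form X K (\<lambda>x. if x = \<beta> then s else if x = \<gamma> then t else 0)
       = K \<beta> \<beta> * cnj s * s + K \<beta> \<gamma> * cnj s * t + K \<gamma> \<beta> * cnj t * s + K \<gamma> \<gamma> * cnj t * t"
proof -
  let ?v = "\<lambda>x. if x = \<beta> then s else if x = \<gamma> then t else 0"
  have two: "(\<Sum>x\<in>Pow X. F x) = F \<beta> + F \<gamma>" if "\<And>x. x \<noteq> \<beta> \<Longrightarrow> x \<noteq> \<gamma> \<Longrightarrow> F x = 0" for F :: "nat set \<Rightarrow> complex"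
  proof -
    have "(\<Sum>x\<in>Pow X. F x) = (\<Sum>x\<in>{\<beta>, \<gamma>}. F x)"
      by (rule sum.mono_neutral_right) (use assms that in auto)
    then show ?thesis using assms by simp
  qed
  have "form X K ?v = (\<Sum>x\<in>Pow X. K x \<beta> * cnj (?v x) * s + K x \<gamma> * cnj (?v x) * t)"
    unfolding form_def by (intro sum.cong refl, subst two) (use assms in auto)
  also have "\<dots> = (K \<beta> \<beta> * cnj s * s + K \<beta> \<gamma> * cnj s * t) + (K \<gamma> \<beta> * cnj t * s + K \<gamma> \<gamma> * cnj t * t)"
    by (subst two) (use assms in auto)
  finally show ?thesis by (simp add: add.assoc)
qed

text \<open>On vectors supported on \<open>\<beta>\<close> and \<open>\<gamma>\<close> the form is
  that of a 2 by 2 matrix with a zero on the diagonal. Its values are real, which makes the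
  off-diagonal entries \<open>a\<close> and \<open>b\<close> conjugate. With
  \<open>s = - u a\<close> and \<open>t = 1\<close> it equals \<open>d - 2 u |a|^2\<close>, which is
  nonnegative for every real \<open>u\<close> only if \<open>a = 0\<close>.\<close>

lemma psd_zero_row:
  assumes "finite X" "psd X K" "\<beta> \<subseteq> X" "\<gamma> \<subseteq> X" "K \<beta> \<beta> = 0"
  shows "K \<beta> \<gamma> = 0" "K \<gamma> \<beta> = 0"
proof -
  have "K \<beta> \<gamma> = 0 \<and> K \<gamma> \<beta> = 0"
  proof (cases "\<beta> = \<gamma>")
    case False
    define a b d where "a = K \<beta> \<gamma>" "b = K \<gamma> \<beta>" "d = K \<gamma> \<gamma>"
    have F: "a * cnj s * t + b * cnj t * s + d * cnj t * t \<ge> 0" for s t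
    proof -
      have "form X K (\<lambda>x. if x = \<beta> then s else if x = \<gamma> then t else 0) \<ge> 0"
        using assms(2) unfolding psd_def by blast
      then show ?thesis by (simp only: form_two[OF assms(1,3,4) False] assms(5) a_b_d_def) simp
    qed
    have d: "d \<ge> 0" using psd_diag[OF assms(1,2,4)] by (simp add: a_b_d_def)
    then have dI: "Im d = 0" by (simp add: less_eq_complex_def)
    have "Im (a + b) = 0" using F[of 1 1] dI by (simp add: less_eq_complex_def)
    moreover have "Im (\<i> * (b - a)) = 0" using F[of \<i> 1] dI by (simp add: less_eq_complex_def algebra_simps)
    ultimately have b: "b = cnj a" by (simp add: complex_eq_iff)
    define u where "u = Re d + 1"
    have u: "u > 0" "Re d < u" using d by (auto simp: u_def less_eq_complex_def)
    have "0 \<le> Re (a * cnj (- of_real u * a) * 1 + b * cnj 1 * (- of_real u * a) + d * cnj 1 * 1)" for u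
      using F[of "- of_real u * a" 1] unfolding less_eq_complex_def by simp
    then have *: "0 \<le> Re d - 2 * u * (cmod a)\<^sup>2" for u
      unfolding b cmod_power2 by (auto simp: power2_eq_square algebra_simps)
    have "a = 0"
    proof (rule ccontr)
      assume "a \<noteq> 0"
      then have "(cmod a)\<^sup>2 > 0" by simp
      then show False using *[of "(Re d + 1) / (cmod a)\<^sup>2"] d by (simp add: less_eq_complex_def)
    qed
    then show ?thesis using b by (simp add: a_b_d_def)
  qed (use assms in auto)
  then show "K \<beta> \<gamma> = 0" "K \<gamma> \<beta> = 0" by auto
qed

section \<open>Undoing a circuit\<close>

fun gate_inv :: "gate \<Rightarrow> gate list" where
  "gate_inv (TGate i) = replicate 7 (TGate i)"
| "gate_inv g = [g]"

lemma evo2_gate_inv: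
  assumes "distinct (gate_wires g)"
  shows "evo2 (gate_inv g) (act2 g K) = K"
proof (cases "classical g")
  case True
  then have "gate_inv g = [g]" by (cases g) auto
  then show ?thesis
    using assms True by (auto simp: evo2_Cons act2_def act_classical perm_perm fun_eq_iff)
next
  case False
  then consider i where "g = Hadamard i" | i where "g = TGate i" by (cases g) auto
  then show ?thesis
  proof cases
    case 1
    have "act \<omega> g (act \<omega> g \<psi>) \<beta> = \<psi> \<beta>" for \<omega> \<psi> \<beta>
      using sqrt2_sq by (auto simp: 1 field_simps insert_absorb)
    then have "act phase g (\<lambda>x. act (cnj phase) g (\<lambda>y. act phase g (\<lambda>x. act (cnj phase) g (K x) y) x) \<gamma>) \<beta> = K \<beta> \<gamma>" for \<beta> \<gamma>
      by (subst act_commute) simp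
    then show ?thesis by (simp add: 1 evo2_Cons act2_def fun_eq_iff)
  next
    case 2
    \<comment> \<open>T has order 8, so the seven T gates of \<open>gate_inv\<close> undo it; the
      gate set itself has no inverse T.\<close>
    have "phase ^ 8 = 1" by (simp add: phase_def Complex.DeMoivre)
    then have *: "phase * (phase * (phase * (phase * (phase * (phase * (phase * phase)))))) = 1"
      by (simp add: numeral_eq_Suc)
    then have "cnj phase * (cnj phase * (cnj phase * (cnj phase * (cnj phase * (cnj phase * (cnj phase * cnj phase)))))) = 1"
      by (metis complex_cnj_mult complex_cnj_one)
    then show ?thesis using *
      by (auto simp: 2 evo2_Cons act2_def fun_eq_iff numeral_eq_Suc algebra_simps)
  qed
qed

definition inverse_gates :: "gate list \<Rightarrow> gate list" where
  "inverse_gates gs = concat (map gate_inv (rev gs))"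

lemma evo2_inverse_gates:
  "\<forall>g\<in>set gs. distinct (gate_wires g) \<Longrightarrow> evo2 (inverse_gates gs) (evo2 gs K) = K"
  by (induction gs arbitrary: K) (simp_all add: inverse_gates_def evo2_Cons evo2_append evo2_gate_inv)

lemma set_inverse_gates: "set (inverse_gates gs) = set gs"
proof -
  have "set (gate_inv g) = {g}" for g by (cases g) auto
  then show ?thesis by (simp add: inverse_gates_def)
qed

lemma length_inverse_gates: "length (inverse_gates gs) \<le> 7 * length gs"
proof -
  have "length (gate_inv g) \<le> 7" for g by (cases g) auto
  then have "length (concat (map gate_inv gs)) \<le> 7 * length gs" for gs
    by (induction gs) (auto intro: order_trans add_mono)
  from this[of "rev gs"] show ?thesis by (simp add: inverse_gates_def)
qed

lemma act_flip:
  assumes "w \<notin> set (gate_wires g)"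
  shows "act \<omega> g (\<lambda>x. \<psi> (flip w x)) \<beta> = act \<omega> g \<psi> (flip w \<beta>)"
proof -
  have "flip w (\<beta> - {i}) = flip w \<beta> - {i}" "flip w (insert i \<beta>) = insert i (flip w \<beta>)"
    "flip w (flip i \<beta>) = flip i (flip w \<beta>)" "i \<in> flip w \<beta> \<longleftrightarrow> i \<in> \<beta>" if "w \<noteq> i" for i
    using that by (auto simp: flip_def)
  then show ?thesis using assms by (cases g) auto
qed

text \<open>A NOT on a wire that no gate touches commutes with the circuit. In
  \<open>run_gentle\<close> this wire holds the copied outcome while the test is undone.\<close>

lemma evo2_flip:
  assumes "\<forall>g\<in>set gs. w \<notin> set (gate_wires g)"
  shows "evo2 gs (\<lambda>x y. K (flip w x) (flip w y)) \<beta> \<gamma> = evo2 gs K (flip w \<beta>) (flip w \<gamma>)"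
  using assms
proof (induction gs arbitrary: K)
  case (Cons g gs)
  then have "act2 g (\<lambda>x y. K (flip w x) (flip w y)) = (\<lambda>x y. act2 g K (flip w x) (flip w y))"
    by (auto simp: act2_def act_flip fun_eq_iff act_flip[of w g _ "\<lambda>x. act _ _ (K x) _"])
  then show ?case using Cons by (simp add: evo2_Cons)
qed auto

section \<open>Circuits as matrices\<close>

lemma bit_set_encode: "finite \<beta> \<Longrightarrow> bit (set_encode \<beta>) i \<longleftrightarrow> i \<in> \<beta>"
  using arg_cong[OF set_encode_inverse[of \<beta>], of "\<lambda>A. i \<in> A"] by (simp add: set_decode_def bit_iff_odd)

lemma eq_set_encodeI: "finite \<beta> \<Longrightarrow> (\<And>i. bit n i \<longleftrightarrow> i \<in> \<beta>) \<Longrightarrow> n = set_encode \<beta>"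
  by (rule bit_eqI) (simp add: bit_set_encode)

lemma set_encode_less: "\<beta> \<subseteq> {..<N} \<Longrightarrow> set_encode \<beta> < 2 ^ N"
proof -
  assume *: "\<beta> \<subseteq> {..<N}"
  then have f: "finite \<beta>" using finite_subset by blast
  have "take_bit N (set_encode \<beta>) = set_encode \<beta>"
    by (rule eq_set_encodeI[OF f]) (use * f in \<open>auto simp: bit_take_bit_iff bit_set_encode\<close>)
  then show ?thesis by (metis take_bit_nat_less_exp)
qed

lemma set_decode_subset: "i < 2 ^ N \<Longrightarrow> set_decode i \<subseteq> {..<N}"
proof
  fix w assume "i < 2 ^ N" "w \<in> set_decode i"
  then have "take_bit N i = i" "bit i w"
    by (simp_all add: take_bit_nat_eq_self set_decode_def bit_iff_odd)
  then have "bit (take_bit N i) w" by simp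
  then show "w \<in> {..<N}" by (simp add: bit_take_bit_iff)
qed

lemma bij_betw_set_encode: "bij_betw set_encode (Pow {..<N}) {..<2 ^ N}"
proof (rule bij_betwI[where g = set_decode])
  show "set_decode (set_encode x) = x" if "x \<in> Pow {..<N}" for x
    using that finite_subset[of x "{..<N}"] by simp
qed (use set_encode_less set_decode_subset in auto)

lemma sum_exp_eq_Pow:
  fixes F :: "nat \<Rightarrow> 'a :: comm_monoid_add"
  shows "(\<Sum>i<2 ^ N. F i) = (\<Sum>\<beta>\<in>Pow {..<N}. F (set_encode \<beta>))"
  by (rule sum.reindex_bij_betw[OF bij_betw_set_encode, symmetric])

text \<open>\<open>set_encode\<close> sends a set of wires to the basis index with exactly these
  bits set, so this is the matrix viewed as a kernel.\<close>

definition ent :: "complex mat \<Rightarrow> kernel" where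
  "ent M \<beta> \<gamma> = M $$ (set_encode \<beta>, set_encode \<gamma>)"

lemma mat_eq_ent:
  assumes "A \<in> carrier_mat (2 ^ N) (2 ^ N)" "B \<in> carrier_mat (2 ^ N) (2 ^ N)"
    and "\<And>\<beta> \<gamma>. \<beta> \<subseteq> {..<N} \<Longrightarrow> \<gamma> \<subseteq> {..<N} \<Longrightarrow> ent A \<beta> \<gamma> = ent B \<beta> \<gamma>"
  shows "A = B"
proof (rule eq_matI)
  fix i j assume "i < dim_row B" "j < dim_col B"
  then show "A $$ (i, j) = B $$ (i, j)"
    using assms(3)[OF set_decode_subset set_decode_subset, of i j] assms(2) by (auto simp: ent_def)
qed (use assms in auto)

lemma ent_mat:
  assumes "\<beta> \<subseteq> {..<N}" "\<gamma> \<subseteq> {..<N}"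
  shows "ent (mat (2 ^ N) (2 ^ N) f) \<beta> \<gamma> = f (set_encode \<beta>, set_encode \<gamma>)"
  using assms set_encode_less by (simp add: ent_def)

lemma ent_mult:
  assumes "A \<in> carrier_mat (2 ^ N) (2 ^ N)" "B \<in> carrier_mat (2 ^ N) (2 ^ N)"
    and "\<beta> \<subseteq> {..<N}" "\<gamma> \<subseteq> {..<N}"
  shows "ent (A * B) \<beta> \<gamma> = (\<Sum>x\<in>Pow {..<N}. ent A \<beta> x * ent B x \<gamma>)"
proof -
  have "ent (A * B) \<beta> \<gamma> = (\<Sum>i<2 ^ N. A $$ (set_encode \<beta>, i) * B $$ (i, set_encode \<gamma>))"
    using assms set_encode_less[of \<beta> N] set_encode_less[of \<gamma> N]
    by (auto simp: ent_def scalar_prod_def atLeast0LessThan intro!: sum.cong)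
  then show ?thesis by (simp add: sum_exp_eq_Pow ent_def)
qed

lemma adjoint_carrier: "A \<in> carrier_mat n m \<Longrightarrow> mat_adjoint A \<in> carrier_mat m n"
  unfolding mat_adjoint_def by (rule carrier_matI) (simp_all add: mat_of_rows_def)

lemma index_adjoint:
  fixes A :: "complex mat"
  shows "A \<in> carrier_mat n m \<Longrightarrow> i < m \<Longrightarrow> j < n \<Longrightarrow> mat_adjoint A $$ (i, j) = cnj (A $$ (j, i))"
  unfolding mat_adjoint_def mat_of_rows_def by simp

lemma ent_adjoint:
  assumes "A \<in> carrier_mat (2 ^ N) (2 ^ N)" "\<beta> \<subseteq> {..<N}" "\<gamma> \<subseteq> {..<N}"
  shows "ent (mat_adjoint A) \<beta> \<gamma> = cnj (ent A \<gamma> \<beta>)"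
  using index_adjoint[OF assms(1)] set_encode_less[OF assms(2)] set_encode_less[OF assms(3)]
  by (simp add: ent_def)

lemma sum_of_bool_eq:
  fixes \<phi> :: "'a \<Rightarrow> complex"
  assumes "finite A" "a \<in> A" "\<And>x. x \<in> A \<Longrightarrow> P x \<longleftrightarrow> x = a"
  shows "(\<Sum>x\<in>A. of_bool (P x) * \<phi> x) = \<phi> a"
proof -
  have "(\<Sum>x\<in>A. of_bool (P x) * \<phi> x) = (\<Sum>x\<in>A. if x = a then \<phi> x else 0)"
    by (intro sum.cong) (auto simp: assms(3))
  then show ?thesis using assms(1,2) by (simp add: sum.delta')
qed

text \<open>A row of a permutation gate or of T has a single nonzero entry and a row of Hadamard has
  two, so the matrix product collapses to \<open>act\<close>.\<close>

lemma gate_entry_act: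
  assumes g: "gate_ok {..<N} g" and \<beta>: "\<beta> \<subseteq> {..<N}"
  shows "(\<Sum>x\<in>Pow {..<N}. gate_entry g (set_encode \<beta>) (set_encode x) * \<phi> x) = act phase g \<phi> \<beta>"
proof -
  note fin = finite_subset[OF _ finite_lessThan]
  have fl: "flip_bit i (set_encode x) = set_encode (flip i x)" if "x \<subseteq> {..<N}" for i x
    by (rule eq_set_encodeI) (use fin[OF that] in \<open>auto simp: flip_def bit_flip_bit_iff bit_set_encode\<close>)
  have un: "unset_bit i (set_encode x) = set_encode (x - {i})" if "x \<subseteq> {..<N}" for i x
    by (rule eq_set_encodeI) (use fin[OF that] in \<open>auto simp: bit_unset_bit_iff bit_set_encode\<close>)
  have eq: "set_encode x = set_encode y \<longleftrightarrow> x = y" if "x \<subseteq> {..<N}" "y \<subseteq> {..<N}" for x y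
    using set_encode_eq fin that by blast
  show ?thesis
  proof (cases "classical g")
    case True
    have p: "gate_entry g (set_encode \<beta>) (set_encode x) = of_bool (\<beta> = perm g x)" if "x \<subseteq> {..<N}" for x
    proof -
      have "gate_entry g (set_encode \<beta>) (set_encode x) = of_bool (set_encode \<beta> = set_encode (perm g x))"
        using True that fin[OF that] by (cases g) (simp_all add: fl bit_set_encode)
      then show ?thesis
        unfolding eq[OF \<beta> perm_subset[OF g that]] .
    qed
    have "(\<Sum>x\<in>Pow {..<N}. gate_entry g (set_encode \<beta>) (set_encode x) * \<phi> x)
        = (\<Sum>x\<in>Pow {..<N}. of_bool (\<beta> = perm g x) * \<phi> x)"
      by (intro sum.cong) (auto simp: p)
    also have "\<dots> = \<phi> (perm g \<beta>)"
      by (rule sum_of_bool_eq) (use g \<beta> perm_subset perm_perm in \<open>auto simp: gate_ok_def\<close>)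
    finally show ?thesis using True by (simp add: act_classical)
  next
    case False
    then consider i where "g = Hadamard i" | i where "g = TGate i" by (cases g) auto
    then show ?thesis
    proof cases
      case 1
      then have i: "i < N" using g by (auto simp: gate_ok_def)
      have e: "gate_entry g (set_encode \<beta>) (set_encode x)
          = (if \<beta> - {i} = x - {i} then (if i \<in> \<beta> \<and> i \<in> x then - 1 else 1) / complex_of_real (sqrt 2) else 0)"
        if "x \<subseteq> {..<N}" for x
      proof -
        have "\<beta> - {i} \<subseteq> {..<N}" "x - {i} \<subseteq> {..<N}" using that \<beta> by blast+
        note eq[OF this]
        then show ?thesis
          unfolding 1 gate_entry.simps un[OF that] un[OF \<beta>] bit_set_encode[OF fin[OF that]] bit_set_encode[OF fin[OF \<beta>]]
          by simp
      qed
      have "(\<Sum>x\<in>Pow {..<N}. gate_entry g (set_encode \<beta>) (set_encode x) * \<phi> x)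
          = (\<Sum>x\<in>{\<beta> - {i}, insert i \<beta>}. gate_entry g (set_encode \<beta>) (set_encode x) * \<phi> x)"
      proof (rule sum.mono_neutral_right)
        show "\<forall>x\<in>Pow {..<N} - {\<beta> - {i}, insert i \<beta>}. gate_entry g (set_encode \<beta>) (set_encode x) * \<phi> x = 0"
        proof
          fix x assume "x \<in> Pow {..<N} - {\<beta> - {i}, insert i \<beta>}"
          moreover from this have "\<beta> - {i} \<noteq> x - {i}" by blast
          ultimately show "gate_entry g (set_encode \<beta>) (set_encode x) * \<phi> x = 0" by (simp add: e)
        qed
      qed (use i \<beta> in auto)
      also have "\<dots> = act phase g \<phi> \<beta>"
      proof -
        have ne: "\<beta> - {i} \<noteq> insert i \<beta>" by blast
        have "\<beta> - {i} \<subseteq> {..<N}" "insert i \<beta> \<subseteq> {..<N}" using i \<beta> by blast+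
        then have "gate_entry g (set_encode \<beta>) (set_encode (\<beta> - {i})) = 1 / complex_of_real (sqrt 2)"
          "gate_entry g (set_encode \<beta>) (set_encode (insert i \<beta>)) = (if i \<in> \<beta> then - 1 else 1) / complex_of_real (sqrt 2)"
          using e by simp_all
        then show ?thesis
          using ne by (simp add: 1 add_divide_distrib)
      qed
      finally show ?thesis .
    next
      case 2
      have "(\<Sum>x\<in>Pow {..<N}. gate_entry g (set_encode \<beta>) (set_encode x) * \<phi> x)
          = (\<Sum>x\<in>Pow {..<N}. of_bool (x = \<beta>) * (act phase g \<phi> x))"
        
      proof (intro sum.cong refl)
        fix x assume "x \<in> Pow {..<N}"
        then have x: "x \<subseteq> {..<N}" by blast
        show "gate_entry g (set_encode \<beta>) (set_encode x) * \<phi> x = of_bool (x = \<beta>) * act phase g \<phi> x"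
          unfolding 2 gate_entry.simps bit_set_encode[OF fin[OF x]] eq[OF \<beta> x] by (auto simp: phase_def)
      qed
      also have "\<dots> = act phase g \<phi> \<beta>"
        by (rule sum_of_bool_eq) (use \<beta> in auto)
      finally show ?thesis .
    qed
  qed
qed

lemma gate_mat_carrier [simp]: "gate_mat N g \<in> carrier_mat (2 ^ N) (2 ^ N)"
  by (simp add: gate_mat_def)

lemma gates_mat_snoc: "gates_mat N (gs @ [g]) = gate_mat N g * gates_mat N gs"
  by (simp add: gates_mat_def)

lemma gates_mat_carrier [simp]: "gates_mat N gs \<in> carrier_mat (2 ^ N) (2 ^ N)"
proof (induction gs rule: rev_induct)
  case (snoc g gs)
  then show ?case unfolding gates_mat_snoc by (intro mult_carrier_mat[of _ _ "2 ^ N"]) simp_all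
qed (simp add: gates_mat_def)

text \<open>Induction on the last gate, because that gate multiplies from the outside on both
  sides.\<close>

lemma ent_gates_mat_sandwich:
  assumes "\<forall>g\<in>set gs. gate_ok {..<N} g" "M \<in> carrier_mat (2 ^ N) (2 ^ N)"
    and "\<beta> \<subseteq> {..<N}" "\<gamma> \<subseteq> {..<N}"
  shows "ent (gates_mat N gs * M * mat_adjoint (gates_mat N gs)) \<beta> \<gamma> = evo2 gs (ent M) \<beta> \<gamma>"
  using assms
proof (induction gs arbitrary: \<beta> \<gamma> rule: rev_induct)
  case Nil
  have "mat_adjoint (1\<^sub>m (2 ^ N) :: complex mat) = 1\<^sub>m (2 ^ N)"
    by (rule eq_matI) (use adjoint_carrier[of "1\<^sub>m (2 ^ N)" "2^N" "2^N"] in \<open>auto simp: index_adjoint[of _ "2^N" "2^N"]\<close>)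
  then show ?case using Nil by (simp add: gates_mat_def)
next
  case (snoc g gs)
  note c = mult_carrier_mat[of _ "2 ^ N" "2 ^ N" _ "2 ^ N"]
  define U where "U = gates_mat N gs"
  define V where "V = U * M * mat_adjoint U"
  define G where "G = gate_mat N g"
  have U: "U \<in> carrier_mat (2 ^ N) (2 ^ N)" and G: "G \<in> carrier_mat (2 ^ N) (2 ^ N)"
    by (simp_all add: U_def G_def)
  note A = adjoint_carrier[OF U] adjoint_carrier[OF G]
  have M: "M \<in> carrier_mat (2 ^ N) (2 ^ N)" using snoc.prems by simp
  have V: "V \<in> carrier_mat (2 ^ N) (2 ^ N)" unfolding V_def by (intro c U M A)
  have GU: "G * U \<in> carrier_mat (2 ^ N) (2 ^ N)" and VG: "V * mat_adjoint G \<in> carrier_mat (2 ^ N) (2 ^ N)"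
    and UG: "mat_adjoint U * mat_adjoint G \<in> carrier_mat (2 ^ N) (2 ^ N)"
    by (intro c U G V A)+
  have GUM: "G * (U * M) \<in> carrier_mat (2 ^ N) (2 ^ N)" "U * M \<in> carrier_mat (2 ^ N) (2 ^ N)"
    by (intro c U G V A M)+
  note car = U G M A V GU VG
  have adj: "mat_adjoint (G * U) = mat_adjoint U * mat_adjoint G"
  proof (rule mat_eq_ent)
    fix \<beta> \<gamma> assume *: "\<beta> \<subseteq> {..<N}" "\<gamma> \<subseteq> {..<N}"
    show "ent (mat_adjoint (G * U)) \<beta> \<gamma> = ent (mat_adjoint U * mat_adjoint G) \<beta> \<gamma>"
      using car * by (simp add: ent_adjoint[of _ N] ent_mult[of _ N] mult.commute)
  qed (use UG adjoint_carrier[OF GU] in auto)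
  have "G * U * M * mat_adjoint (G * U) = G * (V * mat_adjoint G)"
    unfolding adj V_def
    by (simp only: assoc_mult_mat[OF G U M] assoc_mult_mat[OF G GUM(2) UG]
        assoc_mult_mat[OF GUM(2) A(1) A(2), symmetric])
  then have "ent (gates_mat N (gs @ [g]) * M * mat_adjoint (gates_mat N (gs @ [g]))) \<beta> \<gamma>
      = (\<Sum>x\<in>Pow {..<N}. ent G \<beta> x * ent (V * mat_adjoint G) x \<gamma>)"
    using snoc.prems car by (simp add: gates_mat_snoc G_def[symmetric] U_def[symmetric] ent_mult[of _ N])
  also have "\<dots> = (\<Sum>x\<in>Pow {..<N}. ent G \<beta> x * (\<Sum>y\<in>Pow {..<N}. cnj (ent G \<gamma> y) * ent V x y))"
    using snoc.prems car by (intro sum.cong refl) (simp add: ent_mult[of _ N] ent_adjoint[of _ N] mult.commute)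
  also have "\<dots> = (\<Sum>x\<in>Pow {..<N}. ent G \<beta> x * act (cnj phase) g (ent V x) \<gamma>)"
  proof (intro sum.cong refl arg_cong2[of _ _ _ _ "(*)"])
    fix x assume "x \<in> Pow {..<N}"
    \<comment> \<open>The column index meets the conjugated entries of \<open>G\<close>. Conjugating
      the whole sum reduces it to the action of the gate, now with the conjugate phase.\<close>
    have "(\<Sum>y\<in>Pow {..<N}. cnj (ent G \<gamma> y) * ent V x y)
        = cnj (\<Sum>y\<in>Pow {..<N}. gate_entry g (set_encode \<gamma>) (set_encode y) * cnj (ent V x y))"
      using snoc.prems by (auto simp: G_def gate_mat_def ent_mat[of _ N] intro!: sum.cong)
    also have "\<dots> = act (cnj phase) g (ent V x) \<gamma>"
      using snoc.prems by (subst gate_entry_act) (auto simp: act_cnj)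
    finally show "(\<Sum>y\<in>Pow {..<N}. cnj (ent G \<gamma> y) * ent V x y) = act (cnj phase) g (ent V x) \<gamma>" .
  qed
  also have "\<dots> = (\<Sum>x\<in>Pow {..<N}. gate_entry g (set_encode \<beta>) (set_encode x) * act (cnj phase) g (ent V x) \<gamma>)"
    using snoc.prems by (auto simp: G_def gate_mat_def ent_mat[of _ N] intro!: sum.cong)
  also have "\<dots> = act2 g (ent V) \<beta> \<gamma>"
    unfolding act2_def using snoc.prems by (intro gate_entry_act) auto
  also have "\<dots> = act2 g (evo2 gs (ent M)) \<beta> \<gamma>"
  proof (rule act2_cong[of "{..<N}"])
    fix x y assume "x \<subseteq> {..<N}" "y \<subseteq> {..<N}"
    then show "ent V x y = evo2 gs (ent M) x y"
      using snoc.IH[of x y] snoc.prems unfolding V_def U_def by auto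
  qed (use snoc.prems in auto)
  finally show ?case by (simp add: evo2_append evo2_Cons)
qed

section \<open>States, basis states and tensor products as kernels\<close>

definition ker :: "nat \<Rightarrow> complex mat \<Rightarrow> kernel" where
  "ker n \<rho> x y = (if x \<subseteq> {..<n} \<and> y \<subseteq> {..<n} then ent \<rho> x y else 0)"

lemma supported_ker: "supported {..<n} (ker n \<rho>)"
  by (auto simp: supported_def ker_def split: if_splits)

definition true_bits :: "bool list \<Rightarrow> nat set" where
  "true_bits xs = {i. i < length xs \<and> xs ! i}"

lemma true_bits_subset: "true_bits xs \<subseteq> {..<length xs}"
  by (auto simp: true_bits_def)

lemma finite_true_bits [simp]: "finite (true_bits xs)"
  using true_bits_subset finite_subset by blast

lemma true_bits_replicate_False [simp]: "true_bits (replicate n False) = {}"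
  by (auto simp: true_bits_def)

lemma true_bits_Nil [simp]: "true_bits [] = {}"
  by (auto simp: true_bits_def)

lemma true_bits_append: "true_bits (xs @ ys) = true_bits xs \<union> (+) (length xs) ` true_bits ys"
proof -
  have "i \<in> (+) (length xs) ` true_bits ys" if "\<not> i < length xs" "i < length xs + length ys" "ys ! (i - length xs)" for i
    using that by (intro image_eqI[of _ _ "i - length xs"]) (auto simp: true_bits_def)
  then show ?thesis by (auto simp: true_bits_def nth_append)
qed

lemma true_bits_inj: "length xs = length ys \<Longrightarrow> true_bits xs = true_bits ys \<longleftrightarrow> xs = ys"
  by (auto simp: true_bits_def list_eq_iff_nth_eq set_eq_iff)

lemma idx_eq: "idx xs = set_encode (true_bits xs)"
  by (rule eq_set_encodeI)
     (auto simp: idx_def true_bits_def bit_horner_sum_bit_iff)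

lemma idx_less: "idx xs < 2 ^ length xs"
  unfolding idx_eq by (rule set_encode_less[OF true_bits_subset])

lemma true_bits_surj: "\<beta> \<subseteq> {..<n} \<Longrightarrow> \<exists>xs. length xs = n \<and> true_bits xs = \<beta>"
  by (rule exI[of _ "map (\<lambda>i. i \<in> \<beta>) [0..<n]"]) (auto simp: true_bits_def)

lemma bij_betw_true_bits: "bij_betw true_bits (bitstrings n) (Pow {..<n})"
  unfolding bij_betw_def
proof
  show "inj_on true_bits (bitstrings n)"
    by (auto simp: inj_on_def bitstrings_def true_bits_inj)
  show "true_bits ` bitstrings n = Pow {..<n}"
  proof (intro equalityI subsetI)
    fix \<beta> assume "\<beta> \<in> true_bits ` bitstrings n"
    then show "\<beta> \<in> Pow {..<n}" using true_bits_subset by (auto simp: bitstrings_def)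
  next
    fix \<beta> assume "\<beta> \<in> Pow {..<n}"
    then obtain xs where "length xs = n" "true_bits xs = \<beta>" using true_bits_surj by blast
    then show "\<beta> \<in> true_bits ` bitstrings n" by (auto simp: bitstrings_def)
  qed
qed

lemma finite_bitstrings [simp]: "finite (bitstrings n)"
  using bij_betw_finite[OF bij_betw_true_bits] by simp

lemma card_bitstrings: "card (bitstrings n) = 2 ^ n"
  using bij_betw_same_card[OF bij_betw_true_bits[of n]] by (simp add: card_Pow)

lemma sum_Pow_bitstrings:
  fixes F :: "nat set \<Rightarrow> 'a :: comm_monoid_add"
  shows "(\<Sum>\<beta>\<in>Pow {..<n}. F \<beta>) = (\<Sum>x\<in>bitstrings n. F (true_bits x))"
  by (rule sum.reindex_bij_betw[OF bij_betw_true_bits, symmetric])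

lemma basis_state_carrier [simp]: "basis_state xs \<in> carrier_mat (2 ^ length xs) (2 ^ length xs)"
  by (simp add: basis_state_def matrix_unit_def)

lemma matrix_unit_carrier [simp]: "matrix_unit n i j \<in> carrier_mat (2 ^ n) (2 ^ n)"
  by (simp add: matrix_unit_def)

lemma ent_basis_state:
  assumes "\<beta> \<subseteq> {..<length xs}" "\<gamma> \<subseteq> {..<length xs}"
  shows "ent (basis_state xs) \<beta> \<gamma> = of_bool (\<beta> = true_bits xs \<and> \<gamma> = true_bits xs)"
proof -
  have "finite \<beta>" "finite \<gamma>" using assms finite_subset by blast+
  then show ?thesis
    using assms by (simp add: basis_state_def matrix_unit_def ent_mat idx_eq set_encode_eq)
qed

lemma set_encode_shift:
  assumes "s \<subseteq> {..<p}" "finite t"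
  shows "set_encode (s \<union> (+) p ` t) = set_encode s + 2 ^ p * set_encode t"
proof -
  have "finite s" using assms finite_subset by blast
  then have "set_encode (s \<union> (+) p ` t) = set_encode s + (\<Sum>i\<in>(+) p ` t. 2 ^ i)"
    unfolding set_encode_def using assms by (subst sum.union_disjoint) auto
  then show ?thesis
    by (simp add: sum.reindex set_encode_def sum_distrib_left power_add)
qed

lemma tensor_carrier [simp]:
  "A \<in> carrier_mat (2 ^ p) (2 ^ p) \<Longrightarrow> B \<in> carrier_mat (2 ^ q) (2 ^ q) \<Longrightarrow>
    A \<otimes>\<^sub>q B \<in> carrier_mat (2 ^ (p + q)) (2 ^ (p + q))"
  by (auto simp: tensor_def power_add)

lemma ent_tensor:
  assumes "A \<in> carrier_mat (2 ^ p) (2 ^ p)" "B \<in> carrier_mat (2 ^ q) (2 ^ q)"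
    and "s \<subseteq> {..<p}" "s' \<subseteq> {..<p}" "t \<subseteq> {..<q}" "t' \<subseteq> {..<q}"
  shows "ent (A \<otimes>\<^sub>q B) (s \<union> (+) p ` t) (s' \<union> (+) p ` t') = ent A s s' * ent B t t'"
proof -
  have f: "finite t" "finite t'" using assms finite_subset by blast+
  have lt: "set_encode (s \<union> (+) p ` t) < 2 ^ (p + q)" "set_encode (s' \<union> (+) p ` t') < 2 ^ (p + q)"
    using assms by (auto intro!: set_encode_less)
  show ?thesis
    using carrier_matD[OF assms(1)] carrier_matD[OF assms(2)] lt
    by (simp add: ent_def tensor_def power_add set_encode_shift[OF assms(3) f(1)]
        set_encode_shift[OF assms(4) f(2)] set_encode_less[OF assms(3)] set_encode_less[OF assms(4)])
qed

lemma subset_shift_decomp: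
  assumes "\<beta> \<subseteq> {..<p + q :: nat}"
  obtains s t where "s \<subseteq> {..<p}" "t \<subseteq> {..<q}" "\<beta> = s \<union> (+) p ` t"
proof -
  have "\<beta> = (\<beta> \<inter> {..<p}) \<union> (+) p ` {w. p + w \<in> \<beta>}"
  proof (intro equalityI subsetI)
    fix x assume x: "x \<in> \<beta>"
    show "x \<in> (\<beta> \<inter> {..<p}) \<union> (+) p ` {w. p + w \<in> \<beta>}"
      using x by (cases "x < p") (auto intro!: image_eqI[of _ _ "x - p"])
  qed auto
  moreover have "{w. p + w \<in> \<beta>} \<subseteq> {..<q}" using assms by auto
  ultimately show ?thesis using that[of "\<beta> \<inter> {..<p}"] by blast
qed

lemma mat_eq_ent_tensor:
  assumes "A \<in> carrier_mat (2 ^ (p + q)) (2 ^ (p + q))" "B \<in> carrier_mat (2 ^ (p + q)) (2 ^ (p + q))"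
    and "\<And>s s' t t'. s \<subseteq> {..<p} \<Longrightarrow> s' \<subseteq> {..<p} \<Longrightarrow> t \<subseteq> {..<q} \<Longrightarrow> t' \<subseteq> {..<q} \<Longrightarrow>
      ent A (s \<union> (+) p ` t) (s' \<union> (+) p ` t') = ent B (s \<union> (+) p ` t) (s' \<union> (+) p ` t')"
  shows "A = B"
proof (rule mat_eq_ent)
  fix \<beta> \<gamma> assume \<beta>: "\<beta> \<subseteq> {..<p + q}" and \<gamma>: "\<gamma> \<subseteq> {..<p + q}"
  show "ent A \<beta> \<gamma> = ent B \<beta> \<gamma>"
    by (rule subset_shift_decomp[OF \<beta>], rule subset_shift_decomp[OF \<gamma>]) (use assms(3) in simp)
qed fact+

text \<open>Ancillas in the zero state contribute only at \<open>t = {}\<close> and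
  \<open>t' = {}\<close>, so adding any number of them just extends the kernel by zero.\<close>

lemma ent_tensor_zeros:
  assumes "\<rho> \<in> carrier_mat (2 ^ a) (2 ^ a)" "\<beta> \<subseteq> {..<a + b}" "\<gamma> \<subseteq> {..<a + b}"
  shows "ent (\<rho> \<otimes>\<^sub>q basis_state (replicate b False)) \<beta> \<gamma> = ker a \<rho> \<beta> \<gamma>"
proof -
  obtain s t where 1: "s \<subseteq> {..<a}" "t \<subseteq> {..<b}" "\<beta> = s \<union> (+) a ` t"
    using assms(2) by (rule subset_shift_decomp)
  obtain s' t' where 2: "s' \<subseteq> {..<a}" "t' \<subseteq> {..<b}" "\<gamma> = s' \<union> (+) a ` t'"
    using assms(3) by (rule subset_shift_decomp)
  have "basis_state (replicate b False) \<in> carrier_mat (2 ^ b) (2 ^ b)"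
    using basis_state_carrier[of "replicate b False"] by simp
  then have "ent (\<rho> \<otimes>\<^sub>q basis_state (replicate b False)) \<beta> \<gamma> = ent \<rho> s s' * of_bool (t = {} \<and> t' = {})"
    using assms 1 2 by (simp add: ent_tensor ent_basis_state)
  moreover have "s \<union> (+) a ` t \<subseteq> {..<a} \<longleftrightarrow> t = {}" if "s \<subseteq> {..<a}" for s t :: "nat set"
    using that by auto
  ultimately show ?thesis using 1 2 by (auto simp: ker_def)
qed

section \<open>Partial trace and the action of a circuit\<close>

definition pick :: "nat list \<Rightarrow> nat set \<Rightarrow> nat set" where
  "pick os r = (!) os ` r"

lemma pick_subset: "r \<subseteq> {..<length os} \<Longrightarrow> pick os r \<subseteq> set os"
  by (auto simp: pick_def)

lemma ent_reduced:
  assumes os: "distinct os" "set os \<subseteq> {..<N}"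
    and r: "r \<subseteq> {..<length os}" and c: "c \<subseteq> {..<length os}"
  shows "ent (reduced N os M) r c = (\<Sum>g\<in>Pow ({..<N} - set os). ent M (pick os r \<union> g) (pick os c \<union> g))"
proof -
  let ?G = "Pow ({..<N} - set os)"
  define P where "P R C \<longleftrightarrow> (\<forall>t<length os. (os ! t \<in> R \<longleftrightarrow> t \<in> r) \<and> (os ! t \<in> C \<longleftrightarrow> t \<in> c))
    \<and> (\<forall>w<N. w \<notin> set os \<longrightarrow> (w \<in> R \<longleftrightarrow> w \<in> C))" for R C
  have fin: "finite r" "finite c" using r c finite_subset by blast+
  have finN: "finite R" if "R \<in> Pow {..<N}" for R using that finite_subset by blast
  have "ent (reduced N os M) r c = (\<Sum>R\<in>Pow {..<N}. \<Sum>C\<in>Pow {..<N}. if P R C then ent M R C else 0)"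
    unfolding reduced_def ent_mat[OF r c] prod.case sum_exp_eq_Pow P_def ent_def[of M]
    by (intro sum.cong refl if_cong) (simp add: bit_set_encode fin finN del: Pow_iff)
  also have "\<dots> = (\<Sum>(R, C)\<in>Pow {..<N} \<times> Pow {..<N}. if P R C then ent M R C else 0)"
    by (simp add: sum.cartesian_product)
  also have "\<dots> = (\<Sum>(R, C)\<in>(\<lambda>g. (pick os r \<union> g, pick os c \<union> g)) ` ?G. ent M R C)"
  proof (rule sum.mono_neutral_cong_right)
    have key: "R = pick os r \<union> (R - set os)" if "\<forall>t<length os. os ! t \<in> R \<longleftrightarrow> t \<in> r" "r \<subseteq> {..<length os}" for R r
    proof (intro equalityI subsetI)
      fix x assume "x \<in> R"
      then show "x \<in> pick os r \<union> (R - set os)"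
        using that by (cases "x \<in> set os") (auto simp: pick_def in_set_conv_nth)
    qed (use that in \<open>auto simp: pick_def\<close>)
    show "\<forall>i\<in>Pow {..<N} \<times> Pow {..<N} - (\<lambda>g. (pick os r \<union> g, pick os c \<union> g)) ` ?G.
        (case i of (R, C) \<Rightarrow> if P R C then ent M R C else 0) = 0"
    proof (clarsimp)
      fix R C assume *: "R \<subseteq> {..<N}" "C \<subseteq> {..<N}" "(R, C) \<notin> (\<lambda>g. (pick os r \<union> g, pick os c \<union> g)) ` ?G" "P R C"
      have "R = pick os r \<union> (R - set os)" "C = pick os c \<union> (C - set os)"
        using key *(4) r c by (auto simp: P_def)
      moreover have "C - set os = R - set os" using * by (auto simp: P_def)
      ultimately have "(R, C) = (\<lambda>g. (pick os r \<union> g, pick os c \<union> g)) (R - set os)" by simp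
      moreover have "R - set os \<in> ?G" using * by auto
      ultimately have False using *(3) by blast
      then show "ent M R C = 0" ..
    qed
    show "(\<lambda>g. (pick os r \<union> g, pick os c \<union> g)) ` ?G \<subseteq> Pow {..<N} \<times> Pow {..<N}"
      using pick_subset[OF r] pick_subset[OF c] os by auto
    have mem: "os ! t \<in> pick os r \<longleftrightarrow> t \<in> r" if "t < length os" "r \<subseteq> {..<length os}" for t r
      using that os by (auto simp: pick_def nth_eq_iff_index_eq subset_iff)
    have "P (pick os r \<union> g) (pick os c \<union> g)" if "g \<in> ?G" for g
    proof -
      have "os ! t \<notin> g" if "t < length os" for t using that \<open>g \<in> ?G\<close> by (meson DiffD2 PowD nth_mem subsetD)
      moreover have "w \<notin> pick os r" "w \<notin> pick os c" if "w \<notin> set os" for w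
        using pick_subset[OF r] pick_subset[OF c] that by auto
      ultimately show ?thesis using mem r c by (auto simp: P_def)
    qed
    then show "(case x of (R, C) \<Rightarrow> if P R C then ent M R C else 0) = (case x of (R, C) \<Rightarrow> ent M R C)"
      if "x \<in> (\<lambda>g. (pick os r \<union> g, pick os c \<union> g)) ` ?G" for x
      using that by auto
  qed auto
  also have "\<dots> = (\<Sum>g\<in>?G. ent M (pick os r \<union> g) (pick os c \<union> g))"
  proof (subst sum.reindex)
    show "inj_on (\<lambda>g. (pick os r \<union> g, pick os c \<union> g)) ?G"
      using pick_subset[OF r] by (fastforce simp: inj_on_def)
  qed simp
  finally show ?thesis .
qed

definition garbage :: "qcircuit \<Rightarrow> nat set" where
  "garbage Q = {..<q_wires Q} - set (q_outs Q)"

lemma finite_garbage [simp]: "finite (garbage Q)"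
  by (simp add: garbage_def)

lemma q_wf_iff:
  "q_wf Q \<longleftrightarrow> (\<forall>g\<in>set (q_gates Q). gate_ok {..<q_wires Q} g) \<and> distinct (q_outs Q) \<and> set (q_outs Q) \<subseteq> {..<q_wires Q}"
  by (auto simp: q_wf_def gate_ok_def)

lemma run_carrier [simp]: "run Q \<rho> \<in> carrier_mat (2 ^ q_out Q) (2 ^ q_out Q)"
  by (simp add: run_def reduced_def Let_def)

text \<open>Evolve the kernel, then sum over the values of the wires that are traced out. The later
  results on \<open>run\<close> rest on this formula.\<close>

lemma ent_run:
  assumes "q_wf Q" "\<rho> \<in> carrier_mat (2 ^ q_in Q) (2 ^ q_in Q)"
    and "r \<subseteq> {..<q_out Q}" "c \<subseteq> {..<q_out Q}"
  shows "ent (run Q \<rho>) r c = (\<Sum>g\<in>Pow (garbage Q).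
    evo2 (q_gates Q) (ker (q_in Q) \<rho>) (pick (q_outs Q) r \<union> g) (pick (q_outs Q) c \<union> g))"
proof -
  let ?M = "\<rho> \<otimes>\<^sub>q basis_state (replicate (q_anc Q) False)"
  have wf: "\<forall>g\<in>set (q_gates Q). gate_ok {..<q_wires Q} g" "distinct (q_outs Q)" "set (q_outs Q) \<subseteq> {..<q_wires Q}"
    using assms(1) by (simp_all add: q_wf_iff)
  have M: "?M \<in> carrier_mat (2 ^ q_wires Q) (2 ^ q_wires Q)"
    using assms(2) basis_state_carrier[of "replicate (q_anc Q) False"] unfolding q_wires_def
    by (intro tensor_carrier) auto
  show ?thesis
    unfolding run_def Let_def ent_reduced[OF wf(2,3) assms(3,4)] garbage_def
  proof (intro sum.cong refl)
    fix g assume "g \<in> Pow ({..<q_wires Q} - set (q_outs Q))"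
    then have *: "pick (q_outs Q) r \<union> g \<subseteq> {..<q_wires Q}" "pick (q_outs Q) c \<union> g \<subseteq> {..<q_wires Q}"
      using pick_subset[OF assms(3)] pick_subset[OF assms(4)] wf(3) by auto
    show "ent (gates_mat (q_wires Q) (q_gates Q) * ?M * mat_adjoint (gates_mat (q_wires Q) (q_gates Q)))
         (pick (q_outs Q) r \<union> g) (pick (q_outs Q) c \<union> g)
       = evo2 (q_gates Q) (ker (q_in Q) \<rho>) (pick (q_outs Q) r \<union> g) (pick (q_outs Q) c \<union> g)"
      unfolding ent_gates_mat_sandwich[OF wf(1) M *]
      by (rule evo2_cong[OF wf(1) *]) (use ent_tensor_zeros[OF assms(2)] in \<open>simp add: q_wires_def\<close>)
  qed
qed

section \<open>Sequential and parallel composition\<close>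

lemma sum_Pow_Un:
  fixes F :: "nat set \<Rightarrow> 'a :: comm_monoid_add"
  assumes "finite A" "finite B" "A \<inter> B = {}"
  shows "(\<Sum>g\<in>Pow (A \<union> B). F g) = (\<Sum>a\<in>Pow A. \<Sum>b\<in>Pow B. F (a \<union> b))"
proof -
  have "(\<Sum>g\<in>Pow (A \<union> B). F g) = (\<Sum>(a, b)\<in>Pow A \<times> Pow B. F (a \<union> b))"
    by (rule sum.reindex_bij_witness[of _ "\<lambda>(a, b). a \<union> b" "\<lambda>g. (g \<inter> A, g \<inter> B)"])
       (use assms in \<open>auto simp flip: Int_Un_distrib simp: Int_absorb2\<close>)
  then show ?thesis by (simp add: sum.cartesian_product)
qed

lemma sum_Pow_image:
  assumes "inj_on f G"
  shows "(\<Sum>b\<in>Pow (f ` G). F b) = (\<Sum>b\<in>Pow G. F (f ` b))"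
proof -
  have "inj_on ((`) f) (Pow G)" using assms by (rule inj_on_image_Pow)
  then show ?thesis by (simp add: image_Pow_surj[OF refl, symmetric] sum.reindex)
qed

lemma pick_map: "r \<subseteq> {..<length os} \<Longrightarrow> pick (map f os) r = f ` pick os r"
  unfolding pick_def image_image by (rule image_cong) auto

lemma pick_append:
  assumes "s \<subseteq> {..<length os}" "t \<subseteq> {..<length os'}"
  shows "pick (os @ os') (s \<union> (+) (length os) ` t) = pick os s \<union> pick os' t"
proof -
  have "pick (os @ os') s = pick os s"
    unfolding pick_def using assms(1) by (intro image_cong refl) (auto simp: nth_append)
  moreover have "pick (os @ os') ((+) (length os) ` t) = pick os' t"
    unfolding pick_def image_image by (intro image_cong refl) auto
  ultimately show ?thesis by (simp add: pick_def image_Un)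
qed

lemma pick_upt: "s \<subseteq> {..<j - i} \<Longrightarrow> pick [i..<j] s = (+) i ` s"
  unfolding pick_def by (rule image_cong) auto

section \<open>Sequential composition\<close>

definition seq_wire :: "qcircuit \<Rightarrow> qcircuit \<Rightarrow> nat \<Rightarrow> nat" where
  "seq_wire P Q w = (if w < q_in Q then q_outs P ! w else q_wires P + (w - q_in Q))"

text \<open>The inputs of \<open>Q\<close> are identified with the output wires of \<open>P\<close>,
  and the ancillas of \<open>Q\<close> become new wires behind those of \<open>P\<close>. What
  \<open>P\<close> does not output stays as garbage.\<close>

definition seq :: "qcircuit \<Rightarrow> qcircuit \<Rightarrow> qcircuit" (infixl \<open>;;\<close> 65) where
  "P ;; Q = QCircuit (q_in P) (q_anc P + q_anc Q)
     (q_gates P @ map (map_wires (seq_wire P Q)) (q_gates Q)) (map (seq_wire P Q) (q_outs Q))"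

lemma seq_simps [simp]:
  "q_in (P ;; Q) = q_in P" "q_anc (P ;; Q) = q_anc P + q_anc Q" "q_out (P ;; Q) = q_out Q"
  "q_gates (P ;; Q) = q_gates P @ map (map_wires (seq_wire P Q)) (q_gates Q)"
  "q_outs (P ;; Q) = map (seq_wire P Q) (q_outs Q)"
  by (simp_all add: seq_def)

lemma seq_wires [simp]: "q_wires (P ;; Q) = q_wires P + q_anc Q"
  by (simp add: q_wires_def)

lemma seq_size: "q_size (P ;; Q) \<le> q_size P + q_size Q"
  by (simp add: q_size_def q_wires_def)

lemma seq_wire_inputs:
  assumes "q_out P = q_in Q"
  shows "seq_wire P Q ` {..<q_in Q} = set (q_outs P)"
proof -
  have "seq_wire P Q ` {..<q_in Q} = (!) (q_outs P) ` {..<q_out P}"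
    using assms by (intro image_cong) (auto simp: seq_wire_def)
  then show ?thesis by (auto simp: set_conv_nth)
qed

lemma seq_wire_inj:
  assumes "q_wf P" "q_out P = q_in Q"
  shows "inj_on (seq_wire P Q) X"
proof (rule inj_onI)
  fix x y assume *: "seq_wire P Q x = seq_wire P Q y"
  have lt: "q_outs P ! w < q_wires P" if "w < q_in Q" for w
    using assms that by (simp add: q_wf_def)
  have "distinct (q_outs P)" using assms by (simp add: q_wf_iff)
  then show "x = y"
    using * lt[of x] lt[of y] assms
    by (auto simp: seq_wire_def nth_eq_iff_index_eq split: if_splits)
qed

lemma seq_wire_range:
  assumes "q_wf P" "q_out P = q_in Q"
  shows "seq_wire P Q ` {..<q_wires Q} = set (q_outs P) \<union> {q_wires P..<q_wires P + q_anc Q}"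
proof -
  have "{..<q_wires Q} = {..<q_in Q} \<union> {q_in Q..<q_in Q + q_anc Q}" by (auto simp: q_wires_def)
  moreover have "seq_wire P Q ` {q_in Q..<q_in Q + q_anc Q} = {q_wires P..<q_wires P + q_anc Q}"
  proof (intro equalityI subsetI)
    fix x assume "x \<in> {q_wires P..<q_wires P + q_anc Q}"
    then show "x \<in> seq_wire P Q ` {q_in Q..<q_in Q + q_anc Q}"
      by (intro image_eqI[of _ _ "x - q_wires P + q_in Q"]) (auto simp: seq_wire_def)
  qed (auto simp: seq_wire_def)
  ultimately show ?thesis by (simp add: image_Un seq_wire_inputs[OF assms(2)])
qed

lemma seq_wf [simp]:
  assumes "q_wf P" "q_wf Q" "q_out P = q_in Q"
  shows "q_wf (P ;; Q)"
proof -
  note inj = seq_wire_inj[OF assms(1,3)]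
  have sub: "seq_wire P Q ` {..<q_wires Q} \<subseteq> {..<q_wires P + q_anc Q}"
    using assms(1) by (auto simp: seq_wire_range[OF assms(1,3)] q_wf_iff)
  have "gate_ok {..<q_wires P + q_anc Q} g" if "g \<in> set (q_gates P)" for g
    using assms(1) that by (auto simp: q_wf_iff intro: gate_ok_mono)
  moreover have "gate_ok {..<q_wires P + q_anc Q} (map_wires (seq_wire P Q) g)" if "g \<in> set (q_gates Q)" for g
    using gate_ok_mono[OF gate_ok_map[OF _ inj] sub] assms(2) that by (auto simp: q_wf_iff)
  moreover have "set (map (seq_wire P Q) (q_outs Q)) \<subseteq> {..<q_wires P + q_anc Q}"
    using assms(2) sub by (auto simp: q_wf_iff)
  ultimately show ?thesis
    using assms(2) inj by (auto simp: q_wf_iff distinct_map)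
qed

text \<open>The gates of \<open>Q\<close> leave the garbage \<open>a\<close> of \<open>P\<close>
  alone, so for fixed \<open>a\<close> they act on a slice of the evolved kernel. By linearity the
  sum over \<open>a\<close> can be taken first, and the summed slices are the kernel of
  \<open>run P \<rho>\<close>.\<close>

lemma run_seq:
  assumes P: "q_wf P" and Q: "q_wf Q" and PQ: "q_out P = q_in Q"
    and \<rho>: "\<rho> \<in> carrier_mat (2 ^ q_in P) (2 ^ q_in P)"
  shows "run (P ;; Q) \<rho> = run Q (run P \<rho>)"
proof (rule mat_eq_ent[of _ "q_out Q"])
  fix r c assume r: "r \<subseteq> {..<q_out Q}" and c: "c \<subseteq> {..<q_out Q}"
  let ?f = "seq_wire P Q" and ?K = "evo2 (q_gates P) (ker (q_in P) \<rho>)"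
  note inj = seq_wire_inj[OF P PQ]
  have wfP: "set (q_outs P) \<subseteq> {..<q_wires P}" "\<forall>g\<in>set (q_gates P). gate_ok {..<q_wires P} g"
    using P by (auto simp: q_wf_iff)
  have wfQ: "\<forall>g\<in>set (q_gates Q). gate_ok {..<q_wires Q} g" "set (q_outs Q) \<subseteq> {..<q_wires Q}"
    using Q by (auto simp: q_wf_iff)
  have disj: "garbage P \<inter> ?f ` {..<q_wires Q} = {}"
    by (auto simp: seq_wire_range[OF P PQ] garbage_def)
  have gQ: "garbage Q \<subseteq> {..<q_wires Q}" by (auto simp: garbage_def)
  have garb: "garbage (P ;; Q) = garbage P \<union> ?f ` garbage Q"
  proof -
    have 1: "?f ` garbage Q = ?f ` {..<q_wires Q} - ?f ` set (q_outs Q)"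
      by (simp add: garbage_def inj_on_image_set_diff[OF inj[of UNIV]])
    have "?f ` set (q_outs Q) \<subseteq> ?f ` {..<q_wires Q}" using wfQ(2) by blast
    then have 2: "garbage P - ?f ` set (q_outs Q) = garbage P" using disj by blast
    have 3: "{..<q_wires P + q_anc Q} = garbage P \<union> ?f ` {..<q_wires Q}"
      using wfP(1) by (auto simp: seq_wire_range[OF P PQ] garbage_def)
    have "garbage (P ;; Q) = {..<q_wires P + q_anc Q} - ?f ` set (q_outs Q)"
      by (simp add: garbage_def)
    then show ?thesis by (simp only: 1 2 3 Un_Diff)
  qed
  have suppK: "supported {..<q_wires P} ?K"
    by (rule evo2_supported[OF wfP(2)], rule supported_mono[OF supported_ker]) (simp add: q_wires_def)
  have inner: "(\<Sum>a\<in>Pow (garbage P). ?K (?f ` x \<union> a) (?f ` y \<union> a)) = ker (q_in Q) (run P \<rho>) x y"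
    if x: "x \<subseteq> {..<q_wires Q}" and y: "y \<subseteq> {..<q_wires Q}" for x y
  proof (cases "x \<subseteq> {..<q_in Q} \<and> y \<subseteq> {..<q_in Q}")
    case True
    have "?f ` x = pick (q_outs P) x" if "x \<subseteq> {..<q_in Q}" for x
      unfolding pick_def using that by (intro image_cong) (auto simp: seq_wire_def)
    then show ?thesis using True PQ by (simp add: ker_def ent_run[OF P \<rho>])
  next
    case False
    \<comment> \<open>An ancilla of \<open>Q\<close> is mapped beyond the wires of \<open>P\<close>,
      where the evolved kernel vanishes: the ancillas of \<open>Q\<close> start at zero.\<close>
    have out: "\<not> ?f ` z \<subseteq> {..<q_wires P}" if z: "\<not> z \<subseteq> {..<q_in Q}" for z
    proof -
      obtain w where "w \<in> z" "\<not> w < q_in Q" using z by blast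
      then show ?thesis by (auto simp: seq_wire_def intro!: bexI[of _ w])
    qed
    have "?K (?f ` x \<union> a) (?f ` y \<union> a) = 0" for a
      by (rule supportedD[OF suppK]) (use False out in auto)
    then show ?thesis using False by (auto simp: ker_def)
  qed
  have "ent (run (P ;; Q) \<rho>) r c
      = (\<Sum>a\<in>Pow (garbage P). \<Sum>b\<in>Pow (garbage Q).
          evo2 (map (map_wires ?f) (q_gates Q)) ?K (?f ` (pick (q_outs Q) r \<union> b) \<union> a) (?f ` (pick (q_outs Q) c \<union> b) \<union> a))"
  proof -
    have d: "garbage P \<inter> ?f ` garbage Q = {}" using disj gQ by blast
    have eq: "?f ` pick (q_outs Q) z \<union> (a \<union> ?f ` b) = ?f ` (pick (q_outs Q) z \<union> b) \<union> a" for z a b by blast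
    have \<rho>': "\<rho> \<in> carrier_mat (2 ^ q_in (P ;; Q)) (2 ^ q_in (P ;; Q))" using \<rho> by simp
    have rc: "r \<subseteq> {..<q_out (P ;; Q)}" "c \<subseteq> {..<q_out (P ;; Q)}" using r c by simp_all
    show ?thesis
      unfolding ent_run[OF seq_wf[OF P Q PQ] \<rho>' rc] garb
      by (subst sum_Pow_Un) (simp_all add: d sum_Pow_image[OF inj] evo2_append pick_map r c eq)
  qed
  also have "\<dots> = (\<Sum>a\<in>Pow (garbage P). \<Sum>b\<in>Pow (garbage Q).
      evo2 (q_gates Q) (\<lambda>x y. ?K (?f ` x \<union> a) (?f ` y \<union> a)) (pick (q_outs Q) r \<union> b) (pick (q_outs Q) c \<union> b))"
  proof (intro sum.cong refl evo2_map_wires[OF inj wfQ(1)])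
    fix a b assume "a \<in> Pow (garbage P)" "b \<in> Pow (garbage Q)"
    then show "pick (q_outs Q) r \<union> b \<subseteq> {..<q_wires Q}" "pick (q_outs Q) c \<union> b \<subseteq> {..<q_wires Q}"
      "a \<inter> ?f ` {..<q_wires Q} = {}" "a \<inter> ?f ` {..<q_wires Q} = {}"
      using pick_subset[OF r] pick_subset[OF c] wfQ(2) gQ disj by blast+
  qed
  also have "\<dots> = (\<Sum>b\<in>Pow (garbage Q).
      evo2 (q_gates Q) (\<lambda>x y. \<Sum>a\<in>Pow (garbage P). ?K (?f ` x \<union> a) (?f ` y \<union> a)) (pick (q_outs Q) r \<union> b) (pick (q_outs Q) c \<union> b))"
    by (subst sum.swap) (simp add: evo2_sum)
  also have "\<dots> = (\<Sum>b\<in>Pow (garbage Q).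
      evo2 (q_gates Q) (ker (q_in Q) (run P \<rho>)) (pick (q_outs Q) r \<union> b) (pick (q_outs Q) c \<union> b))"
  proof (intro sum.cong refl evo2_cong[OF wfQ(1)])
    fix b assume "b \<in> Pow (garbage Q)"
    then show "pick (q_outs Q) r \<union> b \<subseteq> {..<q_wires Q}" "pick (q_outs Q) c \<union> b \<subseteq> {..<q_wires Q}"
      using pick_subset[OF r] pick_subset[OF c] wfQ(2) gQ by blast+
  qed (use inner in auto)
  also have "\<dots> = ent (run Q (run P \<rho>)) r c"
    using run_carrier[of P \<rho>] PQ by (simp add: ent_run[OF Q _ r c])
  finally show "ent (run (P ;; Q) \<rho>) r c = ent (run Q (run P \<rho>)) r c" .
qed (use run_carrier[of "P ;; Q" \<rho>] in auto)

section \<open>Parallel composition\<close>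

definition par_wire1 :: "qcircuit \<Rightarrow> qcircuit \<Rightarrow> nat \<Rightarrow> nat" where
  "par_wire1 P Q w = (if w < q_in P then w else w + q_in Q)"

definition par_wire2 :: "qcircuit \<Rightarrow> qcircuit \<Rightarrow> nat \<Rightarrow> nat" where
  "par_wire2 P Q w = (if w < q_in Q then q_in P + w else q_wires P + w)"

text \<open>Inputs have to precede ancillas, so the wires are ordered as inputs of \<open>P\<close>,
  inputs of \<open>Q\<close>, ancillas of \<open>P\<close>, ancillas of \<open>Q\<close>.\<close>

definition par :: "qcircuit \<Rightarrow> qcircuit \<Rightarrow> qcircuit" (infixl \<open>\<parallel>\<close> 68) where
  "P \<parallel> Q = QCircuit (q_in P + q_in Q) (q_anc P + q_anc Q)
     (map (map_wires (par_wire1 P Q)) (q_gates P) @ map (map_wires (par_wire2 P Q)) (q_gates Q))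
     (map (par_wire1 P Q) (q_outs P) @ map (par_wire2 P Q) (q_outs Q))"

lemma par_simps [simp]:
  "q_in (P \<parallel> Q) = q_in P + q_in Q" "q_anc (P \<parallel> Q) = q_anc P + q_anc Q" "q_out (P \<parallel> Q) = q_out P + q_out Q"
  "q_gates (P \<parallel> Q) = map (map_wires (par_wire1 P Q)) (q_gates P) @ map (map_wires (par_wire2 P Q)) (q_gates Q)"
  "q_outs (P \<parallel> Q) = map (par_wire1 P Q) (q_outs P) @ map (par_wire2 P Q) (q_outs Q)"
  by (simp_all add: par_def)

lemma par_wires [simp]: "q_wires (P \<parallel> Q) = q_wires P + q_wires Q"
  by (simp add: q_wires_def)

lemma par_size: "q_size (P \<parallel> Q) = q_size P + q_size Q"
  by (simp add: q_size_def q_wires_def)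

lemma par_wire_inj: "inj_on (par_wire1 P Q) X" "inj_on (par_wire2 P Q) X"
  by (auto simp: inj_on_def par_wire1_def par_wire2_def q_wires_def split: if_splits)

lemma par_wire_disjoint: "x < q_wires P \<Longrightarrow> par_wire1 P Q x \<noteq> par_wire2 P Q y"
  by (auto simp: par_wire1_def par_wire2_def q_wires_def)

lemma par_wire_range: "par_wire1 P Q ` {..<q_wires P} \<union> par_wire2 P Q ` {..<q_wires Q} = {..<q_wires P + q_wires Q}"
proof (intro equalityI subsetI)
  fix x assume x: "x \<in> {..<q_wires P + q_wires Q}"
  consider "x < q_in P" | "q_in P \<le> x" "x < q_in P + q_in Q"
    | "q_in P + q_in Q \<le> x" "x < q_wires P + q_in Q" | "q_wires P + q_in Q \<le> x" by linarith
  then show "x \<in> par_wire1 P Q ` {..<q_wires P} \<union> par_wire2 P Q ` {..<q_wires Q}"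
  proof cases
    case 1
    then show ?thesis by (intro UnI1 image_eqI[of _ _ x]) (auto simp: par_wire1_def q_wires_def)
  next
    case 2
    then show ?thesis by (intro UnI2 image_eqI[of _ _ "x - q_in P"]) (auto simp: par_wire2_def q_wires_def)
  next
    case 3
    then show ?thesis by (intro UnI1 image_eqI[of _ _ "x - q_in Q"]) (auto simp: par_wire1_def q_wires_def)
  next
    case 4
    then show ?thesis using x by (intro UnI2 image_eqI[of _ _ "x - q_wires P"]) (auto simp: par_wire2_def)
  qed
qed (auto simp: par_wire1_def par_wire2_def q_wires_def split: if_splits)

lemma par_wf [simp]:
  assumes "q_wf P" "q_wf Q"
  shows "q_wf (P \<parallel> Q)"
proof -
  note sub = equalityD1[OF par_wire_range[of P Q]]
  have "gate_ok {..<q_wires P + q_wires Q} (map_wires (par_wire1 P Q) g)" if "g \<in> set (q_gates P)" for g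
    by (rule gate_ok_mono[OF gate_ok_map[OF _ par_wire_inj(1), of "{..<q_wires P}"]])
       (use assms that sub in \<open>auto simp: q_wf_iff\<close>)
  moreover have "gate_ok {..<q_wires P + q_wires Q} (map_wires (par_wire2 P Q) g)" if "g \<in> set (q_gates Q)" for g
    by (rule gate_ok_mono[OF gate_ok_map[OF _ par_wire_inj(2), of "{..<q_wires Q}"]])
       (use assms that sub in \<open>auto simp: q_wf_iff\<close>)
  moreover have "par_wire1 P Q ` set (q_outs P) \<inter> par_wire2 P Q ` set (q_outs Q) = {}"
    using assms par_wire_disjoint by (fastforce simp: q_wf_iff)
  moreover have "par_wire1 P Q ` set (q_outs P) \<union> par_wire2 P Q ` set (q_outs Q) \<subseteq> {..<q_wires P + q_wires Q}"
    using assms sub unfolding q_wf_iff by blast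
  ultimately show ?thesis
    using assms by (auto simp: q_wf_iff distinct_map par_wire_inj)
qed

text \<open>The initial kernel is a product. Each circuit acts on its own factor, and the other
  factor is a scalar that linearity takes out.\<close>

lemma run_par:
  assumes P: "q_wf P" and Q: "q_wf Q"
    and A: "A \<in> carrier_mat (2 ^ q_in P) (2 ^ q_in P)" and B: "B \<in> carrier_mat (2 ^ q_in Q) (2 ^ q_in Q)"
  shows "run (P \<parallel> Q) (A \<otimes>\<^sub>q B) = run P A \<otimes>\<^sub>q run Q B"
proof (rule mat_eq_ent_tensor[of _ "q_out P" "q_out Q"])
  fix s s' t t' assume s: "s \<subseteq> {..<q_out P}" "s' \<subseteq> {..<q_out P}" and t: "t \<subseteq> {..<q_out Q}" "t' \<subseteq> {..<q_out Q}"
  let ?f = "par_wire1 P Q" and ?h = "par_wire2 P Q" and ?K = "ker (q_in P + q_in Q) (A \<otimes>\<^sub>q B)"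
  let ?s = "pick (q_outs P) s" and ?s' = "pick (q_outs P) s'" and ?t = "pick (q_outs Q) t" and ?t' = "pick (q_outs Q) t'"
  have wfP: "set (q_outs P) \<subseteq> {..<q_wires P}" "\<forall>g\<in>set (q_gates P). gate_ok {..<q_wires P} g"
    using P by (auto simp: q_wf_iff)
  have wfQ: "\<forall>g\<in>set (q_gates Q). gate_ok {..<q_wires Q} g" "set (q_outs Q) \<subseteq> {..<q_wires Q}"
    using Q by (auto simp: q_wf_iff)
  have disj: "?f ` {..<q_wires P} \<inter> ?h ` {..<q_wires Q} = {}" using par_wire_disjoint by blast
  have gP: "garbage P \<subseteq> {..<q_wires P}" and gQ: "garbage Q \<subseteq> {..<q_wires Q}" by (auto simp: garbage_def)
  have garb: "garbage (P \<parallel> Q) = ?f ` garbage P \<union> ?h ` garbage Q"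
  proof -
    have 1: "?f ` garbage P = ?f ` {..<q_wires P} - ?f ` set (q_outs P)" "?h ` garbage Q = ?h ` {..<q_wires Q} - ?h ` set (q_outs Q)"
      by (simp_all add: garbage_def inj_on_image_set_diff[OF par_wire_inj(1)[of _ _ UNIV]] inj_on_image_set_diff[OF par_wire_inj(2)[of _ _ UNIV]])
    have "?f ` set (q_outs P) \<subseteq> ?f ` {..<q_wires P}" "?h ` set (q_outs Q) \<subseteq> ?h ` {..<q_wires Q}"
      using wfP wfQ by blast+
    then have 2: "?f ` {..<q_wires P} - (?f ` set (q_outs P) \<union> ?h ` set (q_outs Q)) = ?f ` {..<q_wires P} - ?f ` set (q_outs P)"
      "?h ` {..<q_wires Q} - (?f ` set (q_outs P) \<union> ?h ` set (q_outs Q)) = ?h ` {..<q_wires Q} - ?h ` set (q_outs Q)"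
      using disj by blast+
    have "garbage (P \<parallel> Q) = ?f ` {..<q_wires P} \<union> ?h ` {..<q_wires Q} - (?f ` set (q_outs P) \<union> ?h ` set (q_outs Q))"
      by (simp add: garbage_def par_wire_range)
    then show ?thesis by (simp only: 1 2 Un_Diff)
  qed
  \<comment> \<open>The product form also holds where some ancilla carries a 1, since then both
    sides vanish.\<close>
  have K: "?K (?f ` u \<union> ?h ` x) (?f ` v \<union> ?h ` y) = ker (q_in P) A u v * ker (q_in Q) B x y"
    if "u \<subseteq> {..<q_wires P}" "v \<subseteq> {..<q_wires P}" "x \<subseteq> {..<q_wires Q}" "y \<subseteq> {..<q_wires Q}" for u v x y
  proof -
    have 1: "?f ` u = u" if "u \<subseteq> {..<q_in P}" for u
    proof -
      have "?f ` u = id ` u" by (rule image_cong) (use that in \<open>auto simp: par_wire1_def\<close>)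
      then show ?thesis by simp
    qed
    have 2: "?h ` x = (+) (q_in P) ` x" if "x \<subseteq> {..<q_in Q}" for x
      by (rule image_cong) (use that in \<open>auto simp: par_wire2_def\<close>)
    have 3: "?f ` u \<subseteq> {..<q_in P + q_in Q} \<longleftrightarrow> u \<subseteq> {..<q_in P}" for u
      by (auto simp: par_wire1_def subset_iff split: if_splits)
    have 4: "?h ` x \<subseteq> {..<q_in P + q_in Q} \<longleftrightarrow> x \<subseteq> {..<q_in Q}" for x
      by (auto simp: par_wire2_def subset_iff q_wires_def split: if_splits)
    show ?thesis
    proof (cases "u \<subseteq> {..<q_in P} \<and> v \<subseteq> {..<q_in P} \<and> x \<subseteq> {..<q_in Q} \<and> y \<subseteq> {..<q_in Q}")
      case True
      then show ?thesis
        using 3[of u] 3[of v] 4[of x] 4[of y] by (simp add: ker_def 1 2 ent_tensor[OF A B])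
    next
      case False
      then show ?thesis
        using 3[of u] 3[of v] 4[of x] 4[of y] by (auto simp: ker_def)
    qed
  qed
  have sub: "s \<union> (+) (q_out P) ` t \<subseteq> {..<q_out (P \<parallel> Q)}" "s' \<union> (+) (q_out P) ` t' \<subseteq> {..<q_out (P \<parallel> Q)}"
    using s t by auto
  have pk: "pick (q_outs (P \<parallel> Q)) (s \<union> (+) (q_out P) ` t) = ?f ` pick (q_outs P) s \<union> ?h ` pick (q_outs Q) t"
    if "s \<subseteq> {..<q_out P}" "t \<subseteq> {..<q_out Q}" for s t
    using pick_append[of s "map ?f (q_outs P)" t "map ?h (q_outs Q)"] that by (simp add: pick_map)
  have in_wires: "?s \<union> a \<subseteq> {..<q_wires P}" "?s' \<union> a \<subseteq> {..<q_wires P}" "?t \<union> b \<subseteq> {..<q_wires Q}" "?t' \<union> b \<subseteq> {..<q_wires Q}"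
    if "a \<in> Pow (garbage P)" "b \<in> Pow (garbage Q)" for a b
    using that gP gQ wfP wfQ pick_subset[OF s(1)] pick_subset[OF s(2)] pick_subset[OF t(1)] pick_subset[OF t(2)] by blast+
  have "ent (run (P \<parallel> Q) (A \<otimes>\<^sub>q B)) (s \<union> (+) (q_out P) ` t) (s' \<union> (+) (q_out P) ` t')
      = (\<Sum>g\<in>Pow (?f ` garbage P \<union> ?h ` garbage Q). evo2 (q_gates (P \<parallel> Q)) ?K (?f ` ?s \<union> ?h ` ?t \<union> g) (?f ` ?s' \<union> ?h ` ?t' \<union> g))"
    using tensor_carrier[OF A B] unfolding garb[symmetric] pk[OF s(1) t(1), symmetric] pk[OF s(2) t(2), symmetric]
    by (subst ent_run[OF par_wf[OF P Q] _ sub]) simp_all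
  also have "\<dots> = (\<Sum>a\<in>Pow (garbage P). \<Sum>b\<in>Pow (garbage Q).
      evo2 (q_gates (P \<parallel> Q)) ?K (?h ` (?t \<union> b) \<union> ?f ` (?s \<union> a)) (?h ` (?t' \<union> b) \<union> ?f ` (?s' \<union> a)))"
  proof -
    have d: "?f ` garbage P \<inter> ?h ` garbage Q = {}" using disj gP gQ by blast
    have eq: "?f ` u \<union> ?h ` x \<union> (?f ` a \<union> ?h ` b) = ?h ` (x \<union> b) \<union> ?f ` (u \<union> a)" for u x a b by blast
    show ?thesis
      by (subst sum_Pow_Un) (simp_all only: d sum_Pow_image[OF par_wire_inj(1)] sum_Pow_image[OF par_wire_inj(2)] eq finite_imageI finite_garbage)
  qed
  also have "\<dots> = (\<Sum>a\<in>Pow (garbage P). \<Sum>b\<in>Pow (garbage Q).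
      evo2 (q_gates P) (ker (q_in P) A) (?s \<union> a) (?s' \<union> a) * evo2 (q_gates Q) (ker (q_in Q) B) (?t \<union> b) (?t' \<union> b))"
  proof (intro sum.cong refl)
    fix a b assume "a \<in> Pow (garbage P)" "b \<in> Pow (garbage Q)"
    note iw = in_wires[OF this]
    have d: "?f ` u \<inter> ?h ` {..<q_wires Q} = {}" if "u \<subseteq> {..<q_wires P}" for u using disj that by blast
    have d': "?h ` x \<inter> ?f ` {..<q_wires P} = {}" if "x \<subseteq> {..<q_wires Q}" for x using disj that by blast
    have "evo2 (q_gates (P \<parallel> Q)) ?K (?h ` (?t \<union> b) \<union> ?f ` (?s \<union> a)) (?h ` (?t' \<union> b) \<union> ?f ` (?s' \<union> a))
        = evo2 (q_gates Q) (\<lambda>x y. evo2 (map (map_wires ?f) (q_gates P)) ?K (?f ` (?s \<union> a) \<union> ?h ` x) (?f ` (?s' \<union> a) \<union> ?h ` y)) (?t \<union> b) (?t' \<union> b)"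
      by (simp only: par_simps evo2_append evo2_map_wires[OF par_wire_inj(2) wfQ(1) iw(3,4) d[OF iw(1)] d[OF iw(2)]])
         (simp only: Un_commute)
    also have "\<dots> = evo2 (q_gates Q) (\<lambda>x y. evo2 (q_gates P) (ker (q_in P) A) (?s \<union> a) (?s' \<union> a) * ker (q_in Q) B x y) (?t \<union> b) (?t' \<union> b)"
    proof (rule evo2_cong[OF wfQ(1) iw(3,4)])
      fix x y assume x: "x \<subseteq> {..<q_wires Q}" and y: "y \<subseteq> {..<q_wires Q}"
      have "evo2 (map (map_wires ?f) (q_gates P)) ?K (?f ` (?s \<union> a) \<union> ?h ` x) (?f ` (?s' \<union> a) \<union> ?h ` y)
          = evo2 (q_gates P) (\<lambda>u v. ?K (?f ` u \<union> ?h ` x) (?f ` v \<union> ?h ` y)) (?s \<union> a) (?s' \<union> a)"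
        by (rule evo2_map_wires[OF par_wire_inj(1) wfP(2) iw(1,2) d'[OF x] d'[OF y]])
      also have "\<dots> = evo2 (q_gates P) (\<lambda>u v. ker (q_in Q) B x y * ker (q_in P) A u v) (?s \<union> a) (?s' \<union> a)"
        by (rule evo2_cong[OF wfP(2) iw(1,2)]) (simp add: K x y)
      finally show "evo2 (map (map_wires ?f) (q_gates P)) ?K (?f ` (?s \<union> a) \<union> ?h ` x) (?f ` (?s' \<union> a) \<union> ?h ` y)
          = evo2 (q_gates P) (ker (q_in P) A) (?s \<union> a) (?s' \<union> a) * ker (q_in Q) B x y"
        by (simp add: evo2_scale)
    qed
    finally show "evo2 (q_gates (P \<parallel> Q)) ?K (?h ` (?t \<union> b) \<union> ?f ` (?s \<union> a)) (?h ` (?t' \<union> b) \<union> ?f ` (?s' \<union> a))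
        = evo2 (q_gates P) (ker (q_in P) A) (?s \<union> a) (?s' \<union> a) * evo2 (q_gates Q) (ker (q_in Q) B) (?t \<union> b) (?t' \<union> b)"
      by (simp add: evo2_scale)
  qed
  also have "\<dots> = ent (run P A) s s' * ent (run Q B) t t'"
    by (simp add: ent_run[OF P A s] ent_run[OF Q B t] sum_product)
  also have "\<dots> = ent (run P A \<otimes>\<^sub>q run Q B) (s \<union> (+) (q_out P) ` t) (s' \<union> (+) (q_out P) ` t')"
    by (simp add: ent_tensor[OF run_carrier run_carrier s t])
  finally show "ent (run (P \<parallel> Q) (A \<otimes>\<^sub>q B)) (s \<union> (+) (q_out P) ` t) (s' \<union> (+) (q_out P) ` t')
    = ent (run P A \<otimes>\<^sub>q run Q B) (s \<union> (+) (q_out P) ` t) (s' \<union> (+) (q_out P) ` t')" .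
qed (use run_carrier[of "P \<parallel> Q" "A \<otimes>\<^sub>q B"] in \<open>auto intro!: tensor_carrier\<close>)

section \<open>Tensor algebra and circuits without gates\<close>

lemma tensor_assoc: "(A \<otimes>\<^sub>q B) \<otimes>\<^sub>q C = A \<otimes>\<^sub>q (B \<otimes>\<^sub>q C)"
proof (rule eq_matI)
  fix i j assume "i < dim_row (A \<otimes>\<^sub>q (B \<otimes>\<^sub>q C))" "j < dim_col (A \<otimes>\<^sub>q (B \<otimes>\<^sub>q C))"
  then have i: "i < dim_row A * (dim_row B * dim_row C)" and j: "j < dim_col A * (dim_col B * dim_col C)"
    by (simp_all add: tensor_def)
  have m: "a * (b * c) > i \<Longrightarrow> i mod (a * b) < a * b \<and> i div (a * b) < c \<and> i mod a < a \<and> i div a < b * c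
    \<and> (i mod (a * b)) mod a = i mod a \<and> (i mod (a * b)) div a = (i div a) mod b \<and> i div (a * b) = (i div a) div b" for a b c i :: nat
  proof -
    assume *: "i < a * (b * c)"
    then have "a > 0" "b > 0" by (auto intro!: Nat.gr0I)
    then have "i mod (a * b) < a * b" by simp
    with \<open>a > 0\<close> \<open>b > 0\<close> show ?thesis
      using * by (simp add: div_mult2_eq less_mult_imp_div_less mult.assoc mult.commute mult.left_commute
          mod_mult2_eq[of i a b])
  qed
  show "((A \<otimes>\<^sub>q B) \<otimes>\<^sub>q C) $$ (i, j) = (A \<otimes>\<^sub>q (B \<otimes>\<^sub>q C)) $$ (i, j)"
    using i j m[OF i] m[OF j] by (simp add: tensor_def mult.assoc)
qed (simp_all add: tensor_def mult.assoc)

abbreviation one_state :: "complex mat" where "one_state \<equiv> basis_state []"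

lemma one_state_carrier: "one_state \<in> carrier_mat (2 ^ 0) (2 ^ 0)"
  using basis_state_carrier[of "[]"] by simp

lemma one_state_entry: "dim_row one_state = 1" "dim_col one_state = 1" "one_state $$ (0, 0) = 1"
  by (simp_all add: basis_state_def matrix_unit_def idx_def)

lemma tensor_one_left [simp]: "one_state \<otimes>\<^sub>q A = A"
  by (rule eq_matI) (simp_all add: tensor_def one_state_entry)

lemma tensor_one_right [simp]: "A \<otimes>\<^sub>q one_state = A"
  by (rule eq_matI) (simp_all add: tensor_def one_state_entry)

lemma basis_state_append: "basis_state (xs @ ys) = basis_state xs \<otimes>\<^sub>q basis_state ys"
proof (rule mat_eq_ent_tensor[of _ "length xs" "length ys"])
  fix s s' t t' assume s: "s \<subseteq> {..<length xs}" "s' \<subseteq> {..<length xs}" and t: "t \<subseteq> {..<length ys}" "t' \<subseteq> {..<length ys}"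
  have inj: "s \<union> (+) (length xs) ` t = true_bits (xs @ ys) \<longleftrightarrow> s = true_bits xs \<and> t = true_bits ys"
    if "s \<subseteq> {..<length xs}" for s t
  proof -
    have "s = (s \<union> (+) (length xs) ` t) \<inter> {..<length xs}" "t = {w. length xs + w \<in> s \<union> (+) (length xs) ` t}"
      if "s \<subseteq> {..<length xs}" for s t using that by auto
    from this[OF that] this[OF true_bits_subset[of xs], of "true_bits ys"] show ?thesis
      unfolding true_bits_append by metis
  qed
  have "s \<union> (+) (length xs) ` t \<subseteq> {..<length (xs @ ys)}" "s' \<union> (+) (length xs) ` t' \<subseteq> {..<length (xs @ ys)}"
    using s t by auto
  then show "ent (basis_state (xs @ ys)) (s \<union> (+) (length xs) ` t) (s' \<union> (+) (length xs) ` t')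
      = ent (basis_state xs \<otimes>\<^sub>q basis_state ys) (s \<union> (+) (length xs) ` t) (s' \<union> (+) (length xs) ` t')"
    using s t by (simp add: ent_basis_state ent_tensor[OF basis_state_carrier basis_state_carrier] inj)
qed (use basis_state_carrier[of "xs @ ys"] in \<open>simp_all add: tensor_carrier\<close>)

definition wires :: "nat \<Rightarrow> nat list \<Rightarrow> qcircuit" where
  "wires a os = QCircuit a 0 [] os"

lemma wires_simps [simp]:
  "q_in (wires a os) = a" "q_anc (wires a os) = 0" "q_gates (wires a os) = []" "q_outs (wires a os) = os"
  "q_wires (wires a os) = a" "q_size (wires a os) = a + length os"
  by (simp_all add: wires_def q_wires_def q_size_def)

definition idc :: "nat \<Rightarrow> qcircuit" where "idc n = wires n [0..<n]"

definition swapc :: "nat \<Rightarrow> nat \<Rightarrow> qcircuit" where "swapc p q = wires (p + q) ([p..<p + q] @ [0..<p])"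

definition discard :: "nat \<Rightarrow> qcircuit" where "discard n = wires n []"

definition zeros :: "nat \<Rightarrow> qcircuit" where "zeros n = QCircuit 0 n [] [0..<n]"

lemma basic_simps [simp]:
  "q_in (idc n) = n" "q_out (idc n) = n" "q_in (swapc p q) = p + q" "q_out (swapc p q) = p + q"
  "q_in (discard n) = n" "q_out (discard n) = 0" "q_in (zeros n) = 0" "q_out (zeros n) = n"
  by (simp_all add: idc_def swapc_def discard_def zeros_def add.commute)

lemma basic_wf [simp]: "q_wf (idc n)" "q_wf (swapc p q)" "q_wf (discard n)" "q_wf (zeros n)"
  by (auto simp: idc_def swapc_def discard_def zeros_def q_wf_iff q_wires_def)

lemma basic_size [simp]:
  "q_size (idc n) = 2 * n" "q_size (swapc p q) = 2 * (p + q)" "q_size (discard n) = n" "q_size (zeros n) = 2 * n"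
  by (auto simp: idc_def swapc_def discard_def zeros_def q_size_def q_wires_def)

lemma run_idc [simp]:
  assumes "\<rho> \<in> carrier_mat (2 ^ n) (2 ^ n)"
  shows "run (idc n) \<rho> = \<rho>"
proof (rule mat_eq_ent[of _ n])
  fix r c assume r: "r \<subseteq> {..<n}" and c: "c \<subseteq> {..<n}"
  have "garbage (idc n) = {}" by (auto simp: garbage_def idc_def)
  then show "ent (run (idc n) \<rho>) r c = ent \<rho> r c"
    using r c assms by (subst ent_run) (auto simp: ker_def, simp_all add: idc_def pick_upt ker_def)
qed (use run_carrier[of "idc n" \<rho>] assms in simp_all)

lemma run_swapc [simp]:
  assumes A: "A \<in> carrier_mat (2 ^ p) (2 ^ p)" and B: "B \<in> carrier_mat (2 ^ q) (2 ^ q)"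
  shows "run (swapc p q) (A \<otimes>\<^sub>q B) = B \<otimes>\<^sub>q A"
proof (rule mat_eq_ent_tensor[of _ q p])
  fix s s' t t' assume s: "s \<subseteq> {..<q}" "s' \<subseteq> {..<q}" and t: "t \<subseteq> {..<p}" "t' \<subseteq> {..<p}"
  have g: "garbage (swapc p q) = {}" by (auto simp: garbage_def swapc_def)
  have pk: "pick (q_outs (swapc p q)) (s \<union> (+) q ` t) = t \<union> (+) p ` s" if "s \<subseteq> {..<q}" "t \<subseteq> {..<p}" for s t
    using that pick_append[of s "[p..<p+q]" t "[0..<p]"] by (simp add: swapc_def pick_upt Un_commute)
  have sub: "s \<union> (+) q ` t \<subseteq> {..<q_out (swapc p q)}" "s' \<union> (+) q ` t' \<subseteq> {..<q_out (swapc p q)}"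
    using s t by auto
  have sub': "t \<union> (+) p ` s \<subseteq> {..<p + q}" "t' \<union> (+) p ` s' \<subseteq> {..<p + q}"
    using s t by auto
  have AB: "A \<otimes>\<^sub>q B \<in> carrier_mat (2 ^ q_in (swapc p q)) (2 ^ q_in (swapc p q))"
    using tensor_carrier[OF A B] by simp
  have gates: "q_gates (swapc p q) = []" by (simp add: swapc_def)
  show "ent (run (swapc p q) (A \<otimes>\<^sub>q B)) (s \<union> (+) q ` t) (s' \<union> (+) q ` t') = ent (B \<otimes>\<^sub>q A) (s \<union> (+) q ` t) (s' \<union> (+) q ` t')"
    unfolding ent_run[OF basic_wf(2) AB sub] g gates pk[OF s(1) t(1)] pk[OF s(2) t(2)]
    using sub' s t by (simp add: ker_def ent_tensor[OF A B] ent_tensor[OF B A])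
qed (use run_carrier[of "swapc p q" "A \<otimes>\<^sub>q B"] A B in \<open>simp_all add: add.commute[of p q] tensor_carrier\<close>)

lemma run_zeros [simp]: "run (zeros n) one_state = basis_state (replicate n False)"
proof (rule mat_eq_ent[of _ n])
  fix r c assume r: "r \<subseteq> {..<n}" and c: "c \<subseteq> {..<n}"
  have g: "garbage (zeros n) = {}" by (auto simp: garbage_def zeros_def q_wires_def)
  have o: "one_state \<in> carrier_mat (2 ^ q_in (zeros n)) (2 ^ q_in (zeros n))" using one_state_carrier by simp
  have p: "pick (q_outs (zeros n)) r = r" if "r \<subseteq> {..<n}" for r using that by (simp add: zeros_def pick_upt)
  have gates: "q_gates (zeros n) = []" by (simp add: zeros_def)
  have "ent (run (zeros n) one_state) r c = ker 0 one_state r c"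
    using r c g gates p by (subst ent_run[OF basic_wf(4) o]) simp_all
  also have "\<dots> = ent (basis_state (replicate n False)) r c"
    using r c by (simp add: ent_basis_state ker_def)
  finally show "ent (run (zeros n) one_state) r c = ent (basis_state (replicate n False)) r c" .
qed (use run_carrier[of "zeros n" one_state] basis_state_carrier[of "replicate n False"] in simp_all)

lemma run_discard [simp]: "length xs = n \<Longrightarrow> run (discard n) (basis_state xs) = one_state"
proof (rule mat_eq_ent[of _ 0])
  fix r c :: "nat set" assume n: "length xs = n" and r: "r \<subseteq> {..<0}" and c: "c \<subseteq> {..<0}"
  have g: "garbage (discard n) = {..<n}" by (auto simp: garbage_def discard_def)
  have o: "basis_state xs \<in> carrier_mat (2 ^ q_in (discard n)) (2 ^ q_in (discard n))" using n basis_state_carrier[of xs] by simp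
  have gates: "q_gates (discard n) = []" by (simp add: discard_def)
  have "ent (run (discard n) (basis_state xs)) r c = (\<Sum>g\<in>Pow {..<n}. ker n (basis_state xs) g g)"
    using r c g gates by (subst ent_run[OF basic_wf(3) o]) (simp_all add: pick_def)
  also have "\<dots> = (\<Sum>g\<in>Pow {..<n}. of_bool (g = true_bits xs) * 1)"
    by (intro sum.cong refl) (use n in \<open>auto simp: ker_def ent_basis_state\<close>)
  also have "\<dots> = 1"
    by (rule sum_of_bool_eq) (use true_bits_subset n in auto)
  finally show "ent (run (discard n) (basis_state xs)) r c = ent one_state r c"
    using r c by (simp add: ent_basis_state)
qed (use run_carrier[of "discard n" "basis_state xs"] one_state_carrier in auto)

section \<open>Linearity and positivity\<close>

lemma index_ent: "i < 2 ^ n \<Longrightarrow> j < 2 ^ n \<Longrightarrow> M $$ (i, j) = ent M (set_decode i) (set_decode j)"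
  by (simp add: ent_def)

text \<open>Stated entrywise, so that expansions into matrix units or basis states can be used
  without sums of matrices.\<close>

lemma run_linear:
  assumes Q: "q_wf Q" and M: "M \<in> carrier_mat (2 ^ q_in Q) (2 ^ q_in Q)"
    and Ma: "\<And>a. a \<in> S \<Longrightarrow> Ma a \<in> carrier_mat (2 ^ q_in Q) (2 ^ q_in Q)"
    and eq: "\<And>i j. i < 2 ^ q_in Q \<Longrightarrow> j < 2 ^ q_in Q \<Longrightarrow> M $$ (i, j) = (\<Sum>a\<in>S. c a * Ma a $$ (i, j))"
    and ij: "i < 2 ^ q_out Q" "j < 2 ^ q_out Q"
  shows "run Q M $$ (i, j) = (\<Sum>a\<in>S. c a * run Q (Ma a) $$ (i, j))"
proof -
  note d = set_decode_subset[OF ij(1)] set_decode_subset[OF ij(2)]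
  have k: "ker (q_in Q) M = (\<lambda>x y. \<Sum>a\<in>S. c a * ker (q_in Q) (Ma a) x y)"
  proof (intro ext)
    fix x y
    show "ker (q_in Q) M x y = (\<Sum>a\<in>S. c a * ker (q_in Q) (Ma a) x y)"
    proof (cases "x \<subseteq> {..<q_in Q} \<and> y \<subseteq> {..<q_in Q}")
      case True
      then show ?thesis using eq[OF set_encode_less set_encode_less, of x y] by (simp add: ker_def ent_def)
    next
      case False
      show ?thesis unfolding ker_def if_not_P[OF False] by simp
    qed
  qed
  have "run Q M $$ (i, j) = (\<Sum>g\<in>Pow (garbage Q). \<Sum>a\<in>S. c a *
      evo2 (q_gates Q) (ker (q_in Q) (Ma a)) (pick (q_outs Q) (set_decode i) \<union> g) (pick (q_outs Q) (set_decode j) \<union> g))"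
    by (simp add: index_ent[OF ij] ent_run[OF Q M d] k evo2_sum evo2_scale)
  also have "\<dots> = (\<Sum>a\<in>S. c a * run Q (Ma a) $$ (i, j))"
    by (subst sum.swap) (auto simp: index_ent[OF ij] ent_run[OF Q Ma d] sum_distrib_left intro!: sum.cong)
  finally show ?thesis .
qed

lemma run_smult:
  assumes "q_wf Q" "M \<in> carrier_mat (2 ^ q_in Q) (2 ^ q_in Q)"
  shows "run Q (c \<cdot>\<^sub>m M) = c \<cdot>\<^sub>m run Q M"
proof (rule eq_matI)
  fix i j assume "i < dim_row (c \<cdot>\<^sub>m run Q M)" "j < dim_col (c \<cdot>\<^sub>m run Q M)"
  then have ij: "i < 2 ^ q_out Q" "j < 2 ^ q_out Q" using run_carrier[of Q M] by auto
  have "run Q (c \<cdot>\<^sub>m M) $$ (i, j) = (\<Sum>a\<in>{()}. c * run Q M $$ (i, j))"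
    by (rule run_linear[OF assms(1) _ _ _ ij]) (use assms in auto)
  then show "run Q (c \<cdot>\<^sub>m M) $$ (i, j) = (c \<cdot>\<^sub>m run Q M) $$ (i, j)"
    using ij carrier_matD[OF run_carrier[of Q M]] by simp
qed (use carrier_matD[OF run_carrier[of Q M]] carrier_matD[OF run_carrier[of Q "c \<cdot>\<^sub>m M"]] in simp_all)

section \<open>Circuits preserve density matrices\<close>

lemma density_iff:
  "density n \<rho> \<longleftrightarrow> \<rho> \<in> carrier_mat (2 ^ n) (2 ^ n) \<and> psd {..<n} (ent \<rho>) \<and> (\<Sum>\<beta>\<in>Pow {..<n}. ent \<rho> \<beta> \<beta>) = 1"
proof (cases "\<rho> \<in> carrier_mat (2 ^ n) (2 ^ n)")
  case True
  have form: "(\<rho> *\<^sub>v w) \<bullet>c w = form {..<n} (ent \<rho>) (\<lambda>\<beta>. w $ set_encode \<beta>)" if w: "w \<in> carrier_vec (2 ^ n)" for w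
  proof -
    have "(\<rho> *\<^sub>v w) \<bullet>c w = (\<Sum>i<2 ^ n. (\<Sum>j<2 ^ n. \<rho> $$ (i, j) * w $ j) * cnj (w $ i))"
      using w True by (auto simp: scalar_prod_def atLeast0LessThan intro!: sum.cong)
    then show ?thesis
      by (simp add: sum_exp_eq_Pow form_def ent_def sum_distrib_left algebra_simps)
  qed
  have "(\<forall>v\<in>carrier_vec (2 ^ n). (\<rho> *\<^sub>v v) \<bullet>c v \<ge> 0) \<longleftrightarrow> psd {..<n} (ent \<rho>)"
  proof
    assume *: "\<forall>v\<in>carrier_vec (2 ^ n). (\<rho> *\<^sub>v v) \<bullet>c v \<ge> 0"
    show "psd {..<n} (ent \<rho>)" unfolding psd_def
    proof
      fix v :: "nat set \<Rightarrow> complex"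
      let ?w = "Matrix.vec (2 ^ n) (\<lambda>i. v (set_decode i))"
      have "(\<rho> *\<^sub>v ?w) \<bullet>c ?w = form {..<n} (ent \<rho>) (\<lambda>\<beta>. ?w $ set_encode \<beta>)"
        by (rule form) simp
      also have "\<dots> = form {..<n} (ent \<rho>) v"
        unfolding form_def
      proof (intro sum.cong refl)
        fix \<beta> \<gamma> assume "\<beta> \<in> Pow {..<n}" "\<gamma> \<in> Pow {..<n}"
        then have "?w $ set_encode \<beta> = v \<beta>" "?w $ set_encode \<gamma> = v \<gamma>"
          using set_encode_less finite_subset[OF _ finite_lessThan] by auto
        then show "ent \<rho> \<beta> \<gamma> * cnj (?w $ set_encode \<beta>) * ?w $ set_encode \<gamma> = ent \<rho> \<beta> \<gamma> * cnj (v \<beta>) * v \<gamma>"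
          by simp
      qed
      finally show "form {..<n} (ent \<rho>) v \<ge> 0" using * by (metis vec_carrier)
    qed
  next
    assume "psd {..<n} (ent \<rho>)"
    then show "\<forall>v\<in>carrier_vec (2 ^ n). (\<rho> *\<^sub>v v) \<bullet>c v \<ge> 0" by (simp add: form psd_def)
  qed
  then show ?thesis
    unfolding density_def sum_exp_eq_Pow ent_def by simp
qed (simp add: density_def)

lemma density_carrier: "density n \<rho> \<Longrightarrow> \<rho> \<in> carrier_mat (2 ^ n) (2 ^ n)"
  by (simp add: density_def)

definition unpick :: "nat list \<Rightarrow> nat set \<Rightarrow> nat set" where
  "unpick os \<beta> = {t. t < length os \<and> os ! t \<in> \<beta>}"

lemma unpick_pick:
  assumes "distinct os" "r \<subseteq> {..<length os}" "g \<inter> set os = {}"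
  shows "unpick os (pick os r \<union> g) = r"
proof -
  have "os ! t \<notin> g" if "t < length os" for t using assms(3) that nth_mem by blast
  then show ?thesis
    using assms(1,2) by (auto simp: unpick_def pick_def nth_eq_iff_index_eq subset_iff)
qed

text \<open>Every assignment to all wires splits into a part on the outputs and a part on the
  garbage, in the shape in which the partial trace sums them.\<close>

lemma sum_Pow_outs:
  fixes F :: "nat set \<Rightarrow> complex"
  assumes "q_wf Q"
  shows "(\<Sum>\<beta>\<in>Pow {..<q_wires Q}. F \<beta>) = (\<Sum>r\<in>Pow {..<q_out Q}. \<Sum>g\<in>Pow (garbage Q). F (pick (q_outs Q) r \<union> g))"
proof -
  have d: "distinct (q_outs Q)" using assms by (simp add: q_wf_iff)
  have s: "set (q_outs Q) = (!) (q_outs Q) ` {..<q_out Q}" by (auto simp: set_conv_nth)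
  have "{..<q_wires Q} = set (q_outs Q) \<union> garbage Q"
    using assms by (auto simp: q_wf_iff garbage_def)
  then have "(\<Sum>\<beta>\<in>Pow {..<q_wires Q}. F \<beta>) = (\<Sum>a\<in>Pow (set (q_outs Q)). \<Sum>g\<in>Pow (garbage Q). F (a \<union> g))"
    by (simp only:) (rule sum_Pow_Un, auto simp: garbage_def)
  also have "\<dots> = (\<Sum>r\<in>Pow {..<q_out Q}. \<Sum>g\<in>Pow (garbage Q). F (pick (q_outs Q) r \<union> g))"
    unfolding s pick_def by (rule sum_Pow_image) (use d in \<open>auto simp: inj_on_def nth_eq_iff_index_eq\<close>)
  finally show ?thesis .
qed

lemma psd_ker:
  assumes "psd {..<a} (ent \<rho>)" "a \<le> N"
  shows "psd {..<N} (ker a \<rho>)"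
proof -
  have sub: "Pow {..<a} \<subseteq> Pow {..<N}" using assms(2) by auto
  have "form {..<N} (ker a \<rho>) v = form {..<a} (ent \<rho>) v" for v
  proof -
    have "form {..<N} (ker a \<rho>) v = (\<Sum>\<beta>\<in>Pow {..<a}. \<Sum>\<gamma>\<in>Pow {..<N}. ker a \<rho> \<beta> \<gamma> * cnj (v \<beta>) * v \<gamma>)"
      unfolding form_def by (rule sum.mono_neutral_right[OF _ sub]) (auto simp: ker_def)
    also have "\<dots> = (\<Sum>\<beta>\<in>Pow {..<a}. \<Sum>\<gamma>\<in>Pow {..<a}. ker a \<rho> \<beta> \<gamma> * cnj (v \<beta>) * v \<gamma>)"
      by (intro sum.cong refl sum.mono_neutral_right[OF _ sub]) (auto simp: ker_def)
    also have "\<dots> = form {..<a} (ent \<rho>) v"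
      unfolding form_def by (intro sum.cong refl) (auto simp: ker_def)
    finally show ?thesis .
  qed
  then show ?thesis using assms(1) by (simp add: psd_def)
qed

text \<open>Positivity survives the partial trace: the form of the reduced matrix at
  \<open>v\<close> is the sum, over the values \<open>g\<close> of the traced-out wires, of the full
  form at \<open>v\<close> tensored with the basis vector \<open>g\<close>. These tensored vectors
  are \<open>u g\<close>.\<close>

lemma density_run:
  assumes Q: "q_wf Q" and \<rho>: "density (q_in Q) \<rho>"
  shows "density (q_out Q) (run Q \<rho>)"
proof -
  let ?N = "{..<q_wires Q}" and ?K = "evo2 (q_gates Q) (ker (q_in Q) \<rho>)" and ?os = "q_outs Q"
  have car: "\<rho> \<in> carrier_mat (2 ^ q_in Q) (2 ^ q_in Q)" and psd: "psd {..<q_in Q} (ent \<rho>)"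
    and tr: "(\<Sum>\<beta>\<in>Pow {..<q_in Q}. ent \<rho> \<beta> \<beta>) = 1" using \<rho> by (auto simp: density_iff)
  have wf: "\<forall>g\<in>set (q_gates Q). gate_ok ?N g" "distinct ?os" using Q by (auto simp: q_wf_iff)
  have sub: "Pow {..<q_in Q} \<subseteq> Pow ?N" by (auto simp: q_wires_def)
  have "psd ?N (ker (q_in Q) \<rho>)" using psd by (rule psd_ker) (simp add: q_wires_def)
  then have psdK: "psd ?N ?K" by (rule evo2_psd[OF finite_lessThan wf(1)])
  have "(\<Sum>\<beta>\<in>Pow ?N. ker (q_in Q) \<rho> \<beta> \<beta>) = (\<Sum>\<beta>\<in>Pow {..<q_in Q}. ker (q_in Q) \<rho> \<beta> \<beta>)"
    by (rule sum.mono_neutral_right[OF _ sub]) (auto simp: ker_def)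
  also have "\<dots> = 1" unfolding tr[symmetric] by (intro sum.cong refl) (auto simp: ker_def)
  finally have trK: "(\<Sum>\<beta>\<in>Pow ?N. ?K \<beta> \<beta>) = 1"
    by (simp add: evo2_trace[OF finite_lessThan wf(1)])
  have "form {..<q_out Q} (ent (run Q \<rho>)) v \<ge> 0" for v
  proof -
    define u where "u g \<beta> = (if \<beta> - set ?os = g then v (unpick ?os \<beta>) else 0)" for g \<beta>
    have u: "u g (pick ?os r \<union> h) = (if h = g then v r else 0)"
      if "h \<in> Pow (garbage Q)" "r \<in> Pow {..<q_out Q}" for g h r
    proof -
      have "pick ?os r \<union> h - set ?os = h" using that pick_subset[of r ?os] by (auto simp: garbage_def)
      moreover have "unpick ?os (pick ?os r \<union> h) = r"
        by (rule unpick_pick[OF wf(2)]) (use that in \<open>auto simp: garbage_def\<close>)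
      ultimately show ?thesis by (auto simp: u_def)
    qed
    have "form {..<q_out Q} (ent (run Q \<rho>)) v
        = (\<Sum>r\<in>Pow {..<q_out Q}. \<Sum>c\<in>Pow {..<q_out Q}. \<Sum>g\<in>Pow (garbage Q). ?K (pick ?os r \<union> g) (pick ?os c \<union> g) * cnj (v r) * v c)"
      unfolding form_def by (intro sum.cong refl) (simp add: ent_run[OF Q car] sum_distrib_right)
    also have "\<dots> = (\<Sum>r\<in>Pow {..<q_out Q}. \<Sum>g\<in>Pow (garbage Q). \<Sum>c\<in>Pow {..<q_out Q}. ?K (pick ?os r \<union> g) (pick ?os c \<union> g) * cnj (v r) * v c)"
      by (rule sum.cong[OF refl], rule sum.swap)
    also have "\<dots> = (\<Sum>g\<in>Pow (garbage Q). \<Sum>r\<in>Pow {..<q_out Q}. \<Sum>c\<in>Pow {..<q_out Q}. ?K (pick ?os r \<union> g) (pick ?os c \<union> g) * cnj (v r) * v c)"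
      by (rule sum.swap)
    also have "\<dots> = (\<Sum>g\<in>Pow (garbage Q). form ?N ?K (u g))"
    proof (intro sum.cong refl)
      fix g assume g: "g \<in> Pow (garbage Q)"
      have inner: "(\<Sum>h'\<in>Pow (garbage Q). ?K x (pick ?os c \<union> h') * y * u g (pick ?os c \<union> h')) = ?K x (pick ?os c \<union> g) * y * v c"
        if "c \<in> Pow {..<q_out Q}" for x y c
      proof -
        have "(\<Sum>h'\<in>Pow (garbage Q). ?K x (pick ?os c \<union> h') * y * u g (pick ?os c \<union> h'))
            = (\<Sum>h'\<in>Pow (garbage Q). if h' = g then ?K x (pick ?os c \<union> g) * y * v c else 0)"
          by (intro sum.cong refl) (use that u in auto)
        then show ?thesis using g by (simp add: sum.delta')
      qed
      have "form ?N ?K (u g) = (\<Sum>r\<in>Pow {..<q_out Q}. \<Sum>h\<in>Pow (garbage Q). \<Sum>c\<in>Pow {..<q_out Q}.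
          ?K (pick ?os r \<union> h) (pick ?os c \<union> g) * cnj (u g (pick ?os r \<union> h)) * v c)"
        unfolding form_def sum_Pow_outs[OF Q] by (intro sum.cong refl) (simp only: inner)
      also have "\<dots> = (\<Sum>r\<in>Pow {..<q_out Q}. \<Sum>h\<in>Pow (garbage Q). if h = g then \<Sum>c\<in>Pow {..<q_out Q}.
          ?K (pick ?os r \<union> g) (pick ?os c \<union> g) * cnj (v r) * v c else 0)"
        by (intro sum.cong refl) (use u in auto)
      also have "\<dots> = (\<Sum>r\<in>Pow {..<q_out Q}. \<Sum>c\<in>Pow {..<q_out Q}. ?K (pick ?os r \<union> g) (pick ?os c \<union> g) * cnj (v r) * v c)"
        using g by (simp add: sum.delta')
      finally show "(\<Sum>r\<in>Pow {..<q_out Q}. \<Sum>c\<in>Pow {..<q_out Q}. ?K (pick ?os r \<union> g) (pick ?os c \<union> g) * cnj (v r) * v c) = form ?N ?K (u g)" ..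
    qed
    also have "\<dots> \<ge> 0" using psdK unfolding psd_def by (intro sum_nonneg) auto
    finally show ?thesis .
  qed
  moreover have "(\<Sum>r\<in>Pow {..<q_out Q}. ent (run Q \<rho>) r r) = 1"
    using trK unfolding sum_Pow_outs[OF Q] by (simp add: ent_run[OF Q car])
  ultimately show ?thesis by (simp add: density_iff psd_def)
qed

lemma outcome_prob_ent: "outcome_prob Q \<rho> y = Re (ent (run Q \<rho>) (true_bits y) (true_bits y))"
  by (simp add: outcome_prob_def idx_eq ent_def)

lemma density_diag:
  assumes "density n \<rho>" "\<beta> \<subseteq> {..<n}"
  shows "ent \<rho> \<beta> \<beta> \<ge> 0" "Re (ent \<rho> \<beta> \<beta>) \<le> 1"
proof -
  have pos: "ent \<rho> \<gamma> \<gamma> \<ge> 0" if "\<gamma> \<subseteq> {..<n}" for \<gamma>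
    using assms(1) psd_diag[OF finite_lessThan _ that] by (simp add: density_iff)
  then show "ent \<rho> \<beta> \<beta> \<ge> 0" using assms(2) by blast
  have "Re (ent \<rho> \<beta> \<beta>) \<le> (\<Sum>\<gamma>\<in>Pow {..<n}. Re (ent \<rho> \<gamma> \<gamma>))"
    by (rule member_le_sum) (use assms(2) pos in \<open>auto simp: less_eq_complex_def\<close>)
  also have "\<dots> = 1" using assms(1) by (simp add: density_iff flip: Re_sum)
  finally show "Re (ent \<rho> \<beta> \<beta>) \<le> 1" .
qed

lemma outcome_prob_bounds:
  assumes "q_wf Q" "density (q_in Q) \<rho>" "length y = q_out Q"
  shows "0 \<le> outcome_prob Q \<rho> y" "outcome_prob Q \<rho> y \<le> 1"
  using density_diag[OF density_run[OF assms(1,2)], of "true_bits y"] true_bits_subset[of y] assms(3)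
  by (auto simp: outcome_prob_ent less_eq_complex_def)

lemma outcome_prob_sum:
  assumes "q_wf Q" "density (q_in Q) \<rho>"
  shows "(\<Sum>y\<in>bitstrings (q_out Q). outcome_prob Q \<rho> y) = 1"
  using density_run[OF assms] unfolding density_iff sum_Pow_bitstrings outcome_prob_ent
  by (simp flip: Re_sum)

section \<open>Classical circuits\<close>

text \<open>The one wire that a classical gate can change; the last case is a dummy value for the
  remaining gates.\<close>

fun target :: "gate \<Rightarrow> nat" where
  "target (NOT i) = i"
| "target (CNOT i j) = j"
| "target (Toffoli i j k) = k"
| "target _ = 0"

text \<open>\<open>fwd\<close> follows a basis state through the gates. A kernel evolves by being
  evaluated at the preimage, and this is \<open>bwd\<close>, as classical gates on distinct wires
  are involutions.\<close>

abbreviation fwd :: "gate list \<Rightarrow> nat set \<Rightarrow> nat set" where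
  "fwd gs \<beta> \<equiv> fold perm gs \<beta>"

abbreviation bwd :: "gate list \<Rightarrow> nat set \<Rightarrow> nat set" where
  "bwd gs \<beta> \<equiv> foldr perm gs \<beta>"

lemma evo2_classical:
  "\<forall>g\<in>set gs. classical g \<Longrightarrow> evo2 gs K \<beta> \<gamma> = K (bwd gs \<beta>) (bwd gs \<gamma>)"
  by (induction gs arbitrary: K) (simp_all add: evo2_Cons act2_def act_classical)

lemma fwd_back: "\<forall>g\<in>set gs. distinct (gate_wires g) \<Longrightarrow> fwd gs (bwd gs \<beta>) = \<beta>"
  by (induction gs) (simp_all add: perm_perm)

lemma back_fwd: "\<forall>g\<in>set gs. distinct (gate_wires g) \<Longrightarrow> bwd gs (fwd gs \<beta>) = \<beta>"
  by (induction gs arbitrary: \<beta>) (simp_all add: perm_perm)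

lemma perm_target: "w \<noteq> target g \<Longrightarrow> w \<in> perm g \<beta> \<longleftrightarrow> w \<in> \<beta>"
  by (cases g) (auto simp: mem_flip)

lemma back_inputs: "\<forall>g\<in>set gs. target g \<ge> a \<Longrightarrow> bwd gs \<beta> \<inter> {..<a} = \<beta> \<inter> {..<a}"
proof (induction gs)
  case (Cons g gs)
  have "perm g \<delta> \<inter> {..<a} = \<delta> \<inter> {..<a}" for \<delta> using Cons.prems perm_target[of _ g \<delta>] by force
  then show ?case using Cons by simp
qed simp

lemma fwd_inputs: "\<forall>g\<in>set gs. target g \<ge> a \<Longrightarrow> fwd gs \<beta> \<inter> {..<a} = \<beta> \<inter> {..<a}"
proof (induction gs arbitrary: \<beta>)
  case (Cons g gs)
  have "perm g \<delta> \<inter> {..<a} = \<delta> \<inter> {..<a}" for \<delta> using Cons.prems perm_target[of _ g \<delta>] by force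
  then show ?case using Cons by simp
qed simp

lemma fwd_subset: "\<forall>g\<in>set gs. gate_ok X g \<Longrightarrow> \<beta> \<subseteq> X \<Longrightarrow> fwd gs \<beta> \<subseteq> X"
  by (induction gs arbitrary: \<beta>) (simp_all add: perm_subset)

text \<open>The condition is on all matrices: only the diagonal of the input matters, as if the
  input had been measured. So such a circuit can be applied to the quantum output of another one,
  which \<open>maps\<close> does not cover.\<close>

definition computes :: "qcircuit \<Rightarrow> (bool list \<Rightarrow> bool list) \<Rightarrow> bool" where
  "computes Q f \<longleftrightarrow> q_wf Q \<and> (\<forall>xs\<in>bitstrings (q_in Q). length (f xs) = q_out Q)
     \<and> (\<forall>\<rho>\<in>carrier_mat (2 ^ q_in Q) (2 ^ q_in Q). \<forall>r\<subseteq>{..<q_out Q}. \<forall>c\<subseteq>{..<q_out Q}.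
          ent (run Q \<rho>) r c = (\<Sum>xs\<in>bitstrings (q_in Q).
            of_bool (r = true_bits (f xs) \<and> c = true_bits (f xs)) * ent \<rho> (true_bits xs) (true_bits xs)))"

definition maps :: "qcircuit \<Rightarrow> (bool list \<Rightarrow> bool list) \<Rightarrow> bool" where
  "maps Q f \<longleftrightarrow> q_wf Q \<and> (\<forall>xs\<in>bitstrings (q_in Q). length (f xs) = q_out Q \<and> run Q (basis_state xs) = basis_state (f xs))"

text \<open>No gate writes to an input wire and no input wire is output, so the inputs remain in the
  garbage. Tracing them out destroys the coherence between different inputs, and each input leaves
  exactly one garbage value.\<close>

lemma classical_computes:
  assumes Q: "q_wf Q" and gs: "\<forall>g\<in>set (q_gates Q). classical g \<and> target g \<ge> q_in Q"
    and os: "\<forall>w\<in>set (q_outs Q). w \<ge> q_in Q"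
    and f: "\<And>xs. length xs = q_in Q \<Longrightarrow> f xs = map (\<lambda>w. w \<in> fwd (q_gates Q) (true_bits xs)) (q_outs Q)"
  shows "computes Q f"
proof -
  let ?os = "q_outs Q" and ?gs = "q_gates Q" and ?a = "q_in Q"
  have wf: "\<forall>g\<in>set ?gs. gate_ok {..<q_wires Q} g" "distinct ?os" "set ?os \<subseteq> {..<q_wires Q}"
    using Q by (auto simp: q_wf_iff)
  have dist: "\<forall>g\<in>set ?gs. distinct (gate_wires g)" using wf(1) by (auto simp: gate_ok_def)
  have tb: "true_bits (f xs) = unpick ?os (fwd ?gs (true_bits xs))" if "length xs = ?a" for xs
    using f[OF that] by (auto simp: true_bits_def unpick_def)
  have "ent (run Q \<rho>) r c = (\<Sum>xs\<in>bitstrings ?a.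
        of_bool (r = true_bits (f xs) \<and> c = true_bits (f xs)) * ent \<rho> (true_bits xs) (true_bits xs))"
    if \<rho>: "\<rho> \<in> carrier_mat (2 ^ ?a) (2 ^ ?a)" and r: "r \<subseteq> {..<q_out Q}" and c: "c \<subseteq> {..<q_out Q}" for \<rho> :: "complex mat" and r c
  proof -
    define P where "P g \<longleftrightarrow> pick ?os r \<union> g = fwd ?gs (g \<inter> {..<?a}) \<and> pick ?os c \<union> g = fwd ?gs (g \<inter> {..<?a})" for g
    define R where "R x \<longleftrightarrow> r = unpick ?os (fwd ?gs x) \<and> c = unpick ?os (fwd ?gs x)" for x
    have dis: "pick ?os z \<inter> {..<?a} = {}" if "z \<subseteq> {..<q_out Q}" for z
      using pick_subset[OF that] os by fastforce
    \<comment> \<open>A term survives only if its row and its column both arise from an input with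
      zero ancillas. It is then the same input for both, because the input wires belong to the
      common garbage \<open>g\<close>.\<close>
    have trm: "ker ?a \<rho> (bwd ?gs (pick ?os r \<union> g)) (bwd ?gs (pick ?os c \<union> g))
        = (if P g then ent \<rho> (g \<inter> {..<?a}) (g \<inter> {..<?a}) else 0)" for g
    proof -
      have 1: "bwd ?gs (pick ?os z \<union> g) \<inter> {..<?a} = g \<inter> {..<?a}" if "z \<subseteq> {..<q_out Q}" for z
        using back_inputs[of ?gs ?a] gs dis[OF that] by auto
      have 2: "bwd ?gs (pick ?os z \<union> g) \<subseteq> {..<?a} \<longleftrightarrow> pick ?os z \<union> g = fwd ?gs (g \<inter> {..<?a})" if "z \<subseteq> {..<q_out Q}" for z
      proof -
        have "bwd ?gs (pick ?os z \<union> g) \<subseteq> {..<?a} \<longleftrightarrow> bwd ?gs (pick ?os z \<union> g) = g \<inter> {..<?a}"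
          using 1[OF that] by blast
        also have "\<dots> \<longleftrightarrow> pick ?os z \<union> g = fwd ?gs (g \<inter> {..<?a})"
          by (metis fwd_back[OF dist] back_fwd[OF dist])
        finally show ?thesis .
      qed
      show ?thesis
      proof (cases "P g")
        case True
        then have "bwd ?gs (pick ?os r \<union> g) \<subseteq> {..<?a}" "bwd ?gs (pick ?os c \<union> g) \<subseteq> {..<?a}"
          using 2[OF r] 2[OF c] by (simp_all add: P_def)
        moreover from this have "bwd ?gs (pick ?os r \<union> g) = g \<inter> {..<?a}" "bwd ?gs (pick ?os c \<union> g) = g \<inter> {..<?a}"
          using 1[OF r] 1[OF c] by blast+
        ultimately show ?thesis using True by (simp add: ker_def)
      next
        case False
        then show ?thesis using 2[OF r] 2[OF c] by (auto simp: P_def ker_def)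
      qed
    qed
    have "ent (run Q \<rho>) r c = (\<Sum>g\<in>Pow (garbage Q). if P g then ent \<rho> (g \<inter> {..<?a}) (g \<inter> {..<?a}) else 0)"
      using gs by (simp add: ent_run[OF Q \<rho> r c] evo2_classical trm)
    also have "\<dots> = (\<Sum>g\<in>{g\<in>Pow (garbage Q). P g}. ent \<rho> (g \<inter> {..<?a}) (g \<inter> {..<?a}))"
      by (rule sum.inter_filter[symmetric]) simp
    also have "\<dots> = (\<Sum>x\<in>{x\<in>Pow {..<?a}. R x}. ent \<rho> x x)"
    \<comment> \<open>Garbage determines the input as its part below \<open>?a\<close>, and an input
      determines the garbage as what its run leaves outside the output wires.\<close>
    proof (rule sum.reindex_bij_witness[of _ "\<lambda>x. fwd ?gs x - set ?os" "\<lambda>g. g \<inter> {..<?a}"])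
      fix g assume g: "g \<in> {g\<in>Pow (garbage Q). P g}"
      have e: "fwd ?gs (g \<inter> {..<?a}) = pick ?os r \<union> g" using g by (simp add: P_def)
      have "g \<inter> set ?os = {}" using g by (auto simp: garbage_def)
      then show "fwd ?gs (g \<inter> {..<?a}) - set ?os = g"
        unfolding e using pick_subset[OF r] by blast
      have "unpick ?os (pick ?os z \<union> g) = z" if "z \<subseteq> {..<q_out Q}" for z
        by (rule unpick_pick) (use wf that \<open>g \<inter> set ?os = {}\<close> in auto)
      then have "R (g \<inter> {..<?a})" unfolding R_def using g r c by (metis (mono_tags, lifting) P_def mem_Collect_eq)
      then show "g \<inter> {..<?a} \<in> {x\<in>Pow {..<?a}. R x}" by simp
    next
      fix x assume x: "x \<in> {x\<in>Pow {..<?a}. R x}"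
      have sub: "fwd ?gs x \<subseteq> {..<q_wires Q}" by (rule fwd_subset[OF wf(1)]) (use x in \<open>auto simp: q_wires_def\<close>)
      have "set ?os \<inter> {..<?a} = {}" using os by force
      moreover have "fwd ?gs x \<inter> {..<?a} = x" using fwd_inputs[of ?gs ?a x] gs x by auto
      ultimately show e: "(fwd ?gs x - set ?os) \<inter> {..<?a} = x" by blast
      have "pick ?os (unpick ?os (fwd ?gs x)) = fwd ?gs x \<inter> set ?os"
        by (auto simp: pick_def unpick_def in_set_conv_nth)
      then have "pick ?os r \<union> (fwd ?gs x - set ?os) = fwd ?gs x" "pick ?os c \<union> (fwd ?gs x - set ?os) = fwd ?gs x"
        using x unfolding R_def by (smt (verit) Int_Diff_Un mem_Collect_eq)+
      then show "fwd ?gs x - set ?os \<in> {g\<in>Pow (garbage Q). P g}"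
        using sub e by (auto simp: P_def garbage_def)
    qed auto
    also have "\<dots> = (\<Sum>x\<in>Pow {..<?a}. if R x then ent \<rho> x x else 0)"
      by (rule sum.inter_filter) simp
    also have "\<dots> = (\<Sum>xs\<in>bitstrings ?a. of_bool (r = true_bits (f xs) \<and> c = true_bits (f xs)) * ent \<rho> (true_bits xs) (true_bits xs))"
      unfolding sum_Pow_bitstrings by (intro sum.cong refl) (auto simp: R_def tb bitstrings_def)
    finally show ?thesis .
  qed
  moreover have "length (f xs) = q_out Q" if "xs \<in> bitstrings ?a" for xs using f that by (simp add: bitstrings_def)
  ultimately show ?thesis using Q by (auto simp: computes_def)
qed

lemma computes_maps: "computes Q f \<Longrightarrow> maps Q f"
proof -
  assume *: "computes Q f"
  have "run Q (basis_state xs) = basis_state (f xs)" if xs: "xs \<in> bitstrings (q_in Q)" for xs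
  proof (rule mat_eq_ent[of _ "q_out Q"])
    have len: "length xs = q_in Q" "length (f xs) = q_out Q" using xs * by (auto simp: bitstrings_def computes_def)
    have car: "basis_state xs \<in> carrier_mat (2 ^ q_in Q) (2 ^ q_in Q)" using basis_state_carrier[of xs] len by simp
    show "basis_state (f xs) \<in> carrier_mat (2 ^ q_out Q) (2 ^ q_out Q)" using basis_state_carrier[of "f xs"] len by simp
    fix r c assume r: "r \<subseteq> {..<q_out Q}" and c: "c \<subseteq> {..<q_out Q}"
    have "ent (run Q (basis_state xs)) r c = (\<Sum>ys\<in>bitstrings (q_in Q).
        of_bool (r = true_bits (f ys) \<and> c = true_bits (f ys)) * ent (basis_state xs) (true_bits ys) (true_bits ys))"
      using * car r c by (simp add: computes_def)
    also have "\<dots> = (\<Sum>ys\<in>bitstrings (q_in Q). if ys = xs then of_bool (r = true_bits (f xs) \<and> c = true_bits (f xs)) else 0)"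
    proof (intro sum.cong refl)
      fix ys assume "ys \<in> bitstrings (q_in Q)"
      then have "length ys = length xs" using len by (simp add: bitstrings_def)
      then show "of_bool (r = true_bits (f ys) \<and> c = true_bits (f ys)) * ent (basis_state xs) (true_bits ys) (true_bits ys)
          = (if ys = xs then of_bool (r = true_bits (f xs) \<and> c = true_bits (f xs)) else 0)"
        using true_bits_subset[of ys] by (auto simp: ent_basis_state true_bits_inj)
    qed
    also have "\<dots> = ent (basis_state (f xs)) r c"
      using xs r c len by (simp add: sum.delta ent_basis_state)
    finally show "ent (run Q (basis_state xs)) r c = ent (basis_state (f xs)) r c" .
  qed simp
  then show ?thesis using * by (simp add: maps_def computes_def)
qed

lemma maps_seq:
  assumes "maps P f" "maps Q g" "q_out P = q_in Q"
  shows "maps (P ;; Q) (g \<circ> f)"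
  using assms by (auto simp: maps_def run_seq bitstrings_def) (metis basis_state_carrier run_seq)

lemma maps_par:
  assumes "maps P f" "maps Q g"
  shows "maps (P \<parallel> Q) (\<lambda>xs. f (take (q_in P) xs) @ g (drop (q_in P) xs))"
  unfolding maps_def
proof (intro conjI ballI)
  fix xs assume "xs \<in> bitstrings (q_in (P \<parallel> Q))"
  then have l: "length (take (q_in P) xs) = q_in P" "length (drop (q_in P) xs) = q_in Q"
    by (simp_all add: bitstrings_def)
  have c: "basis_state (take (q_in P) xs) \<in> carrier_mat (2 ^ q_in P) (2 ^ q_in P)"
     "basis_state (drop (q_in P) xs) \<in> carrier_mat (2 ^ q_in Q) (2 ^ q_in Q)"
    using basis_state_carrier l by metis+
  have "run (P \<parallel> Q) (basis_state xs) = run (P \<parallel> Q) (basis_state (take (q_in P) xs) \<otimes>\<^sub>q basis_state (drop (q_in P) xs))"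
    by (simp flip: basis_state_append)
  also have "\<dots> = basis_state (f (take (q_in P) xs) @ g (drop (q_in P) xs))"
    using assms l c by (simp add: maps_def run_par bitstrings_def basis_state_append)
  finally show "run (P \<parallel> Q) (basis_state xs) = basis_state (f (take (q_in P) xs) @ g (drop (q_in P) xs))" .
  show "length (f (take (q_in P) xs) @ g (drop (q_in P) xs)) = q_out (P \<parallel> Q)"
    using assms l by (simp add: maps_def bitstrings_def)
qed (use assms in \<open>simp add: maps_def\<close>)

text \<open>The first stage already acts as a measurement, so the second one meets only basis states
  and \<open>maps\<close> suffices for it.\<close>

lemma computes_seq:
  assumes P: "computes P f" and Q: "maps Q g" and PQ: "q_out P = q_in Q"
  shows "computes (P ;; Q) (g \<circ> f)"
  unfolding computes_def
proof (intro conjI ballI allI impI)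
  have wf: "q_wf P" "q_wf Q" using P Q by (auto simp: computes_def maps_def)
  then show "q_wf (P ;; Q)" using PQ by simp
  have fl: "length (f xs) = q_in Q" if "xs \<in> bitstrings (q_in P)" for xs
    using P PQ that by (simp add: computes_def)
  then show "length ((g \<circ> f) xs) = q_out (P ;; Q)" if "xs \<in> bitstrings (q_in (P ;; Q))" for xs
    using Q that by (simp add: maps_def bitstrings_def)
  fix \<rho> :: "complex mat" and r c assume \<rho>: "\<rho> \<in> carrier_mat (2 ^ q_in (P ;; Q)) (2 ^ q_in (P ;; Q))"
    and r: "r \<subseteq> {..<q_out (P ;; Q)}" and c: "c \<subseteq> {..<q_out (P ;; Q)}"
  have \<rho>': "\<rho> \<in> carrier_mat (2 ^ q_in P) (2 ^ q_in P)" using \<rho> by simp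
  have car: "run P \<rho> \<in> carrier_mat (2 ^ q_in Q) (2 ^ q_in Q)" using run_carrier[of P \<rho>] PQ by simp
  have car': "basis_state (f xs) \<in> carrier_mat (2 ^ q_in Q) (2 ^ q_in Q)" if "xs \<in> bitstrings (q_in P)" for xs
    using basis_state_carrier[of "f xs"] fl[OF that] by simp
  have "run Q (run P \<rho>) $$ (set_encode r, set_encode c)
      = (\<Sum>xs\<in>bitstrings (q_in P). ent \<rho> (true_bits xs) (true_bits xs) * run Q (basis_state (f xs)) $$ (set_encode r, set_encode c))"
  proof (rule run_linear[OF wf(2) car car'])
    fix i j :: nat assume ij: "i < 2 ^ q_in Q" "j < 2 ^ q_in Q"
    have "ent (run P \<rho>) (set_decode i) (set_decode j) = (\<Sum>xs\<in>bitstrings (q_in P).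
          of_bool (set_decode i = true_bits (f xs) \<and> set_decode j = true_bits (f xs)) * ent \<rho> (true_bits xs) (true_bits xs))"
      using P \<rho>' set_decode_subset[OF ij(1)] set_decode_subset[OF ij(2)] PQ by (simp add: computes_def)
    also have "\<dots> = (\<Sum>xs\<in>bitstrings (q_in P). ent \<rho> (true_bits xs) (true_bits xs) * ent (basis_state (f xs)) (set_decode i) (set_decode j))"
      using set_decode_subset[OF ij(1)] set_decode_subset[OF ij(2)] fl
      by (intro sum.cong refl) (simp add: ent_basis_state)
    finally show "run P \<rho> $$ (i, j) = (\<Sum>xs\<in>bitstrings (q_in P). ent \<rho> (true_bits xs) (true_bits xs) * basis_state (f xs) $$ (i, j))"
      by (simp add: ent_def)
  qed (use r c set_encode_less in auto)
  also have "\<dots> = (\<Sum>xs\<in>bitstrings (q_in P). ent \<rho> (true_bits xs) (true_bits xs) * ent (basis_state (g (f xs))) r c)"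
    using Q fl by (intro sum.cong refl) (simp add: maps_def bitstrings_def ent_def)
  also have "\<dots> = (\<Sum>xs\<in>bitstrings (q_in P). of_bool (r = true_bits (g (f xs)) \<and> c = true_bits (g (f xs))) * ent \<rho> (true_bits xs) (true_bits xs))"
    using Q fl r c by (intro sum.cong refl) (simp add: maps_def bitstrings_def ent_basis_state)
  finally show "ent (run (P ;; Q) \<rho>) r c = (\<Sum>xs\<in>bitstrings (q_in (P ;; Q)).
      of_bool (r = true_bits ((g \<circ> f) xs) \<and> c = true_bits ((g \<circ> f) xs)) * ent \<rho> (true_bits xs) (true_bits xs))"
    by (simp add: run_seq[OF wf PQ \<rho>'] ent_def)
qed

section \<open>Writing bits to fresh wires\<close>

lemma true_bits_snoc: "true_bits (zs @ [b]) = (if b then insert (length zs) (true_bits zs) else true_bits zs)"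
  by (auto simp: true_bits_def nth_append less_Suc_eq)

lemma mem_true_bits: "i \<in> true_bits zs \<longleftrightarrow> i < length zs \<and> zs ! i"
  by (simp add: true_bits_def)

lemma flip_fresh: "flip (length zs) (true_bits zs) = true_bits (zs @ [True])"
  by (simp add: flip_def true_bits_snoc mem_true_bits)

text \<open>A wire carrying zero does not show in the set, so writing to a fresh wire appends one
  bit to the list. Each block has to work whatever the earlier blocks have written behind
  \<open>xs\<close>.\<close>

lemma fwd_append_bits:
  assumes "\<And>u zs. u < m \<Longrightarrow> length zs = length xs + u \<Longrightarrow> take (length xs) zs = xs \<Longrightarrow>
      fwd (G u) (true_bits zs) = true_bits (zs @ [h u])"
  shows "fwd (concat (map G [0..<m])) (true_bits xs) = true_bits (xs @ map h [0..<m])"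
  using assms
proof (induction m)
  case (Suc m)
  have "fwd (G m) (true_bits (xs @ map h [0..<m])) = true_bits ((xs @ map h [0..<m]) @ [h m])"
    by (rule Suc.prems) auto
  then show ?case using Suc by simp
qed simp

lemma nth_take_eq: "take n zs = xs \<Longrightarrow> i < n \<Longrightarrow> i < length zs \<Longrightarrow> zs ! i = xs ! i"
  by (metis nth_take)

lemma fwd_CNOT_fresh: "j < length zs \<Longrightarrow> fwd [CNOT j (length zs)] (true_bits zs) = true_bits (zs @ [zs ! j])"
  by (simp add: mem_true_bits flip_fresh) (simp add: true_bits_snoc)

lemma flip_fresh_snoc: "flip (length zs) (true_bits (zs @ [b])) = true_bits (zs @ [\<not> b])"
  by (cases b) (auto simp: flip_def true_bits_snoc mem_true_bits)

lemma true_bits_snoc_False: "true_bits (zs @ [False]) = true_bits zs"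
  by (simp add: true_bits_snoc)

text \<open>A Toffoli gate needs distinct controls, hence the CNOT for equal inputs.\<close>

lemma fwd_NAND_fresh:
  assumes "i < length zs" "j < length zs"
  shows "fwd [if i = j then CNOT i (length zs) else Toffoli i j (length zs), NOT (length zs)] (true_bits zs)
    = true_bits (zs @ [\<not> (zs ! i \<and> zs ! j)])"
proof -
  have "fwd [if i = j then CNOT i (length zs) else Toffoli i j (length zs)] (true_bits zs) = true_bits (zs @ [zs ! i \<and> zs ! j])"
    using assms by (auto simp: mem_true_bits flip_fresh true_bits_snoc_False)
  then show ?thesis by (simp add: flip_fresh_snoc del: de_Morgan_conj)
qed

lemma map_mem_true_bits: "length xs = a \<Longrightarrow> map (\<lambda>w. w \<in> true_bits (xs @ ys)) [a..<a + length ys] = ys"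
  by (rule nth_equalityI) (auto simp: mem_true_bits nth_append)

definition prep :: "bool list \<Rightarrow> qcircuit" where
  "prep xs = QCircuit 0 (length xs) (concat (map (\<lambda>u. if xs ! u then [NOT u] else []) [0..<length xs])) [0..<length xs]"

lemma prep_simps [simp]: "q_in (prep xs) = 0" "q_out (prep xs) = length xs"
  by (simp_all add: prep_def)

lemma prep_computes: "computes (prep xs) (\<lambda>_. xs)"
proof (rule classical_computes)
  show "q_wf (prep xs)"
    by (auto simp: q_wf_iff prep_def q_wires_def gate_ok_def split: if_splits)
  fix ys :: "bool list" assume "length ys = q_in (prep xs)"
  then have ys: "ys = []" by simp
  have "fwd (concat (map (\<lambda>u. if xs ! u then [NOT u] else []) [0..<length xs])) (true_bits []) = true_bits ([] @ map ((!) xs) [0..<length xs])"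
    by (rule fwd_append_bits) (auto simp: flip_fresh, auto simp: true_bits_snoc)
  then show "xs = map (\<lambda>w. w \<in> fwd (q_gates (prep xs)) (true_bits ys)) (q_outs (prep xs))"
    using map_mem_true_bits[of "[]" 0 xs] by (simp add: prep_def map_nth ys)
qed (auto simp: prep_def split: if_splits)

lemma run_prep: "run (prep xs) one_state = basis_state xs"
  using computes_maps[OF prep_computes, of xs] by (simp add: maps_def bitstrings_def)

text \<open>
  This restriction on \<open>\<omega>\<close> makes \<open>\<alpha> \<otimes>\<^sub>q \<omega>\<close> a density matrix for every density matrix \<open>\<alpha>\<close> without a spectral
  theorem: run the circuit that prepares \<open>\<omega>\<close> next to \<open>\<alpha>\<close>.
\<close>

definition preparable :: "nat \<Rightarrow> complex mat \<Rightarrow> bool" where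
  "preparable n \<omega> \<longleftrightarrow> (\<exists>Q. q_wf Q \<and> q_in Q = 0 \<and> q_out Q = n \<and> run Q one_state = \<omega>)"

lemma preparable_basis_state: "length xs = n \<Longrightarrow> preparable n (basis_state xs)"
  unfolding preparable_def using computes_maps[OF prep_computes, of xs] run_prep[of xs]
  by (intro exI[of _ "prep xs"]) (simp add: maps_def)

lemma preparable_run: "preparable n \<omega> \<Longrightarrow> q_wf Q \<Longrightarrow> q_in Q = n \<Longrightarrow> q_out Q = m \<Longrightarrow> preparable m (run Q \<omega>)"
proof -
  assume *: "preparable n \<omega>" "q_wf Q" "q_in Q = n" "q_out Q = m"
  then obtain P where P: "q_wf P" "q_in P = 0" "q_out P = n" "run P one_state = \<omega>" by (auto simp: preparable_def)
  then show ?thesis unfolding preparable_def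
    using * one_state_carrier by (intro exI[of _ "P ;; Q"]) (simp add: run_seq)
qed

lemma preparable_tensor: "preparable n \<omega> \<Longrightarrow> preparable m \<tau> \<Longrightarrow> preparable (n + m) (\<omega> \<otimes>\<^sub>q \<tau>)"
proof -
  assume "preparable n \<omega>" "preparable m \<tau>"
  then obtain P Q where P: "q_wf P" "q_in P = 0" "q_out P = n" "run P one_state = \<omega>"
    and Q: "q_wf Q" "q_in Q = 0" "q_out Q = m" "run Q one_state = \<tau>" by (auto simp: preparable_def)
  then show ?thesis unfolding preparable_def
    using run_par[OF P(1) Q(1), of one_state one_state] one_state_carrier by (intro exI[of _ "P \<parallel> Q"]) simp
qed

lemma preparable_carrier: "preparable n \<omega> \<Longrightarrow> \<omega> \<in> carrier_mat (2 ^ n) (2 ^ n)"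
  unfolding preparable_def using run_carrier by blast

lemma density_tensor_preparable:
  assumes "density p \<alpha>" "preparable n \<omega>"
  shows "density (p + n) (\<alpha> \<otimes>\<^sub>q \<omega>)"
proof -
  obtain P where P: "q_wf P" "q_in P = 0" "q_out P = n" "run P one_state = \<omega>" using assms by (auto simp: preparable_def)
  have "run (idc p \<parallel> P) (\<alpha> \<otimes>\<^sub>q one_state) = \<alpha> \<otimes>\<^sub>q \<omega>"
    using run_par[of "idc p" P \<alpha> one_state] P density_carrier[OF assms(1)] one_state_carrier by simp
  moreover have "density (q_out (idc p \<parallel> P)) (run (idc p \<parallel> P) \<alpha>)"
    by (rule density_run) (use P assms in simp_all)
  ultimately show ?thesis using P by simp
qed

lemma density_one: "density 0 one_state"
  using one_state_carrier
  by (auto simp: density_def one_state_entry scalar_prod_def less_eq_complex_def)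

lemma preparable_density: "preparable n \<omega> \<Longrightarrow> density n \<omega>"
  using density_tensor_preparable[OF density_one, of n \<omega>] by simp

section \<open>Copying and NAND circuits\<close>

definition copies :: "nat \<Rightarrow> nat \<Rightarrow> qcircuit" where
  "copies r n = QCircuit n (r * n) (concat (map (\<lambda>u. [CNOT (u mod n) (n + u)]) [0..<r * n])) [n..<n + r * n]"

lemma copies_simps [simp]: "q_in (copies r n) = n" "q_out (copies r n) = r * n"
  by (simp_all add: copies_def)

lemma copies_size: "q_size (copies r n) = n + 3 * (r * n)"
  by (simp add: copies_def q_size_def q_wires_def length_concat sum_list_triv comp_def)

lemma map_nth_mod: "length xs = n \<Longrightarrow> map (\<lambda>u. xs ! (u mod n)) [0..<r * n] = concat (replicate r xs)"
proof (induction r)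
  case (Suc r)
  have "map (\<lambda>u. xs ! (u mod n)) [r * n..<r * n + n] = xs"
    by (rule nth_equalityI) (use Suc.prems in auto)
  moreover have "concat (replicate (Suc r) xs) = concat (replicate r xs) @ xs"
    by (simp flip: replicate_append_same)
  moreover have "[0..<Suc r * n] = [0..<r * n] @ [r * n..<r * n + n]"
    by (metis add.commute mult_Suc le_add1 upt_add_eq_append zero_le add_0)
  ultimately show ?case using Suc by (simp del: replicate_Suc)
qed simp

text \<open>The original stays behind as garbage and only fresh wires are output, so copying acts as
  a measurement. In \<open>branch\<close> it is what measures the outcome of the decryption.\<close>

lemma copies_computes: "computes (copies r n) (\<lambda>xs. concat (replicate r xs))"
proof (rule classical_computes)
  have "u mod n < n" if "u < r * n" for u
    using that by (cases n) auto
  then show "q_wf (copies r n)"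
    by (force simp: q_wf_iff copies_def q_wires_def gate_ok_def)
  fix xs :: "bool list" assume xs: "length xs = q_in (copies r n)"
  have "fwd (concat (map (\<lambda>u. [CNOT (u mod n) (n + u)]) [0..<r * n])) (true_bits xs)
      = true_bits (xs @ map (\<lambda>u. xs ! (u mod n)) [0..<r * n])"
  proof (rule fwd_append_bits)
    fix u zs assume *: "u < r * n" "length zs = length xs + u" "take (length xs) zs = xs"
    have "u mod n < n" using *(1) by (cases n) auto
    then show "fwd [CNOT (u mod n) (n + u)] (true_bits zs) = true_bits (zs @ [xs ! (u mod n)])"
      using fwd_CNOT_fresh[of "u mod n" zs] * xs nth_take_eq[OF *(3), of "u mod n"] by simp
  qed
  also have "map (\<lambda>u. xs ! (u mod n)) [0..<r * n] = concat (replicate r xs)"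
    using map_nth_mod[of xs n r] xs by simp
  finally show "concat (replicate r xs) = map (\<lambda>w. w \<in> fwd (q_gates (copies r n)) (true_bits xs)) (q_outs (copies r n))"
    using map_mem_true_bits[of xs n "concat (replicate r xs)"] xs by (simp add: copies_def length_concat sum_list_replicate)
qed (auto simp: copies_def)

definition nand_wires :: "(nat \<times> nat) list \<Rightarrow> bool list \<Rightarrow> bool list" where
  "nand_wires gs x = foldl (\<lambda>ws (i, j). ws @ [\<not> (ws ! i \<and> ws ! j)]) x gs"

lemma nand_wires_snoc: "nand_wires (gs @ [(i, j)]) x = nand_wires gs x @ [\<not> (nand_wires gs x ! i \<and> nand_wires gs x ! j)]"
  by (simp add: nand_wires_def)

lemma length_nand_wires: "length (nand_wires gs x) = length x + length gs"
  by (induction gs rule: rev_induct) (auto simp: nand_wires_snoc, simp add: nand_wires_def)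

lemma b_eval_nand_wires: "b_eval B x = map ((!) (nand_wires (b_gates B) x)) (b_outs B)"
  by (simp add: b_eval_def nand_wires_def Let_def)

definition nand_block :: "nat \<Rightarrow> nat \<Rightarrow> bcircuit \<Rightarrow> nat \<Rightarrow> gate list" where
  "nand_block k a B t = (let (i, j) = b_gates B ! t
     in [if i = j then CNOT (k + i) (a + t) else Toffoli (k + i) (k + j) (a + t), NOT (a + t)])"

lemma b_to_q_simps [simp]:
  "q_in (b_to_q k B) = k + b_in B" "q_anc (b_to_q k B) = b_size B + length (b_outs B)"
  "q_out (b_to_q k B) = length (b_outs B)"
  by (simp_all add: b_to_q_def Let_def)

lemma b_to_q_gates: "q_gates (b_to_q k B) = concat (map (nand_block k (k + b_in B) B) [0..<b_size B])
    @ concat (map (\<lambda>u. [CNOT (k + b_outs B ! u) (k + b_in B + b_size B + u)]) [0..<length (b_outs B)])"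
  and b_to_q_outs: "q_outs (b_to_q k B) = [k + b_in B + b_size B..<k + b_in B + b_size B + length (b_outs B)]"
  by (simp_all add: b_to_q_def Let_def nand_block_def[abs_def])

lemma length_concat_le: "\<forall>x\<in>set xs. length (f x) \<le> b \<Longrightarrow> length (concat (map f xs)) \<le> length xs * b"
  by (induction xs) auto

lemma b_to_q_size: "q_size (b_to_q k B) \<le> k + b_in B + 3 * b_size B + 3 * length (b_outs B)"
proof -
  have "length (concat (map (nand_block k (k + b_in B) B) [0..<b_size B])) \<le> length [0..<b_size B] * 2"
    by (rule length_concat_le) (auto simp: nand_block_def Let_def split: prod.splits)
  moreover have "length (concat (map (\<lambda>u. [CNOT (k + b_outs B ! u) (k + b_in B + b_size B + u)]) [0..<length (b_outs B)])) \<le> length [0..<length (b_outs B)] * 1"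
    by (rule length_concat_le) auto
  ultimately show ?thesis by (simp add: q_size_def q_wires_def b_to_q_gates)
qed

text \<open>Invariant: after \<open>t\<close> blocks the wires carry the \<open>k\<close> padding
  bits, the input and the first \<open>t\<close> NAND values.\<close>

lemma b_to_q_computes:
  assumes B: "b_wf n m B"
  shows "computes (b_to_q k B) (\<lambda>z. b_eval B (drop k z))"
proof (rule classical_computes)
  define a where "a = k + n"
  have n: "b_in B = n" "length (b_outs B) = m" using B by (auto simp: b_wf_def)
  have ga: "fst (b_gates B ! t) < n + t" "snd (b_gates B ! t) < n + t" if "t < b_size B" for t
    using B that by (auto simp: b_wf_def)
  have outs: "b_outs B ! u < n + b_size B" if "u < m" for u
    using B that by (auto simp: b_wf_def)
  have block: "gate_ok {..<a + b_size B + m} g \<and> classical g \<and> target g \<ge> a"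
    if g: "g \<in> set (nand_block k (k + b_in B) B t)" and t: "t < b_size B" for g t
  proof -
    obtain i j where ij: "b_gates B ! t = (i, j)" by fastforce
    have "i < n + t" "j < n + t" using ga[OF t] ij by auto
    then show ?thesis
      using g t by (auto simp: nand_block_def ij gate_ok_def n a_def split: if_splits)
  qed
  have gts: "\<forall>g\<in>set (q_gates (b_to_q k B)). gate_ok {..<a + b_size B + m} g \<and> classical g \<and> target g \<ge> a"
  proof -
    have "gate_ok {..<a + b_size B + m} (CNOT (k + b_outs B ! u) (a + b_size B + u))" if "u < m" for u
      using outs[OF that] that by (auto simp: gate_ok_def a_def)
    then show ?thesis using block by (auto simp: b_to_q_gates n a_def[symmetric])
  qed
  then show "q_wf (b_to_q k B)"
    by (auto simp: q_wf_iff q_wires_def n a_def b_to_q_outs algebra_simps)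
  show "\<forall>g\<in>set (q_gates (b_to_q k B)). classical g \<and> target g \<ge> q_in (b_to_q k B)"
    using gts by (simp add: n a_def)
  show "\<forall>w\<in>set (q_outs (b_to_q k B)). w \<ge> q_in (b_to_q k B)" by (auto simp: b_to_q_outs)
  fix z :: "bool list" assume "length z = q_in (b_to_q k B)"
  then have z: "length z = a" by (simp add: n a_def)
  define p x where "p = take k z" and "x = drop k z"
  have zpx: "z = p @ x" and lp: "length p = k" and lx: "length x = n" using z by (auto simp: p_def x_def a_def)
  let ?ws = "\<lambda>t. nand_wires (take t (b_gates B)) x"
  have step: "fwd (concat (map (nand_block k a B) [0..<t])) (true_bits z) = true_bits (p @ ?ws t)" if "t \<le> b_size B" for t
    using that
  proof (induction t)
    case 0
    then show ?case by (simp add: zpx nand_wires_def)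
  next
    case (Suc t)
    obtain i j where ij: "b_gates B ! t = (i, j)" by fastforce
    have lt: "i < n + t" "j < n + t" using ga[of t] Suc.prems ij by auto
    let ?zs = "p @ ?ws t"
    have len: "length ?zs = a + t" using Suc.prems by (simp add: length_nand_wires lp lx a_def b_size_def min_def)
    have nth: "?zs ! (k + w) = ?ws t ! w" for w by (simp add: nth_append lp)
    have tk: "take (Suc t) (b_gates B) = take t (b_gates B) @ [(i, j)]"
      using Suc.prems ij by (simp add: take_Suc_conv_app_nth b_size_def)
    have "fwd (nand_block k a B t) (true_bits ?zs) = true_bits (?zs @ [\<not> (?ws t ! i \<and> ?ws t ! j)])"
    proof -
      have NB: "nand_block k a B t = [if k + i = k + j then CNOT (k + i) (a + t) else Toffoli (k + i) (k + j) (a + t), NOT (a + t)]"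
        by (simp add: nand_block_def ij)
      show ?thesis
        unfolding NB len[symmetric] nth[symmetric]
        by (rule fwd_NAND_fresh) (use lt len in \<open>simp_all add: a_def\<close>)
    qed
    then show ?case using Suc by (simp add: tk nand_wires_snoc)
  qed
  have zs: "fwd (concat (map (nand_block k a B) [0..<b_size B])) (true_bits z) = true_bits (p @ ?ws (b_size B))"
    by (rule step) simp
  let ?zs = "p @ nand_wires (b_gates B) x"
  have len: "length ?zs = a + b_size B" by (simp add: length_nand_wires lp lx a_def b_size_def)
  have "fwd (concat (map (\<lambda>u. [CNOT (k + b_outs B ! u) (a + b_size B + u)]) [0..<m])) (true_bits ?zs)
      = true_bits (?zs @ map (\<lambda>u. nand_wires (b_gates B) x ! (b_outs B ! u)) [0..<m])"
  proof (rule fwd_append_bits)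
    fix u ys assume *: "u < m" "length ys = length ?zs + u" "take (length ?zs) ys = ?zs"
    have lt: "k + b_outs B ! u < length ?zs" using outs[OF *(1)] unfolding len by (simp add: a_def)
    then have nth: "nand_wires (b_gates B) x ! (b_outs B ! u) = ys ! (k + b_outs B ! u)"
      using nth_take_eq[OF *(3), of "k + b_outs B ! u"] * by (simp add: nth_append lp)
    have len': "a + b_size B + u = length ys" using * len by simp
    show "fwd [CNOT (k + b_outs B ! u) (a + b_size B + u)] (true_bits ys)
        = true_bits (ys @ [nand_wires (b_gates B) x ! (b_outs B ! u)])"
      unfolding nth len' by (rule fwd_CNOT_fresh) (use lt * in simp)
  qed
  moreover have "map (\<lambda>u. nand_wires (b_gates B) x ! (b_outs B ! u)) [0..<m] = b_eval B x"
    by (rule nth_equalityI) (auto simp: b_eval_nand_wires n)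
  ultimately have "fwd (q_gates (b_to_q k B)) (true_bits z) = true_bits (?zs @ b_eval B x)"
    using zs by (simp add: b_to_q_gates n a_def[symmetric] b_size_def)
  moreover have "length (b_eval B x) = m" by (simp add: b_eval_def n)
  ultimately show "b_eval B (drop k z) = map (\<lambda>w. w \<in> fwd (q_gates (b_to_q k B)) (true_bits z)) (q_outs (b_to_q k B))"
    using map_mem_true_bits[OF len, of "b_eval B x"] by (simp add: b_to_q_outs n a_def[symmetric] x_def[symmetric])
qed

section \<open>The circuit built from a key-testable ciphertext\<close>

text \<open>AND is NAND followed by a negation; for \<open>b = False\<close> both inputs are negated
  beforehand.\<close>

definition both_bc :: "bool \<Rightarrow> bcircuit" where
  "both_bc b = (if b then BCircuit 2 [(0, 1), (2, 2)] [3] else BCircuit 2 [(0, 0), (1, 1), (2, 3), (4, 4)] [5])"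

lemma both_bc_wf: "b_wf 2 1 (both_bc b)"
  by (auto simp: both_bc_def b_wf_def b_size_def less_Suc_eq numeral_eq_Suc)

lemma both_bc_eval: "b_eval (both_bc b) [p, q] = [p = b \<and> q = b]"
  by (auto simp: both_bc_def b_eval_def numeral_eq_Suc)

text \<open>It takes all \<open>n + 2\<close> bits and reads the first two, so that in
  \<open>branch\<close> it can be fed one of three equal copies.\<close>

definition and_bc :: "nat \<Rightarrow> bcircuit" where
  "and_bc n = BCircuit (n + 2) [(0, 1), (n + 2, n + 2)] [n + 3]"

lemma and_bc_wf: "b_wf (n + 2) 1 (and_bc n)"
  by (auto simp: and_bc_def b_wf_def b_size_def less_Suc_eq)

lemma and_bc_eval: "length x = n \<Longrightarrow> b_eval (and_bc n) ([t, d] @ x) = [t \<and> d]"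
  by (auto simp: and_bc_def b_eval_def nth_append)

text \<open>The fresh wire receives bit \<open>u\<close> of the first word. If the selector on wire
  \<open>2 * m\<close> is set, that bit is cancelled and bit \<open>u\<close> of the second word is
  added.\<close>

definition select_block :: "nat \<Rightarrow> nat \<Rightarrow> gate list" where
  "select_block m u = [CNOT u (2 * m + 1 + u), Toffoli (2 * m) u (2 * m + 1 + u), Toffoli (2 * m) (m + u) (2 * m + 1 + u)]"

definition selc :: "nat \<Rightarrow> qcircuit" where
  "selc m = QCircuit (2 * m + 1) m (concat (map (select_block m) [0..<m])) [2 * m + 1..<2 * m + 1 + m]"

lemma selc_simps [simp]: "q_in (selc m) = 2 * m + 1" "q_out (selc m) = m"
  by (simp_all add: selc_def)

lemma selc_size: "q_size (selc m) = 7 * m + 1"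
  by (simp add: selc_def q_size_def q_wires_def length_concat comp_def select_block_def sum_list_triv)

lemma fwd_select_fresh:
  assumes "i < length zs" "j < length zs" "e < length zs"
  shows "fwd [CNOT i (length zs), Toffoli e i (length zs), Toffoli e j (length zs)] (true_bits zs)
    = true_bits (zs @ [if zs ! e then zs ! j else zs ! i])"
proof -
  have 1: "fwd [CNOT i (length zs)] (true_bits zs) = true_bits (zs @ [zs ! i])"
    by (rule fwd_CNOT_fresh[OF assms(1)])
  have 2: "fwd [Toffoli e w (length zs)] (true_bits (zs @ [b])) = true_bits (zs @ [b \<noteq> (zs ! e \<and> zs ! w)])"
    if "w < length zs" for w b
  proof -
    have "fwd [Toffoli e w (length zs)] (true_bits (zs @ [b])) = (if zs ! e \<and> zs ! w then true_bits (zs @ [\<not> b]) else true_bits (zs @ [b]))"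
      using that assms(3) by (simp add: flip_fresh_snoc) (auto simp: mem_true_bits nth_append)
    then show ?thesis by (cases b) auto
  qed
  have "fwd [CNOT i (length zs), Toffoli e i (length zs), Toffoli e j (length zs)] (true_bits zs)
      = fwd [Toffoli e j (length zs)] (fwd [Toffoli e i (length zs)] (fwd [CNOT i (length zs)] (true_bits zs)))"
    by simp
  also have "\<dots> = true_bits (zs @ [(zs ! i \<noteq> (zs ! e \<and> zs ! i)) \<noteq> (zs ! e \<and> zs ! j)])"
    unfolding 1 2[OF assms(1)] 2[OF assms(2)] ..
  also have "((zs ! i \<noteq> (zs ! e \<and> zs ! i)) \<noteq> (zs ! e \<and> zs ! j)) = (if zs ! e then zs ! j else zs ! i)" by auto
  finally show ?thesis .
qed

lemma selc_computes: "computes (selc m) (\<lambda>z. if z ! (2 * m) then take m (drop m z) else take m z)"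
proof (rule classical_computes)
  show "q_wf (selc m)"
    by (auto simp: q_wf_iff selc_def q_wires_def gate_ok_def select_block_def)
  show "\<forall>g\<in>set (q_gates (selc m)). classical g \<and> target g \<ge> q_in (selc m)"
    by (auto simp: selc_def select_block_def)
  fix z :: "bool list" assume "length z = q_in (selc m)"
  then have z: "length z = 2 * m + 1" by simp
  let ?h = "\<lambda>u. if z ! (2 * m) then z ! (m + u) else z ! u"
  have "fwd (concat (map (select_block m) [0..<m])) (true_bits z) = true_bits (z @ map ?h [0..<m])"
  proof (rule fwd_append_bits)
    fix u zs assume *: "u < m" "length zs = length z + u" "take (length z) zs = z"
    have len: "2 * m + 1 + u = length zs" using * z by simp
    have nth: "z ! i = zs ! i" if "i < 2 * m + 1" for i
      using nth_take_eq[OF *(3), of i] that z * by simp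
    show "fwd (select_block m u) (true_bits zs) = true_bits (zs @ [?h u])"
      unfolding select_block_def len
      using fwd_select_fresh[of u zs "m + u" "2 * m"] nth[of "2 * m"] nth[of "m + u"] nth[of u] * z by simp
  qed
  moreover have "map ?h [0..<m] = (if z ! (2 * m) then take m (drop m z) else take m z)"
    by (rule nth_equalityI) (use z in \<open>auto simp: min_def\<close>)
  moreover have "q_outs (selc m) = [2 * m + 1..<2 * m + 1 + length (map ?h [0..<m])]"
    by (simp add: selc_def)
  moreover have "q_gates (selc m) = concat (map (select_block m) [0..<m])"
    by (simp add: selc_def)
  ultimately show "(if z ! (2 * m) then take m (drop m z) else take m z) = map (\<lambda>w. w \<in> fwd (q_gates (selc m)) (true_bits z)) (q_outs (selc m))"
    using map_mem_true_bits[OF z, of "map ?h [0..<m]"] by metis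
qed (auto simp: selc_def)

text \<open>On input \<open>t, d, x\<close>: the value of the second circuit at \<open>x\<close> if \<open>t\<close> and \<open>d\<close>, of the first one otherwise.\<close>

definition branch :: "nat \<Rightarrow> nat \<Rightarrow> bcircuit \<Rightarrow> bcircuit \<Rightarrow> qcircuit" where
  "branch n m B B' = copies 3 (n + 2) ;; ((b_to_q 2 B \<parallel> (b_to_q 2 B' \<parallel> b_to_q 0 (and_bc n))) ;; selc m)"

lemma b_eval_length: "b_wf n m B \<Longrightarrow> length (b_eval B x) = m"
  by (simp add: b_eval_def b_wf_def Let_def)

lemma branch_simps:
  assumes "b_wf n m B" "b_wf n m B'"
  shows "q_in (branch n m B B') = n + 2" "q_out (branch n m B B') = m"
    "q_size (branch n m B B') \<le> 30 * (n + m + b_size B + b_size B' + 2)"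
proof -
  have a: "b_in (and_bc n) = n + 2" "b_size (and_bc n) = 2" "length (b_outs (and_bc n)) = 1"
    by (simp_all add: and_bc_def b_size_def)
  have b: "b_in B = n" "length (b_outs B) = m" "b_in B' = n" "length (b_outs B') = m"
    using assms by (auto simp: b_wf_def)
  show "q_in (branch n m B B') = n + 2" "q_out (branch n m B B') = m"
    by (simp_all add: branch_def)
  have "q_size (branch n m B B') \<le> q_size (copies 3 (n + 2)) + (q_size (b_to_q 2 B) + (q_size (b_to_q 2 B') + q_size (b_to_q 0 (and_bc n))) + q_size (selc m))"
    unfolding branch_def by (rule order_trans[OF seq_size] add_mono order_refl | simp add: par_size[symmetric])+
  also have "\<dots> \<le> 30 * (n + m + b_size B + b_size B' + 2)"
    using b_to_q_size[of 2 B] b_to_q_size[of 2 B'] b_to_q_size[of 0 "and_bc n"]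
    by (simp add: copies_size selc_size a b)
  finally show "q_size (branch n m B B') \<le> 30 * (n + m + b_size B + b_size B' + 2)" .
qed

text \<open>The function is existential because the composed one is unwieldy, and only its values on
  inputs of this shape are used later.\<close>

lemma branch_computes:
  assumes "b_wf n m B" "b_wf n m B'"
  shows "\<exists>f. computes (branch n m B B') f
    \<and> (\<forall>t d x. length x = n \<longrightarrow> f ([t, d] @ x) = (if t \<and> d then b_eval B' x else b_eval B x))"
proof -
  have b: "b_in B = n" "length (b_outs B) = m" "b_in B' = n" "length (b_outs B') = m"
    using assms by (auto simp: b_wf_def)
  have a: "b_in (and_bc n) = n + 2" "length (b_outs (and_bc n)) = 1" by (simp_all add: and_bc_def)
  define F where "F = (\<lambda>xs. b_eval B (drop 2 (take (n + 2) xs)) @ b_eval B' (drop 2 (take (n + 2) (drop (n + 2) xs)))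
    @ b_eval (and_bc n) (drop (n + 2) (drop (n + 2) xs)))"
  have m23: "maps (b_to_q 2 B' \<parallel> b_to_q 0 (and_bc n)) (\<lambda>xs. b_eval B' (drop 2 (take (n + 2) xs)) @ b_eval (and_bc n) (drop (n + 2) xs))"
    using maps_par[OF computes_maps[OF b_to_q_computes[OF assms(2), of 2]] computes_maps[OF b_to_q_computes[OF and_bc_wf[of n], of 0]]]
    by (simp add: b add.commute)
  then have mF: "maps (b_to_q 2 B \<parallel> (b_to_q 2 B' \<parallel> b_to_q 0 (and_bc n))) F"
    using maps_par[OF computes_maps[OF b_to_q_computes[OF assms(1), of 2]] m23] unfolding F_def by (simp add: b add.commute)
  define S where "S = (\<lambda>z :: bool list. if z ! (2 * m) then take m (drop m z) else take m z)"
  have "maps ((b_to_q 2 B \<parallel> (b_to_q 2 B' \<parallel> b_to_q 0 (and_bc n))) ;; selc m) (S \<circ> F)"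
    unfolding S_def by (rule maps_seq[OF mF computes_maps[OF selc_computes]]) (simp add: b a)
  then have c: "computes (branch n m B B') ((S \<circ> F) \<circ> (\<lambda>xs. concat (replicate 3 xs)))"
    unfolding branch_def by (rule computes_seq[OF copies_computes]) (simp add: b a)
  have "S (F (concat (replicate 3 ([t, d] @ x)))) = (if t \<and> d then b_eval B' x else b_eval B x)" if x: "length x = n" for t d x
  proof -
    have "F (concat (replicate 3 ([t, d] @ x))) = b_eval B x @ b_eval B' x @ [t \<and> d]"
      using and_bc_eval[OF x, of t d] x by (simp add: F_def numeral_eq_Suc)
    then show ?thesis
      using b_eval_length[OF assms(1), of x] b_eval_length[OF assms(2), of x] by (simp add: S_def nth_append)
  qed
  then show ?thesis using c by (intro exI[of _ "(S \<circ> F) \<circ> (\<lambda>xs. concat (replicate 3 xs))"]) simp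
qed

lemma bitstrings_1: "bitstrings 1 = {[True], [False]}"
  by (auto simp: bitstrings_def length_Suc_conv)

section \<open>Testing without disturbance\<close>

text \<open>
  Run a one-bit test, copy its outcome and undo the test. If the outcome is certain, this does not
  disturb the tested state.
\<close>

definition gentle :: "qcircuit \<Rightarrow> qcircuit" where
  "gentle T = QCircuit (q_in T) (q_anc T + 1)
     (q_gates T @ CNOT (hd (q_outs T)) (q_wires T) # inverse_gates (q_gates T)) (q_wires T # [0..<q_in T])"

lemma gentle_simps [simp]: "q_in (gentle T) = q_in T" "q_out (gentle T) = 1 + q_in T"
  by (simp_all add: gentle_def)

lemma gentle_size: "q_size (gentle T) \<le> 10 * q_size T + 3"
  using length_inverse_gates[of "q_gates T"] by (simp add: gentle_def q_size_def q_wires_def)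

lemma gentle_wf:
  assumes T: "q_wf T" "q_out T = 1"
  shows "q_wf (gentle T)"
proof -
  obtain w where w: "q_outs T = [w]" using T(2) by (auto simp: length_Suc_conv)
  then have "w < q_wires T" using T(1) by (auto simp: q_wf_iff)
  moreover have "gate_ok {..<Suc (q_wires T)} g" if "g \<in> set (q_gates T)" for g
    using T(1) that by (auto simp: q_wf_iff intro: gate_ok_mono)
  ultimately show ?thesis
    by (auto simp: gentle_def q_wf_iff q_wires_def w set_inverse_gates, auto simp: gate_ok_def)
qed

text \<open>If the outcome \<open>v\<close> is certain, the state after the test has no component in
  which the outcome wire differs from \<open>v\<close>. On what remains, the controlled NOT is an
  unconditional NOT on the fresh wire, or nothing, and so commutes with undoing the test.\<close>

lemma run_gentle:
  assumes T: "q_wf T" "q_out T = 1" and \<rho>: "density (q_in T) \<rho>" and v: "outcome_prob T \<rho> [v] = 1"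
  shows "run (gentle T) \<rho> = basis_state [v] \<otimes>\<^sub>q \<rho>"
proof (rule mat_eq_ent_tensor[of _ 1 "q_in T"])
  let ?p = "q_in T" and ?w = "q_wires T" and ?gs = "q_gates T"
  define K0 where "K0 = ker ?p \<rho>"
  define K where "K = evo2 ?gs K0"
  have car: "\<rho> \<in> carrier_mat (2 ^ ?p) (2 ^ ?p)" by (rule density_carrier[OF \<rho>])
  show "basis_state [v] \<otimes>\<^sub>q \<rho> \<in> carrier_mat (2 ^ (1 + ?p)) (2 ^ (1 + ?p))"
    using tensor_carrier[OF basis_state_carrier[of "[v]"] car] by simp
  show "run (gentle T) \<rho> \<in> carrier_mat (2 ^ (1 + ?p)) (2 ^ (1 + ?p))"
    using run_carrier[of "gentle T" \<rho>] by simp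
  fix s s' t t' :: "nat set" assume s: "s \<subseteq> {..<1}" "s' \<subseteq> {..<1}" and t: "t \<subseteq> {..<?p}" "t' \<subseteq> {..<?p}"
  obtain w where w: "q_outs T = [w]" using T(2) by (auto simp: length_Suc_conv)
  have wN: "w < ?w" using T(1) w by (auto simp: q_wf_iff)
  have gs: "\<forall>g\<in>set ?gs. gate_ok {..<?w} g" using T(1) by (simp add: q_wf_iff)
  have pN: "?p \<le> ?w" by (simp add: q_wires_def)
  have supp0: "supported {..<?w} K0" unfolding K0_def using supported_mono[OF supported_ker] pN by simp
  have supp: "supported {..<?w} K" unfolding K_def by (rule evo2_supported[OF gs supp0])
  have psd: "psd {..<?w} K"
  proof -
    have "psd {..<?w} K0" unfolding K0_def using \<rho> pN by (intro psd_ker) (auto simp: density_iff)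
    then show ?thesis unfolding K_def by (rule evo2_psd[OF finite_lessThan gs])
  qed
  \<comment> \<open>The diagonal entries with the wrong outcome are nonnegative and sum to its
    probability, which is 0.\<close>
  have zero_diag: "K \<beta> \<beta> = 0" if \<beta>: "\<beta> \<subseteq> {..<?w}" "(w \<in> \<beta>) \<noteq> v" for \<beta>
  proof -
    have "outcome_prob T \<rho> [True] + outcome_prob T \<rho> [False] = 1"
      using outcome_prob_sum[OF T(1) \<rho>] unfolding T(2) bitstrings_1 by simp
    then have "outcome_prob T \<rho> [\<not> v] = 0" using v by (cases v) auto
    also have "outcome_prob T \<rho> [\<not> v] = (\<Sum>g\<in>Pow (garbage T). Re (K (pick [w] (true_bits [\<not> v]) \<union> g) (pick [w] (true_bits [\<not> v]) \<union> g)))"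
      using T(2) true_bits_subset[of "[\<not> v]"]
      by (simp add: outcome_prob_ent ent_run[OF T(1) car] w K_def K0_def)
    finally have sum0: "(\<Sum>g\<in>Pow (garbage T). Re (K (pick [w] (true_bits [\<not> v]) \<union> g) (pick [w] (true_bits [\<not> v]) \<union> g))) = 0" .
    have pos: "K \<gamma> \<gamma> \<ge> 0" if "\<gamma> \<subseteq> {..<?w}" for \<gamma> by (rule psd_diag[OF _ psd that]) simp
    have sub: "pick [w] r \<union> g \<subseteq> {..<?w}" if "r \<subseteq> {..<1}" "g \<in> Pow (garbage T)" for r g
      using that wN by (auto simp: pick_def garbage_def)
    have "Re (K (pick [w] (true_bits [\<not> v]) \<union> g) (pick [w] (true_bits [\<not> v]) \<union> g)) \<ge> 0" if "g \<in> Pow (garbage T)" for g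
      using pos[OF sub[OF _ that]] true_bits_subset[of "[\<not> v]"] by (simp add: less_eq_complex_def)
    then have "\<forall>g\<in>Pow (garbage T). Re (K (pick [w] (true_bits [\<not> v]) \<union> g) (pick [w] (true_bits [\<not> v]) \<union> g)) = 0"
      using sum0 by (subst (asm) sum_nonneg_eq_0_iff) auto
    moreover have "\<beta> - {w} \<in> Pow (garbage T)" using \<beta> by (auto simp: garbage_def w)
    moreover have "pick [w] (true_bits [\<not> v]) \<union> (\<beta> - {w}) = \<beta>"
      using \<beta>(2) by (cases v) (auto simp: pick_def true_bits_def)
    ultimately have "Re (K \<beta> \<beta>) = 0" by metis
    then show ?thesis using pos[OF \<beta>(1)] by (simp add: less_eq_complex_def complex_eq_iff)
  qed
  \<comment> \<open>Positivity extends the vanishing from the diagonal to whole rows and columns: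
    there is no coherence with the wrong outcome either.\<close>
  have zero: "K \<beta> \<gamma> = 0" if "(w \<in> \<beta>) \<noteq> v \<or> (w \<in> \<gamma>) \<noteq> v" for \<beta> \<gamma>
  proof (cases "\<beta> \<subseteq> {..<?w} \<and> \<gamma> \<subseteq> {..<?w}")
    case True
    then show ?thesis
      using that psd_zero_row[OF finite_lessThan psd _ _ zero_diag] by blast
  next
    case False
    then show ?thesis using supportedD[OF supp] by blast
  qed
  \<comment> \<open>The controlled NOT with its control replaced by the certain value
    \<open>v\<close>.\<close>
  define fl where "fl \<beta> = (if v then flip ?w \<beta> else \<beta>)" for \<beta>
  have wfl: "w \<in> fl \<beta> \<longleftrightarrow> w \<in> \<beta>" for \<beta> using wN by (auto simp: fl_def mem_flip)
  have "evo2 [CNOT w ?w] K = (\<lambda>\<beta> \<gamma>. K (fl \<beta>) (fl \<gamma>))"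
  proof (intro ext)
    fix \<beta> \<gamma>
    have "w \<in> perm (CNOT w ?w) \<delta> \<longleftrightarrow> w \<in> \<delta>" for \<delta> using wN by (simp add: mem_flip)
    moreover have "perm (CNOT w ?w) \<delta> = fl \<delta>" if "(w \<in> \<delta>) = v" for \<delta> using that by (simp add: fl_def)
    ultimately show "evo2 [CNOT w ?w] K \<beta> \<gamma> = K (fl \<beta>) (fl \<gamma>)"
      by (cases "(w \<in> \<beta>) = v \<and> (w \<in> \<gamma>) = v") (auto simp: evo2_classical zero wfl simp del: perm.simps)
  qed
  then have K3: "evo2 (q_gates (gentle T)) K0 = evo2 (inverse_gates ?gs) (\<lambda>\<beta> \<gamma>. K (fl \<beta>) (fl \<gamma>))"
    by (simp add: gentle_def w evo2_append K_def evo2_Cons)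
  have inv: "evo2 (inverse_gates ?gs) K = K0"
    unfolding K_def by (rule evo2_inverse_gates) (use gs in \<open>auto simp: gate_ok_def\<close>)
  have K4: "evo2 (q_gates (gentle T)) K0 = (\<lambda>\<beta> \<gamma>. K0 (fl \<beta>) (fl \<gamma>))"
  proof (cases v)
    case True
    have "\<forall>g\<in>set (inverse_gates ?gs). ?w \<notin> set (gate_wires g)"
      using gs by (auto simp: set_inverse_gates gate_ok_def)
    then show ?thesis unfolding K3 fl_def using True by (simp add: fun_eq_iff evo2_flip inv)
  next
    case False
    then show ?thesis unfolding K3 fl_def by (simp add: inv)
  qed
  have garb: "garbage (gentle T) = {?p..<?w}"
    using pN by (auto simp: garbage_def gentle_def q_wires_def)
  have pk: "pick (q_outs (gentle T)) (s \<union> (+) 1 ` t) = pick [?w] s \<union> t" if "s \<subseteq> {..<1}" "t \<subseteq> {..<?p}" for s t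
    using pick_append[of s "[?w]" t "[0..<?p]"] that by (simp add: gentle_def pick_upt)
  have sub: "s \<union> (+) 1 ` t \<subseteq> {..<q_out (gentle T)}" "s' \<union> (+) 1 ` t' \<subseteq> {..<q_out (gentle T)}"
    using s t by auto
  have "ent (run (gentle T) \<rho>) (s \<union> (+) 1 ` t) (s' \<union> (+) 1 ` t')
      = (\<Sum>g\<in>Pow {?p..<?w}. K0 (fl (pick [?w] s \<union> t \<union> g)) (fl (pick [?w] s' \<union> t' \<union> g)))"
    using ent_run[OF gentle_wf[OF T] _ sub, of \<rho>] car unfolding pk[OF s(1) t(1)] pk[OF s(2) t(2)] garb
    by (simp add: K4[unfolded K0_def] K0_def)
  \<comment> \<open>The garbage consists of the ancillas of the test, which are back at zero, so
    only \<open>g = {}\<close> contributes.\<close>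
  also have "\<dots> = (\<Sum>g\<in>Pow {?p..<?w}. of_bool (g = {}) * (of_bool (s = true_bits [v] \<and> s' = true_bits [v]) * ent \<rho> t t'))"
  proof (intro sum.cong refl)
    fix g assume g: "g \<in> Pow {?p..<?w}"
    have "fl (pick [?w] s \<union> t \<union> g) \<subseteq> {..<?p} \<longleftrightarrow> s = true_bits [v] \<and> g = {}"
      and "s = true_bits [v] \<Longrightarrow> g = {} \<Longrightarrow> fl (pick [?w] s \<union> t \<union> g) = t" if "s \<subseteq> {..<1}" "t \<subseteq> {..<?p}" for s t
    proof -
      have s01: "s = {} \<or> s = {0}" using that(1) by auto
      have tb: "true_bits [v] = (if v then {0} else {})" by (auto simp: true_bits_def)
      have "?w \<notin> t" "?w \<notin> g" "g \<inter> {..<?p} = {}" using that(2) g pN by auto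
      then show "fl (pick [?w] s \<union> t \<union> g) \<subseteq> {..<?p} \<longleftrightarrow> s = true_bits [v] \<and> g = {}"
        and "s = true_bits [v] \<Longrightarrow> g = {} \<Longrightarrow> fl (pick [?w] s \<union> t \<union> g) = t"
        using s01 that(2) pN by (auto simp: tb fl_def pick_def flip_def split: if_splits)
    qed
    then show "K0 (fl (pick [?w] s \<union> t \<union> g)) (fl (pick [?w] s' \<union> t' \<union> g))
        = of_bool (g = {}) * (of_bool (s = true_bits [v] \<and> s' = true_bits [v]) * ent \<rho> t t')"
      using s t by (auto simp: K0_def ker_def)
  qed
  also have "\<dots> = of_bool (s = true_bits [v] \<and> s' = true_bits [v]) * ent \<rho> t t'"
    by (rule sum_of_bool_eq) auto
  also have "\<dots> = ent (basis_state [v] \<otimes>\<^sub>q \<rho>) (s \<union> (+) 1 ` t) (s' \<union> (+) 1 ` t')"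
    using ent_tensor[OF basis_state_carrier[of "[v]"] car] s t by (simp add: ent_basis_state)
  finally show "ent (run (gentle T) \<rho>) (s \<union> (+) 1 ` t) (s' \<union> (+) 1 ` t') = ent (basis_state [v] \<otimes>\<^sub>q \<rho>) (s \<union> (+) 1 ` t) (s' \<union> (+) 1 ` t')" .
qed

section \<open>The switching circuit\<close>

text \<open>
  The inputs are a ciphertext of \<open>c\<close> qubits padded to \<open>k\<close> qubits, and \<open>x\<close>. If \<open>x\<close> passes the test as a
  key of the ciphertext and decrypts it to 1, the output is \<open>B' x\<close>, otherwise \<open>B x\<close>.
\<close>

definition switch :: "nat \<Rightarrow> nat \<Rightarrow> nat \<Rightarrow> nat \<Rightarrow> qcircuit \<Rightarrow> qcircuit \<Rightarrow> bcircuit \<Rightarrow> bcircuit \<Rightarrow> qcircuit" where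
  "switch n m c k T D B B' =
     (idc c \<parallel> discard (k - c) \<parallel> idc n) ;; swapc c n ;; (copies 2 n \<parallel> idc c) ;; (idc n \<parallel> gentle T) ;;
     (idc (n + 1) \<parallel> D) ;; swapc n 2 ;; branch n m B B'"

lemma computes_ent:
  assumes "computes Q f" "q_in Q = a" "\<rho> \<in> carrier_mat (2 ^ a) (2 ^ a)" "r \<subseteq> {..<q_out Q}" "c \<subseteq> {..<q_out Q}"
  shows "ent (run Q \<rho>) r c = (\<Sum>xs\<in>bitstrings a.
    of_bool (r = true_bits (f xs) \<and> c = true_bits (f xs)) * ent \<rho> (true_bits xs) (true_bits xs))"
proof -
  have "\<forall>\<rho>\<in>carrier_mat (2 ^ q_in Q) (2 ^ q_in Q). \<forall>r\<subseteq>{..<q_out Q}. \<forall>c\<subseteq>{..<q_out Q}.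
      ent (run Q \<rho>) r c = (\<Sum>xs\<in>bitstrings (q_in Q).
        of_bool (r = true_bits (f xs) \<and> c = true_bits (f xs)) * ent \<rho> (true_bits xs) (true_bits xs))"
    using assms(1) unfolding computes_def by (elim conjE)
  from this[rule_format, of \<rho> r c] show ?thesis using assms(2-) by simp
qed

lemma basis_carrier: "length x = n \<Longrightarrow> basis_state x \<in> carrier_mat (2 ^ n) (2 ^ n)"
  using basis_state_carrier by blast

context
  fixes n m c k :: nat and T D :: qcircuit and B B' :: bcircuit
  assumes T: "q_wf T" "q_in T = n + c" "q_out T = 1"
    and D: "q_wf D" "q_in D = n + c" "q_out D = 1"
    and B: "b_wf n m B" and B': "b_wf n m B'" and ck: "c \<le> k"
begin

lemma switch_simps: "q_in (switch n m c k T D B B') = k + n" "q_out (switch n m c k T D B B') = m"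
  using ck branch_simps[OF B B'] by (simp_all add: switch_def)

lemma branch_wf: "q_wf (branch n m B B')"
  using branch_computes[OF B B'] by (auto simp: computes_def)

lemma copies_wf: "q_wf (copies r j)"
  using copies_computes[of r j] by (simp add: computes_def)

lemma switch_wf: "q_wf (switch n m c k T D B B')"
  unfolding switch_def
  by (intro seq_wf par_wf basic_wf gentle_wf T D branch_wf copies_wf) (simp_all add: T D branch_simps[OF B B'])

lemma switch_size:
  "q_size (switch n m c k T D B B') \<le> 60 * (n + m + c + k + q_size T + q_size D + b_size B + b_size B' + 2)"
proof -
  have "q_size (switch n m c k T D B B') \<le> q_size (idc c \<parallel> discard (k - c) \<parallel> idc n) + q_size (swapc c n)
     + q_size (copies 2 n \<parallel> idc c) + q_size (idc n \<parallel> gentle T) + q_size (idc (n + 1) \<parallel> D) + q_size (swapc n 2) + q_size (branch n m B B')"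
    unfolding switch_def by (rule order_trans[OF seq_size] add_mono order_refl)+
  then show ?thesis
    using gentle_size[of T] branch_simps(3)[OF B B'] by (simp add: par_size copies_size)
qed

text \<open>The test leaves key and ciphertext intact, so the decryption acts on the genuine
  ciphertext and its outcome \<open>d\<close> has the distribution it would have without the test;
  \<open>branch\<close> then measures \<open>d\<close>.\<close>

lemma switch_outcome:
  assumes \<omega>: "preparable c \<omega>" and x: "length x = n" and y: "length y = m"
    and v: "outcome_prob T (basis_state x \<otimes>\<^sub>q \<omega>) [v] = 1"
  shows "outcome_prob (switch n m c k T D B B') ((\<omega> \<otimes>\<^sub>q basis_state (replicate (k - c) False)) \<otimes>\<^sub>q basis_state x) y
    = (\<Sum>d\<in>UNIV. of_bool ((if v \<and> d then b_eval B' x else b_eval B x) = y) * outcome_prob D (basis_state x \<otimes>\<^sub>q \<omega>) [d])"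
proof -
  note [simp] = basis_carrier[OF x] preparable_carrier[OF \<omega>]
  let ?z = "basis_state (replicate (k - c) False)"
  have z: "?z \<in> carrier_mat (2 ^ (k - c)) (2 ^ (k - c))" by (rule basis_carrier) simp
  note wf = seq_wf par_wf basic_wf gentle_wf T D branch_wf copies_wf
  note tc = tensor_carrier
  have xw: "basis_state x \<otimes>\<^sub>q \<omega> \<in> carrier_mat (2 ^ (n + c)) (2 ^ (n + c))" by (intro tc) simp_all
  have dens: "density (n + c) (basis_state x \<otimes>\<^sub>q \<omega>)"
    by (intro preparable_density preparable_tensor preparable_basis_state x \<omega>)
  have v1: "basis_state [v] \<in> carrier_mat (2 ^ 1) (2 ^ 1)" by (rule basis_carrier) simp
  define \<rho>d where "\<rho>d = run D (basis_state x \<otimes>\<^sub>q \<omega>)"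
  have \<rho>d: "\<rho>d \<in> carrier_mat (2 ^ 1) (2 ^ 1)" unfolding \<rho>d_def using run_carrier[of D] D by metis
  have 1: "run (idc c \<parallel> discard (k - c) \<parallel> idc n) ((\<omega> \<otimes>\<^sub>q ?z) \<otimes>\<^sub>q basis_state x) = \<omega> \<otimes>\<^sub>q basis_state x"
    using z by (simp add: run_par tc)
  have 2: "run (swapc c n) (\<omega> \<otimes>\<^sub>q basis_state x) = basis_state x \<otimes>\<^sub>q \<omega>" by simp
  \<comment> \<open>One copy of \<open>x\<close> is the key for testing and decrypting, the other is
    kept as the input of \<open>branch\<close>.\<close>
  have 3: "run (copies 2 n \<parallel> idc c) (basis_state x \<otimes>\<^sub>q \<omega>) = basis_state x \<otimes>\<^sub>q (basis_state x \<otimes>\<^sub>q \<omega>)"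
  proof -
    have "run (copies 2 n) (basis_state x) = basis_state (x @ x)"
      using computes_maps[OF copies_computes[of 2 n]] x by (simp add: maps_def bitstrings_def numeral_eq_Suc)
    then show ?thesis using run_par[OF copies_wf[of 2 n] basic_wf(1)[of c], of "basis_state x" \<omega>]
      by (simp add: basis_state_append tensor_assoc)
  qed
  have 4: "run (idc n \<parallel> gentle T) (basis_state x \<otimes>\<^sub>q (basis_state x \<otimes>\<^sub>q \<omega>)) = basis_state x \<otimes>\<^sub>q basis_state [v] \<otimes>\<^sub>q (basis_state x \<otimes>\<^sub>q \<omega>)"
    using run_gentle[OF T(1,3) _ v] dens T xw by (simp add: run_par gentle_wf tensor_assoc)
  have 5: "run (idc (n + 1) \<parallel> D) (basis_state x \<otimes>\<^sub>q basis_state [v] \<otimes>\<^sub>q (basis_state x \<otimes>\<^sub>q \<omega>)) = basis_state x \<otimes>\<^sub>q (basis_state [v] \<otimes>\<^sub>q \<rho>d)"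
    using tc[OF basis_carrier[OF x] v1] D xw
    by (subst run_par) (simp_all add: \<rho>d_def tensor_assoc)
  have c2: "basis_state [v] \<otimes>\<^sub>q \<rho>d \<in> carrier_mat (2 ^ 2) (2 ^ 2)" using tc[OF v1 \<rho>d] by (simp add: numeral_eq_Suc)
  have 6: "run (swapc n 2) (basis_state x \<otimes>\<^sub>q (basis_state [v] \<otimes>\<^sub>q \<rho>d)) = basis_state [v] \<otimes>\<^sub>q \<rho>d \<otimes>\<^sub>q basis_state x"
    by (rule run_swapc[OF _ c2]) simp
  have all: "run (switch n m c k T D B B') ((\<omega> \<otimes>\<^sub>q ?z) \<otimes>\<^sub>q basis_state x) = run (branch n m B B') (basis_state [v] \<otimes>\<^sub>q \<rho>d \<otimes>\<^sub>q basis_state x)"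
  proof -
    have car: "\<omega> \<otimes>\<^sub>q ?z \<otimes>\<^sub>q basis_state x \<in> carrier_mat (2 ^ (c + (k - c) + n)) (2 ^ (c + (k - c) + n))"
      by (intro tc z) simp_all
    show ?thesis unfolding switch_def
      using car by (simp add: run_seq wf T D branch_simps[OF B B'] 1 2 3 4 5[simplified] 6 del: run_swapc)
  qed
  obtain f where f: "computes (branch n m B B') f"
      "\<And>t d x. length x = n \<Longrightarrow> f ([t, d] @ x) = (if t \<and> d then b_eval B' x else b_eval B x)"
    using branch_computes[OF B B'] by blast
  let ?M = "basis_state [v] \<otimes>\<^sub>q \<rho>d \<otimes>\<^sub>q basis_state x"
  have M: "?M \<in> carrier_mat (2 ^ (n + 2)) (2 ^ (n + 2))" using tc[OF c2 basis_carrier[OF x]] by (simp add: add.commute)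
  have fl: "length (f xs) = m" if "xs \<in> bitstrings (n + 2)" for xs
    using f(1) that by (simp add: computes_def branch_simps[OF B B'])
  \<comment> \<open>By \<open>computes_ent\<close> only the diagonal matters. It is concentrated on
    \<open>t = v\<close> and \<open>z = x\<close>, with the probabilities of the decryption outcomes
    as weights.\<close>
  have diag: "ent ?M (true_bits ([t, d] @ z)) (true_bits ([t, d] @ z)) = of_bool (t = v \<and> z = x) * ent \<rho>d (true_bits [d]) (true_bits [d])"
    if z: "length z = n" for t d z
  proof -
    have b1: "true_bits [b] \<subseteq> {..<1}" for b using true_bits_subset[of "[b]"] by simp
    have b2: "true_bits [t] \<union> (+) 1 ` true_bits [d] \<subseteq> {..<2}" using b1[of t] b1[of d] by auto
    have zn: "true_bits z \<subseteq> {..<n}" using true_bits_subset[of z] z by simp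
    have "[t, d] @ z = ([t] @ [d]) @ z" by simp
    then have tb: "true_bits ([t, d] @ z) = true_bits [t] \<union> (+) 1 ` true_bits [d] \<union> (+) 2 ` true_bits z"
      by (simp only: true_bits_append) simp
    have "ent ?M (true_bits ([t, d] @ z)) (true_bits ([t, d] @ z))
        = ent (basis_state [v]) (true_bits [t]) (true_bits [t]) * ent \<rho>d (true_bits [d]) (true_bits [d]) * ent (basis_state x) (true_bits z) (true_bits z)"
      unfolding tb ent_tensor[OF c2 basis_carrier[OF x] b2 b2 zn zn] ent_tensor[OF v1 \<rho>d b1 b1 b1 b1] ..
    then show ?thesis using b1 zn x z by (simp add: ent_basis_state true_bits_inj)
  qed
  have "outcome_prob (switch n m c k T D B B') ((\<omega> \<otimes>\<^sub>q ?z) \<otimes>\<^sub>q basis_state x) y = Re (ent (run (branch n m B B') ?M) (true_bits y) (true_bits y))"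
    by (simp add: outcome_prob_ent all)
  also have "ent (run (branch n m B B') ?M) (true_bits y) (true_bits y)
      = (\<Sum>xs\<in>bitstrings (n + 2). of_bool (true_bits y = true_bits (f xs)) * ent ?M (true_bits xs) (true_bits xs))"
    using computes_ent[OF f(1) branch_simps(1)[OF B B'] M, of "true_bits y" "true_bits y"] true_bits_subset[of y] y
    unfolding branch_simps(2)[OF B B'] by simp
  also have "\<dots> = (\<Sum>xs\<in>(\<lambda>d. [v, d] @ x) ` UNIV. of_bool (true_bits y = true_bits (f xs)) * ent ?M (true_bits xs) (true_bits xs))"
  proof (rule sum.mono_neutral_right)
    show "(\<lambda>d. [v, d] @ x) ` UNIV \<subseteq> bitstrings (n + 2)" using x by (auto simp: bitstrings_def)
    show "\<forall>xs\<in>bitstrings (n + 2) - (\<lambda>d. [v, d] @ x) ` UNIV. of_bool (true_bits y = true_bits (f xs)) * ent ?M (true_bits xs) (true_bits xs) = 0"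
    proof
      fix xs assume xs: "xs \<in> bitstrings (n + 2) - (\<lambda>d. [v, d] @ x) ` UNIV"
      then obtain t d z where tdz: "xs = [t, d] @ z" "length z = n"
        by (auto simp: bitstrings_def length_Suc_conv)
      then have "\<not> (t = v \<and> z = x)" using xs by auto
      then show "of_bool (true_bits y = true_bits (f xs)) * ent ?M (true_bits xs) (true_bits xs) = 0"
        using diag[OF tdz(2), of t d] tdz(1) by simp
    qed
  qed simp
  also have "\<dots> = (\<Sum>d\<in>UNIV. of_bool (true_bits y = true_bits (f ([v, d] @ x))) * ent ?M (true_bits ([v, d] @ x)) (true_bits ([v, d] @ x)))"
    by (subst sum.reindex) (auto simp: inj_on_def)
  also have "\<dots> = (\<Sum>d\<in>UNIV. of_bool ((if v \<and> d then b_eval B' x else b_eval B x) = y) * ent \<rho>d (true_bits [d]) (true_bits [d]))"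
  proof (intro sum.cong refl)
    fix d
    have "true_bits y = true_bits (f ([v, d] @ x)) \<longleftrightarrow> f ([v, d] @ x) = y"
      using true_bits_inj[of y "f ([v, d] @ x)"] fl[of "[v, d] @ x"] x y by (auto simp: bitstrings_def)
    then show "of_bool (true_bits y = true_bits (f ([v, d] @ x))) * ent ?M (true_bits ([v, d] @ x)) (true_bits ([v, d] @ x))
      = of_bool ((if v \<and> d then b_eval B' x else b_eval B x) = y) * ent \<rho>d (true_bits [d]) (true_bits [d])"
      by (simp only: diag[OF x] f(2)[OF x]) simp
  qed
  finally show ?thesis
    by (simp add: outcome_prob_ent \<rho>d_def Re_sum del: UNIV_bool)
qed

end

section \<open>Both guesses as one measurement\<close>

text \<open>The inputs are a state on \<open>kB + kC\<close> qubits, then the classical inputs of \<open>P\<close> and of \<open>Q\<close>.\<close>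

definition joint :: "nat \<Rightarrow> nat \<Rightarrow> nat \<Rightarrow> qcircuit \<Rightarrow> qcircuit \<Rightarrow> bool \<Rightarrow> qcircuit" where
  "joint n kB kC P Q b = (idc kB \<parallel> swapc kC (n + n)) ;; (swapc kB n \<parallel> idc (n + kC)) ;; (P \<parallel> Q) ;; b_to_q 0 (both_bc b)"

lemma sum_lessThan_mult:
  fixes F :: "nat \<Rightarrow> 'a :: comm_monoid_add"
  shows "(\<Sum>p<a * b. F p) = (\<Sum>i<a. \<Sum>j<b. F (i + a * j))"
proof (cases "a = 0")
  case False
  have "(\<Sum>p<a * b. F p) = (\<Sum>(i, j)\<in>{..<a} \<times> {..<b}. F (i + a * j))"
  proof (rule sum.reindex_bij_witness[of _ "\<lambda>(i, j). i + a * j" "\<lambda>p. (p mod a, p div a)"])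
    fix ij assume "ij \<in> {..<a} \<times> {..<b}"
    then obtain i j where ij: "ij = (i, j)" "i < a" "j < b" by auto
    then have "a * Suc j \<le> a * b" by (intro mult_le_mono2) simp
    then have "i + a * j < a * b" using ij(2) by (simp add: algebra_simps)
    then show "(case ij of (i, j) \<Rightarrow> i + a * j) \<in> {..<a * b}" using ij by simp
  qed (use False in \<open>auto simp: less_mult_imp_div_less mult.commute\<close>)
  then show ?thesis by (simp add: sum.cartesian_product)
qed simp

lemma matrix_unit_tensor:
  assumes "i < 2 ^ p" "i' < 2 ^ p"
  shows "matrix_unit p i i' \<otimes>\<^sub>q matrix_unit q j j' = matrix_unit (p + q) (i + 2 ^ p * j) (i' + 2 ^ p * j')"
proof -
  have eq: "r = i + 2 ^ p * j \<longleftrightarrow> (r mod 2 ^ p = i \<and> r div 2 ^ p = j)" if "i < 2 ^ p" for r i j :: nat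
    using that by auto
  show ?thesis
  proof (rule eq_matI)
    fix r c assume "r < dim_row (matrix_unit (p + q) (i + 2 ^ p * j) (i' + 2 ^ p * j'))"
      "c < dim_col (matrix_unit (p + q) (i + 2 ^ p * j) (i' + 2 ^ p * j'))"
    then have rc: "r < 2 ^ p * 2 ^ q" "c < 2 ^ p * 2 ^ q" by (simp_all add: matrix_unit_def power_add)
    then have d: "r div 2 ^ p < 2 ^ q" "c div 2 ^ p < 2 ^ q" by (simp_all add: less_mult_imp_div_less mult.commute)
    have "(matrix_unit p i i' \<otimes>\<^sub>q matrix_unit q j j') $$ (r, c)
        = of_bool (r mod 2 ^ p = i \<and> c mod 2 ^ p = i') * of_bool (r div 2 ^ p = j \<and> c div 2 ^ p = j')"
      using rc d by (simp add: tensor_def matrix_unit_def)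
    also have "\<dots> = of_bool (r = i + 2 ^ p * j \<and> c = i' + 2 ^ p * j')"
      unfolding eq[OF assms(1)] eq[OF assms(2)] by auto
    also have "\<dots> = matrix_unit (p + q) (i + 2 ^ p * j) (i' + 2 ^ p * j') $$ (r, c)"
      using rc by (simp add: matrix_unit_def power_add)
    finally show "(matrix_unit p i i' \<otimes>\<^sub>q matrix_unit q j j') $$ (r, c) = matrix_unit (p + q) (i + 2 ^ p * j) (i' + 2 ^ p * j') $$ (r, c)" .
  qed (simp_all add: tensor_def matrix_unit_def power_add)
qed

text \<open>Only the left factor is expanded into matrix units; the right one will hold the
  classical inputs.\<close>

lemma run_tensor_expand:
  assumes Q: "q_wf Q" "q_in Q = p + q" and \<sigma>: "\<sigma> \<in> carrier_mat (2 ^ p) (2 ^ p)" and X: "X \<in> carrier_mat (2 ^ q) (2 ^ q)"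
    and ij: "i < 2 ^ q_out Q" "j < 2 ^ q_out Q"
  shows "run Q (\<sigma> \<otimes>\<^sub>q X) $$ (i, j) = (\<Sum>(a, b)\<in>{..<2 ^ p} \<times> {..<2 ^ p}. \<sigma> $$ (a, b) * run Q (matrix_unit p a b \<otimes>\<^sub>q X) $$ (i, j))"
proof -
  have "run Q (\<sigma> \<otimes>\<^sub>q X) $$ (i, j) = (\<Sum>ab\<in>{..<2 ^ p} \<times> {..<2 ^ p}. \<sigma> $$ ab * run Q (matrix_unit p (fst ab) (snd ab) \<otimes>\<^sub>q X) $$ (i, j))"
  proof (rule run_linear[OF Q(1) _ _ _ ij])
    fix r c :: nat assume rc: "r < 2 ^ q_in Q" "c < 2 ^ q_in Q"
    have mu: "(matrix_unit p a b \<otimes>\<^sub>q X) $$ (r, c) = of_bool (a = r mod 2 ^ p \<and> b = c mod 2 ^ p) * X $$ (r div 2 ^ p, c div 2 ^ p)" for a b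
      using rc Q X by (auto simp: tensor_def matrix_unit_def power_add)
    have "(\<Sum>ab\<in>{..<2 ^ p} \<times> {..<2 ^ p}. \<sigma> $$ ab * (matrix_unit p (fst ab) (snd ab) \<otimes>\<^sub>q X) $$ (r, c))
        = (\<Sum>ab\<in>{..<2 ^ p} \<times> {..<2 ^ p}. if ab = (r mod 2 ^ p, c mod 2 ^ p) then \<sigma> $$ ab * X $$ (r div 2 ^ p, c div 2 ^ p) else 0)"
      by (intro sum.cong refl) (auto simp: mu prod_eq_iff)
    also have "\<dots> = \<sigma> $$ (r mod 2 ^ p, c mod 2 ^ p) * X $$ (r div 2 ^ p, c div 2 ^ p)"
      by (subst sum.delta) auto
    also have "\<dots> = (\<sigma> \<otimes>\<^sub>q X) $$ (r, c)"
      using rc Q \<sigma> X by (auto simp: tensor_def power_add)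
    finally show "(\<sigma> \<otimes>\<^sub>q X) $$ (r, c) = (\<Sum>ab\<in>{..<2 ^ p} \<times> {..<2 ^ p}. \<sigma> $$ ab * (matrix_unit p (fst ab) (snd ab) \<otimes>\<^sub>q X) $$ (r, c))" ..
  qed (use Q \<sigma> X in \<open>auto intro!: tensor_carrier\<close>)
  then show ?thesis by (simp add: case_prod_unfold)
qed

context
  fixes n kB kC :: nat and P Q :: qcircuit
  assumes P: "q_wf P" "q_in P = n + kB" "q_out P = 1" and Q: "q_wf Q" "q_in Q = n + kC" "q_out Q = 1"
begin

lemma joint_simps:
  "q_in (joint n kB kC P Q b) = (kB + kC) + (n + n)" "q_out (joint n kB kC P Q b) = 1" "q_wf (joint n kB kC P Q b)"
  "q_size (joint n kB kC P Q b) \<le> 20 * (n + kB + kC + q_size P + q_size Q + 2)"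
proof -
  have b: "b_in (both_bc b) = 2" "length (b_outs (both_bc b)) = 1" "b_size (both_bc b) \<le> 4"
    by (auto simp: both_bc_def b_size_def)
  have bw: "q_wf (b_to_q 0 (both_bc b))" using b_to_q_computes[OF both_bc_wf] by (simp add: computes_def)
  show "q_in (joint n kB kC P Q b) = (kB + kC) + (n + n)" "q_out (joint n kB kC P Q b) = 1"
    by (simp_all add: joint_def b)
  show "q_wf (joint n kB kC P Q b)"
    unfolding joint_def by (intro seq_wf par_wf basic_wf P Q bw) (simp_all add: P Q b)
  have "q_size (joint n kB kC P Q b) \<le> q_size (idc kB \<parallel> swapc kC (n + n)) + q_size (swapc kB n \<parallel> idc (n + kC)) + q_size (P \<parallel> Q) + q_size (b_to_q 0 (both_bc b))"
    unfolding joint_def by (rule order_trans[OF seq_size] add_mono order_refl)+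
  then show "q_size (joint n kB kC P Q b) \<le> 20 * (n + kB + kC + q_size P + q_size Q + 2)"
    using b_to_q_size[of 0 "both_bc b"] b by (simp add: par_size)
qed

text \<open>For arbitrary matrices \<open>A\<close> and \<open>A'\<close>, because it is applied to
  matrix units, which need not be states.\<close>

lemma run_joint_product:
  assumes A: "A \<in> carrier_mat (2 ^ kB) (2 ^ kB)" and A': "A' \<in> carrier_mat (2 ^ kC) (2 ^ kC)" and x: "length x = n" "length x' = n"
  shows "run (joint n kB kC P Q b) ((A \<otimes>\<^sub>q A') \<otimes>\<^sub>q (basis_state x \<otimes>\<^sub>q basis_state x')) $$ (idx [True], idx [True])
    = run P (basis_state x \<otimes>\<^sub>q A) $$ (idx [b], idx [b]) * run Q (basis_state x' \<otimes>\<^sub>q A') $$ (idx [b], idx [b])"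
proof -
  note xc = basis_carrier[OF x(1)] basis_carrier[OF x(2)]
  note tc = tensor_carrier
  have b: "b_in (both_bc b) = 2" "length (b_outs (both_bc b)) = 1" by (auto simp: both_bc_def)
  have bc: "computes (b_to_q 0 (both_bc b)) (b_eval (both_bc b))" using b_to_q_computes[OF both_bc_wf, of 0] by simp
  have bw: "q_wf (b_to_q 0 (both_bc b))" using bc by (simp add: computes_def)
  have xx: "basis_state x \<otimes>\<^sub>q basis_state x' \<in> carrier_mat (2 ^ (n + n)) (2 ^ (n + n))" by (intro tc xc)
  have RP: "run P M \<in> carrier_mat (2 ^ 1) (2 ^ 1)" and RQ: "run Q M \<in> carrier_mat (2 ^ 1) (2 ^ 1)" for M
    using run_carrier[of P M] run_carrier[of Q M] P Q by simp_all
  have "run (idc kB \<parallel> swapc kC (n + n)) (A \<otimes>\<^sub>q (A' \<otimes>\<^sub>q (basis_state x \<otimes>\<^sub>q basis_state x')))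
      = A \<otimes>\<^sub>q ((basis_state x \<otimes>\<^sub>q basis_state x') \<otimes>\<^sub>q A')"
    using A A' xx by (subst run_par) (auto intro!: tc)
  then have 1: "run (idc kB \<parallel> swapc kC (n + n)) ((A \<otimes>\<^sub>q A') \<otimes>\<^sub>q (basis_state x \<otimes>\<^sub>q basis_state x'))
      = (A \<otimes>\<^sub>q basis_state x) \<otimes>\<^sub>q (basis_state x' \<otimes>\<^sub>q A')"
    by (simp add: tensor_assoc)
  have 2: "run (swapc kB n \<parallel> idc (n + kC)) ((A \<otimes>\<^sub>q basis_state x) \<otimes>\<^sub>q (basis_state x' \<otimes>\<^sub>q A'))
      = (basis_state x \<otimes>\<^sub>q A) \<otimes>\<^sub>q (basis_state x' \<otimes>\<^sub>q A')"
    using A A' xc by (subst run_par) (auto intro!: tc)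
  have 3: "run (P \<parallel> Q) ((basis_state x \<otimes>\<^sub>q A) \<otimes>\<^sub>q (basis_state x' \<otimes>\<^sub>q A')) = run P (basis_state x \<otimes>\<^sub>q A) \<otimes>\<^sub>q run Q (basis_state x' \<otimes>\<^sub>q A')"
    by (rule run_par[OF P(1) Q(1)]) (use P Q A A' xc in \<open>auto intro!: tc\<close>)
  let ?M = "run P (basis_state x \<otimes>\<^sub>q A) \<otimes>\<^sub>q run Q (basis_state x' \<otimes>\<^sub>q A')"
  have M: "?M \<in> carrier_mat (2 ^ 2) (2 ^ 2)" using tc[OF RP RQ] by (simp add: numeral_eq_Suc)
  have car: "(A \<otimes>\<^sub>q A') \<otimes>\<^sub>q (basis_state x \<otimes>\<^sub>q basis_state x') \<in> carrier_mat (2 ^ (kB + kC + (n + n))) (2 ^ (kB + kC + (n + n)))"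
    by (intro tc A A' xc)
  have all: "run (joint n kB kC P Q b) ((A \<otimes>\<^sub>q A') \<otimes>\<^sub>q (basis_state x \<otimes>\<^sub>q basis_state x')) = run (b_to_q 0 (both_bc b)) ?M"
    unfolding joint_def using car
    by (simp add: run_seq seq_wf par_wf P Q bw b 1 2 3 add.assoc)
  have t1: "true_bits [True] \<subseteq> {..<1}" "true_bits [p] \<subseteq> {..<1}" for p using true_bits_subset[of "[True]"] true_bits_subset[of "[p]"] by simp_all
  have bits2: "bitstrings 2 = (\<lambda>(p, q). [p, q]) ` (UNIV \<times> UNIV)"
    by (auto simp: bitstrings_def length_Suc_conv numeral_eq_Suc image_iff)
  have "run (b_to_q 0 (both_bc b)) ?M $$ (idx [True], idx [True]) = ent (run (b_to_q 0 (both_bc b)) ?M) (true_bits [True]) (true_bits [True])"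
    by (simp add: ent_def idx_eq)
  also have "\<dots> = (\<Sum>xs\<in>bitstrings 2. of_bool (true_bits [True] = true_bits (b_eval (both_bc b) xs)) * ent ?M (true_bits xs) (true_bits xs))"
    using computes_ent[OF bc _ M, of "true_bits [True]" "true_bits [True]"] t1(1) by (simp only: b_to_q_simps b conj_absorb add_0)
  also have "\<dots> = (\<Sum>xs\<in>bitstrings 2. of_bool (xs = [b, b]) * ent ?M (true_bits xs) (true_bits xs))"
  proof (intro sum.cong refl)
    fix xs assume "xs \<in> bitstrings 2"
    then obtain p q where "xs = [p, q]" by (auto simp: bits2)
    then show "of_bool (true_bits [True] = true_bits (b_eval (both_bc b) xs)) * ent ?M (true_bits xs) (true_bits xs)
        = of_bool (xs = [b, b]) * ent ?M (true_bits xs) (true_bits xs)"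
      using true_bits_inj[of "[True]" "[p = b \<and> q = b]"] by (auto simp: both_bc_eval)
  qed
  also have "\<dots> = ent ?M (true_bits [b, b]) (true_bits [b, b])"
    by (rule sum_of_bool_eq) (simp_all, simp add: bitstrings_def)
  also have "true_bits [b, b] = true_bits [b] \<union> (+) 1 ` true_bits [b]"
    using true_bits_append[of "[b]" "[b]"] by simp
  also have "ent ?M (true_bits [b] \<union> (+) 1 ` true_bits [b]) (true_bits [b] \<union> (+) 1 ` true_bits [b])
      = ent (run P (basis_state x \<otimes>\<^sub>q A)) (true_bits [b]) (true_bits [b]) * ent (run Q (basis_state x' \<otimes>\<^sub>q A')) (true_bits [b]) (true_bits [b])"
    by (rule ent_tensor[OF RP RQ]) (use t1(2) in auto)
  finally show ?thesis unfolding all by (simp add: ent_def idx_eq)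
qed

text \<open>\<open>both_output_prob\<close> expands the state into products of matrix units, so by
  linearity of \<open>run\<close> agreement on products is enough. This turns the formula into an
  acceptance probability.\<close>

lemma joint_outcome:
  assumes \<sigma>: "\<sigma> \<in> carrier_mat (2 ^ (kB + kC)) (2 ^ (kB + kC))" and x: "length x = n" "length x' = n"
  shows "outcome_prob (joint n kB kC P Q b) (\<sigma> \<otimes>\<^sub>q (basis_state x \<otimes>\<^sub>q basis_state x')) [True]
    = both_output_prob P Q kB kC x x' \<sigma> b"
proof -
  let ?J = "joint n kB kC P Q b" and ?X = "basis_state x \<otimes>\<^sub>q basis_state x'"
  let ?p = "\<lambda>i i'. run P (basis_state x \<otimes>\<^sub>q matrix_unit kB i i') $$ (idx [b], idx [b])"
  let ?q = "\<lambda>j j'. run Q (basis_state x' \<otimes>\<^sub>q matrix_unit kC j j') $$ (idx [b], idx [b])"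
  have X: "?X \<in> carrier_mat (2 ^ (n + n)) (2 ^ (n + n))" by (intro tensor_carrier basis_carrier x)
  have i1: "idx [True] < 2 ^ q_out ?J" using idx_less[of "[True]"] joint_simps(2) by simp
  have "run ?J (\<sigma> \<otimes>\<^sub>q ?X) $$ (idx [True], idx [True])
      = (\<Sum>(p, p')\<in>{..<2 ^ (kB + kC)} \<times> {..<2 ^ (kB + kC)}. \<sigma> $$ (p, p') * run ?J (matrix_unit (kB + kC) p p' \<otimes>\<^sub>q ?X) $$ (idx [True], idx [True]))"
    by (rule run_tensor_expand[OF joint_simps(3,1) \<sigma> X i1 i1])
  also have "\<dots> = (\<Sum>p<2 ^ kB * 2 ^ kC. \<Sum>p'<2 ^ kB * 2 ^ kC. \<sigma> $$ (p, p') * run ?J (matrix_unit (kB + kC) p p' \<otimes>\<^sub>q ?X) $$ (idx [True], idx [True]))"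
    by (simp add: sum.cartesian_product power_add)
  also have "\<dots> = (\<Sum>i<2 ^ kB. \<Sum>j<2 ^ kC. \<Sum>i'<2 ^ kB. \<Sum>j'<2 ^ kC. \<sigma> $$ (i + 2 ^ kB * j, i' + 2 ^ kB * j')
      * run ?J (matrix_unit (kB + kC) (i + 2 ^ kB * j) (i' + 2 ^ kB * j') \<otimes>\<^sub>q ?X) $$ (idx [True], idx [True]))"
    unfolding sum_lessThan_mult ..
  also have "\<dots> = (\<Sum>i<2 ^ kB. \<Sum>j<2 ^ kC. \<Sum>i'<2 ^ kB. \<Sum>j'<2 ^ kC. \<sigma> $$ (i + 2 ^ kB * j, i' + 2 ^ kB * j') * ?p i i' * ?q j j')"
  proof (intro sum.cong refl)
    fix i j i' j' :: nat assume "i \<in> {..<2 ^ kB}" "i' \<in> {..<2 ^ kB}"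
    then have m: "matrix_unit (kB + kC) (i + 2 ^ kB * j) (i' + 2 ^ kB * j') = matrix_unit kB i i' \<otimes>\<^sub>q matrix_unit kC j j'"
      by (simp add: matrix_unit_tensor)
    show "\<sigma> $$ (i + 2 ^ kB * j, i' + 2 ^ kB * j') * run ?J (matrix_unit (kB + kC) (i + 2 ^ kB * j) (i' + 2 ^ kB * j') \<otimes>\<^sub>q ?X) $$ (idx [True], idx [True])
      = \<sigma> $$ (i + 2 ^ kB * j, i' + 2 ^ kB * j') * ?p i i' * ?q j j'"
      unfolding m run_joint_product[OF matrix_unit_carrier matrix_unit_carrier x] by (simp only: mult.assoc)
  qed
  also have "\<dots> = (\<Sum>i<2 ^ kB. \<Sum>i'<2 ^ kB. \<Sum>j<2 ^ kC. \<Sum>j'<2 ^ kC. \<sigma> $$ (i + 2 ^ kB * j, i' + 2 ^ kB * j') * ?p i i' * ?q j j')"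
    by (rule sum.cong[OF refl], rule sum.swap)
  finally show ?thesis by (simp add: outcome_prob_def both_output_prob_def)
qed

end

section \<open>Polynomial bounds and uniformity\<close>

text \<open>With base \<open>l + 2\<close> a single exponent absorbs constants and factors of 2, so
  sums and products become immediate.\<close>

lemma poly_bounded_iff: "poly_bounded f \<longleftrightarrow> (\<exists>c. \<forall>l. f l \<le> (l + 2) ^ c)"
proof
  assume "poly_bounded f"
  then obtain c where c: "\<And>l. f l \<le> l ^ c + c" by (auto simp: poly_bounded_def)
  have "f l \<le> (l + 2) ^ Suc c" for l
  proof -
    have "l ^ c \<le> (l + 2) ^ c" by (intro power_mono) auto
    moreover have "c \<le> 2 ^ c" by (simp add: less_imp_le)
    moreover have "(2::nat) ^ c \<le> (l + 2) ^ c" by (intro power_mono) auto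
    ultimately have "f l \<le> 2 * (l + 2) ^ c" using c[of l] by linarith
    also have "\<dots> \<le> (l + 2) ^ Suc c" by simp
    finally show ?thesis .
  qed
  then show "\<exists>c. \<forall>l. f l \<le> (l + 2) ^ c" by blast
next
  assume "\<exists>c. \<forall>l. f l \<le> (l + 2) ^ c"
  then obtain c where c: "\<And>l. f l \<le> (l + 2) ^ c" by auto
  \<comment> \<open>The summand \<open>3 ^ c\<close> covers \<open>l < 2\<close>. For larger
    \<open>l\<close> the inequality \<open>l + 2 \<le> l ^ 2\<close> doubles the exponent.\<close>
  have "f l \<le> l ^ (2 * c + 3 ^ c) + (2 * c + 3 ^ c)" for l
  proof (cases "l < 2")
    case True
    then have "(l + 2) ^ c \<le> 3 ^ c" by (intro power_mono) auto
    then show ?thesis using c[of l] by linarith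
  next
    case False
    then have "2 * l \<le> l * l" by (intro mult_le_mono1) simp
    then have "l + 2 \<le> l ^ 2" using False unfolding power2_eq_square by linarith
    then have "(l + 2) ^ c \<le> l ^ (2 * c)" by (simp add: power_mono power_mult)
    also have "\<dots> \<le> l ^ (2 * c + 3 ^ c)" using False by (intro power_increasing) auto
    finally show ?thesis using c[of l] by linarith
  qed
  then show "poly_bounded f" unfolding poly_bounded_def by blast
qed

lemma poly_bounded_mono: "poly_bounded f \<Longrightarrow> (\<And>l. g l \<le> f l) \<Longrightarrow> poly_bounded g"
  unfolding poly_bounded_iff by (meson order_trans)

lemma poly_bounded_const: "poly_bounded (\<lambda>_. c)"
  unfolding poly_bounded_def by (intro exI[of _ c]) simp

lemma poly_bounded_id: "poly_bounded (\<lambda>l. l)"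
  unfolding poly_bounded_def by (intro exI[of _ 1]) simp

lemma poly_bounded_add:
  assumes "poly_bounded f" "poly_bounded g"
  shows "poly_bounded (\<lambda>l. f l + g l)"
proof -
  obtain c d where cd: "\<And>l. f l \<le> (l + 2) ^ c" "\<And>l. g l \<le> (l + 2) ^ d" using assms by (auto simp: poly_bounded_iff)
  have "f l + g l \<le> (l + 2) ^ Suc (c + d)" for l
  proof -
    have "(l + 2) ^ c \<le> (l + 2) ^ (c + d)" "(l + 2) ^ d \<le> (l + 2) ^ (c + d)" by (auto intro: power_increasing)
    then have "f l + g l \<le> 2 * (l + 2) ^ (c + d)" using cd(1)[of l] cd(2)[of l] by linarith
    also have "\<dots> \<le> (l + 2) ^ Suc (c + d)" by simp
    finally show ?thesis .
  qed
  then show ?thesis unfolding poly_bounded_iff by blast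
qed

lemma poly_bounded_mult:
  assumes "poly_bounded f" "poly_bounded g"
  shows "poly_bounded (\<lambda>l. f l * g l)"
proof -
  obtain c d where cd: "\<And>l. f l \<le> (l + 2) ^ c" "\<And>l. g l \<le> (l + 2) ^ d" using assms by (auto simp: poly_bounded_iff)
  have "f l * g l \<le> (l + 2) ^ (c + d)" for l
    unfolding power_add by (intro mult_le_mono cd)
  then show ?thesis unfolding poly_bounded_iff by blast
qed

lemma poly_bounded_power: "poly_bounded f \<Longrightarrow> poly_bounded (\<lambda>l. f l ^ c)"
  by (induction c) (simp_all add: poly_bounded_const poly_bounded_mult)

lemma poly_bounded_compose:
  assumes "poly_bounded f" "poly_bounded g"
  shows "poly_bounded (\<lambda>l. f (g l))"
proof -
  obtain c where c: "\<And>l. f l \<le> l ^ c + c" using assms(1) by (auto simp: poly_bounded_def)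
  show ?thesis
    by (rule poly_bounded_mono[OF poly_bounded_add[OF poly_bounded_power[OF assms(2), of c] poly_bounded_const[of c]]])
       (rule c)
qed

lemmas poly_bounded_intros = poly_bounded_const poly_bounded_id poly_bounded_add poly_bounded_mult poly_bounded_power

lemma length_enc_nat [simp]: "length (enc_nat n) = n + 1"
  by (simp add: enc_nat_def)

lemma length_enc_list_le:
  assumes "\<And>x. x \<in> set xs \<Longrightarrow> length (e x) \<le> b"
  shows "length (enc_list e xs) \<le> length xs + 1 + length xs * b"
  using length_concat_le[of xs e b] assms by (simp add: enc_list_def)

text \<open>Numbers are written in unary: a gate costs at most 5 bits for its tag plus three times
  the number of wires, so the total is quadratic.\<close>

lemma length_enc_qcircuit:
  assumes "q_wf Q"
  shows "length (enc_qcircuit Q) \<le> 8 * (q_size Q + 1) ^ 2"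
proof -
  let ?N = "q_wires Q" and ?G = "length (q_gates Q)" and ?O = "q_out Q" and ?s = "q_size Q"
  have g: "length (enc_gate g) \<le> 5 + 3 * ?N" if "g \<in> set (q_gates Q)" for g
  proof -
    have "\<forall>w\<in>set (gate_wires g). w < ?N" using assms that by (auto simp: q_wf_def)
    then show ?thesis by (cases g) auto
  qed
  have o: "length (enc_nat w) \<le> ?N" if "w \<in> set (q_outs Q)" for w
    using assms that by (auto simp: q_wf_def)
  have "length (enc_qcircuit Q) = length (enc_nat (q_in Q)) + length (enc_nat (q_anc Q)) + length (enc_list enc_gate (q_gates Q)) + length (enc_list enc_nat (q_outs Q))"
    by (cases Q) (simp del: length_enc_nat)
  also have "\<dots> \<le> ?N + 2 + (?G + 1 + ?G * (5 + 3 * ?N)) + (?O + 1 + ?O * ?N)"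
    using length_enc_list_le[of "q_gates Q" enc_gate, OF g] length_enc_list_le[of "q_outs Q" enc_nat, OF o]
    by (simp add: q_wires_def)
  also have "\<dots> \<le> ?s + 2 + (?s + 1 + ?s * (5 + 3 * ?s)) + (?s + 1 + ?s * ?s)"
    by (intro add_mono mult_le_mono order_refl) (simp_all add: q_size_def)
  also have "\<dots> \<le> 8 * (?s + 1) ^ 2" by (simp add: power2_eq_square algebra_simps)
  finally show ?thesis .
qed

section \<open>Negligible functions and change of the security parameter\<close>

lemma eventually_le_inverse_power_Suc:
  assumes "c > 0"
  shows "\<forall>\<^sub>F l in sequentially. c * (1 / real l ^ Suc d) \<le> 1 / real l ^ d"
proof -
  have "\<forall>\<^sub>F l in sequentially. real l \<ge> c" by (rule eventually_sequentiallyI[of "nat \<lceil>c\<rceil>"]) linarith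
  moreover have "\<forall>\<^sub>F l in sequentially. l > 0" by (rule eventually_gt_at_top)
  ultimately show ?thesis
    by eventually_elim (simp add: field_simps mult_right_mono)
qed

lemma negligibleD: "negligible \<epsilon> \<Longrightarrow> \<forall>\<^sub>F l in sequentially. \<bar>\<epsilon> l\<bar> \<le> 1 / real l ^ c"
  by (simp add: negligible_def)

lemma negligible_0: "negligible (\<lambda>_. 0)"
  by (simp add: negligible_def)

text \<open>Negligibility at exponent \<open>2 * c\<close> gives exponent \<open>c\<close> after
  taking the root.\<close>

lemma negligible_sqrt:
  assumes "negligible \<epsilon>"
  shows "negligible (\<lambda>l. sqrt \<bar>\<epsilon> l\<bar>)"
  unfolding negligible_def
proof
  fix c
  show "\<forall>\<^sub>F l in sequentially. \<bar>sqrt \<bar>\<epsilon> l\<bar>\<bar> \<le> 1 / real l ^ c"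
    using negligibleD[OF assms, of "2 * c"]
  proof eventually_elim
    case (elim l)
    have "1 / real l ^ (2 * c) = (1 / real l ^ c)\<^sup>2" by (simp add: power_divide mult.commute flip: power_mult)
    then have "sqrt \<bar>\<epsilon> l\<bar> \<le> sqrt ((1 / real l ^ c)\<^sup>2)" using elim by (simp only: real_sqrt_le_iff)
    also have "\<dots> = 1 / real l ^ c" by (simp only: real_sqrt_abs) simp
    finally show ?case by simp
  qed
qed

text \<open>The bound \<open>l \<le> n l ^ c\<close> forces \<open>n\<close> to tend to infinity, so
  what holds eventually in the encryption parameter \<open>n l\<close> holds eventually in
  \<open>l\<close>.\<close>

lemma eventually_compose_growth:
  assumes P: "eventually P sequentially" and n: "\<forall>\<^sub>F l in sequentially. l \<le> n l ^ c"
  shows "\<forall>\<^sub>F l in sequentially. P (n l)"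
proof -
  obtain N where N: "\<And>l. l \<ge> N \<Longrightarrow> P l" using P by (auto simp: eventually_sequentially)
  have "\<forall>\<^sub>F l in sequentially. l > N ^ c" by (rule eventually_gt_at_top)
  then show ?thesis
    using n
  proof eventually_elim
    case (elim l)
    have "n l \<ge> N" using elim by (metis le_cases less_le_trans linorder_not_less power_mono zero_le)
    then show ?case by (rule N)
  qed
qed

lemma inverse_power_growth:
  assumes "l \<le> n ^ c" "l > 0"
  shows "1 / real n ^ (c * d) \<le> 1 / real l ^ d"
proof -
  have "real l ^ d \<le> real (n ^ c) ^ d" using assms(1) by (intro power_mono) (auto simp flip: of_nat_power)
  also have "\<dots> = real n ^ (c * d)" by (simp add: power_mult)
  finally show ?thesis using assms(2) by (intro frac_le) auto
qed

text \<open>Polynomial growth of \<open>n\<close> bounds an inverse power of \<open>n l\<close> by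
  an inverse power of \<open>l\<close>, at the cost of a factor \<open>c\<close> in the
  exponent.\<close>

lemma negligible_compose:
  assumes \<epsilon>: "negligible \<epsilon>" and n: "\<forall>\<^sub>F l in sequentially. l \<le> n l ^ c"
  shows "negligible (\<lambda>l. \<epsilon> (n l))"
  unfolding negligible_def
proof
  fix d
  have "\<forall>\<^sub>F l in sequentially. l > (0::nat)" by (rule eventually_gt_at_top)
  with n eventually_compose_growth[OF negligibleD[OF \<epsilon>, of "c * d"] n]
  show "\<forall>\<^sub>F l in sequentially. \<bar>\<epsilon> (n l)\<bar> \<le> 1 / real l ^ d"
  proof eventually_elim
    case (elim l)
    then show ?case using inverse_power_growth[of l "n l" c d] by linarith
  qed
qed

text \<open>The positive part of the excess over \<open>b\<close> is the witness. What remains is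
  one inverse polynomial at a time, and such \<open>eventually\<close> statements can be
  combined.\<close>

lemma negligibleI_bound:
  assumes "\<And>d. \<forall>\<^sub>F l in sequentially. w l \<le> b + 1 / real l ^ d"
  shows "\<exists>\<epsilon>. negligible \<epsilon> \<and> (\<forall>l. w l \<le> b + \<epsilon> l)"
proof (intro exI conjI allI)
  show "negligible (\<lambda>l. max 0 (w l - b))"
    unfolding negligible_def
  proof
    fix d show "\<forall>\<^sub>F l in sequentially. \<bar>max 0 (w l - b)\<bar> \<le> 1 / real l ^ d"
      using assms[of d] by eventually_elim (auto simp: max_def)
  qed
qed auto

section \<open>Security bounds for all instances at once\<close>

text \<open>
  Non-uniformity: since the families of the security game are arbitrary, a bound for every family
  is a bound for all choices at a given security parameter.
\<close>

definition qsio_instance ::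
  "obfuscator \<Rightarrow> nat \<Rightarrow> nat \<Rightarrow> nat \<Rightarrow> nat \<Rightarrow> nat \<Rightarrow> real \<Rightarrow> nat \<Rightarrow>
   (bool list \<Rightarrow> bool list) \<Rightarrow> qcircuit \<times> complex mat \<Rightarrow> qcircuit \<times> complex mat \<Rightarrow> nat \<times> complex mat \<times> qcircuit \<Rightarrow> bool" where
  "qsio_instance Obf l n m L k e p f I\<^sub>0 I\<^sub>1 X \<longleftrightarrow>
     (\<forall>I\<in>{I\<^sub>0, I\<^sub>1}. length (enc_qcircuit (fst I)) \<le> L \<and> implementation n m k (1 - e) (fst I) (snd I) f)
   \<and> (case X of (a, \<alpha>, D) \<Rightarrow> q_wf D \<and> q_size D \<le> p \<and> q_in D = a + q_out (Obf l L k) \<and> q_out D = 1 \<and> density a \<alpha>)"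

definition qsio_prob :: "obfuscator \<Rightarrow> nat \<Rightarrow> nat \<Rightarrow> nat \<Rightarrow> nat \<times> complex mat \<times> qcircuit \<Rightarrow> qcircuit \<times> complex mat \<Rightarrow> real" where
  "qsio_prob Obf l L k X I = (case X of (a, \<alpha>, D) \<Rightarrow> outcome_prob D (\<alpha> \<otimes>\<^sub>q obfuscate Obf l L k (fst I) (snd I)) [True])"

text \<open>Choose at each \<open>l\<close> an instance that violates the bound if there is one, and
  any valid instance otherwise. The choices form one family, which security bounds eventually; from
  then on no instance violates the bound. A family needs a member at every \<open>l\<close>, and
  \<open>default\<close> provides it.\<close>

lemma qsio_secure_uniform:
  assumes sec: "qsio_secure Obf" and poly: "poly_bounded n" "poly_bounded m" "poly_bounded L" "poly_bounded k" "poly_bounded p"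
    and e: "negligible e"
    and default: "\<And>l. \<exists>f I\<^sub>0 I\<^sub>1 X. qsio_instance Obf l (n l) (m l) (L l) (k l) (e l) (p l) f I\<^sub>0 I\<^sub>1 X"
  shows "\<forall>\<^sub>F l in sequentially. \<forall>f I\<^sub>0 I\<^sub>1 X. qsio_instance Obf l (n l) (m l) (L l) (k l) (e l) (p l) f I\<^sub>0 I\<^sub>1 X \<longrightarrow>
    \<bar>qsio_prob Obf l (L l) (k l) X I\<^sub>0 - qsio_prob Obf l (L l) (k l) X I\<^sub>1\<bar> \<le> 1 / real l ^ d"
proof (rule ccontr)
  define V where "V l t = (case t of (f, I\<^sub>0, I\<^sub>1, X) \<Rightarrow> qsio_instance Obf l (n l) (m l) (L l) (k l) (e l) (p l) f I\<^sub>0 I\<^sub>1 X)" for l t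
  define \<Delta> where "\<Delta> l t = (case t of (f, I\<^sub>0, I\<^sub>1, X) \<Rightarrow> \<bar>qsio_prob Obf l (L l) (k l) X I\<^sub>0 - qsio_prob Obf l (L l) (k l) X I\<^sub>1\<bar>)"
    for l and t :: "(bool list \<Rightarrow> bool list) \<times> (qcircuit \<times> complex mat) \<times> (qcircuit \<times> complex mat) \<times> (nat \<times> complex mat \<times> qcircuit)"
  assume neg: "\<not> ?thesis"
  have "\<exists>t. V l t \<and> ((\<exists>t'. V l t' \<and> \<not> \<Delta> l t' \<le> 1 / real l ^ d) \<longrightarrow> \<not> \<Delta> l t \<le> 1 / real l ^ d)" for l
  proof (cases "\<exists>t'. V l t' \<and> \<not> \<Delta> l t' \<le> 1 / real l ^ d")
    case True
    then show ?thesis by blast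
  next
    case False
    have "\<exists>t. V l t" using default[of l] by (simp add: V_def)
    then show ?thesis using False by blast
  qed
  then have "\<exists>t. \<forall>l. V l (t l) \<and> ((\<exists>t'. V l t' \<and> \<not> \<Delta> l t' \<le> 1 / real l ^ d) \<longrightarrow> \<not> \<Delta> l (t l) \<le> 1 / real l ^ d)"
    by (intro choice allI)
  then obtain t where t: "\<And>l. V l (t l)" "\<And>l t'. V l t' \<Longrightarrow> \<not> \<Delta> l t' \<le> 1 / real l ^ d \<Longrightarrow> \<not> \<Delta> l (t l) \<le> 1 / real l ^ d"
    by blast
  define f I\<^sub>0 I\<^sub>1 X where "f l = fst (t l)" and "I\<^sub>0 l = fst (snd (t l))" and "I\<^sub>1 l = fst (snd (snd (t l)))" and "X l = snd (snd (snd (t l)))" for l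
  have tl: "t l = (f l, I\<^sub>0 l, I\<^sub>1 l, X l)" for l by (simp add: f_def I\<^sub>0_def I\<^sub>1_def X_def)
  have V: "qsio_instance Obf l (n l) (m l) (L l) (k l) (e l) (p l) (f l) (I\<^sub>0 l) (I\<^sub>1 l) (X l)" for l
    using t(1)[of l] by (simp add: tl V_def)
  have impl: "negl_implementation n m L k (\<lambda>l. fst (I\<^sub>0 l)) (\<lambda>l. snd (I\<^sub>0 l)) f" "negl_implementation n m L k (\<lambda>l. fst (I\<^sub>1 l)) (\<lambda>l. snd (I\<^sub>1 l)) f"
    unfolding negl_implementation_def using V poly e by (auto simp: qsio_instance_def)
  have dist: "distinguisher (\<lambda>l. q_out (Obf l (L l) (k l))) (\<lambda>l. fst (X l)) (\<lambda>l. fst (snd (X l))) (\<lambda>l. snd (snd (X l)))"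
    unfolding distinguisher_def poly_size_def
    using V poly_bounded_mono[OF poly(5), of "\<lambda>l. q_size (snd (snd (X l)))"] by (auto simp: qsio_instance_def case_prod_unfold)
  have "negligible (\<lambda>l. qsio_prob Obf l (L l) (k l) (X l) (I\<^sub>0 l) - qsio_prob Obf l (L l) (k l) (X l) (I\<^sub>1 l))"
    using sec[unfolded qsio_secure_def, rule_format, OF impl dist] by (simp add: qsio_prob_def case_prod_unfold)
  from negligibleD[OF this, of d]
  have "\<forall>\<^sub>F l in sequentially. \<Delta> l (t l) \<le> 1 / real l ^ d" by (simp add: tl \<Delta>_def)
  then have "\<forall>\<^sub>F l in sequentially. \<forall>t'. V l t' \<longrightarrow> \<Delta> l t' \<le> 1 / real l ^ d"
    by eventually_elim (use t(2) in blast)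
  then show False using neg by (simp add: V_def \<Delta>_def)
qed

definition cloner_at :: "nat \<Rightarrow> nat \<Rightarrow> nat \<Rightarrow> cloner \<Rightarrow> nat \<Rightarrow> bool" where
  "cloner_at c n p A l \<longleftrightarrow>
     (\<forall>Q\<in>{stage1 A l, stage2 A l, bob A l, charlie A l}. q_wf Q \<and> q_size Q \<le> p)
   \<and> density (advice_len A l) (advice A l)
   \<and> q_in (stage1 A l) = advice_len A l \<and> msg_len A l \<le> q_out (stage1 A l)
   \<and> q_in (stage2 A l) = mem_len A l + c \<and> bob_len A l \<le> q_out (stage2 A l)
   \<and> q_in (bob A l) = n + bob_len A l \<and> q_out (bob A l) = 1
   \<and> q_in (charlie A l) = n + charlie_len A l \<and> q_out (charlie A l) = 1"

text \<open>The same worst-case choice, now among adversaries for one security parameter. The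
  hypothesis \<open>large\<close> leaves room for a trivial adversary, so that there always is one
  to choose.\<close>

lemma unclonable_uniform:
  assumes sec: "unclonable_indistinguishable Enc" and p: "poly_bounded p"
    and large: "\<And>l. l + q_out (Enc l) + 4 \<le> p l"
  shows "\<forall>\<^sub>F l in sequentially. \<forall>A. cloner_at (q_out (Enc l)) l (p l) A l \<and> msg_len A l = 2 \<longrightarrow>
    ue_win_prob Enc A l \<le> 1 / 2 + 1 / real l ^ d"
proof (rule ccontr)
  define V where "V l A \<longleftrightarrow> cloner_at (q_out (Enc l)) l (p l) A l \<and> msg_len A l = 2" for l A
  assume neg: "\<not> ?thesis"
  have "\<exists>A. V l A" for l
  proof (intro exI)
    \<comment> \<open>It sends two zero bits and throws the ciphertext away; both guessers output an
      ancilla.\<close>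
    let ?A = "\<lparr>advice_len = (\<lambda>l. 0), advice = (\<lambda>l. one_state), msg_len = (\<lambda>l. 2), stage1 = (\<lambda>l. zeros 2),
      stage2 = (\<lambda>l. discard (q_out (Enc l))), bob_len = (\<lambda>l. 0), bob = (\<lambda>l. QCircuit l 1 [] [l]), charlie = (\<lambda>l. QCircuit l 1 [] [l])\<rparr>"
    have w: "q_wf (QCircuit l 1 [] [l])" by (simp add: q_wf_iff q_wires_def)
    have s: "q_size (QCircuit l 1 [] [l]) = l + 2" by (simp add: q_size_def q_wires_def)
    show "V l ?A"
      unfolding V_def using large[of l] density_one by (auto simp: cloner_at_def mem_len_def charlie_len_def w s simp del: One_nat_def)
  qed
  then have "\<exists>A. V l A \<and> ((\<exists>A'. V l A' \<and> \<not> ue_win_prob Enc A' l \<le> 1 / 2 + 1 / real l ^ d) \<longrightarrow> \<not> ue_win_prob Enc A l \<le> 1 / 2 + 1 / real l ^ d)" for l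
    by blast
  then have "\<exists>S. \<forall>l. V l (S l) \<and> ((\<exists>A'. V l A' \<and> \<not> ue_win_prob Enc A' l \<le> 1 / 2 + 1 / real l ^ d) \<longrightarrow> \<not> ue_win_prob Enc (S l) l \<le> 1 / 2 + 1 / real l ^ d)"
    by (intro choice allI)
  then obtain S where S: "\<And>l. V l (S l)"
      "\<And>l A'. V l A' \<Longrightarrow> \<not> ue_win_prob Enc A' l \<le> 1 / 2 + 1 / real l ^ d \<Longrightarrow> \<not> ue_win_prob Enc (S l) l \<le> 1 / 2 + 1 / real l ^ d"
    by blast
  \<comment> \<open>The game at parameter \<open>l\<close> depends only on the fields at
    \<open>l\<close>, so the chosen adversaries can be glued into one.\<close>
  define A where "A = \<lparr>advice_len = (\<lambda>l. advice_len (S l) l), advice = (\<lambda>l. advice (S l) l), msg_len = (\<lambda>l. msg_len (S l) l),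
     stage1 = (\<lambda>l. stage1 (S l) l), stage2 = (\<lambda>l. stage2 (S l) l), bob_len = (\<lambda>l. bob_len (S l) l), bob = (\<lambda>l. bob (S l) l), charlie = (\<lambda>l. charlie (S l) l)\<rparr>"
  have sel: "advice_len A l = advice_len (S l) l" "advice A l = advice (S l) l" "msg_len A l = msg_len (S l) l"
    "stage1 A l = stage1 (S l) l" "stage2 A l = stage2 (S l) l" "bob_len A l = bob_len (S l) l" "bob A l = bob (S l) l"
    "charlie A l = charlie (S l) l" "mem_len A l = mem_len (S l) l" "charlie_len A l = charlie_len (S l) l" for l
    by (simp_all add: A_def mem_len_def charlie_len_def)
  have win: "ue_win_prob Enc A l = ue_win_prob Enc (S l) l" for l
    by (simp add: ue_win_prob_def clone_prob_def memory_after_def sel)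
  have two: "2 \<le> q_out (stage1 (S l) l)" for l
    using S(1)[of l] by (auto simp: V_def cloner_at_def)
  have "cloner_wf (\<lambda>l. q_out (Enc l)) (\<lambda>l. l) A \<and> (\<forall>l. msg_len A l = 2)"
    unfolding cloner_wf_def poly_size_def
    using S(1) two by (auto simp: V_def cloner_at_def sel intro!: poly_bounded_mono[OF p])
  then obtain \<epsilon> where \<epsilon>: "negligible \<epsilon>" "\<And>l. ue_win_prob Enc A l \<le> 1 / 2 + \<epsilon> l"
    using sec unfolding unclonable_indistinguishable_def by blast
  have "\<forall>\<^sub>F l in sequentially. \<forall>A'. V l A' \<longrightarrow> ue_win_prob Enc A' l \<le> 1 / 2 + 1 / real l ^ d"
    using negligibleD[OF \<epsilon>(1), of d]
  proof eventually_elim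
    case (elim l)
    then have "ue_win_prob Enc (S l) l \<le> 1 / 2 + 1 / real l ^ d" using \<epsilon>(2)[of l] by (simp add: win)
    then show ?case using S(2) by blast
  qed
  then show False using neg by (simp add: V_def)
qed

section \<open>The cloning games\<close>

lemma sum_Pow_shift:
  fixes F :: "nat set \<Rightarrow> 'a :: comm_monoid_add"
  shows "(\<Sum>\<beta>\<in>Pow {..<p + q}. F \<beta>) = (\<Sum>s\<in>Pow {..<p}. \<Sum>t\<in>Pow {..<q}. F (s \<union> (+) p ` t))"
proof -
  have "{..<p + q} = {..<p} \<union> (+) p ` {..<q}"
  proof (intro equalityI subsetI)
    fix x assume "x \<in> {..<p + q}"
    then show "x \<in> {..<p} \<union> (+) p ` {..<q}" by (cases "x < p") (auto intro!: image_eqI[of _ _ "x - p"])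
  qed auto
  then show ?thesis by (simp only:) (subst sum_Pow_Un, auto simp: sum_Pow_image)
qed

text \<open>The block of one classical value \<open>s\<close> of the first register: its form is the
  full form at vectors supported on that value.\<close>

lemma psd_slice:
  assumes K: "psd {..<p + q} K" and s: "s \<subseteq> {..<p}"
  shows "psd {..<q} (\<lambda>r c. K (s \<union> (+) p ` r) (s \<union> (+) p ` c))"
proof -
  have "form {..<q} (\<lambda>r c. K (s \<union> (+) p ` r) (s \<union> (+) p ` c)) v
      = form {..<p + q} K (\<lambda>\<beta>. if \<beta> \<inter> {..<p} = s then v {w. p + w \<in> \<beta>} else 0)" for v
  proof -
    let ?v = "\<lambda>\<beta>. if \<beta> \<inter> {..<p} = s then v {w. p + w \<in> \<beta>} else 0"
    have v: "?v (s' \<union> (+) p ` t) = (if s' = s then v t else 0)" if "s' \<in> Pow {..<p}" for s' t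
    proof -
      have 1: "(s' \<union> (+) p ` t) \<inter> {..<p} = s'" and 2: "{w. p + w \<in> s' \<union> (+) p ` t} = t" using that by auto
      show ?thesis unfolding 1 2 ..
    qed
    have fin: "finite (Pow {..<p})" by simp
    have inner: "(\<Sum>s'\<in>Pow {..<p}. \<Sum>t\<in>Pow {..<q}. G s' t * ?v (s' \<union> (+) p ` t)) = (\<Sum>t\<in>Pow {..<q}. G s t * v t)" for G
    proof -
      have "(\<Sum>s'\<in>Pow {..<p}. \<Sum>t\<in>Pow {..<q}. G s' t * ?v (s' \<union> (+) p ` t))
          = (\<Sum>s'\<in>Pow {..<p}. if s' = s then \<Sum>t\<in>Pow {..<q}. G s t * v t else 0)"
        by (intro sum.cong refl) (auto simp: v)
      then show ?thesis using s by (simp add: sum.delta)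
    qed
    have cv: "cnj (?v \<beta>) = (if \<beta> \<inter> {..<p} = s then cnj (v {w. p + w \<in> \<beta>}) else 0)" for \<beta> by simp
    have "form {..<p + q} K ?v = (\<Sum>s'\<in>Pow {..<p}. \<Sum>r\<in>Pow {..<q}. \<Sum>c\<in>Pow {..<q}.
        K (s' \<union> (+) p ` r) (s \<union> (+) p ` c) * cnj (?v (s' \<union> (+) p ` r)) * v c)"
      unfolding form_def sum_Pow_shift inner ..
    also have "\<dots> = (\<Sum>s'\<in>Pow {..<p}. if s' = s then form {..<q} (\<lambda>r c. K (s \<union> (+) p ` r) (s \<union> (+) p ` c)) v else 0)"
      by (intro sum.cong refl) (auto simp: v form_def)
    also have "\<dots> = form {..<q} (\<lambda>r c. K (s \<union> (+) p ` r) (s \<union> (+) p ` c)) v"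
      using s by (simp add: sum.delta)
    finally show ?thesis ..
  qed
  then show ?thesis using K by (simp add: psd_def)
qed

text \<open>Divide by the trace. If the trace is 0, a positive matrix vanishes, and any state will
  do.\<close>

lemma psd_normalize:
  assumes M: "M \<in> carrier_mat (2 ^ q) (2 ^ q)" and psd: "psd {..<q} (ent M)"
  defines "t \<equiv> (\<Sum>\<beta>\<in>Pow {..<q}. ent M \<beta> \<beta>)"
  shows "t \<ge> 0" "\<exists>\<alpha>. density q \<alpha> \<and> M = t \<cdot>\<^sub>m \<alpha>"
proof -
  have pos: "ent M \<beta> \<beta> \<ge> 0" if "\<beta> \<in> Pow {..<q}" for \<beta> using psd_diag[OF finite_lessThan psd] that by simp
  then show t0: "t \<ge> 0" unfolding t_def by (rule sum_nonneg)
  show "\<exists>\<alpha>. density q \<alpha> \<and> M = t \<cdot>\<^sub>m \<alpha>"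
  proof (cases "t = 0")
    case True
    then have diag: "ent M \<beta> \<beta> = 0" if "\<beta> \<in> Pow {..<q}" for \<beta>
      using that sum_nonneg_eq_0_iff[of "Pow {..<q}" "\<lambda>\<beta>. ent M \<beta> \<beta>"] pos by (simp add: t_def)
    have "M = t \<cdot>\<^sub>m basis_state (replicate q False)"
    proof (rule mat_eq_ent)
      show "t \<cdot>\<^sub>m basis_state (replicate q False) \<in> carrier_mat (2 ^ q) (2 ^ q)"
        using basis_carrier[of "replicate q False" q] by simp
      fix \<beta> \<gamma> assume *: "\<beta> \<subseteq> {..<q}" "\<gamma> \<subseteq> {..<q}"
      then have "ent M \<beta> \<gamma> = 0" using psd_zero_row[OF finite_lessThan psd] diag by simp
      then show "ent M \<beta> \<gamma> = ent (t \<cdot>\<^sub>m basis_state (replicate q False)) \<beta> \<gamma>"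
        using True * carrier_matD[OF basis_carrier[of "replicate q False" q]] set_encode_less by (simp add: ent_def)
    qed fact
    then show ?thesis using preparable_density[OF preparable_basis_state[of "replicate q False" q]] by auto
  next
    case False
    have e: "ent ((1 / t) \<cdot>\<^sub>m M) \<beta> \<gamma> = 1 / t * ent M \<beta> \<gamma>" if "\<beta> \<subseteq> {..<q}" "\<gamma> \<subseteq> {..<q}" for \<beta> \<gamma>
      using that M set_encode_less by (auto simp: ent_def)
    have "form {..<q} (ent ((1 / t) \<cdot>\<^sub>m M)) v = 1 / t * form {..<q} (ent M) v" for v
      unfolding form_def sum_distrib_left by (intro sum.cong refl) (auto simp: e)
    moreover have "1 / t * form {..<q} (ent M) v \<ge> 0" for v
    proof -
      have "form {..<q} (ent M) v \<ge> 0" using psd by (simp add: psd_def)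
      moreover have inv: "1 / t = complex_of_real (1 / Re t)" using t0 by (simp add: less_eq_complex_def complex_eq_iff Re_divide Im_divide power2_eq_square)
      moreover have "1 / Re t \<ge> 0" using t0 by (simp add: less_eq_complex_def)
      ultimately show ?thesis unfolding inv by (simp add: less_eq_complex_def del: of_real_divide)
    qed
    ultimately have "psd {..<q} (ent ((1 / t) \<cdot>\<^sub>m M))" by (simp add: psd_def)
    moreover have "(\<Sum>\<beta>\<in>Pow {..<q}. ent ((1 / t) \<cdot>\<^sub>m M) \<beta> \<beta>) = 1 / t * t"
    proof -
      have "(\<Sum>\<beta>\<in>Pow {..<q}. ent ((1 / t) \<cdot>\<^sub>m M) \<beta> \<beta>) = (\<Sum>\<beta>\<in>Pow {..<q}. 1 / t * ent M \<beta> \<beta>)"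
        by (intro sum.cong refl e) auto
      then show ?thesis by (simp only: t_def[symmetric] sum_distrib_left[symmetric])
    qed
    ultimately have "density q ((1 / t) \<cdot>\<^sub>m M)" using M False by (simp add: density_iff)
    moreover have "M = t \<cdot>\<^sub>m ((1 / t) \<cdot>\<^sub>m M)" using False M by (intro eq_matI) auto
    ultimately show ?thesis by blast
  qed
qed

lemma ent_memory_after:
  assumes len: "length z = msg_len A l" and out: "msg_len A l \<le> q_out (stage1 A l)"
    and rc: "r \<subseteq> {..<mem_len A l}" "c \<subseteq> {..<mem_len A l}"
  shows "ent (memory_after A l z) r c
    = ent (run (stage1 A l) (advice A l)) (true_bits z \<union> (+) (msg_len A l) ` r) (true_bits z \<union> (+) (msg_len A l) ` c)"
proof -
  have tz: "true_bits z \<subseteq> {..<msg_len A l}" using true_bits_subset[of z] len by simp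
  have f: "finite r" "finite c" using rc finite_subset by blast+
  show ?thesis
    unfolding memory_after_def Let_def ent_mat[OF rc] prod.case
    by (simp add: ent_def idx_eq set_encode_shift[OF tz f(1)] set_encode_shift[OF tz f(2)])
qed

lemma memory_after_carrier [simp]: "memory_after A l z \<in> carrier_mat (2 ^ mem_len A l) (2 ^ mem_len A l)"
  by (simp add: memory_after_def Let_def)

text \<open>The memories are diagonal blocks of the state after the first stage, so their traces are
  the probabilities of the messages. Once normalized they can be handed out as advice, and no
  reduction has to run the first stage until it sends a given message.\<close>

lemma memory_after_normalize:
  assumes wf: "q_wf (stage1 A l)" "density (advice_len A l) (advice A l)" "q_in (stage1 A l) = advice_len A l"
      "msg_len A l \<le> q_out (stage1 A l)"
  shows "\<exists>w \<alpha>. (\<forall>z\<in>bitstrings (msg_len A l). w z \<ge> 0 \<and> density (mem_len A l) (\<alpha> z)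
      \<and> memory_after A l z = complex_of_real (w z) \<cdot>\<^sub>m \<alpha> z) \<and> (\<Sum>z\<in>bitstrings (msg_len A l). w z) = 1"
proof -
  let ?p = "msg_len A l" and ?q = "mem_len A l"
  let ?\<tau> = "run (stage1 A l) (advice A l)"
  have pq: "q_out (stage1 A l) = ?p + ?q" using wf by (simp add: mem_len_def)
  have dens: "density (?p + ?q) ?\<tau>" using density_run[of "stage1 A l" "advice A l"] wf pq by simp
  define t where "t z = (\<Sum>\<beta>\<in>Pow {..<?q}. ent (memory_after A l z) \<beta> \<beta>)" for z
  have psd: "psd {..<?q} (ent (memory_after A l z))" if z: "z \<in> bitstrings ?p" for z
  proof -
    have z': "length z = ?p" "true_bits z \<subseteq> {..<?p}" using z true_bits_subset[of z] by (auto simp: bitstrings_def)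
    have "psd {..<?q} (\<lambda>r c. ent ?\<tau> (true_bits z \<union> (+) ?p ` r) (true_bits z \<union> (+) ?p ` c))"
      by (rule psd_slice[OF _ z'(2)]) (use dens in \<open>simp add: density_iff\<close>)
    moreover have "form {..<?q} (ent (memory_after A l z)) v = form {..<?q} (\<lambda>r c. ent ?\<tau> (true_bits z \<union> (+) ?p ` r) (true_bits z \<union> (+) ?p ` c)) v" for v
      unfolding form_def by (intro sum.cong refl) (simp add: ent_memory_after[OF z'(1) wf(4)])
    ultimately show ?thesis by (simp add: psd_def)
  qed
  have sum1: "(\<Sum>z\<in>bitstrings ?p. t z) = 1"
  proof -
    have "(\<Sum>z\<in>bitstrings ?p. t z) = (\<Sum>z\<in>bitstrings ?p. \<Sum>\<beta>\<in>Pow {..<?q}. ent ?\<tau> (true_bits z \<union> (+) ?p ` \<beta>) (true_bits z \<union> (+) ?p ` \<beta>))"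
      unfolding t_def by (intro sum.cong refl) (simp add: ent_memory_after wf bitstrings_def)
    also have "\<dots> = (\<Sum>\<beta>\<in>Pow {..<?p + ?q}. ent ?\<tau> \<beta> \<beta>)"
      unfolding sum_Pow_shift sum_Pow_bitstrings[of _ ?p] ..
    also have "\<dots> = 1" using dens by (simp add: density_iff)
    finally show ?thesis .
  qed
  have "\<exists>a. z \<in> bitstrings ?p \<longrightarrow> density ?q a \<and> memory_after A l z = t z \<cdot>\<^sub>m a" for z
    using psd_normalize(2)[OF memory_after_carrier psd, of z] unfolding t_def by blast
  then have "\<exists>\<alpha>. \<forall>z. z \<in> bitstrings ?p \<longrightarrow> density ?q (\<alpha> z) \<and> memory_after A l z = t z \<cdot>\<^sub>m \<alpha> z"
    by (intro choice allI)
  then obtain \<alpha> where \<alpha>: "\<And>z. z \<in> bitstrings ?p \<Longrightarrow> density ?q (\<alpha> z) \<and> memory_after A l z = t z \<cdot>\<^sub>m \<alpha> z"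
    by blast
  have t0: "t z \<ge> 0" if "z \<in> bitstrings ?p" for z
    unfolding t_def by (rule psd_normalize(1)[OF memory_after_carrier psd[OF that]])
  then have "t z = complex_of_real (Re (t z))" "Re (t z) \<ge> 0" if "z \<in> bitstrings ?p" for z
    using that by (auto simp: less_eq_complex_def complex_eq_iff)
  moreover have "(\<Sum>z\<in>bitstrings ?p. Re (t z)) = 1" using sum1 by (simp flip: Re_sum)
  ultimately show ?thesis
    using \<alpha> by (intro exI[of _ "\<lambda>z. Re (t z)"] exI[of _ \<alpha>]) simp
qed

lemma tensor_smult: "(c \<cdot>\<^sub>m A) \<otimes>\<^sub>q B = c \<cdot>\<^sub>m (A \<otimes>\<^sub>q B)"
proof (rule eq_matI)
  fix i j assume "i < dim_row (c \<cdot>\<^sub>m (A \<otimes>\<^sub>q B))" "j < dim_col (c \<cdot>\<^sub>m (A \<otimes>\<^sub>q B))"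
  then have "i < dim_row A * dim_row B" "j < dim_col A * dim_col B" by (simp_all add: tensor_def)
  moreover from this have "dim_row A > 0" "dim_col A > 0" by (auto intro!: Nat.gr0I)
  ultimately show "((c \<cdot>\<^sub>m A) \<otimes>\<^sub>q B) $$ (i, j) = (c \<cdot>\<^sub>m (A \<otimes>\<^sub>q B)) $$ (i, j)"
    by (simp add: tensor_def)
qed (simp_all add: tensor_def)

lemma both_output_prob_smult:
  assumes "\<sigma> \<in> carrier_mat (2 ^ (kB + kC)) (2 ^ (kB + kC))"
  shows "both_output_prob P Q kB kC x x' (complex_of_real w \<cdot>\<^sub>m \<sigma>) b = w * both_output_prob P Q kB kC x x' \<sigma> b"
proof -
  have lt: "i + 2 ^ kB * j < 2 ^ (kB + kC)" if "i < 2 ^ kB" "j < 2 ^ kC" for i j :: nat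
  proof -
    have "2 ^ kB * Suc j \<le> 2 ^ kB * 2 ^ kC" using that(2) by (intro mult_le_mono2) simp
    then show ?thesis using that(1) by (simp add: power_add)
  qed
  have "w * Re z = Re (complex_of_real w * z)" for z by simp
  then show ?thesis
    unfolding both_output_prob_def sum_distrib_left
    by (simp only:) (intro arg_cong[of _ _ Re] sum.cong refl, use assms lt in \<open>simp add: sum_distrib_left mult.assoc\<close>)
qed

text \<open>The distinguisher for one point. The memory and two copies of the point come first, as
  its advice; the obfuscation comes last, as its challenge.\<close>

definition attack :: "nat \<Rightarrow> nat \<Rightarrow> nat \<Rightarrow> qcircuit \<Rightarrow> nat \<Rightarrow> nat \<Rightarrow> qcircuit \<Rightarrow> qcircuit \<Rightarrow> bool \<Rightarrow> qcircuit" where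
  "attack n \<mu> N S kB kC P Q b = (idc \<mu> \<parallel> swapc (n + n) N) ;; (S \<parallel> idc (n + n)) ;; joint n kB kC P Q b"

context
  fixes n \<mu> N kB kC :: nat and S P Q :: qcircuit
  assumes P: "q_wf P" "q_in P = n + kB" "q_out P = 1" and Q: "q_wf Q" "q_in Q = n + kC" "q_out Q = 1"
    and S: "q_wf S" "q_in S = \<mu> + N" "q_out S = kB + kC"
begin

lemma attack_simps:
  "q_in (attack n \<mu> N S kB kC P Q b) = \<mu> + (n + n) + N" "q_out (attack n \<mu> N S kB kC P Q b) = 1"
  "q_wf (attack n \<mu> N S kB kC P Q b)"
  "q_size (attack n \<mu> N S kB kC P Q b) \<le> 30 * (n + \<mu> + N + kB + kC + q_size S + q_size P + q_size Q + 2)"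
proof -
  note j = joint_simps[OF P Q]
  show "q_in (attack n \<mu> N S kB kC P Q b) = \<mu> + (n + n) + N" "q_out (attack n \<mu> N S kB kC P Q b) = 1"
    by (simp_all add: attack_def j(2)[simplified])
  show "q_wf (attack n \<mu> N S kB kC P Q b)"
    unfolding attack_def by (intro seq_wf par_wf basic_wf S j) (simp_all add: S j add_ac)
  have "q_size (attack n \<mu> N S kB kC P Q b) \<le> q_size (idc \<mu> \<parallel> swapc (n + n) N) + q_size (S \<parallel> idc (n + n)) + q_size (joint n kB kC P Q b)"
    unfolding attack_def by (rule order_trans[OF seq_size] add_mono order_refl)+
  then show "q_size (attack n \<mu> N S kB kC P Q b) \<le> 30 * (n + \<mu> + N + kB + kC + q_size S + q_size P + q_size Q + 2)"
    using j(4)[of b] by (simp add: par_size)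
qed

lemma attack_outcome:
  assumes \<alpha>: "\<alpha> \<in> carrier_mat (2 ^ \<mu>) (2 ^ \<mu>)" and \<omega>: "\<omega> \<in> carrier_mat (2 ^ N) (2 ^ N)" and x: "length x = n" "length x' = n"
  shows "outcome_prob (attack n \<mu> N S kB kC P Q b) ((\<alpha> \<otimes>\<^sub>q (basis_state x \<otimes>\<^sub>q basis_state x')) \<otimes>\<^sub>q \<omega>) [True]
    = both_output_prob P Q kB kC x x' (run S (\<alpha> \<otimes>\<^sub>q \<omega>)) b"
proof -
  note j = joint_simps[OF P Q]
  let ?X = "basis_state x \<otimes>\<^sub>q basis_state x'"
  have X: "?X \<in> carrier_mat (2 ^ (n + n)) (2 ^ (n + n))" by (intro tensor_carrier basis_carrier x)
  have \<alpha>\<omega>: "\<alpha> \<otimes>\<^sub>q \<omega> \<in> carrier_mat (2 ^ q_in S) (2 ^ q_in S)" using tensor_carrier[OF \<alpha> \<omega>] S by simp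
  have \<sigma>: "run S (\<alpha> \<otimes>\<^sub>q \<omega>) \<in> carrier_mat (2 ^ (kB + kC)) (2 ^ (kB + kC))" using run_carrier[of S] S by metis
  have 1: "run (idc \<mu> \<parallel> swapc (n + n) N) (\<alpha> \<otimes>\<^sub>q (?X \<otimes>\<^sub>q \<omega>)) = \<alpha> \<otimes>\<^sub>q (\<omega> \<otimes>\<^sub>q ?X)"
    using run_par[of "idc \<mu>" "swapc (n + n) N" \<alpha> "?X \<otimes>\<^sub>q \<omega>"] \<alpha> tensor_carrier[OF X \<omega>] run_swapc[OF X \<omega>] by simp
  have 2: "run (S \<parallel> idc (n + n)) (\<alpha> \<otimes>\<^sub>q \<omega> \<otimes>\<^sub>q ?X) = run S (\<alpha> \<otimes>\<^sub>q \<omega>) \<otimes>\<^sub>q ?X"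
    using run_par[of S "idc (n + n)" "\<alpha> \<otimes>\<^sub>q \<omega>" ?X] \<alpha>\<omega> X S by simp
  have car: "\<alpha> \<otimes>\<^sub>q ?X \<otimes>\<^sub>q \<omega> \<in> carrier_mat (2 ^ (\<mu> + (n + n) + N)) (2 ^ (\<mu> + (n + n) + N))"
    by (intro tensor_carrier \<alpha> X \<omega>)
  have c1: "\<alpha> \<otimes>\<^sub>q ?X \<otimes>\<^sub>q \<omega> \<in> carrier_mat (2 ^ q_in (idc \<mu> \<parallel> swapc (n + n) N)) (2 ^ q_in (idc \<mu> \<parallel> swapc (n + n) N))"
    using car by (simp add: add_ac)
  have w2: "q_wf ((idc \<mu> \<parallel> swapc (n + n) N) ;; (S \<parallel> idc (n + n)))"
    by (intro seq_wf par_wf basic_wf S) (simp add: S add_ac)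
  have "run ((idc \<mu> \<parallel> swapc (n + n) N) ;; (S \<parallel> idc (n + n))) (\<alpha> \<otimes>\<^sub>q ?X \<otimes>\<^sub>q \<omega>)
      = run (S \<parallel> idc (n + n)) (run (idc \<mu> \<parallel> swapc (n + n) N) (\<alpha> \<otimes>\<^sub>q ?X \<otimes>\<^sub>q \<omega>))"
    by (rule run_seq[OF _ _ _ c1]) (simp_all add: S)
  also have "run (idc \<mu> \<parallel> swapc (n + n) N) (\<alpha> \<otimes>\<^sub>q ?X \<otimes>\<^sub>q \<omega>) = \<alpha> \<otimes>\<^sub>q \<omega> \<otimes>\<^sub>q ?X"
    using 1 by (simp only: tensor_assoc)
  finally have 12: "run ((idc \<mu> \<parallel> swapc (n + n) N) ;; (S \<parallel> idc (n + n))) (\<alpha> \<otimes>\<^sub>q ?X \<otimes>\<^sub>q \<omega>) = run S (\<alpha> \<otimes>\<^sub>q \<omega>) \<otimes>\<^sub>q ?X"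
    unfolding 2 .
  have "run (attack n \<mu> N S kB kC P Q b) (\<alpha> \<otimes>\<^sub>q ?X \<otimes>\<^sub>q \<omega>) = run (joint n kB kC P Q b) (run S (\<alpha> \<otimes>\<^sub>q \<omega>) \<otimes>\<^sub>q ?X)"
    unfolding attack_def 12[symmetric]
    by (rule run_seq[OF w2 j(3)]) (use c1 j S in \<open>simp_all add: add_ac\<close>)
  then show ?thesis
    using joint_outcome[OF P Q \<sigma> x, of b] by (simp add: outcome_prob_def)
qed

text \<open>The values are acceptance probabilities of a circuit on a state; from the expansion into
  matrix units these bounds are not visible.\<close>

lemma attack_bounds:
  assumes \<alpha>: "density \<mu> \<alpha>" and \<omega>: "preparable N \<omega>" and x: "length x = n"
  shows "0 \<le> both_output_prob P Q kB kC x x (run S (\<alpha> \<otimes>\<^sub>q \<omega>)) b" "both_output_prob P Q kB kC x x (run S (\<alpha> \<otimes>\<^sub>q \<omega>)) b \<le> 1"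
proof -
  have "preparable (n + n + N) (basis_state x \<otimes>\<^sub>q basis_state x \<otimes>\<^sub>q \<omega>)"
    by (intro preparable_tensor preparable_basis_state x \<omega>)
  from density_tensor_preparable[OF \<alpha> this]
  have "density (q_in (attack n \<mu> N S kB kC P Q b)) (\<alpha> \<otimes>\<^sub>q (basis_state x \<otimes>\<^sub>q basis_state x) \<otimes>\<^sub>q \<omega>)"
    by (simp add: attack_simps tensor_assoc add_ac)
  from outcome_prob_bounds[OF attack_simps(3) this, of "[True]"]
  show "0 \<le> both_output_prob P Q kB kC x x (run S (\<alpha> \<otimes>\<^sub>q \<omega>)) b" "both_output_prob P Q kB kC x x (run S (\<alpha> \<otimes>\<^sub>q \<omega>)) b \<le> 1"
    using attack_simps(2)[of b]
    by (simp_all add: attack_outcome[OF density_carrier[OF \<alpha>] preparable_carrier[OF \<omega>] x x])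
qed

end

text \<open>The circuit is exact. The slack \<open>e\<close> is there because it shares an instance,
  and hence the error bound, with the switching circuit.\<close>

lemma b_to_q_implementation:
  assumes "b_wf n m B" "e \<ge> 0"
  shows "implementation n m k (1 - e) (b_to_q k B) (basis_state (replicate k False)) (b_eval B)"
  unfolding implementation_def
proof (intro conjI ballI)
  have c: "computes (b_to_q k B) (\<lambda>z. b_eval B (drop k z))" by (rule b_to_q_computes[OF assms(1)])
  then show "q_wf (b_to_q k B)" by (simp add: computes_def)
  show "q_in (b_to_q k B) = k + n" "q_out (b_to_q k B) = m" using assms by (auto simp: b_wf_def)
  show "density k (basis_state (replicate k False))"
    by (intro preparable_density preparable_basis_state) simp
  fix x assume x: "x \<in> bitstrings n"
  then show y: "b_eval B x \<in> bitstrings m" using b_eval_length[OF assms(1)] by (simp add: bitstrings_def)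
  have "run (b_to_q k B) (basis_state (replicate k False @ x)) = basis_state (b_eval B x)"
    using computes_maps[OF c] x assms by (auto simp: maps_def bitstrings_def b_wf_def)
  then have "outcome_prob (b_to_q k B) (basis_state (replicate k False) \<otimes>\<^sub>q basis_state x) (b_eval B x) = 1"
    using true_bits_subset[of "b_eval B x"] by (simp add: outcome_prob_ent basis_state_append ent_basis_state)
  then show "1 - e \<le> outcome_prob (b_to_q k B) (basis_state (replicate k False) \<otimes>\<^sub>q basis_state x) (b_eval B x)"
    using assms(2) by simp
qed

text \<open>Away from the key the test rejects with certainty, so the result of decrypting under a
  wrong key, about which nothing is known, does not matter. At the key the only error is that of
  decryption.\<close>

lemma switch_implementation:
  assumes T: "q_wf T" "q_in T = n + c" "q_out T = 1" and D: "q_wf D" "q_in D = n + c" "q_out D = 1"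
    and B: "b_wf n m B" and B': "b_wf n m B'" and ck: "c \<le> k"
    and \<omega>: "preparable c \<omega>" and s: "length s = n" and e: "e \<ge> 0"
    and test: "\<And>x. length x = n \<Longrightarrow> outcome_prob T (basis_state x \<otimes>\<^sub>q \<omega>) [x = s] = 1"
    and dec: "outcome_prob D (basis_state s \<otimes>\<^sub>q \<omega>) [b] \<ge> 1 - e"
    and f: "\<And>x. length x = n \<Longrightarrow> f x = (if x = s \<and> b then b_eval B' x else b_eval B x)"
  shows "implementation n m k (1 - e) (switch n m c k T D B B') (\<omega> \<otimes>\<^sub>q basis_state (replicate (k - c) False)) f"
  unfolding implementation_def
proof (intro conjI ballI)
  note sw = T D B B' ck
  show "q_wf (switch n m c k T D B B')" "q_in (switch n m c k T D B B') = k + n" "q_out (switch n m c k T D B B') = m"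
    by (rule switch_wf[OF sw] switch_simps[OF sw])+
  have "preparable (c + (k - c)) (\<omega> \<otimes>\<^sub>q basis_state (replicate (k - c) False))"
    by (intro preparable_tensor preparable_basis_state \<omega>) simp
  then show "density k (\<omega> \<otimes>\<^sub>q basis_state (replicate (k - c) False))"
    using ck preparable_density by simp
  fix x assume "x \<in> bitstrings n"
  then have x: "length x = n" by (simp add: bitstrings_def)
  then show y: "f x \<in> bitstrings m"
    using f[OF x] b_eval_length[OF B] b_eval_length[OF B'] by (simp add: bitstrings_def)
  let ?d = "\<lambda>d. outcome_prob D (basis_state x \<otimes>\<^sub>q \<omega>) [d]"
  have dens: "density (n + c) (basis_state x \<otimes>\<^sub>q \<omega>)"
    by (intro preparable_density preparable_tensor preparable_basis_state x \<omega>)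
  then have d0: "?d d \<ge> 0" for d using outcome_prob_bounds(1)[OF D(1), of _ "[d]"] D by simp
  have d1: "?d True + ?d False = 1"
    using outcome_prob_sum[OF D(1), of "basis_state x \<otimes>\<^sub>q \<omega>"] dens unfolding D bitstrings_1 by simp
  have "outcome_prob (switch n m c k T D B B') (\<omega> \<otimes>\<^sub>q basis_state (replicate (k - c) False) \<otimes>\<^sub>q basis_state x) (f x)
      = (\<Sum>d\<in>UNIV. of_bool ((if x = s \<and> d then b_eval B' x else b_eval B x) = f x) * ?d d)"
    by (rule switch_outcome[OF sw \<omega> x _ test[OF x]]) (use y in \<open>simp add: bitstrings_def\<close>)
  also have "\<dots> = of_bool ((if x = s then b_eval B' x else b_eval B x) = f x) * ?d True + of_bool (b_eval B x = f x) * ?d False"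
    by (simp add: UNIV_bool)
  also have "\<dots> \<ge> 1 - e"
  proof (cases "x = s")
    case True
    then show ?thesis using dec f[OF x] d0[of True] d0[of False] by (cases b) auto
  next
    case False
    then show ?thesis using f[OF x] d1 e by simp
  qed
  finally show "1 - e \<le> outcome_prob (switch n m c k T D B B') (\<omega> \<otimes>\<^sub>q basis_state (replicate (k - c) False) \<otimes>\<^sub>q basis_state x) (f x)" .
qed

section \<open>The adversary against encryption\<close>

text \<open>
  The adversary against unclonable encryption that sends the messages 0 and 1, obfuscates the given
  circuit together with the ciphertext, and hands the result to the second stage \<open>S\<close>.
\<close>

definition ue_cloner ::
  "nat \<Rightarrow> complex mat \<Rightarrow> bool list \<Rightarrow> nat \<Rightarrow> nat \<Rightarrow> qcircuit \<Rightarrow> qcircuit \<Rightarrow> nat \<Rightarrow> qcircuit \<Rightarrow> qcircuit \<Rightarrow> cloner" where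
  "ue_cloner \<mu> \<alpha> desc c k Ob S kB P Q =
     \<lparr>advice_len = \<lambda>_. \<mu> + length desc, advice = \<lambda>_. \<alpha> \<otimes>\<^sub>q basis_state desc, msg_len = \<lambda>_. 2,
      stage1 = \<lambda>_. prep [False, True] \<parallel> idc (\<mu> + length desc),
      stage2 = \<lambda>_. (idc (\<mu> + length desc) \<parallel> (idc c \<parallel> zeros (k - c))) ;; (idc \<mu> \<parallel> Ob) ;; S,
      bob_len = \<lambda>_. kB, bob = \<lambda>_. P, charlie = \<lambda>_. Q\<rparr>"

context
  fixes n \<mu> c k kB kC :: nat and S P Q Ob :: qcircuit and desc :: "bool list" and \<alpha> :: "complex mat"
  assumes P: "q_wf P" "q_in P = n + kB" "q_out P = 1" and Q: "q_wf Q" "q_in Q = n + kC" "q_out Q = 1"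
    and S: "q_wf S" "q_in S = \<mu> + q_out Ob" "q_out S = kB + kC"
    and Ob: "q_wf Ob" "q_in Ob = length desc + k" and ck: "c \<le> k" and \<alpha>: "density \<mu> \<alpha>"
begin

lemma prep_wf: "q_wf (prep xs)"
  using prep_computes by (simp add: computes_def)

lemma ue_cloner_at:
  assumes "4 * (\<mu> + length desc + k + 2) + q_size Ob + q_size S + q_size P + q_size Q + 6 \<le> p"
  shows "cloner_at c n p (ue_cloner \<mu> \<alpha> desc c k Ob S kB P Q) n"
proof -
  let ?A = "ue_cloner \<mu> \<alpha> desc c k Ob S kB P Q"
  have s1: "q_size (stage1 ?A n) \<le> p" "q_wf (stage1 ?A n)"
    using assms prep_wf by (simp_all add: ue_cloner_def par_size) (simp add: prep_def q_size_def q_wires_def)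
  have "q_size (stage2 ?A n) \<le> q_size (idc (\<mu> + length desc) \<parallel> (idc c \<parallel> zeros (k - c))) + q_size (idc \<mu> \<parallel> Ob) + q_size S"
    unfolding ue_cloner_def cloner.simps by (rule order_trans[OF seq_size] add_mono order_refl)+
  then have s2: "q_size (stage2 ?A n) \<le> p" using assms ck by (simp add: par_size)
  have w2: "q_wf (stage2 ?A n)"
    unfolding ue_cloner_def cloner.simps by (intro seq_wf par_wf basic_wf S Ob) (use ck in \<open>simp_all add: S Ob\<close>)
  have "density (\<mu> + length desc) (\<alpha> \<otimes>\<^sub>q basis_state desc)"
    by (rule density_tensor_preparable[OF \<alpha> preparable_basis_state]) simp
  then show ?thesis
    using s1 s2 w2 assms P Q S
    by (simp add: cloner_at_def) (simp add: ue_cloner_def mem_len_def charlie_len_def)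
qed

lemma ue_cloner_run:
  assumes \<omega>: "\<omega> \<in> carrier_mat (2 ^ c) (2 ^ c)"
  shows "run (stage2 (ue_cloner \<mu> \<alpha> desc c k Ob S kB P Q) n) ((\<alpha> \<otimes>\<^sub>q basis_state desc) \<otimes>\<^sub>q \<omega>)
    = run S (\<alpha> \<otimes>\<^sub>q run Ob (basis_state desc \<otimes>\<^sub>q (\<omega> \<otimes>\<^sub>q basis_state (replicate (k - c) False))))"
proof -
  let ?z = "basis_state (replicate (k - c) False)" and ?d = "basis_state desc"
  let ?C1 = "idc (\<mu> + length desc) \<parallel> (idc c \<parallel> zeros (k - c))" and ?C2 = "idc \<mu> \<parallel> Ob"
  have ac: "\<alpha> \<in> carrier_mat (2 ^ \<mu>) (2 ^ \<mu>)" by (rule density_carrier[OF \<alpha>])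
  have zc: "?z \<in> carrier_mat (2 ^ (k - c)) (2 ^ (k - c))" by (rule basis_carrier) simp
  have adc: "\<alpha> \<otimes>\<^sub>q ?d \<in> carrier_mat (2 ^ (\<mu> + length desc)) (2 ^ (\<mu> + length desc))" by (intro tensor_carrier ac basis_carrier refl)
  have oz: "\<omega> \<otimes>\<^sub>q ?z \<in> carrier_mat (2 ^ k) (2 ^ k)" using tensor_carrier[OF \<omega> zc] ck by simp
  have doz: "?d \<otimes>\<^sub>q (\<omega> \<otimes>\<^sub>q ?z) \<in> carrier_mat (2 ^ q_in Ob) (2 ^ q_in Ob)"
    using tensor_carrier[OF basis_carrier[OF refl, of desc] oz] Ob by simp
  have "run (idc c \<parallel> zeros (k - c)) (\<omega> \<otimes>\<^sub>q one_state) = \<omega> \<otimes>\<^sub>q ?z"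
    using run_par[of "idc c" "zeros (k - c)" \<omega> one_state] \<omega> one_state_carrier by simp
  then have 1: "run ?C1 (\<alpha> \<otimes>\<^sub>q ?d \<otimes>\<^sub>q \<omega>) = \<alpha> \<otimes>\<^sub>q ?d \<otimes>\<^sub>q (\<omega> \<otimes>\<^sub>q ?z)"
    using run_par[of "idc (\<mu> + length desc)" "idc c \<parallel> zeros (k - c)" "\<alpha> \<otimes>\<^sub>q ?d" \<omega>] adc \<omega> by simp
  have 2: "run ?C2 (\<alpha> \<otimes>\<^sub>q (?d \<otimes>\<^sub>q (\<omega> \<otimes>\<^sub>q ?z))) = \<alpha> \<otimes>\<^sub>q run Ob (?d \<otimes>\<^sub>q (\<omega> \<otimes>\<^sub>q ?z))"
    using run_par[OF basic_wf(1)[of \<mu>] Ob(1), of \<alpha> "?d \<otimes>\<^sub>q (\<omega> \<otimes>\<^sub>q ?z)"] ac doz by simp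
  have c1: "\<alpha> \<otimes>\<^sub>q ?d \<otimes>\<^sub>q \<omega> \<in> carrier_mat (2 ^ q_in ?C1) (2 ^ q_in ?C1)" using tensor_carrier[OF adc \<omega>] by simp
  have w1: "q_wf ?C1" and w2: "q_wf ?C2" and io: "q_out ?C1 = q_in ?C2"
    using Ob ck by simp_all
  have "run (?C1 ;; ?C2 ;; S) (\<alpha> \<otimes>\<^sub>q ?d \<otimes>\<^sub>q \<omega>) = run S (run (?C1 ;; ?C2) (\<alpha> \<otimes>\<^sub>q ?d \<otimes>\<^sub>q \<omega>))"
    by (rule run_seq[OF seq_wf[OF w1 w2 io] S(1)]) (use c1 S in simp_all)
  also have "run (?C1 ;; ?C2) (\<alpha> \<otimes>\<^sub>q ?d \<otimes>\<^sub>q \<omega>) = run ?C2 (run ?C1 (\<alpha> \<otimes>\<^sub>q ?d \<otimes>\<^sub>q \<omega>))"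
    by (rule run_seq[OF w1 w2 io c1])
  also have "\<dots> = \<alpha> \<otimes>\<^sub>q run Ob (?d \<otimes>\<^sub>q (\<omega> \<otimes>\<^sub>q ?z))"
    unfolding 1 using 2 by (simp only: tensor_assoc)
  finally show ?thesis unfolding ue_cloner_def cloner.simps .
qed

text \<open>The message is deterministic: all weight is on \<open>[False, True]\<close>, so the
  challenge for bit \<open>b\<close> is an encryption of \<open>b\<close> itself.\<close>

lemma ue_cloner_win_prob:
  assumes c: "c = q_out (Enc n)"
  shows "ue_win_prob Enc (ue_cloner \<mu> \<alpha> desc c k Ob S kB P Q) n
    = measure_pmf.expectation (pmf_of_set (bitstrings n)) (\<lambda>s. \<Sum>b\<in>UNIV. both_output_prob P Q kB kC s s
        (run S (\<alpha> \<otimes>\<^sub>q run Ob (basis_state desc \<otimes>\<^sub>q (ciphertext Enc n s b \<otimes>\<^sub>q basis_state (replicate (k - c) False))))) b / 2)"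
proof -
  let ?A = "ue_cloner \<mu> \<alpha> desc c k Ob S kB P Q" and ?a = "\<alpha> \<otimes>\<^sub>q basis_state desc" and ?q = "\<mu> + length desc"
  let ?G = "\<lambda>\<omega> s b. both_output_prob P Q kB kC s s (run S (\<alpha> \<otimes>\<^sub>q run Ob (basis_state desc \<otimes>\<^sub>q (\<omega> \<otimes>\<^sub>q basis_state (replicate (k - c) False))))) b"
  have adc: "?a \<in> carrier_mat (2 ^ ?q) (2 ^ ?q)" by (intro tensor_carrier density_carrier[OF \<alpha>] basis_carrier refl)
  have sel: "msg_len ?A n = 2" "mem_len ?A n = ?q" "msg_len ?A n \<le> q_out (stage1 ?A n)" "bob ?A n = P" "charlie ?A n = Q" "bob_len ?A n = kB"
     "charlie_len ?A n = kC" "q_wf (stage2 ?A n)" "q_in (stage2 ?A n) = ?q + c" "q_out (stage2 ?A n) = kB + kC"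
    using ue_cloner_at[OF order_refl] S by (simp_all add: cloner_at_def) (simp_all add: ue_cloner_def mem_len_def charlie_len_def S)
  have "run (prep [False, True] \<parallel> idc ?q) (one_state \<otimes>\<^sub>q ?a) = basis_state [False, True] \<otimes>\<^sub>q ?a"
    using run_par[OF prep_wf[of "[False, True]"] basic_wf(1)[of ?q], of one_state ?a] adc one_state_carrier by (simp add: run_prep)
  then have s1: "run (stage1 ?A n) (advice ?A n) = basis_state [False, True] \<otimes>\<^sub>q ?a" by (simp add: ue_cloner_def)
  have FT: "basis_state [False, True] \<in> carrier_mat (2 ^ 2) (2 ^ 2)" by (rule basis_carrier) simp
  have mem: "memory_after ?A n z = complex_of_real (of_bool (z = [False, True])) \<cdot>\<^sub>m ?a" if "z \<in> bitstrings 2" for z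
  proof (rule mat_eq_ent[of _ ?q])
    fix r c assume rc: "r \<subseteq> {..<?q}" "c \<subseteq> {..<?q}"
    have z: "length z = 2" "true_bits z \<subseteq> {..<2}" using that true_bits_subset[of z] by (auto simp: bitstrings_def)
    have "ent (memory_after ?A n z) r c = ent (basis_state [False, True] \<otimes>\<^sub>q ?a) (true_bits z \<union> (+) 2 ` r) (true_bits z \<union> (+) 2 ` c)"
      using ent_memory_after[of z ?A n r c] z rc sel by (simp add: s1)
    also have "\<dots> = of_bool (z = [False, True]) * ent ?a r c"
    proof -
      have "true_bits z \<subseteq> {..<length [False, True]}" using z by (simp add: numeral_2_eq_2)
      then have "ent (basis_state [False, True]) (true_bits z) (true_bits z) = of_bool (z = [False, True])"
        using z by (simp only: ent_basis_state) (simp add: true_bits_inj)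
      then show ?thesis using z rc by (simp only: ent_tensor[OF FT adc])
    qed
    also have "\<dots> = ent (complex_of_real (of_bool (z = [False, True])) \<cdot>\<^sub>m ?a) r c"
      using adc rc set_encode_less by (auto simp: ent_def)
    finally show "ent (memory_after ?A n z) r c = ent (complex_of_real (of_bool (z = [False, True])) \<cdot>\<^sub>m ?a) r c" .
  qed (use memory_after_carrier[of ?A n z] adc sel in simp_all)
  have clone: "clone_prob ?A n z \<omega> s s b = of_bool (z = [False, True]) * ?G \<omega> s b"
    if z: "z \<in> bitstrings 2" and \<omega>: "\<omega> \<in> carrier_mat (2 ^ c) (2 ^ c)" for z \<omega> s b
  proof -
    have car: "?a \<otimes>\<^sub>q \<omega> \<in> carrier_mat (2 ^ q_in (stage2 ?A n)) (2 ^ q_in (stage2 ?A n))" using tensor_carrier[OF adc \<omega>] sel by simp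
    have rc: "run (stage2 ?A n) (?a \<otimes>\<^sub>q \<omega>) \<in> carrier_mat (2 ^ (kB + kC)) (2 ^ (kB + kC))"
      using run_carrier[of "stage2 ?A n"] sel by metis
    show ?thesis
      unfolding clone_prob_def mem[OF z] tensor_smult run_smult[OF sel(8) car] sel(4-7) ue_cloner_run[OF \<omega>]
        both_output_prob_smult[OF rc[unfolded ue_cloner_run[OF \<omega>]]] ..
  qed
  have "(\<Sum>z\<in>bitstrings 2. (\<Sum>b\<in>UNIV. clone_prob ?A n z (ciphertext Enc n s (z ! of_bool b)) s s b) / 2)
      = (\<Sum>b\<in>UNIV. ?G (ciphertext Enc n s b) s b / 2)" for s
  proof -
    have cc: "ciphertext Enc n s b \<in> carrier_mat (2 ^ c) (2 ^ c)" for b unfolding ciphertext_def c by (rule run_carrier)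
    have "(\<Sum>z\<in>bitstrings 2. (\<Sum>b\<in>UNIV. clone_prob ?A n z (ciphertext Enc n s (z ! of_bool b)) s s b) / 2)
        = (\<Sum>z\<in>bitstrings 2. if z = [False, True] then \<Sum>b\<in>UNIV. ?G (ciphertext Enc n s b) s b / 2 else 0)"
    proof (intro sum.cong refl)
      fix z assume z: "z \<in> bitstrings 2"
      show "(\<Sum>b\<in>UNIV. clone_prob ?A n z (ciphertext Enc n s (z ! of_bool b)) s s b) / 2
          = (if z = [False, True] then \<Sum>b\<in>UNIV. ?G (ciphertext Enc n s b) s b / 2 else 0)"
        by (simp add: clone[OF z cc] sum_divide_distrib UNIV_bool)
    qed
    also have "\<dots> = (\<Sum>b\<in>UNIV. ?G (ciphertext Enc n s b) s b / 2)"
      by (subst sum.delta) (auto simp: bitstrings_def[of 2] finite_bitstrings[of 2, unfolded bitstrings_def])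
    finally show ?thesis .
  qed
  then show ?thesis unfolding ue_win_prob_def by simp
qed

end

text \<open>A point below the threshold loses more than the square root of
  \<open>\<bar>\<epsilon>\<bar>\<close>, while the average loss is at most
  \<open>\<epsilon>\<close>. This threshold makes both the error at good points and the fraction of
  bad points negligible when \<open>\<epsilon>\<close> is.\<close>

lemma markov:
  fixes P :: "'a \<Rightarrow> real" and \<epsilon> :: real
  assumes X: "finite X" and P: "\<And>x. x \<in> X \<Longrightarrow> P x \<le> 1" and avg: "(\<Sum>x\<in>X. P x) \<ge> (1 - \<epsilon>) * real (card X)"
  shows "real (card {x\<in>X. P x < 1 - sqrt \<bar>\<epsilon>\<bar>}) \<le> sqrt \<bar>\<epsilon>\<bar> * card X"
proof -
  let ?\<delta> = "sqrt \<bar>\<epsilon>\<bar>" and ?B = "{x\<in>X. P x < 1 - sqrt \<bar>\<epsilon>\<bar>}"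
  have "card ?B * ?\<delta> = (\<Sum>x\<in>?B. ?\<delta>)" by simp
  also have "\<dots> \<le> (\<Sum>x\<in>?B. 1 - P x)" by (intro sum_mono) auto
  also have "\<dots> \<le> (\<Sum>x\<in>X. 1 - P x)" using X P by (intro sum_mono2) auto
  also have "\<dots> = card X - (\<Sum>x\<in>X. P x)" by (simp add: sum_subtractf)
  also have "\<dots> \<le> \<epsilon> * card X" using avg by (simp add: algebra_simps)
  also have "\<dots> \<le> \<bar>\<epsilon>\<bar> * card X" by (intro mult_right_mono) auto
  also have "\<dots> = ?\<delta> * (?\<delta> * card X)" by (simp flip: mult.assoc)
  finally have *: "card ?B * ?\<delta> \<le> ?\<delta> * (?\<delta> * card X)" .
  show ?thesis
  proof (cases "?\<delta> = 0")
    \<comment> \<open>Division by \<open>?\<delta>\<close> is impossible here. But the nonnegative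
      losses then sum to 0, so no point is bad.\<close>
    case True
    then have "\<epsilon> = 0" by simp
    then have "(\<Sum>x\<in>X. 1 - P x) \<le> 0" using avg by (simp add: sum_subtractf)
    moreover have nn: "\<And>x. x \<in> X \<Longrightarrow> 0 \<le> 1 - P x" using P by simp
    moreover have "(\<Sum>x\<in>X. 1 - P x) \<ge> 0" by (rule sum_nonneg[OF nn])
    ultimately have "\<forall>x\<in>X. 1 - P x = 0" using sum_nonneg_eq_0_iff[OF X, of "\<lambda>x. 1 - P x"] by fastforce
    then have "?B = {}" using \<open>\<epsilon> = 0\<close> by auto
    then show ?thesis by (simp only: card.empty) simp
  next
    case False
    then have "?\<delta> > 0" by simp
    with * show ?thesis by (simp add: mult.commute)
  qed
qed

lemma qpt_1:
  assumes "qpt 1 (\<lambda>ns. F (ns ! 0))"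
  shows "q_wf (F l)" "poly_bounded (\<lambda>l. q_size (F l))"
proof -
  have "\<forall>ns. length ns = 1 \<longrightarrow> q_wf (F (ns ! 0))" using assms by (simp add: qpt_def)
  from this[rule_format, of "[l]"] show "q_wf (F l)" by simp
  obtain c where "\<forall>ns. length ns = 1 \<longrightarrow> q_size (F (ns ! 0)) \<le> sum_list ns ^ c + c" using assms by (auto simp: qpt_def)
  from this[rule_format, of "[l]" for l] show "poly_bounded (\<lambda>l. q_size (F l))"
    unfolding poly_bounded_def by auto
qed

lemma qpt_obfuscator_Obf:
  assumes "qpt_obfuscator Obf Eval" and "poly_bounded L" "poly_bounded k"
  shows "q_wf (Obf l L' k')" "q_in (Obf l L' k') = L' + k'" "poly_bounded (\<lambda>l. q_size (Obf l (L l) (k l)))"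
proof -
  have Q: "qpt 3 (\<lambda>ns. Obf (ns ! 0) (ns ! 1) (ns ! 2))" using assms by (simp add: qpt_obfuscator_def)
  then have "\<forall>ns. length ns = 3 \<longrightarrow> q_wf (Obf (ns ! 0) (ns ! 1) (ns ! 2))" by (simp add: qpt_def)
  from this[rule_format, of "[l, L', k']"] show "q_wf (Obf l L' k')" by simp
  show "q_in (Obf l L' k') = L' + k'" using assms by (simp add: qpt_obfuscator_def)
  obtain c where "\<forall>ns. length ns = 3 \<longrightarrow> q_size (Obf (ns ! 0) (ns ! 1) (ns ! 2)) \<le> sum_list ns ^ c + c"
    using Q by (auto simp: qpt_def)
  from this[rule_format, of "[l, L l, k l]" for l] have le: "q_size (Obf l (L l) (k l)) \<le> (l + (L l + k l)) ^ c + c" for l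
    by simp
  show "poly_bounded (\<lambda>l. q_size (Obf l (L l) (k l)))"
    by (rule poly_bounded_mono[OF _ le]) (intro poly_bounded_intros assms)
qed

text \<open>Fallback for security parameters at which there is nothing to obfuscate.\<close>

definition const_circ :: "nat \<Rightarrow> nat \<Rightarrow> qcircuit" where
  "const_circ a m = QCircuit a m [] [a..<a + m]"

lemma const_circ_simps [simp]: "q_in (const_circ a m) = a" "q_out (const_circ a m) = m" "q_wf (const_circ a m)"
  "q_size (const_circ a m) = a + 2 * m"
  by (auto simp: const_circ_def q_wf_iff q_wires_def q_size_def)

lemma const_circ_implementation:
  assumes "e \<ge> 0"
  shows "implementation n m k (1 - e) (const_circ (k + n) m) (basis_state (replicate k False)) (\<lambda>_. replicate m False)"
  unfolding implementation_def
proof (intro conjI ballI)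
  show "density k (basis_state (replicate k False))"
    by (intro preparable_density preparable_basis_state) simp
  have c: "computes (const_circ (k + n) m) (\<lambda>_. replicate m False)"
  proof (rule classical_computes)
    fix xs :: "bool list" assume "length xs = q_in (const_circ (k + n) m)"
    then show "replicate m False = map (\<lambda>w. w \<in> fwd (q_gates (const_circ (k + n) m)) (true_bits xs)) (q_outs (const_circ (k + n) m))"
      by (intro nth_equalityI) (auto simp: const_circ_def mem_true_bits)
  qed (auto simp: const_circ_def q_wf_iff q_wires_def)
  fix x assume x: "x \<in> bitstrings n"
  have "run (const_circ (k + n) m) (basis_state (replicate k False @ x)) = basis_state (replicate m False)"
    using computes_maps[OF c] x by (auto simp: maps_def bitstrings_def)
  then have "outcome_prob (const_circ (k + n) m) (basis_state (replicate k False) \<otimes>\<^sub>q basis_state x) (replicate m False) = 1"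
    by (simp add: outcome_prob_ent basis_state_append ent_basis_state)
  then show "1 - e \<le> outcome_prob (const_circ (k + n) m) (basis_state (replicate k False) \<otimes>\<^sub>q basis_state x) (replicate m False)"
    using assms by simp
qed (auto simp: bitstrings_def)

lemma length_enc_le:
  assumes "q_wf C" "q_size C \<le> s" "8 * (s + 1) ^ 2 \<le> L"
  shows "length (enc_qcircuit C) \<le> L"
proof -
  have "8 * (q_size C + 1) ^ 2 \<le> 8 * (s + 1) ^ 2" using assms(2) by (intro mult_le_mono2 power_mono) auto
  then show ?thesis using length_enc_qcircuit[OF assms(1)] assms(3) by linarith
qed

text \<open>Correctness of the obfuscator gives an error bound for one circuit per security
  parameter, while one bound for all keys is wanted. There are finitely many keys and inputs at each
  parameter, so a family of worst circuits bounds all of them.\<close>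

lemma qsio_upo_correct:
  assumes qs: "qsio Obf Eval" and W: "keyed_circuit_class W" and poly: "poly_bounded L" "poly_bounded k"
    and S: "\<And>l s. s \<in> keys W l \<Longrightarrow> b_wf (in_len W l) (out_len W l) (circ W l s) \<and> b_size (circ W l s) = S l"
    and G: "\<And>l. k l + in_len W l + 3 * S l + 3 * out_len W l \<le> G l" and L: "\<And>l. 8 * (G l + 1) ^ 2 \<le> L l"
  shows "upo_correct W L k Obf Eval"
proof -
  let ?n = "in_len W" and ?m = "out_len W"
  let ?z = "\<lambda>l. basis_state (replicate (k l) False)"
  define pr where "pr l C x y = obf_eval_prob Obf Eval l (?n l) (?m l) (L l) (k l) C (?z l) x y" for l C x y
  let ?C = "\<lambda>l s. b_to_q (k l) (circ W l s)" and ?f = "\<lambda>l s. b_eval (circ W l s)"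
  \<comment> \<open>At some input, \<open>C\<close> does no better than a given key at a given
    input, for every key and every input of the class. The error is 0, as classical circuits are
    exact.\<close>
  define V where "V l C f \<longleftrightarrow> length (enc_qcircuit C) \<le> L l \<and> implementation (?n l) (?m l) (k l) (1 - 0) C (?z l) f
      \<and> (\<forall>s\<in>keys W l. \<forall>x\<in>bitstrings (?n l). \<exists>x'\<in>bitstrings (?n l). pr l C x' (f x') \<le> pr l (?C l s) x (?f l s x))" for l C f
  have ex: "\<exists>Cf. V l (fst Cf) (snd Cf)" for l
  proof (cases "keys W l = {}")
    case True
    have "length (enc_qcircuit (const_circ (k l + ?n l) (?m l))) \<le> L l"
      by (rule length_enc_le[OF _ _ L]) (use G[of l] in simp_all)
    then have "V l (const_circ (k l + ?n l) (?m l)) (\<lambda>_. replicate (?m l) False)"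
      using const_circ_implementation[of 0 "?n l" "?m l" "k l"] True by (simp add: V_def)
    then show ?thesis by (intro exI[of _ "(const_circ (k l + ?n l) (?m l), \<lambda>_. replicate (?m l) False)"]) simp
  next
    case False
    let ?X = "(\<lambda>(s, x). pr l (?C l s) x (?f l s x)) ` (keys W l \<times> bitstrings (?n l))"
    have "finite (keys W l)"
      using W finite_subset[OF _ finite_bitstrings] by (auto simp: keyed_circuit_class_def)
    then have fin: "finite ?X" by simp
    have "bitstrings (?n l) \<noteq> {}" using card_bitstrings[of "?n l"] by auto
    then have "?X \<noteq> {}" using False by simp
    then have "Min ?X \<in> ?X" using fin by (rule Min_in[rotated])
    then obtain s x where sx: "s \<in> keys W l" "x \<in> bitstrings (?n l)" "Min ?X = pr l (?C l s) x (?f l s x)" by auto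
    have min: "pr l (?C l s) x (?f l s x) \<le> pr l (?C l s') x' (?f l s' x')" if "s' \<in> keys W l" "x' \<in> bitstrings (?n l)" for s' x'
      unfolding sx(3)[symmetric] by (rule Min_le[OF fin]) (use that in auto)
    have w: "b_wf (?n l) (?m l) (circ W l s)" "b_size (circ W l s) = S l" using S[OF sx(1)] by auto
    have "q_wf (?C l s)" using b_to_q_computes[OF w(1)] by (simp add: computes_def)
    moreover have "q_size (?C l s) \<le> G l"
      using b_to_q_size[of "k l" "circ W l s"] w G[of l] by (auto simp: b_wf_def)
    ultimately have "length (enc_qcircuit (?C l s)) \<le> L l" by (rule length_enc_le[OF _ _ L])
    then have "V l (?C l s) (?f l s)"
      unfolding V_def using b_to_q_implementation[OF w(1), of 0 "k l"] min sx(2) by auto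
    then show ?thesis by (intro exI[of _ "(?C l s, ?f l s)"]) simp
  qed
  have "\<exists>Cf. \<forall>l. V l (fst (Cf l)) (snd (Cf l))" by (rule choice[OF allI[OF ex]])
  then obtain Cf where V: "\<And>l. V l (fst (Cf l)) (snd (Cf l))" by blast
  define C f where "C l = fst (Cf l)" and "f l = snd (Cf l)" for l
  have V: "V l (C l) (f l)" for l using V by (simp add: C_def f_def)
  have neg: "negl_implementation ?n ?m L k C ?z f"
    unfolding negl_implementation_def
    using W poly V negligible_0 by (auto simp: V_def keyed_circuit_class_def)
  have "qsio_correct Obf Eval" using qs by (simp add: qsio_def)
  from this[unfolded qsio_correct_def, rule_format, OF neg]
  obtain \<epsilon> where \<epsilon>: "negligible \<epsilon>" "\<And>l x. x \<in> bitstrings (?n l) \<Longrightarrow> pr l (C l) x (f l x) \<ge> 1 - \<epsilon> l"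
    unfolding pr_def by blast
  show ?thesis
    unfolding upo_correct_def
  proof (intro exI[of _ \<epsilon>] conjI allI ballI)
    fix l s x assume s: "s \<in> keys W l" and x: "x \<in> bitstrings (?n l)"
    have "\<forall>s\<in>keys W l. \<forall>x\<in>bitstrings (?n l). \<exists>x'\<in>bitstrings (?n l). pr l (C l) x' (f l x') \<le> pr l (?C l s) x (?f l s x)"
      using V[of l] unfolding V_def by (elim conjE)
    from bspec[OF bspec[OF this s] x] obtain x' where "x' \<in> bitstrings (?n l)" "pr l (C l) x' (f l x') \<le> pr l (?C l s) x (?f l s x)" ..
    then have "1 - \<epsilon> l \<le> pr l (?C l s) x (?f l s x)" using \<epsilon>(2)[of x' l] by linarith
    then show "1 - \<epsilon> l \<le> outcome_prob (Eval l (q_out (Obf l (L l) (k l))) (?n l) (?m l))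
          (obfuscate_classical Obf l (L l) (k l) (circ W l s) \<otimes>\<^sub>q basis_state x) (b_eval (circ W l s) x)"
      by (simp only: pr_def obf_eval_prob_def obfuscate_classical_def)
  qed (rule \<epsilon>(1))
qed

section \<open>Generalized security\<close>

text \<open>
  The winning probability is linear in the memory, and the traces of the memories after the possible
  messages sum to 1; so a bound for one fixed message and normalized memories suffices.
\<close>

lemma upo_win_prob_le:
  assumes W: "keyed_circuit_class W" and A: "cloner_wf (\<lambda>l. q_out (Obf l (L l) (k l))) (in_len W) A" and B: "0 \<le> B"
    and bound: "\<And>s \<mu>\<^sub>B \<mu>\<^sub>C z \<alpha>. upo_msg W q l z (s, \<mu>\<^sub>B, \<mu>\<^sub>C) \<Longrightarrow> density (mem_len A l) \<alpha> \<Longrightarrow>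
      (\<Sum>x\<in>bitstrings (in_len W l). \<Sum>b\<in>UNIV. both_output_prob (bob A l) (charlie A l) (bob_len A l) (charlie_len A l) x x
        (run (stage2 A l) (\<alpha> \<otimes>\<^sub>q obfuscate_classical Obf l (L l) (k l) (if b then GP l s x x \<mu>\<^sub>B \<mu>\<^sub>C else circ W l s))) b / 2)
      / 2 ^ in_len W l \<le> B"
  shows "upo_win_prob W GP L k Obf (Id_U (in_len W)) q A l \<le> B"
proof -
  let ?n = "in_len W l"
  let ?F = "\<lambda>\<alpha> \<omega> x b. both_output_prob (bob A l) (charlie A l) (bob_len A l) (charlie_len A l) x x (run (stage2 A l) (\<alpha> \<otimes>\<^sub>q \<omega>)) b"
  have wf: "q_wf (stage1 A l)" "density (advice_len A l) (advice A l)" "q_in (stage1 A l) = advice_len A l"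
      "msg_len A l \<le> q_out (stage1 A l)" and wf2: "q_wf (stage2 A l)" "q_in (stage2 A l) = mem_len A l + q_out (Obf l (L l) (k l))"
      "q_out (stage2 A l) = bob_len A l + charlie_len A l"
    using A by (auto simp: cloner_wf_def poly_size_def charlie_len_def)
  obtain w \<alpha> where w: "\<And>z. z \<in> bitstrings (msg_len A l) \<Longrightarrow> w z \<ge> 0 \<and> density (mem_len A l) (\<alpha> z)
      \<and> memory_after A l z = complex_of_real (w z) \<cdot>\<^sub>m \<alpha> z" and w1: "(\<Sum>z\<in>bitstrings (msg_len A l). w z) = 1"
    using memory_after_normalize[OF wf] by blast
  have clone: "clone_prob A l z \<omega> x x b = w z * ?F (\<alpha> z) \<omega> x b"
    if z: "z \<in> bitstrings (msg_len A l)" and \<omega>: "\<omega> \<in> carrier_mat (2 ^ q_out (Obf l (L l) (k l))) (2 ^ q_out (Obf l (L l) (k l)))" for z \<omega> x b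
  proof -
    have car: "\<alpha> z \<otimes>\<^sub>q \<omega> \<in> carrier_mat (2 ^ q_in (stage2 A l)) (2 ^ q_in (stage2 A l))"
      using tensor_carrier[OF density_carrier \<omega>] w[OF z] wf2 by simp
    have rc: "run (stage2 A l) (\<alpha> z \<otimes>\<^sub>q \<omega>) \<in> carrier_mat (2 ^ (bob_len A l + charlie_len A l)) (2 ^ (bob_len A l + charlie_len A l))"
      using run_carrier[of "stage2 A l"] wf2 by metis
    have m: "memory_after A l z = complex_of_real (w z) \<cdot>\<^sub>m \<alpha> z" using w[OF z] by simp
    show ?thesis unfolding clone_prob_def m tensor_smult run_smult[OF wf2(1) car] both_output_prob_smult[OF rc] ..
  qed
  have "upo_win_prob W GP L k Obf (Id_U (in_len W)) q A l \<le> (\<Sum>z\<in>bitstrings (msg_len A l). w z * B)"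
    unfolding upo_win_prob_def
  proof (rule sum_mono)
    fix z assume z: "z \<in> bitstrings (msg_len A l)"
    show "(if \<exists>t. upo_msg W q l z t
        then case THE t. upo_msg W q l z t of (s, \<mu>\<^sub>B, \<mu>\<^sub>C) \<Rightarrow>
          measure_pmf.expectation (Id_U (in_len W) l) (\<lambda>(x\<^sub>B, x\<^sub>C).
            (\<Sum>b\<in>UNIV. clone_prob A l z (obfuscate_classical Obf l (L l) (k l)
                  (if b then GP l s x\<^sub>B x\<^sub>C \<mu>\<^sub>B \<mu>\<^sub>C else circ W l s)) x\<^sub>B x\<^sub>C b) / 2)
        else 0) \<le> w z * B"
    proof (cases "\<exists>t. upo_msg W q l z t")
      case True
      then obtain s \<mu>\<^sub>B \<mu>\<^sub>C where msg: "upo_msg W q l z (s, \<mu>\<^sub>B, \<mu>\<^sub>C)" by auto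
      then have the: "(THE t. upo_msg W q l z t) = (s, \<mu>\<^sub>B, \<mu>\<^sub>C)"
        using upo_msg_unique[OF W] by (intro the_equality) blast+
      let ?\<omega> = "\<lambda>x b. obfuscate_classical Obf l (L l) (k l) (if b then GP l s x x \<mu>\<^sub>B \<mu>\<^sub>C else circ W l s)"
      have \<omega>: "?\<omega> x b \<in> carrier_mat (2 ^ q_out (Obf l (L l) (k l))) (2 ^ q_out (Obf l (L l) (k l)))" for x b
        unfolding obfuscate_classical_def obfuscate_def by (rule run_carrier)
      have ne: "bitstrings ?n \<noteq> {}" using card_bitstrings[of ?n] by auto
      have "measure_pmf.expectation (Id_U (in_len W) l) (\<lambda>(x\<^sub>B, x\<^sub>C).
            (\<Sum>b\<in>UNIV. clone_prob A l z (obfuscate_classical Obf l (L l) (k l)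
                  (if b then GP l s x\<^sub>B x\<^sub>C \<mu>\<^sub>B \<mu>\<^sub>C else circ W l s)) x\<^sub>B x\<^sub>C b) / 2)
          = (\<Sum>x\<in>bitstrings ?n. (\<Sum>b\<in>UNIV. clone_prob A l z (?\<omega> x b) x x b) / 2) / 2 ^ ?n"
        by (simp add: Id_U_def integral_map_pmf integral_pmf_of_set[OF ne finite_bitstrings] card_bitstrings
            flip: sum_divide_distrib)
      also have "\<dots> = w z * ((\<Sum>x\<in>bitstrings ?n. \<Sum>b\<in>UNIV. ?F (\<alpha> z) (?\<omega> x b) x b / 2) / 2 ^ ?n)"
        unfolding clone[OF z \<omega>] by (simp add: sum_distrib_left sum_divide_distrib)
      also have "\<dots> \<le> w z * B"
        using bound[OF msg, of "\<alpha> z"] w[OF z] by (intro mult_left_mono) auto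
      finally show ?thesis using True the by simp
    next
      case False
      then show ?thesis using w[OF z] B by simp
    qed
  qed
  also have "\<dots> = B" using w1 by (simp flip: sum_distrib_right)
  finally show ?thesis .
qed

lemma expectation_bitstrings:
  fixes F :: "bool list \<Rightarrow> real"
  shows "measure_pmf.expectation (pmf_of_set (bitstrings n)) F = (\<Sum>x\<in>bitstrings n. F x) / 2 ^ n"
proof -
  have "bitstrings n \<noteq> {}" using card_bitstrings[of n] by auto
  then show ?thesis by (simp add: integral_pmf_of_set card_bitstrings)
qed

lemma q_out_le_size: "q_out Q \<le> q_size Q"
  by (simp add: q_size_def)

text \<open>\<open>G\<close> bounds the sizes of the circuits that get obfuscated, with the constant
  of \<open>switch_size\<close>, and \<open>L\<close> leaves room for their descriptions by
  \<open>length_enc_qcircuit\<close>. The proof compares the games point by point, bounds the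
  exceptional points by \<open>markov\<close> and averages the rest into the encryption
  game.\<close>

lemma qsio_upo_secure:
  assumes ue: "key_testable_ue Enc Dec Test" and qs: "qsio Obf Eval" and gp: "generalized_puncturable W GP"
    and grow: "\<forall>\<^sub>F l in sequentially. l \<le> in_len W l ^ c\<^sub>0"
    and poly: "poly_bounded L" "poly_bounded k"
    and Sz: "\<And>l s. s \<in> keys W l \<Longrightarrow> b_wf (in_len W l) (out_len W l) (circ W l s) \<and> b_size (circ W l s) = Sz l"
    and ck: "\<And>l. q_out (Enc (in_len W l)) \<le> k l"
    and G: "\<And>l. 60 * (in_len W l + out_len W l + q_out (Enc (in_len W l)) + k l + q_size (Test (in_len W l))
        + q_size (Dec (in_len W l)) + Sz l + q l + 2) \<le> G l"
    and L: "\<And>l. 8 * (G l + 1) ^ 2 \<le> L l"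
  shows "generalized_upo_secure W GP L k Obf (Id_U (in_len W)) q"
  unfolding generalized_upo_secure_def
proof (intro allI impI negligibleI_bound)
  fix A d
  assume A: "cloner_wf (\<lambda>l. q_out (Obf l (L l) (k l))) (in_len W) A"
  define n m c N where "n = in_len W" and "m = out_len W" and "c l = q_out (Enc (n l))" and "N l = q_out (Obf l (L l) (k l))" for l
  define S P Q where "S = stage2 A" and "P = bob A" and "Q = charlie A"
  define \<mu> kB kC where "\<mu> l = mem_len A l" and "kB l = bob_len A l" and "kC l = charlie_len A l" for l
  have Wc: "keyed_circuit_class W" and gpc: "gen_puncture_correct W GP" using gp by (auto simp: generalized_puncturable_def)
  have polynm: "poly_bounded n" "poly_bounded m" using Wc by (auto simp: keyed_circuit_class_def n_def m_def)
  have syn: "ue_syntax Enc Dec Test" and corr: "ue_correct Enc Dec" and unc: "unclonable_indistinguishable Enc" and kt: "key_testable Enc Test"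
    using ue by (auto simp: key_testable_ue_def)
  have qE: "q_wf (Enc j)" "poly_bounded (\<lambda>j. q_size (Enc j))" "q_in (Enc j) = j + 1" for j
    using syn qpt_1[of Enc] by (auto simp: ue_syntax_def)
  have qT: "q_wf (Test j)" "q_in (Test j) = j + q_out (Enc j)" "q_out (Test j) = 1" for j
    using syn qpt_1[of Test] by (auto simp: ue_syntax_def)
  have qD: "q_wf (Dec j)" "q_in (Dec j) = j + q_out (Enc j)" "q_out (Dec j) = 1" for j
    using syn qpt_1[of Dec] by (auto simp: ue_syntax_def)
  have qob: "qpt_obfuscator Obf Eval" and qsec: "qsio_secure Obf" using qs by (auto simp: qsio_def)
  note Ob = qpt_obfuscator_Obf[OF qob poly]
  have st: "q_wf (stage1 A l)" "q_wf (S l)" "q_wf (P l)" "q_wf (Q l)" and psize: "poly_bounded (\<lambda>l. q_size (stage1 A l))"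
    "poly_bounded (\<lambda>l. q_size (S l))" "poly_bounded (\<lambda>l. q_size (P l))" "poly_bounded (\<lambda>l. q_size (Q l))"
    and io: "q_in (S l) = \<mu> l + N l" "q_out (S l) = kB l + kC l" "q_in (P l) = n l + kB l" "q_out (P l) = 1" "q_in (Q l) = n l + kC l" "q_out (Q l) = 1"
    for l
    using A by (auto simp: cloner_wf_def poly_size_def S_def P_def Q_def \<mu>_def kB_def kC_def charlie_len_def N_def n_def)
  have \<mu>le: "\<mu> l \<le> q_size (stage1 A l)" for l
    using q_out_le_size[of "stage1 A l"] by (simp add: \<mu>_def mem_len_def)
  have kBle: "kB l + kC l \<le> q_size (S l)" for l
    using q_out_le_size[of "S l"] io by simp
  obtain \<epsilon> where \<epsilon>: "negligible \<epsilon>" and dec: "\<And>l b. measure_pmf.expectation (pmf_of_set (bitstrings l))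
       (\<lambda>sk. outcome_prob (Dec l) (basis_state sk \<otimes>\<^sub>q ciphertext Enc l sk b) [b]) \<ge> 1 - \<epsilon> l"
    using corr by (auto simp: ue_correct_def)
  \<comment> \<open>Plays two roles: the decryption error allowed at a good point, and the bound on
    the fraction of bad points.\<close>
  define \<delta> where "\<delta> l = sqrt \<bar>\<epsilon> (n l)\<bar>" for l
  have \<delta>: "negligible \<delta>" "\<And>l. \<delta> l \<ge> 0"
    using negligible_sqrt[OF negligible_compose[OF \<epsilon> grow]] by (simp_all add: \<delta>_def[abs_def] n_def)
  \<comment> \<open>The size bound of \<open>attack_simps\<close>.\<close>
  define p where "p l = 30 * (n l + \<mu> l + N l + kB l + kC l + q_size (S l) + q_size (P l) + q_size (Q l) + 2)" for l
  have pN: "poly_bounded N" by (rule poly_bounded_mono[OF Ob(3)]) (simp add: N_def q_out_le_size)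
  have p\<mu>: "poly_bounded \<mu>" by (rule poly_bounded_mono[OF psize(1) \<mu>le])
  have pk: "poly_bounded kB" "poly_bounded kC"
    by (rule poly_bounded_mono[OF psize(2)], use kBle add_leD1 in blast, rule poly_bounded_mono[OF psize(2)], use kBle add_leD2 in blast)
  have pp: "poly_bounded p" unfolding p_def by (intro poly_bounded_intros polynm p\<mu> pN pk psize)
  \<comment> \<open>The size bound required by \<open>ue_cloner_at\<close>, with a description of
    length \<open>L l\<close>.\<close>
  define Bd where "Bd l = 4 * (\<mu> l + L l + k l + 2) + q_size (Obf l (L l) (k l)) + q_size (S l) + q_size (P l) + q_size (Q l) + 6" for l
  have "poly_bounded Bd" unfolding Bd_def by (intro poly_bounded_intros p\<mu> Ob psize poly)
  then obtain e where e: "\<And>l. Bd l \<le> (l + 2) ^ e" by (auto simp: poly_bounded_iff)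
  \<comment> \<open>Adversaries against encryption are measured in \<open>j = n l\<close>, so the
    bound \<open>(l + 2) ^ e\<close> is rewritten using \<open>l \<le> j ^ c\<^sub>0\<close>. The
    second summand is what \<open>unclonable_uniform\<close> asks for.\<close>
  define p' where "p' j = (j ^ c\<^sub>0 + 2) ^ e + (j + q_out (Enc j) + 4)" for j
  have pE: "poly_bounded (\<lambda>j. q_out (Enc j))" by (rule poly_bounded_mono[OF qE(2)]) (rule q_out_le_size)
  have pp': "poly_bounded p'" unfolding p'_def by (intro poly_bounded_intros pE)
  have E1: "\<forall>\<^sub>F l in sequentially. \<forall>f I\<^sub>0 I\<^sub>1 X. qsio_instance Obf l (n l) (m l) (L l) (k l) (\<delta> l) (p l) f I\<^sub>0 I\<^sub>1 X \<longrightarrow>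
    \<bar>qsio_prob Obf l (L l) (k l) X I\<^sub>0 - qsio_prob Obf l (L l) (k l) X I\<^sub>1\<bar> \<le> 1 / real l ^ Suc d"
  proof (rule qsio_secure_uniform[OF qsec polynm poly pp \<delta>(1)])
    fix l
    \<comment> \<open>A valid instance at every \<open>l\<close>: the same constant circuit twice,
      and a distinguisher that outputs an ancilla.\<close>
    let ?I = "(const_circ (k l + n l) (m l), basis_state (replicate (k l) False))"
    have "length (enc_qcircuit (fst ?I)) \<le> L l"
      by (rule length_enc_le[OF _ _ L]) (use G[of l] in \<open>simp_all add: n_def m_def\<close>)
    then have "qsio_instance Obf l (n l) (m l) (L l) (k l) (\<delta> l) (p l) (\<lambda>_. replicate (m l) False) ?I ?I (0, one_state, const_circ (N l) 1)"
      using const_circ_implementation[OF \<delta>(2)] density_one by (simp add: qsio_instance_def N_def p_def)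
    then show "\<exists>f I\<^sub>0 I\<^sub>1 X. qsio_instance Obf l (n l) (m l) (L l) (k l) (\<delta> l) (p l) f I\<^sub>0 I\<^sub>1 X" by blast
  qed
  \<comment> \<open>The exponent is chosen such that \<open>l \<le> n l ^ c\<^sub>0\<close> turns
    this bound into \<open>1 / real l ^ Suc d\<close>.\<close>
  have "\<forall>\<^sub>F j in sequentially. \<forall>A. cloner_at (q_out (Enc j)) j (p' j) A j \<and> msg_len A j = 2 \<longrightarrow>
    ue_win_prob Enc A j \<le> 1 / 2 + 1 / real j ^ (c\<^sub>0 * Suc d)"
    by (rule unclonable_uniform[OF unc pp']) (simp add: p'_def)
  from eventually_compose_growth[OF this grow]
  have E2: "\<forall>\<^sub>F l in sequentially. \<forall>A. cloner_at (q_out (Enc (n l))) (n l) (p' (n l)) A (n l) \<and> msg_len A (n l) = 2 \<longrightarrow>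
    ue_win_prob Enc A (n l) \<le> 1 / 2 + 1 / real (n l) ^ (c\<^sub>0 * Suc d)" by (simp add: n_def)
  have E3: "\<forall>\<^sub>F l in sequentially. \<bar>\<delta> l\<bar> \<le> 1 / real l ^ Suc d" by (rule negligibleD[OF \<delta>(1)])
  \<comment> \<open>There are three losses, from replacing the obfuscation, from the bad points and
    from the encryption game, each at most \<open>1 / real l ^ Suc d\<close>.\<close>
  have E4: "\<forall>\<^sub>F l in sequentially. 3 * (1 / real l ^ Suc d) \<le> 1 / real l ^ d" by (rule eventually_le_inverse_power_Suc) simp
  have E5: "\<forall>\<^sub>F l in sequentially. l > (0::nat)" by (rule eventually_gt_at_top)
  show "\<forall>\<^sub>F l in sequentially. upo_win_prob W GP L k Obf (Id_U (in_len W)) q A l \<le> 1 / 2 + 1 / real l ^ d"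
    using E1 E2 E3 E4 E5 grow
  proof eventually_elim
    case (elim l)
    show ?case
    proof (rule upo_win_prob_le[OF Wc])
      fix s \<mu>\<^sub>B \<mu>\<^sub>C z \<alpha>
      assume msg: "upo_msg W q l z (s, \<mu>\<^sub>B, \<mu>\<^sub>C)" and \<alpha>: "density (mem_len A l) \<alpha>"
      have s: "s \<in> keys W l" and wB: "b_wf (n l) (m l) \<mu>\<^sub>B" "b_size \<mu>\<^sub>B \<le> q l" and wC: "b_wf (n l) (m l) \<mu>\<^sub>C"
        using msg by (auto simp: upo_msg_def n_def m_def)
      have wS: "b_wf (n l) (m l) (circ W l s)" "b_size (circ W l s) = Sz l" using Sz[OF s] by (auto simp: n_def m_def)
      have \<alpha>': "density (\<mu> l) \<alpha>" using \<alpha> by (simp add: \<mu>_def)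
      let ?X = "bitstrings (n l)"
      \<comment> \<open>What the challenger obfuscates for the point \<open>x\<close> and the bit
        \<open>b\<close>.\<close>
      define B where "B x b = (if b then GP l s x x \<mu>\<^sub>B \<mu>\<^sub>C else circ W l s)" for x b
      have GP: "b_wf (n l) (m l) (GP l s x x \<mu>\<^sub>B \<mu>\<^sub>C)" "b_size (GP l s x x \<mu>\<^sub>B \<mu>\<^sub>C) = Sz l"
        "\<And>y. y \<in> ?X \<Longrightarrow> b_eval (GP l s x x \<mu>\<^sub>B \<mu>\<^sub>C) y = (if y = x then b_eval \<mu>\<^sub>B x else b_eval (circ W l s) y)" if "x \<in> ?X" for x
        using gpc[unfolded gen_puncture_correct_def, rule_format, OF s, of x x \<mu>\<^sub>B \<mu>\<^sub>C] that wB wC wS(2) by (simp_all add: n_def m_def)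
      have wfB: "b_wf (n l) (m l) (B x b)" "b_size (B x b) = Sz l" if "x \<in> ?X" for x b
        using GP[OF that] wS by (simp_all add: B_def)
      \<comment> \<open>Independent of \<open>x\<close> and \<open>b\<close>, which enter only
        through the ciphertext, so its description can be fixed before the key is drawn.\<close>
      define sw where "sw = switch (n l) (m l) (c l) (k l) (Test (n l)) (Dec (n l)) (circ W l s) \<mu>\<^sub>B"
      define ct where "ct x b = ciphertext Enc (n l) x b" for x b
      define zp where "zp = basis_state (replicate (k l - c l) False)"
      have ckl: "c l \<le> k l" using ck[of l] by (simp add: c_def n_def)
      note qT' = qT[of "n l", folded c_def] and qD' = qD[of "n l", folded c_def]
      note swa = qT' qD' wS(1) wB(1) ckl
      have lensw: "length (enc_qcircuit sw) \<le> L l"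
      proof (rule length_enc_le[OF _ _ L])
        show "q_wf sw" unfolding sw_def by (rule switch_wf[OF swa])
        have "q_size sw \<le> 60 * (n l + m l + c l + k l + q_size (Test (n l)) + q_size (Dec (n l)) + b_size (circ W l s) + b_size \<mu>\<^sub>B + 2)"
          unfolding sw_def by (rule switch_size[OF swa])
        also have "\<dots> \<le> G l" using G[of l] wS(2) wB(2) by (simp add: n_def m_def c_def)
        finally show "q_size sw \<le> G l" .
      qed
      have lenB: "length (enc_qcircuit (b_to_q (k l) (B x b))) \<le> L l" if "x \<in> ?X" for x b
      proof (rule length_enc_le[OF _ _ L])
        show "q_wf (b_to_q (k l) (B x b))" using b_to_q_computes[OF wfB(1)[OF that]] by (simp add: computes_def)
        show "q_size (b_to_q (k l) (B x b)) \<le> G l"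
          using b_to_q_size[of "k l" "B x b"] wfB[OF that, of b] G[of l] by (simp add: b_wf_def n_def m_def)
      qed
      have lpad: "length (padded_desc (L l) C) = L l" if "length (enc_qcircuit C) \<le> L l" for C
        using that by (simp add: padded_desc_def)
      \<comment> \<open>A ciphertext is the output of a circuit on a basis state. Being preparable,
        it can be tensored with the arbitrary memory \<open>\<alpha>\<close> without losing
        positivity.\<close>
      have ct: "preparable (c l) (ct x b)" if "x \<in> ?X" for x b
        unfolding ct_def ciphertext_def
        by (rule preparable_run[OF preparable_basis_state qE(1)]) (use that in \<open>simp_all add: qE bitstrings_def c_def\<close>)
      have zp: "preparable (k l - c l) zp" unfolding zp_def by (rule preparable_basis_state) simp
      have ctz: "preparable (k l) (ct x b \<otimes>\<^sub>q zp)" if "x \<in> ?X" for x b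
        using preparable_tensor[OF ct[OF that] zp] ckl by simp
      have obf: "preparable (N l) (obfuscate Obf l (L l) (k l) C \<rho>)" if "length (enc_qcircuit C) \<le> L l" "preparable (k l) \<rho>" for C \<rho>
        unfolding obfuscate_def N_def
        by (rule preparable_run[OF preparable_tensor[OF preparable_basis_state[OF lpad[OF that(1)]] that(2)]]) (simp_all add: Ob)
      define PB where "PB \<omega> x b = both_output_prob (P l) (Q l) (kB l) (kC l) x x (run (S l) (\<alpha> \<otimes>\<^sub>q \<omega>)) b" for \<omega> x b
      \<comment> \<open>\<open>R\<close> is the game at one point and bit with the circuit of the
        challenger, \<open>H\<close> the same with the switch and a ciphertext.\<close>
      define R where "R x b = PB (obfuscate_classical Obf l (L l) (k l) (B x b)) x b" for x b
      define H where "H x b = PB (obfuscate Obf l (L l) (k l) sw (ct x b \<otimes>\<^sub>q zp)) x b" for x b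
      define Pd where "Pd b x = outcome_prob (Dec (n l)) (basis_state x \<otimes>\<^sub>q ct x b) [b]" for b x
      define bad where "bad b = {x \<in> ?X. Pd b x < 1 - \<delta> l}" for b
      note att = st(3)[of l] io(3,4)[of l] st(4)[of l] io(5,6)[of l] st(2)[of l] io(1,2)[of l]
      have PB: "0 \<le> PB \<omega> x b" "PB \<omega> x b \<le> 1" if "preparable (N l) \<omega>" "x \<in> ?X" for \<omega> x b
        using attack_bounds[OF att \<alpha>' that(1), of x b] that(2) by (simp_all add: PB_def bitstrings_def)
      have zk: "preparable (k l) (basis_state (replicate (k l) False))" by (rule preparable_basis_state) simp
      have key: "R x b \<le> H x b + 1 / real l ^ Suc d + of_bool (x \<in> bad b)" if x: "x \<in> ?X" for x b
      proof (cases "x \<in> bad b")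
        \<comment> \<open>At a bad point the switch is not known to implement the right function, so
          only the trivial bound is used: two probabilities differ by at most 1.\<close>
        case True
        have "R x b \<le> 1" "H x b \<ge> 0"
          unfolding R_def H_def obfuscate_classical_def by (intro PB obf lenB lensw ctz zk x)+
        moreover have "0 \<le> 1 / real l ^ Suc d" by simp
        moreover have "(of_bool (x \<in> bad b) :: real) = 1" using True by simp
        ultimately show ?thesis by linarith
      next
        case False
        have lx: "length x = n l" using x by (simp add: bitstrings_def)
        \<comment> \<open>The point occurs twice in the advice, once for each guesser.\<close>
        define XX where "XX = (\<mu> l + (n l + n l), \<alpha> \<otimes>\<^sub>q (basis_state x \<otimes>\<^sub>q basis_state x), attack (n l) (\<mu> l) (N l) (S l) (kB l) (kC l) (P l) (Q l) b)"
        have test: "outcome_prob (Test (n l)) (basis_state y \<otimes>\<^sub>q ct x b) [y = x] = 1" if "length y = n l" for y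
          using kt[unfolded key_testable_def, rule_format, of x "n l" y b] x that by (simp add: ct_def bitstrings_def)
        have "implementation (n l) (m l) (k l) (1 - \<delta> l) sw (ct x b \<otimes>\<^sub>q zp) (b_eval (B x b))"
          unfolding sw_def zp_def
        proof (rule switch_implementation[OF swa ct[OF x] lx \<delta>(2) test])
          show "1 - \<delta> l \<le> outcome_prob (Dec (n l)) (basis_state x \<otimes>\<^sub>q ct x b) [b]"
            using False x by (simp add: bad_def Pd_def)
          \<comment> \<open>Both puncturing points are \<open>x\<close>, so the punctured circuit
            takes the value of \<open>\<mu>\<^sub>B\<close> there.\<close>
          show "b_eval (B x b) y = (if y = x \<and> b then b_eval \<mu>\<^sub>B y else b_eval (circ W l s) y)" if "length y = n l" for y
            using GP(3)[OF x, of y] that by (auto simp: B_def bitstrings_def)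
        qed
        moreover have "implementation (n l) (m l) (k l) (1 - \<delta> l) (b_to_q (k l) (B x b)) (basis_state (replicate (k l) False)) (b_eval (B x b))"
          by (rule b_to_q_implementation[OF wfB(1)[OF x] \<delta>(2)])
        moreover have "density (\<mu> l + (n l + n l)) (\<alpha> \<otimes>\<^sub>q (basis_state x \<otimes>\<^sub>q basis_state x))"
          by (intro density_tensor_preparable \<alpha>' preparable_tensor preparable_basis_state lx)
        ultimately have "qsio_instance Obf l (n l) (m l) (L l) (k l) (\<delta> l) (p l) (b_eval (B x b))
            (b_to_q (k l) (B x b), basis_state (replicate (k l) False)) (sw, ct x b \<otimes>\<^sub>q zp) XX"
          using lenB[OF x, of b] lensw attack_simps[OF att, of b]
          by (simp add: qsio_instance_def XX_def N_def[symmetric] p_def)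
        then have diff: "\<bar>qsio_prob Obf l (L l) (k l) XX (b_to_q (k l) (B x b), basis_state (replicate (k l) False))
            - qsio_prob Obf l (L l) (k l) XX (sw, ct x b \<otimes>\<^sub>q zp)\<bar> \<le> 1 / real l ^ Suc d"
          using elim(1) by blast
        have prob: "qsio_prob Obf l (L l) (k l) XX (C, \<rho>) = PB (obfuscate Obf l (L l) (k l) C \<rho>) x b" for C \<rho>
        proof -
          have "obfuscate Obf l (L l) (k l) C \<rho> \<in> carrier_mat (2 ^ N l) (2 ^ N l)"
            unfolding obfuscate_def N_def by (rule run_carrier)
          from attack_outcome[OF att density_carrier[OF \<alpha>'] this lx lx, of b]
          show ?thesis by (simp add: qsio_prob_def XX_def PB_def)
        qed
        show ?thesis
          using diff False unfolding prob by (simp add: R_def H_def obfuscate_classical_def)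
      qed
      \<comment> \<open>The description of \<open>sw\<close> is part of its advice. The guessers
        need no change: the key that they receive is the point they expect.\<close>
      define ueA where "ueA = ue_cloner (\<mu> l) \<alpha> (padded_desc (L l) sw) (c l) (k l) (Obf l (L l) (k l)) (S l) (kB l) (P l) (Q l)"
      have lendesc: "length (padded_desc (L l) sw) = L l" by (rule lpad[OF lensw])
      have att': "q_in (S l) = \<mu> l + q_out (Obf l (L l) (k l))" "q_in (Obf l (L l) (k l)) = length (padded_desc (L l) sw) + k l"
        using io(1)[of l] Ob(2)[of l "L l" "k l"] lendesc by (simp_all add: N_def)
      note uea = st(3)[of l] io(3,4)[of l] st(4)[of l] io(5,6)[of l] st(2)[of l] att'(1) io(2)[of l] Ob(1)[of l "L l" "k l"] att'(2) ckl \<alpha>'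
      have "cloner_at (c l) (n l) (p' (n l)) ueA (n l)"
        unfolding ueA_def
      proof (rule ue_cloner_at[OF uea])
        have "Bd l \<le> (l + 2) ^ e" by (rule e)
        also have "\<dots> \<le> (n l ^ c\<^sub>0 + 2) ^ e" using elim(6) by (intro power_mono) (auto simp: n_def)
        finally show "4 * (\<mu> l + length (padded_desc (L l) sw) + k l + 2) + q_size (Obf l (L l) (k l)) + q_size (S l) + q_size (P l) + q_size (Q l) + 6 \<le> p' (n l)"
          unfolding lendesc p'_def Bd_def by linarith
      qed
      moreover have "msg_len ueA (n l) = 2" by (simp add: ueA_def ue_cloner_def)
      ultimately have "ue_win_prob Enc ueA (n l) \<le> 1 / 2 + 1 / real (n l) ^ (c\<^sub>0 * Suc d)"
        using elim(2) by (simp add: c_def)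
      also have "\<dots> \<le> 1 / 2 + 1 / real l ^ Suc d"
        using inverse_power_growth[of l "n l" c\<^sub>0 "Suc d"] elim(5,6) by (simp add: n_def)
      also have "ue_win_prob Enc ueA (n l) = (\<Sum>x\<in>?X. \<Sum>b\<in>UNIV. H x b / 2) / 2 ^ n l"
        unfolding ueA_def ue_cloner_win_prob[OF uea, of Enc, OF c_def] expectation_bitstrings
        by (simp add: H_def PB_def obfuscate_def ct_def zp_def)
      finally have ueb: "(\<Sum>x\<in>?X. \<Sum>b\<in>UNIV. H x b / 2) / 2 ^ n l \<le> 1 / 2 + 1 / real l ^ Suc d" .
      have badb: "real (card (bad b)) \<le> \<delta> l * 2 ^ n l" for b
      proof -
        have "Pd b x \<le> 1" if "x \<in> ?X" for x
        proof -
          have "density (q_in (Dec (n l))) (basis_state x \<otimes>\<^sub>q ct x b)"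
            unfolding qD' by (intro preparable_density preparable_tensor preparable_basis_state ct that) (use that in \<open>simp add: bitstrings_def\<close>)
          from outcome_prob_bounds(2)[OF qD'(1) this, of "[b]"] show ?thesis by (simp add: Pd_def qD')
        qed
        moreover have "(\<Sum>x\<in>?X. Pd b x) \<ge> (1 - \<epsilon> (n l)) * real (card ?X)"
          using dec[of "n l" b] unfolding expectation_bitstrings by (simp add: Pd_def ct_def card_bitstrings field_simps)
        ultimately have "real (card {x \<in> ?X. Pd b x < 1 - sqrt \<bar>\<epsilon> (n l)\<bar>}) \<le> sqrt \<bar>\<epsilon> (n l)\<bar> * card ?X"
          by (intro markov) auto
        then show ?thesis by (simp add: bad_def \<delta>_def card_bitstrings)
      qed
      \<comment> \<open>The pointwise comparison is summed over all points; the point is uniform,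
        exactly like the key of the encryption game.\<close>
      have "(\<Sum>x\<in>?X. \<Sum>b\<in>UNIV. R x b / 2) \<le> (\<Sum>x\<in>?X. \<Sum>b\<in>UNIV. (H x b + 1 / real l ^ Suc d + of_bool (x \<in> bad b)) / 2)"
        by (intro sum_mono divide_right_mono key) auto
      also have "\<dots> = (\<Sum>x\<in>?X. \<Sum>b\<in>UNIV. H x b / 2) + 2 ^ n l * (1 / real l ^ Suc d) + (real (card (bad True)) + real (card (bad False))) / 2"
      proof -
        have cardb: "(\<Sum>x\<in>?X. of_bool (x \<in> bad b)) = real (card (bad b))" for b
        proof -
          have "?X \<inter> bad b = bad b" by (auto simp: bad_def)
          then show ?thesis by (simp add: Int_commute)
        qed
        have "(\<Sum>x\<in>?X. \<Sum>b\<in>UNIV. (H x b + 1 / real l ^ Suc d + of_bool (x \<in> bad b)) / 2)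
            = (\<Sum>x\<in>?X. (\<Sum>b\<in>UNIV. H x b / 2) + 1 / real l ^ Suc d + (of_bool (x \<in> bad True) + of_bool (x \<in> bad False)) / 2)"
          by (intro sum.cong refl) (simp add: UNIV_bool add_divide_distrib)
        also have "\<dots> = (\<Sum>x\<in>?X. \<Sum>b\<in>UNIV. H x b / 2) + 2 ^ n l * (1 / real l ^ Suc d) + (real (card (bad True)) + real (card (bad False))) / 2"
          by (simp only: sum.distrib sum_divide_distrib[symmetric] cardb sum_constant card_bitstrings) simp
        finally show ?thesis .
      qed
      also have "\<dots> \<le> (\<Sum>x\<in>?X. \<Sum>b\<in>UNIV. H x b / 2) + 2 ^ n l * (1 / real l ^ Suc d) + 2 ^ n l * \<delta> l"
        using badb[of True] badb[of False] by (simp add: algebra_simps)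
      finally have "(\<Sum>x\<in>?X. \<Sum>b\<in>UNIV. R x b / 2) / 2 ^ n l
          \<le> ((\<Sum>x\<in>?X. \<Sum>b\<in>UNIV. H x b / 2) + 2 ^ n l * (1 / real l ^ Suc d) + 2 ^ n l * \<delta> l) / 2 ^ n l"
        by (intro divide_right_mono) auto
      also have "\<dots> = (\<Sum>x\<in>?X. \<Sum>b\<in>UNIV. H x b / 2) / 2 ^ n l + 1 / real l ^ Suc d + \<delta> l"
        by (simp only: add_divide_distrib) simp
      also have "\<dots> \<le> 1 / 2 + 1 / real l ^ d"
        using ueb elim(3,4) by linarith
      finally have "(\<Sum>x\<in>?X. \<Sum>b\<in>UNIV. R x b / 2) / 2 ^ n l \<le> 1 / 2 + 1 / real l ^ d" .
      then show "(\<Sum>x\<in>bitstrings (in_len W l). \<Sum>b\<in>UNIV. both_output_prob (bob A l) (charlie A l) (bob_len A l) (charlie_len A l) x x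
        (run (stage2 A l) (\<alpha> \<otimes>\<^sub>q obfuscate_classical Obf l (L l) (k l) (if b then GP l s x x \<mu>\<^sub>B \<mu>\<^sub>C else circ W l s))) b / 2)
      / 2 ^ in_len W l \<le> 1 / 2 + 1 / real l ^ d"
        by (simp add: R_def PB_def B_def n_def P_def Q_def S_def kB_def kC_def)
    qed (use A in simp_all)
  qed
qed

theorem theorem51:
  fixes Enc Dec Test :: "nat \<Rightarrow> qcircuit"
    and Obf :: obfuscator and Eval :: evaluator
    and W :: circuit_class and GP :: gen_puncture
    and q :: "nat \<Rightarrow> nat"
  assumes "key_testable_ue Enc Dec Test"
    and "qsio Obf Eval"
    and "generalized_puncturable W GP"
    and "\<exists>c. \<forall>\<^sub>F l in sequentially. l \<le> in_len W l ^ c"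
    and "poly_bounded q"
  shows "sufficiently_padded (\<lambda>L k. generalized_upo W GP L k Obf Eval (Id_U (in_len W)) q)"
proof -
  let ?n = "in_len W" and ?m = "out_len W"
  obtain c\<^sub>0 where grow: "\<forall>\<^sub>F l in sequentially. l \<le> ?n l ^ c\<^sub>0" using assms(4) by blast
  have Wc: "keyed_circuit_class W" using assms(3) by (simp add: generalized_puncturable_def)
  then obtain Sz where Sz: "poly_bounded Sz" "\<And>l s. s \<in> keys W l \<Longrightarrow> b_wf (?n l) (?m l) (circ W l s) \<and> b_size (circ W l s) = Sz l"
    by (auto simp: keyed_circuit_class_def)
  have nm: "poly_bounded ?n" "poly_bounded ?m" using Wc by (auto simp: keyed_circuit_class_def)
  have syn: "ue_syntax Enc Dec Test" using assms(1) by (simp add: key_testable_ue_def)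
  have pED: "poly_bounded (\<lambda>j. q_size (Enc j))" "poly_bounded (\<lambda>j. q_size (Test j))" "poly_bounded (\<lambda>j. q_size (Dec j))"
    using syn qpt_1(2) by (auto simp: ue_syntax_def)
  have pE: "poly_bounded (\<lambda>l. q_out (Enc (?n l)))"
    by (rule poly_bounded_mono[OF poly_bounded_compose[OF pED(1) nm(1)]]) (rule q_out_le_size)
  \<comment> \<open>\<open>k\<close> has to hold a ciphertext. It is fixed before \<open>L\<close>,
    because the padding qubits are inputs of the obfuscated circuits and enter their size.\<close>
  have "\<exists>L\<^sub>0. poly_bounded L\<^sub>0 \<and> (\<forall>L. poly_bounded L \<and> L\<^sub>0 \<le> L \<longrightarrow> generalized_upo W GP L k Obf Eval (Id_U ?n) q)"
    if k: "poly_bounded k" "(\<lambda>l. q_out (Enc (?n l))) \<le> k" for k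
  proof -
    define G where "G l = 60 * (?n l + ?m l + q_out (Enc (?n l)) + k l + q_size (Test (?n l)) + q_size (Dec (?n l)) + Sz l + q l + 2)" for l
    have pG: "poly_bounded (\<lambda>l. 8 * (G l + 1) ^ 2)"
      unfolding G_def by (intro poly_bounded_intros nm pE k Sz assms(5) poly_bounded_compose[OF pED(2)] poly_bounded_compose[OF pED(3)])
    have "generalized_upo W GP L k Obf Eval (Id_U ?n) q" if L: "poly_bounded L" "(\<lambda>l. 8 * (G l + 1) ^ 2) \<le> L" for L
      unfolding generalized_upo_def
    proof (intro conjI)
      show "qpt_obfuscator Obf Eval" using assms(2) by (simp add: qsio_def)
      show "upo_correct W L k Obf Eval"
        by (rule qsio_upo_correct[where G = G, OF assms(2) Wc L(1) k(1) Sz(2)]) (use L(2) in \<open>auto simp: G_def le_fun_def\<close>)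
      show "generalized_upo_secure W GP L k Obf (Id_U ?n) q"
        by (rule qsio_upo_secure[where G = G, OF assms(1-3) grow L(1) k(1) Sz(2)])
           (use L(2) k(2) in \<open>auto simp: G_def le_fun_def\<close>)
    qed
    then show ?thesis using pG by blast
  qed
  then show ?thesis
    unfolding sufficiently_padded_def using pE by blast
qed

end
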